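(* Let $f$ be a piecewise polynomial with respect to $\mathcal T_h$. Let $(\psi,u)\in H^1(\Omega)\times H_0^1(\Omega)$ be the solution of $$\varepsilon^2(\nabla\psi,\nabla\varphi)+(\psi,\varphi)=(f,\varphi)\quad\forall\,\varphi\in H_0^1(\Omega),\qquad (\nabla u,\nabla v)=(\psi,v)\quad\forall\, v\in H^1(\Omega),$$ and let $(\psi_h,u_h)\in V_h\times V_h^0$ be the solution of $$\varepsilon^2(\nabla\psi_h,\nabla\varphi_h)+(\psi_h,\varphi_h)=(f,\varphi_h)\quad\forall\,\varphi_h\in V_h^0,\qquad (\nabla u_h,\nabla v_h)=(\psi_h,v_h)\quad\forall\, v_h\in V_h.$$ Then there exist positive constants $C_9$ and $C_{10}$, independent of the mesh-size function $h$ and of $\varepsilon$, such that $$C_9\Big\{\sum_{T\in\mathcal T_h}\eta_{\psi,T}^2\Big\}^{1/2}\le\|\psi-\psi_h\|_{\mathcal E}$$ and $$C_{10}\Big\{\sum_{T\in\mathcal T_h}\big(\eta_{\psi,T}^2+\eta_{u,T}^2\big)\Big\}^{1/2}\le\|(\psi-\psi_h,u-u_h)\|.$$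
   Context: $\Omega\subset\mathbb{R}^d$, $d\in\{2,3\}$, is a bounded polygonal/polyhedral domain with Lipschitz boundary $\Gamma$; $\varepsilon>0$ is a small parameter ($\varepsilon\ll1$; one may read $0<\varepsilon<1$). $(\cdot,\cdot)$ and $\|\cdot\|$ are the $L^2(\Omega)$ inner product and norm, $|\cdot|_1=\|\nabla\cdot\|$; a subscript $T$ or $E$ means the $L^2$ norm on that set. Mesh and spaces: $\mathcal T_h$ is a shape regular partition of $\Omega$ into triangles (tetrahedra if $d=3$) or parallelograms (parallelepipeds if $d=3$) such that $C_0^{-1}h_T^d\le|T|\le C_0h_T^d$ for all $T\in\mathcal T_h$, where $h_T=\mathrm{diam}(T)$. For a fixed integer $k\ge1$, $P_k(T)$ is the space of polynomials of total degree at most $k$ if $T$ is a simplex, or of degree at most $k$ in each variable if $T$ is a parallelogram/parallelepiped. $V_h=\{v_h\in C(\overline\Omega): v_h|_T\in P_k(T)\ \forall T\in\mathcal T_h\}$ and $V_h^0=\{v_h\in V_h: v_h|_\Gamma=0\}$. Piecewise polynomial means that $f|_T$ is a polynomial, of some fixed maximal degree, for every $T\in\mathcal T_h$. $\mathcal E_h^0$ is the set of interior sides ($d=2$) or faces ($d=3$), $\mathcal E_T$ the set of sides/faces of $T$, $h_E=\mathrm{diam}(E)$. For $E=T_+\cap T_-\in\mathcal E_h^0$, $[v]|_E=(v|_{T_+})|_E-(v|_{T_-})|_E$ is the jump, and $\partial/\partial\mathbf n$ on $E$ is the derivative in a fixed unit normal direction to $E$. Error measures: $\|\varphi\|_{\mathcal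 E}=(\varepsilon^2|\varphi|_1^2+\|\varphi\|^2)^{1/2}$ and $\|(\psi-\psi_h,u-u_h)\|^2=\|\psi-\psi_h\|_{\mathcal E}^2+|u-u_h|_1^2$. Indicators: for $T\in\mathcal T_h$ and $E\subset\partial T$, $\alpha_T=\min\{h_T\varepsilon^{-1},1\}$ and $\alpha_E=\varepsilon^{-1/2}\min\{h_T\varepsilon^{-1},1\}^{1/2}$, $$\eta_{\psi,T}=\Big\{\alpha_T^2\|f+\varepsilon^2\triangle\psi_h-\psi_h\|_T^2+\tfrac12\sum_{E\in\mathcal E_T\cap\mathcal E_h^0}\alpha_E^2\Big\|\Big[\varepsilon^2\tfrac{\partial\psi_h}{\partial\mathbf n}\Big]\Big\|_E^2\Big\}^{1/2},$$ $$\eta_{u,T}=\Big\{h_T^2\|\triangle u_h+\psi_h\|_T^2+\tfrac12\sum_{E\in\mathcal E_T\cap\mathcal E_h^0}h_E\Big\|\Big[\tfrac{\partial u_h}{\partial\mathbf n}\Big]\Big\|_E^2\Big\}^{1/2}.$$ The constants $C_i$ depend only on the mesh shape regularity and $d$ (with $\Omega$, $k$ and the maximal polynomial degree of $f$ fixed). *)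

theory Defs
  imports "HOL-Analysis.Analysis"
begin

text \<open>
  Functions on a closed or open set are represented by total functions on the whole space; only
  their values on that set matter. All integrals are taken with respect to the (complete) Lebesgue
  measure, except for those over the faces of mesh elements.
\<close>

section \<open>Square integrable functions and Sobolev spaces\<close>

definition square_integrable :: "'a measure \<Rightarrow> ('a \<Rightarrow> 'b::euclidean_space) \<Rightarrow> bool" where
  "square_integrable \<mu> v \<longleftrightarrow> v \<in> borel_measurable \<mu> \<and> integrable \<mu> (\<lambda>x. (norm (v x))\<^sup>2)"

definition l2_norm :: "'a measure \<Rightarrow> ('a \<Rightarrow> 'b::euclidean_space) \<Rightarrow> real" where
  "l2_norm \<mu> v = sqrt (LINT x|\<mu>. (norm (v x))\<^sup>2)"

definition l2_inner :: "'a measure \<Rightarrow> ('a \<Rightarrow> 'b::euclidean_space) \<Rightarrow> ('a \<Rightarrow> 'b) \<Rightarrow> real" where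
  "l2_inner \<mu> v w = (LINT x|\<mu>. v x \<bullet> w x)"

definition partial :: "'n \<Rightarrow> (real^'n \<Rightarrow> real) \<Rightarrow> real^'n \<Rightarrow> real" where
  "partial i v x = frechet_derivative v (at x) (axis i 1)"

definition laplacian :: "(real^'n \<Rightarrow> real) \<Rightarrow> real^'n \<Rightarrow> real" where
  "laplacian v x = (\<Sum>i\<in>UNIV. partial i (partial i v) x)"

fun iter_partial :: "'n list \<Rightarrow> (real^'n \<Rightarrow> real) \<Rightarrow> real^'n \<Rightarrow> real" where
  "iter_partial [] v = v"
| "iter_partial (i # is) v = partial i (iter_partial is v)"

text \<open>The space \<open>C\<^sub>c\<^sup>\<infinity>(\<Omega>)\<close>: a function is smooth iff its iterated partial derivatives of every
  order exist and are (totally) differentiable everywhere.\<close>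

definition test_functions :: "(real^'n) set \<Rightarrow> (real^'n \<Rightarrow> real) set" where
  "test_functions \<Omega> = {\<phi>. (\<forall>is x. iter_partial is \<phi> differentiable (at x)) \<and>
     compact (closure {x. \<phi> x \<noteq> 0}) \<and> closure {x. \<phi> x \<noteq> 0} \<subseteq> \<Omega>}"

definition is_weak_grad :: "(real^'n) set \<Rightarrow> (real^'n \<Rightarrow> real) \<Rightarrow> (real^'n \<Rightarrow> real^'n) \<Rightarrow> bool" where
  "is_weak_grad \<Omega> v g \<longleftrightarrow> square_integrable (lebesgue_on \<Omega>) g \<and>
     (\<forall>\<phi>\<in>test_functions \<Omega>. \<forall>i.
        (LINT x|lebesgue_on \<Omega>. v x * partial i \<phi> x) = - (LINT x|lebesgue_on \<Omega>. g x $ i * \<phi> x))"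

definition H1 :: "(real^'n) set \<Rightarrow> (real^'n \<Rightarrow> real) set" where
  "H1 \<Omega> = {v. square_integrable (lebesgue_on \<Omega>) v \<and> (\<exists>g. is_weak_grad \<Omega> v g)}"

text \<open>Meaningful for members of \<open>H1 \<Omega>\<close>; determined up to a null set, so that the integrals
  below do not depend on the choice.\<close>

definition weak_grad :: "(real^'n) set \<Rightarrow> (real^'n \<Rightarrow> real) \<Rightarrow> real^'n \<Rightarrow> real^'n" where
  "weak_grad \<Omega> v = (SOME g. is_weak_grad \<Omega> v g)"

definition h1_seminorm :: "(real^'n) set \<Rightarrow> (real^'n \<Rightarrow> real) \<Rightarrow> real" where
  "h1_seminorm \<Omega> v = l2_norm (lebesgue_on \<Omega>) (weak_grad \<Omega> v)"

text \<open>The closure of \<open>C\<^sub>c\<^sup>\<infinity>(\<Omega>)\<close> in the norm of \<open>H\<^sup>1(\<Omega>)\<close>.\<close>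

definition H10 :: "(real^'n) set \<Rightarrow> (real^'n \<Rightarrow> real) set" where
  "H10 \<Omega> = {v \<in> H1 \<Omega>. \<forall>\<delta>>0. \<exists>\<phi>\<in>test_functions \<Omega>.
     (l2_norm (lebesgue_on \<Omega>) (\<lambda>x. v x - \<phi> x))\<^sup>2 + (h1_seminorm \<Omega> (\<lambda>x. v x - \<phi> x))\<^sup>2 < \<delta>\<^sup>2}"

definition energy_norm :: "(real^'n) set \<Rightarrow> real \<Rightarrow> (real^'n \<Rightarrow> real) \<Rightarrow> real" where
  "energy_norm \<Omega> \<epsilon> v =
     sqrt (\<epsilon>\<^sup>2 * (h1_seminorm \<Omega> v)\<^sup>2 + (l2_norm (lebesgue_on \<Omega>) v)\<^sup>2)"

definition pair_norm ::
    "(real^'n) set \<Rightarrow> real \<Rightarrow> (real^'n \<Rightarrow> real) \<Rightarrow> (real^'n \<Rightarrow> real) \<Rightarrow> real" where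
  "pair_norm \<Omega> \<epsilon> v w = sqrt ((energy_norm \<Omega> \<epsilon> v)\<^sup>2 + (h1_seminorm \<Omega> w)\<^sup>2)"

section \<open>Domains\<close>

text \<open>Near every boundary point, the domain is the set of points strictly above the graph of a
  Lipschitz function \<open>g\<close> over the hyperplane orthogonal to a unit vector \<open>e\<close>.\<close>

definition lipschitz_boundary :: "(real^'n) set \<Rightarrow> bool" where
  "lipschitz_boundary \<Omega> \<longleftrightarrow> (\<forall>x\<in>frontier \<Omega>. \<exists>r>0. \<exists>e g L. norm e = 1 \<and>
     L-lipschitz_on {z. z \<bullet> e = 0} g \<and>
     (\<forall>y\<in>ball x r. y \<in> \<Omega> \<longleftrightarrow> g (y - (y \<bullet> e) *\<^sub>R e) < y \<bullet> e))"

definition polyhedral_lipschitz_domain :: "(real^'n) set \<Rightarrow> bool" where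
  "polyhedral_lipschitz_domain \<Omega> \<longleftrightarrow>
     open \<Omega> \<and> connected \<Omega> \<and> \<Omega> \<noteq> {} \<and> bounded \<Omega> \<and>
     (\<exists>\<F>. finite \<F> \<and> (\<forall>P\<in>\<F>. polytope P \<and> aff_dim P = int CARD('n) - 1) \<and> frontier \<Omega> = \<Union>\<F>) \<and>
     lipschitz_boundary \<Omega>"

section \<open>Meshes and finite element spaces\<close>

definition is_simplex :: "(real^'n) set \<Rightarrow> bool" where
  "is_simplex T \<longleftrightarrow> int CARD('n) simplex T"

definition is_parallelotope :: "(real^'n) set \<Rightarrow> bool" where
  "is_parallelotope T \<longleftrightarrow> (\<exists>a (A :: real^'n \<Rightarrow> real^'n). linear A \<and> inj A \<and> T = (\<lambda>x. a + A x) ` cbox 0 1)"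

definition mesh :: "(real^'n) set \<Rightarrow> (real^'n) set set \<Rightarrow> bool" where
  "mesh \<Omega> \<T> \<longleftrightarrow> finite \<T> \<and> \<Union>\<T> = closure \<Omega> \<and>
     (\<forall>T\<in>\<T>. is_simplex T \<or> is_parallelotope T) \<and>
     (\<forall>S\<in>\<T>. \<forall>T\<in>\<T>. S \<noteq> T \<longrightarrow>
        interior S \<inter> interior T = {} \<and> (S \<inter> T) face_of S \<and> (S \<inter> T) face_of T)"

definition shape_regular :: "real \<Rightarrow> (real^'n) set set \<Rightarrow> bool" where
  "shape_regular C0 \<T> \<longleftrightarrow> (\<forall>T\<in>\<T>.
     inverse C0 * diameter T ^ CARD('n) \<le> measure lebesgue T \<and>
     measure lebesgue T \<le> C0 * diameter T ^ CARD('n))"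

definition total_degree_polys :: "nat \<Rightarrow> (real^'n \<Rightarrow> real) set" where
  "total_degree_polys k =
     {p. \<exists>c :: ('n \<Rightarrow> nat) \<Rightarrow> real.
        p = (\<lambda>x. \<Sum>\<alpha> | (\<Sum>i\<in>UNIV. \<alpha> i) \<le> k. c \<alpha> * (\<Prod>i\<in>UNIV. (x $ i) ^ \<alpha> i))}"

definition coordinate_degree_polys :: "nat \<Rightarrow> (real^'n \<Rightarrow> real) set" where
  "coordinate_degree_polys k =
     {p. \<exists>c :: ('n \<Rightarrow> nat) \<Rightarrow> real.
        p = (\<lambda>x. \<Sum>\<alpha> | \<forall>i. \<alpha> i \<le> k. c \<alpha> * (\<Prod>i\<in>UNIV. (x $ i) ^ \<alpha> i))}"

definition local_space :: "nat \<Rightarrow> (real^'n) set \<Rightarrow> (real^'n \<Rightarrow> real) set" where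
  "local_space k T = (if is_simplex T then total_degree_polys k else coordinate_degree_polys k)"

definition fe_space ::
    "nat \<Rightarrow> (real^'n) set \<Rightarrow> (real^'n) set set \<Rightarrow> (real^'n \<Rightarrow> real) set" where
  "fe_space k \<Omega> \<T> = {v. continuous_on (closure \<Omega>) v \<and>
     (\<forall>T\<in>\<T>. \<exists>p\<in>local_space k T. \<forall>x\<in>T. v x = p x)}"

definition fe_space0 ::
    "nat \<Rightarrow> (real^'n) set \<Rightarrow> (real^'n) set set \<Rightarrow> (real^'n \<Rightarrow> real) set" where
  "fe_space0 k \<Omega> \<T> = {v \<in> fe_space k \<Omega> \<T>. \<forall>x\<in>frontier \<Omega>. v x = 0}"

text \<open>Such functions may jump across faces, so their values on element boundaries
  (a null set) are left unconstrained.\<close>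

definition piecewise_poly :: "nat \<Rightarrow> (real^'n) set set \<Rightarrow> (real^'n \<Rightarrow> real) \<Rightarrow> bool" where
  "piecewise_poly m \<T> f \<longleftrightarrow> (\<forall>T\<in>\<T>. \<exists>p\<in>total_degree_polys m. \<forall>x\<in>interior T. f x = p x)"

section \<open>Faces and jumps\<close>

text \<open>The polynomial that represents \<open>v\<close> on \<open>T\<close>; it is unique since elements have nonempty
  interior. Its derivatives on the boundary of \<open>T\<close> are the one-sided derivatives
  of \<open>v\<close> restricted to \<open>T\<close>.\<close>

definition local_poly :: "(real^'n) set \<Rightarrow> (real^'n \<Rightarrow> real) \<Rightarrow> real^'n \<Rightarrow> real" where
  "local_poly T v = (SOME p. real_polynomial_function p \<and> (\<forall>x\<in>T. p x = v x))"

definition faces :: "(real^'n) set \<Rightarrow> (real^'n) set set" where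
  "faces T = {E. E facet_of T}"

definition interior_faces :: "(real^'n) set set \<Rightarrow> (real^'n) set set" where
  "interior_faces \<T> =
     {E. \<exists>S\<in>\<T>. \<exists>T\<in>\<T>. S \<noteq> T \<and> E = S \<inter> T \<and> E \<in> faces S \<and> E \<in> faces T}"

text \<open>An arbitrary but fixed order \<open>(T\<^sub>+, T\<^sub>-)\<close> of the two elements sharing an interior face.\<close>

definition face_sides :: "(real^'n) set set \<Rightarrow> (real^'n) set \<Rightarrow> (real^'n) set \<times> (real^'n) set" where
  "face_sides \<T> E = (SOME (S, T). S \<in> \<T> \<and> T \<in> \<T> \<and> S \<noteq> T \<and> E = S \<inter> T)"

definition unit_normal :: "(real^'n) set \<Rightarrow> real^'n" where
  "unit_normal E = (SOME n. norm n = 1 \<and> (\<forall>x\<in>E. \<forall>y\<in>E. (x - y) \<bullet> n = 0))"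

text \<open>The jump \<open>[\<partial>v/\<partial>n]\<close> across \<open>E\<close>.\<close>

definition normal_deriv_jump ::
    "(real^'n) set set \<Rightarrow> (real^'n) set \<Rightarrow> (real^'n \<Rightarrow> real) \<Rightarrow> real^'n \<Rightarrow> real" where
  "normal_deriv_jump \<T> E v x =
     frechet_derivative (local_poly (fst (face_sides \<T> E)) v) (at x) (unit_normal E) -
     frechet_derivative (local_poly (snd (face_sides \<T> E)) v) (at x) (unit_normal E)"

text \<open>The surface measure on a flat face \<open>E\<close> of codimension one: by Fubini, the surface measure of
  a subset of \<open>E\<close> is the volume of the right prism of height one over this subset. Hence the
  surface measure is the image of Lebesgue measure on the prism over \<open>E\<close> under the orthogonal
  projection onto the hyperplane through \<open>E\<close>.\<close>

definition surface_measure :: "(real^'n) set \<Rightarrow> (real^'n) measure" where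
  "surface_measure E =
     distr (lebesgue_on {x + t *\<^sub>R unit_normal E | x t. x \<in> E \<and> 0 \<le> t \<and> t \<le> 1}) borel
       (closest_point (affine hull E))"

section \<open>Error indicators\<close>

definition alpha_elem :: "real \<Rightarrow> (real^'n) set \<Rightarrow> real" where
  "alpha_elem \<epsilon> T = min (diameter T / \<epsilon>) 1"

text \<open>The weight of a face of \<open>T\<close>; it depends on the face only through \<open>T\<close>.\<close>

definition alpha_face :: "real \<Rightarrow> (real^'n) set \<Rightarrow> real" where
  "alpha_face \<epsilon> T = \<epsilon> powr (-1/2) * (min (diameter T / \<epsilon>) 1) powr (1/2)"

definition eta_psi ::
    "real \<Rightarrow> (real^'n) set set \<Rightarrow> (real^'n \<Rightarrow> real) \<Rightarrow> (real^'n \<Rightarrow> real) \<Rightarrow> (real^'n) set \<Rightarrow> real" where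
  "eta_psi \<epsilon> \<T> f \<psi>h T = sqrt (
     (alpha_elem \<epsilon> T)\<^sup>2 *
       (l2_norm (lebesgue_on T) (\<lambda>x. f x + \<epsilon>\<^sup>2 * laplacian (local_poly T \<psi>h) x - \<psi>h x))\<^sup>2 +
     1/2 * (\<Sum>E\<in>faces T \<inter> interior_faces \<T>.
       (alpha_face \<epsilon> T)\<^sup>2 *
         (l2_norm (surface_measure E) (\<lambda>x. \<epsilon>\<^sup>2 * normal_deriv_jump \<T> E \<psi>h x))\<^sup>2))"

definition eta_u ::
    "(real^'n) set set \<Rightarrow> (real^'n \<Rightarrow> real) \<Rightarrow> (real^'n \<Rightarrow> real) \<Rightarrow> (real^'n) set \<Rightarrow> real" where
  "eta_u \<T> \<psi>h uh T = sqrt (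
     (diameter T)\<^sup>2 *
       (l2_norm (lebesgue_on T) (\<lambda>x. laplacian (local_poly T uh) x + \<psi>h x))\<^sup>2 +
     1/2 * (\<Sum>E\<in>faces T \<inter> interior_faces \<T>.
       diameter E * (l2_norm (surface_measure E) (normal_deriv_jump \<T> E uh))\<^sup>2))"

end

theory Submission
  imports Defs "HOL-Computational_Algebra.Polynomial"
begin

text \<open>
  For every test function \<open>\<phi> \<in> C\<^sub>c\<^sup>\<infinity>(\<Omega>)\<close>, elementwise integration by parts turns the two continuous
  equations into identities between the element residuals, the jumps of the normal derivatives and
  the errors. The element residuals are bounded by testing with the residual times a bubble, and
  then the jumps by testing with an extension of the jump times a bubble around the face. The
  bubbles are smooth bumps of compact support instead of piecewise polynomials, so that no density
  argument or trace is involved. A bubble only has to live on a ball (or on a cylinder around a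
  point of a face) of size comparable to the element, because for polynomials of bounded degree
  the \<open>L\<^sup>2\<close> norm on such a ball controls all values and derivatives on the whole element. The normal
  derivative enters through the divergence theorem on a half space. Squeezing the face bubble to
  width \<open>min {h, \<epsilon>}\<close> in the normal direction makes the estimates uniform in \<open>\<epsilon>\<close>.
\<close>

section \<open>Smooth functions and bumps\<close>

text \<open>The weights match two scalings. On an element, inverse estimates bound the residual R by
  C (\<epsilon>^2 |e|_1 / h + ||e||), and multiplication by \<open>alpha_elem\<close>, which is at
  most h / \<epsilon> and at most 1, leaves the energy norm. A face bubble of width \<delta> has a
  gradient of size 1 / \<delta> and a support of volume proportional to \<delta>, so the squared
  jump is bounded by C (\<epsilon>^4 |e|_1^2 / \<delta> + \<delta> ||e||^2). The square of
  \<open>alpha_face\<close> is min {h, \<epsilon>} / \<epsilon>^2, which for \<delta> = min {h,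
  \<epsilon>} again leaves the energy norm. The equation for u is treated with coefficient 1 and
  \<delta> = h; there ||\<psi> - \<psi>h||^2 appears with the factor h^2, so the second constant
  involves the diameter of the domain. Shape regularity is given by volumes only, so its geometric
  content has to be extracted: volume comparable to h^n excludes small width in every direction, a
  central point turns width into an inscribed ball, and slicing parallel to a facet turns the ball
  into a disc in the facet. Polynomial estimates are scaled from the unit ball by translations and
  dilations, which avoids reference elements.\<close>

definition smooth_fun :: "(real^'n \<Rightarrow> real) \<Rightarrow> bool" where
  "smooth_fun f \<longleftrightarrow> (\<forall>is x. iter_partial is f differentiable (at x))"

lemma iter_partial_snoc: "iter_partial (is @ [i]) v = iter_partial is (partial i v)"
  by (induction "is") auto

lemma smooth_fun_differentiable: "smooth_fun f \<Longrightarrow> f differentiable (at x)"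
  unfolding smooth_fun_def by (metis iter_partial.simps(1))

lemma smooth_fun_partial: "smooth_fun f \<Longrightarrow> smooth_fun (partial i f)"
  unfolding smooth_fun_def by (metis iter_partial_snoc)

text \<open>\<open>iter_partial\<close> puts the outermost derivative at the head of the list, so a
  class of differentiable functions closed under \<open>partial\<close> contains all iterated
  derivatives by induction on the list.\<close>

lemma smooth_fun_coinduct:
  assumes "P f"
    and step: "\<And>f. P f \<Longrightarrow> (\<forall>x. f differentiable (at x)) \<and> (\<forall>i. P (partial i f))"
  shows "smooth_fun f"
proof -
  have "P (iter_partial is f)" for "is"
    by (induction "is") (use assms in auto)
  then show ?thesis unfolding smooth_fun_def using step by blast
qed

lemma partial_eqI: "(f has_derivative f') (at x) \<Longrightarrow> partial i f x = f' (axis i 1)"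
  unfolding partial_def using frechet_derivative_at by metis

lemma has_derivative_partial:
  assumes "f differentiable (at (x::real^'n))"
  shows "(f has_derivative (\<lambda>h. \<Sum>i\<in>UNIV. h $ i * partial i f x)) (at x)"
proof -
  define D where "D = frechet_derivative f (at x)"
  have D: "(f has_derivative D) (at x)"
    unfolding D_def using assms frechet_derivative_works by blast
  have "D h = (\<Sum>i\<in>UNIV. h $ i * partial i f x)" for h
  proof -
    interpret linear D using D has_derivative_linear by blast
    have "D h = D (\<Sum>i\<in>UNIV. h $ i *\<^sub>R axis i 1)"
      using basis_expansion[of h] by (simp add: scalar_mult_eq_scaleR)
    also have "\<dots> = (\<Sum>i\<in>UNIV. h $ i * D (axis i 1))"
      by (simp add: sum scale)
    finally show ?thesis by (simp add: partial_def D_def)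
  qed
  then have "D = (\<lambda>h. \<Sum>i\<in>UNIV. h $ i * partial i f x)" by (rule ext)
  then show ?thesis using D by simp
qed

lemma frechet_derivative_partial:
  assumes "f differentiable (at (x::real^'n))"
  shows "frechet_derivative f (at x) v = (\<Sum>i\<in>UNIV. v $ i * partial i f x)"
  using frechet_derivative_at[OF has_derivative_partial[OF assms], symmetric] by simp

lemma partial_add:
  assumes "f differentiable (at x)" "g differentiable (at x)"
  shows "partial i (\<lambda>x. f x + g x) x = partial i f x + partial i g x"
  using partial_eqI[OF has_derivative_add[OF assms[unfolded frechet_derivative_works]]]
  by (simp add: partial_def)

lemma partial_mult:
  assumes "f differentiable (at x)" "g differentiable (at x)"
  shows "partial i (\<lambda>x. f x * g x) x = f x * partial i g x + partial i f x * g x"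
  using partial_eqI[OF has_derivative_mult[OF assms[unfolded frechet_derivative_works]]]
  by (simp add: partial_def)

lemma partial_const [simp]: "partial i (\<lambda>x. c) x = 0"
  using partial_eqI[OF has_derivative_const] .

text \<open>The algebra of functions generated by \<open>B\<close>. By the product rule, derivatives
  of the generators need only lie in this algebra, not in \<open>B\<close>, for everything in it to
  be smooth.\<close>

inductive_set alg_closure :: "(real^'n \<Rightarrow> real) set \<Rightarrow> (real^'n \<Rightarrow> real) set"
  for B where
  base: "f \<in> B \<Longrightarrow> f \<in> alg_closure B"
| const: "(\<lambda>x. c) \<in> alg_closure B"
| add: "f \<in> alg_closure B \<Longrightarrow> g \<in> alg_closure B \<Longrightarrow> (\<lambda>x. f x + g x) \<in> alg_closure B"
| mult: "f \<in> alg_closure B \<Longrightarrow> g \<in> alg_closure B \<Longrightarrow> (\<lambda>x. f x * g x) \<in> alg_closure B"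

lemma smooth_fun_alg_closure:
  assumes B: "\<And>f. f \<in> B \<Longrightarrow> (\<forall>x. f differentiable (at x)) \<and> (\<forall>i. partial i f \<in> alg_closure B)"
    and "f \<in> alg_closure B"
  shows "smooth_fun f"
proof (rule smooth_fun_coinduct[of "\<lambda>f. f \<in> alg_closure B"])
  fix f assume "f \<in> alg_closure B"
  then show "(\<forall>x. f differentiable (at x)) \<and> (\<forall>i. partial i f \<in> alg_closure B)"
  proof induction
    case (const c)
    have "partial i (\<lambda>x. c) = (\<lambda>x. 0)" for i by (rule ext) simp
    then show ?case by (auto intro: alg_closure.const)
  next
    case (add f g)
    then have "partial i (\<lambda>x. f x + g x) = (\<lambda>x. partial i f x + partial i g x)" for i
      by (intro ext partial_add) auto
    then show ?case using add by (auto intro!: alg_closure.add differentiable_add)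
  next
    case (mult f g)
    then have "partial i (\<lambda>x. f x * g x) = (\<lambda>x. f x * partial i g x + partial i f x * g x)" for i
      by (intro ext partial_mult) auto
    then show ?case using mult by (auto intro!: alg_closure.add alg_closure.mult differentiable_mult)
  qed (use B in blast)
qed fact

lemma smooth_fun_closure:
  assumes "f \<in> alg_closure (Collect smooth_fun)"
  shows "smooth_fun f"
  using assms
  by (rule smooth_fun_alg_closure[rotated])
    (auto simp: smooth_fun_differentiable smooth_fun_partial intro: alg_closure.base)

lemma smooth_fun_add: "smooth_fun f \<Longrightarrow> smooth_fun g \<Longrightarrow> smooth_fun (\<lambda>x. f x + g x)"
  and smooth_fun_mult: "smooth_fun f \<Longrightarrow> smooth_fun g \<Longrightarrow> smooth_fun (\<lambda>x. f x * g x)"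
  and smooth_fun_const: "smooth_fun (\<lambda>x. c)"
  by (rule smooth_fun_closure, auto intro: alg_closure.intros)+

lemma smooth_fun_sum:
  "(\<And>i. i \<in> I \<Longrightarrow> smooth_fun (f i)) \<Longrightarrow> smooth_fun (\<lambda>x. \<Sum>i\<in>I. f i x)"
  by (induction I rule: infinite_finite_induct) (auto intro: smooth_fun_add smooth_fun_const)

lemma smooth_fun_nth: "smooth_fun (\<lambda>x::real^'n. x $ j)"
proof -
  have D: "((\<lambda>x::real^'n. x $ j) has_derivative (\<lambda>h. h $ j)) (at x)" for x
    using bounded_linear.has_derivative[OF bounded_linear_vec_nth has_derivative_ident] .
  have "partial i (\<lambda>x::real^'n. x $ j) = (\<lambda>x. axis i 1 $ j)" for i
    using partial_eqI[OF D] by (intro ext) auto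
  then have "(\<lambda>x::real^'n. x $ j) \<in> alg_closure {\<lambda>x. x $ j} \<and> 
    (\<forall>i. partial i (\<lambda>x::real^'n. x $ j) \<in> alg_closure {\<lambda>x. x $ j})"
    by (auto intro: alg_closure.intros)
  then show ?thesis
    by (intro smooth_fun_alg_closure[of "{\<lambda>x::real^'n. x $ j}"]) (use D in \<open>auto simp: differentiable_def\<close>)
qed

section \<open>The flat functions p(1/t) exp(-1/t) and the bump exp(-1/t)\<close>

definition flat :: "real poly \<Rightarrow> real \<Rightarrow> real" where
  "flat p t = (if t > 0 then poly p (1 / t) * exp (- (1 / t)) else 0)"

lemma poly_exp_tendsto_0: "((\<lambda>u. poly p u * exp (- u)) \<longlongrightarrow> (0::real)) at_top"
proof -
  have "((\<lambda>u. \<Sum>i\<le>degree p. coeff p i * (u ^ i / exp u)) \<longlongrightarrow> (\<Sum>i\<le>degree p. coeff p i * 0)) at_top"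
    by (intro tendsto_sum tendsto_mult tendsto_const tendsto_power_div_exp_0)
  then show ?thesis
    by (simp add: poly_altdef sum_distrib_right sum_divide_distrib exp_minus field_simps)
qed

text \<open>With u = 1 / t, differentiating p(u) exp(-u) gives the chain rule factor -u^2 times
  (p'(u) - p(u)) exp(-u). The class is therefore closed under derivatives once the polynomial is a
  parameter; \<open>[:0, 0, 1:]\<close> is u^2.\<close>

lemma has_real_derivative_flat:
  "(flat p has_real_derivative flat ([:0, 0, 1:] * (p - pderiv p)) t) (at t)"
proof -
  consider "t > 0" | "t < 0" | "t = 0" by linarith
  then show ?thesis
  proof cases
    case 1
    have "((\<lambda>t. poly p (1 / t) * exp (- (1 / t))) has_real_derivative
      flat ([:0, 0, 1:] * (p - pderiv p)) t) (at t)"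
      using 1 unfolding flat_def
      by (auto intro!: derivative_eq_intros DERIV_chain'[OF _ poly_DERIV] simp: field_simps power2_eq_square)
    then show ?thesis
      by (rule DERIV_cong_ev[THEN iffD1, rotated -1])
        (use 1 in \<open>auto simp: flat_def eventually_nhds intro!: exI[of _ "{0<..}"]\<close>)
  next
    case 2
    have "((\<lambda>t. 0) has_real_derivative flat ([:0, 0, 1:] * (p - pderiv p)) t) (at t)"
      using 2 by (simp add: flat_def)
    then show ?thesis
      by (rule DERIV_cong_ev[THEN iffD1, rotated -1])
        (use 2 in \<open>auto simp: flat_def eventually_nhds intro!: exI[of _ "{..<0}"]\<close>)
  next
    case 3
    \<comment> \<open>At 0 the right difference quotient is u p(u) exp(-u) for u = 1 / h; the
      additional factor u is \<open>[:0, 1:]\<close>.\<close>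
    have "((\<lambda>u. poly ([:0, 1:] * p) u * exp (- u)) \<longlongrightarrow> 0) at_top"
      by (rule poly_exp_tendsto_0)
    then have "((\<lambda>t. poly ([:0, 1:] * p) (inverse t) * exp (- inverse t)) \<longlongrightarrow> 0) (at_right 0)"
      by (rule filterlim_compose[OF _ filterlim_inverse_at_top_right])
    then have r: "((\<lambda>h. (flat p (0 + h) - flat p 0) / h) \<longlongrightarrow> 0) (at_right 0)"
      by (rule Lim_transform_eventually)
        (auto simp: flat_def field_simps eventually_at_right_less intro!: eventually_at_rightI[of 0 1])
    have l: "((\<lambda>h. (flat p (0 + h) - flat p 0) / h) \<longlongrightarrow> 0) (at_left 0)"
      by (rule Lim_transform_eventually[OF tendsto_const])
        (auto simp: flat_def intro!: eventually_at_leftI[of "-1" 0])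
    show ?thesis
      using r l unfolding 3 DERIV_def
      by (simp add: filterlim_at_split flat_def)
  qed
qed

lemma smooth_fun_flat:
  fixes q :: "real^'n \<Rightarrow> real"
  assumes "smooth_fun q"
  shows "smooth_fun (\<lambda>x. flat p (q x))"
proof -
  \<comment> \<open>The chain rule yields a flat function with another polynomial times a derivative
    of \<open>q\<close>, so the generators comprise all \<open>flat p\<close> composed with
    \<open>q\<close> together with all smooth functions.\<close>
  let ?B = "Collect smooth_fun \<union> {\<lambda>x. flat p (q x) |p. True} :: (real^'n \<Rightarrow> real) set"
  show ?thesis
  proof (rule smooth_fun_alg_closure[of ?B])
    fix f assume "f \<in> ?B"
    then show "(\<forall>x. f differentiable at x) \<and> (\<forall>i. partial i f \<in> alg_closure ?B)"
    proof
      assume "f \<in> Collect smooth_fun"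
      then show ?thesis
        by (auto simp: smooth_fun_differentiable smooth_fun_partial intro!: alg_closure.base)
    next
      assume "f \<in> {\<lambda>x. flat p (q x) |p. True}"
      then obtain p where f: "f = (\<lambda>x. flat p (q x))" by blast
      let ?p = "[:0, 0, 1:] * (p - pderiv p)"
      have D: "(f has_derivative (\<lambda>h. flat ?p (q x) * frechet_derivative q (at x) h)) (at x)" for x
        unfolding f
        using has_real_derivative_flat[of p "q x"]
          smooth_fun_differentiable[OF assms, of x, unfolded frechet_derivative_works]
        unfolding has_field_derivative_def by (rule has_derivative_compose[rotated])
      have "partial i f = (\<lambda>x. flat ?p (q x) * partial i q x)" for i
        using partial_eqI[OF D] by (auto simp: partial_def)
      moreover have "(\<lambda>x. flat ?p (q x) * partial i q x) \<in> alg_closure ?B" for i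
        by (intro alg_closure.mult alg_closure.base) (use assms smooth_fun_partial in blast)+
      ultimately show ?thesis using D by (auto simp: differentiable_def)
    qed
  qed (auto intro: alg_closure.base)
qed

definition bump :: "real \<Rightarrow> real" where "bump = flat 1"

lemma bump_eq: "bump t = (if t > 0 then exp (- (1 / t)) else 0)"
  by (simp add: bump_def flat_def)

lemma bump_nonneg: "0 \<le> bump t" and bump_le_1: "bump t \<le> 1"
  and bump_pos_iff: "0 < bump t \<longleftrightarrow> 0 < t" and bump_eq_0_iff: "bump t = 0 \<longleftrightarrow> t \<le> 0"
  by (auto simp: bump_eq)

lemma bump_mono: "s \<le> t \<Longrightarrow> bump s \<le> bump t"
  by (auto simp: bump_eq field_simps)

lemma smooth_fun_bump: "smooth_fun q \<Longrightarrow> smooth_fun (\<lambda>x. bump (q x))"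
  unfolding bump_def by (rule smooth_fun_flat)

text \<open>\<open>flat [:0, 0, 1:]\<close> is the derivative of \<open>bump\<close> (the case p =
  1). Its uniform bound makes the gradient of a cut-off inversely proportional to the cut-off
  radius.\<close>

lemma bump_deriv_bounded: "\<exists>C>0. \<forall>t. \<bar>flat [:0, 0, 1:] t\<bar> \<le> C"
proof -
  have bd: "u^2 * exp (-u) \<le> 2" if "u > 0" for u :: real
  proof -
    have "u^2 \<le> 2 * exp u" using exp_lower_Taylor_quadratic[of u] that by simp
    then show ?thesis by (simp add: exp_minus field_simps)
  qed
  then have "\<bar>flat [:0, 0, 1:] t\<bar> \<le> 2" for t
    using bd[of "1 / t"] by (auto simp: flat_def power2_eq_square)
  then show ?thesis by (intro exI[of _ 2]) auto
qed

lemma DERIV_bump: "(bump has_real_derivative flat [:0, 0, 1:] t) (at t)"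
  using has_real_derivative_flat[of 1 t] unfolding bump_def by simp

section \<open>Polynomials of bounded degree\<close>

definition monomial :: "('n \<Rightarrow> nat) \<Rightarrow> real^'n \<Rightarrow> real" where
  "monomial \<alpha> x = (\<Prod>i\<in>UNIV. (x $ i) ^ \<alpha> i)"

definition multi_indices :: "nat \<Rightarrow> ('n::finite \<Rightarrow> nat) set" where
  "multi_indices k = {\<alpha>. (\<Sum>i\<in>UNIV. \<alpha> i) \<le> k}"

lemma multi_indices_le: "\<alpha> \<in> multi_indices k \<Longrightarrow> \<alpha> i \<le> k"
  unfolding multi_indices_def using member_le_sum[of i UNIV \<alpha>] by auto

lemma finite_bounded_multi_indices: "finite {\<alpha>::'n::finite \<Rightarrow> nat. \<forall>i. \<alpha> i \<le> k}"
proof -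
  have "{\<alpha>::'n \<Rightarrow> nat. \<forall>i. \<alpha> i \<le> k} = PiE UNIV (\<lambda>_. {..k})"
    by (auto simp: PiE_def Pi_def)
  then show ?thesis by (simp add: finite_PiE)
qed

lemma finite_multi_indices [simp]: "finite (multi_indices k)"
  by (rule finite_subset[OF _ finite_bounded_multi_indices[of k]]) (auto intro: multi_indices_le)

lemma total_degree_polys_iff:
  "p \<in> total_degree_polys k \<longleftrightarrow> (\<exists>c. p = (\<lambda>x. \<Sum>\<alpha>\<in>multi_indices k. c \<alpha> * monomial \<alpha> x))"
  unfolding total_degree_polys_def multi_indices_def monomial_def by simp

lemma monomial_in_polys:
  assumes "(\<Sum>i\<in>UNIV. \<alpha> i) \<le> k" shows "monomial \<alpha> \<in> total_degree_polys k"
proof -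
  have \<alpha>: "\<alpha> \<in> multi_indices k" using assms by (simp add: multi_indices_def)
  have "(\<Sum>\<beta>\<in>multi_indices k. (if \<beta> = \<alpha> then 1 else 0) * monomial \<beta> x) =
    (\<Sum>\<beta>\<in>multi_indices k. if \<beta> = \<alpha> then monomial \<alpha> x else 0)" for x
    by (rule sum.cong) auto
  then have "monomial \<alpha> = (\<lambda>x. \<Sum>\<beta>\<in>multi_indices k. (if \<beta> = \<alpha> then 1 else 0) * monomial \<beta> x)"
    using \<alpha> by (intro ext) simp
  then show ?thesis unfolding total_degree_polys_iff
    by (intro exI[of _ "\<lambda>\<beta>. if \<beta> = \<alpha> then 1 else 0"])
qed

lemma polys_add:
  assumes "p \<in> total_degree_polys k" "q \<in> total_degree_polys k"
  shows "(\<lambda>x. p x + q x) \<in> total_degree_polys k"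
proof -
  obtain c d where "p = (\<lambda>x. \<Sum>\<alpha>\<in>multi_indices k. c \<alpha> * monomial \<alpha> x)"
    "q = (\<lambda>x. \<Sum>\<alpha>\<in>multi_indices k. d \<alpha> * monomial \<alpha> x)"
    using assms unfolding total_degree_polys_iff by blast
  then show ?thesis unfolding total_degree_polys_iff
    by (intro exI[of _ "\<lambda>\<alpha>. c \<alpha> + d \<alpha>"]) (simp add: sum.distrib distrib_right)
qed

lemma polys_scale:
  assumes "p \<in> total_degree_polys k" shows "(\<lambda>x. a * p x) \<in> total_degree_polys k"
proof -
  obtain c where "p = (\<lambda>x. \<Sum>\<alpha>\<in>multi_indices k. c \<alpha> * monomial \<alpha> x)"
    using assms unfolding total_degree_polys_iff by blast
  then show ?thesis unfolding total_degree_polys_iff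
    by (intro exI[of _ "\<lambda>\<alpha>. a * c \<alpha>"]) (simp add: sum_distrib_left mult.assoc)
qed

lemma polys_const: "(\<lambda>x. a) \<in> total_degree_polys k"
  using polys_scale[OF monomial_in_polys[of "\<lambda>_. 0" k], of a] by (simp add: monomial_def)

lemma polys_sum:
  "(\<And>i. i \<in> I \<Longrightarrow> f i \<in> total_degree_polys k) \<Longrightarrow> (\<lambda>x. \<Sum>i\<in>I. f i x) \<in> total_degree_polys k"
  by (induction I rule: infinite_finite_induct) (auto intro: polys_add polys_const)

lemma polys_diff:
  assumes "p \<in> total_degree_polys k" "q \<in> total_degree_polys k"
  shows "(\<lambda>x. p x - q x) \<in> total_degree_polys k"
  using polys_add[OF assms(1) polys_scale[OF assms(2), of "-1"]] by simp

lemma polys_mono: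
  assumes "p \<in> total_degree_polys k" "k \<le> l" shows "p \<in> total_degree_polys l"
proof -
  obtain c where "p = (\<lambda>x. \<Sum>\<alpha>\<in>multi_indices k. c \<alpha> * monomial \<alpha> x)"
    using assms unfolding total_degree_polys_iff by blast
  then show ?thesis using assms(2)
    by (auto simp: multi_indices_def intro!: polys_sum polys_scale monomial_in_polys)
qed

lemma monomial_mult: "monomial \<alpha> x * monomial \<beta> x = monomial (\<lambda>i. \<alpha> i + \<beta> i) x"
  by (simp add: monomial_def prod.distrib power_add)

lemma polys_mult:
  assumes "p \<in> total_degree_polys k" "q \<in> total_degree_polys l"
  shows "(\<lambda>x. p x * q x) \<in> total_degree_polys (k + l)"
proof -
  obtain c d where "p = (\<lambda>x. \<Sum>\<alpha>\<in>multi_indices k. c \<alpha> * monomial \<alpha> x)"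
    "q = (\<lambda>x. \<Sum>\<alpha>\<in>multi_indices l. d \<alpha> * monomial \<alpha> x)"
    using assms unfolding total_degree_polys_iff by blast
  then have eq: "(\<lambda>x. p x * q x) = (\<lambda>x. \<Sum>\<alpha>\<in>multi_indices k. \<Sum>\<beta>\<in>multi_indices l.
    (c \<alpha> * d \<beta>) * monomial (\<lambda>i. \<alpha> i + \<beta> i) x)"
    by (simp add: sum_product monomial_mult[symmetric] mult_ac)
  show ?thesis unfolding eq
    by (intro polys_sum polys_scale monomial_in_polys) (auto simp: multi_indices_def sum.distrib)
qed

lemma polys_power:
  assumes "p \<in> total_degree_polys k"
  shows "(\<lambda>x. p x ^ m) \<in> total_degree_polys (m * k)"
proof (induction m)
  case (Suc m)
  then show ?case using polys_mult[OF assms Suc] by simp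
qed (simp add: polys_const)

lemma polys_prod:
  assumes "finite I" "\<And>i. i \<in> I \<Longrightarrow> f i \<in> total_degree_polys (k i)"
  shows "(\<lambda>x. \<Prod>i\<in>I. f i x) \<in> total_degree_polys (\<Sum>i\<in>I. k i)"
  using assms
proof (induction I rule: finite_induct)
  case (insert i I)
  then show ?case using polys_mult[of "f i" "k i" "\<lambda>x. \<Prod>i\<in>I. f i x" "\<Sum>i\<in>I. k i"] by auto
qed (simp add: polys_const)

lemma polys_nth: "(\<lambda>x::real^'n. x $ j) \<in> total_degree_polys 1"
proof -
  have "(\<lambda>x::real^'n. x $ j) = monomial (\<lambda>i. if i = j then 1 else 0)"
    by (auto simp: fun_eq_iff monomial_def if_distrib[of "\<lambda>k. _ ^ k"] cong: if_cong)
  then show ?thesis using monomial_in_polys[of "\<lambda>i. if i = j then 1 else 0" 1] by auto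
qed

lemma polys_linear:
  fixes A :: "real^'n \<Rightarrow> real" assumes "linear A"
  shows "A \<in> total_degree_polys 1"
proof -
  have "A = (\<lambda>x. \<Sum>i\<in>UNIV. A (axis i 1) * x $ i)"
  proof
    fix x
    interpret linear A by fact
    have "A x = A (\<Sum>i\<in>UNIV. x $ i *\<^sub>R axis i 1)"
      using basis_expansion[of x] by (simp add: scalar_mult_eq_scaleR)
    then show "A x = (\<Sum>i\<in>UNIV. A (axis i 1) * x $ i)" by (simp add: sum scale mult.commute)
  qed
  also have "\<dots> \<in> total_degree_polys 1"
    by (intro polys_sum polys_scale polys_nth)
  finally show ?thesis .
qed

lemma polys_affine:
  fixes p :: "real^'n \<Rightarrow> real" and A :: "real^'m \<Rightarrow> real^'n"
  assumes "p \<in> total_degree_polys k" "linear A"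
  shows "(\<lambda>x. p (a + A x)) \<in> total_degree_polys k"
proof -
  obtain c where p: "p = (\<lambda>x. \<Sum>\<alpha>\<in>multi_indices k. c \<alpha> * monomial \<alpha> x)"
    using assms unfolding total_degree_polys_iff by blast
  have lin: "linear (\<lambda>x. A x $ i)" for i
    using linear_compose[OF assms(2) bounded_linear.linear[OF bounded_linear_vec_nth[of i]]]
    by (simp add: o_def)
  have 1: "(\<lambda>x. (a + A x) $ i) \<in> total_degree_polys 1" for i
    using polys_add[OF polys_const polys_linear[OF lin[of i]], of "a $ i"] by simp
  have "(\<lambda>x. monomial \<alpha> (a + A x)) \<in> total_degree_polys (\<Sum>i\<in>UNIV. \<alpha> i)" for \<alpha>
    unfolding monomial_def using polys_power[OF 1] by (intro polys_prod) auto
  then have "(\<lambda>x. monomial \<alpha> (a + A x)) \<in> total_degree_polys k" if "\<alpha> \<in> multi_indices k" for \<alpha>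
    using that polys_mono unfolding multi_indices_def by blast
  then show ?thesis unfolding p by (intro polys_sum polys_scale)
qed

lemma coordinate_degree_polys_subset:
  "coordinate_degree_polys k \<subseteq> (total_degree_polys (CARD('n) * k) :: (real^'n \<Rightarrow> real) set)"
proof
  fix p :: "real^'n \<Rightarrow> real" assume "p \<in> coordinate_degree_polys k"
  then obtain c where p: "p = (\<lambda>x. \<Sum>\<alpha> | \<forall>i. \<alpha> i \<le> k. c \<alpha> * monomial \<alpha> x)"
    unfolding coordinate_degree_polys_def monomial_def by blast
  have "(\<Sum>i\<in>UNIV. \<alpha> i) \<le> CARD('n) * k" if "\<forall>i. \<alpha> i \<le> k" for \<alpha> :: "'n \<Rightarrow> nat"
    using sum_bounded_above[of UNIV \<alpha> k] that by simp
  then show "p \<in> total_degree_polys (CARD('n) * k)"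
    unfolding p by (intro polys_sum polys_scale monomial_in_polys) auto
qed

text \<open>Simplices and parallelotopes carry different polynomial spaces; a common bound on the
  total degree allows the same constants for both.\<close>

lemma local_space_subset:
  "local_space k T \<subseteq> (total_degree_polys (CARD('n) * k) :: (real^'n \<Rightarrow> real) set)"
  unfolding local_space_def using coordinate_degree_polys_subset[of k]
  by (auto intro: polys_mono)

lemma smooth_fun_power: "smooth_fun f \<Longrightarrow> smooth_fun (\<lambda>x. f x ^ m)"
  by (induction m) (auto intro: smooth_fun_mult smooth_fun_const)

lemma smooth_fun_prod:
  "(\<And>i. i \<in> I \<Longrightarrow> smooth_fun (f i)) \<Longrightarrow> smooth_fun (\<lambda>x. \<Prod>i\<in>I. f i x)"
  by (induction I rule: infinite_finite_induct) (auto intro: smooth_fun_mult smooth_fun_const)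

lemma smooth_fun_monomial: "smooth_fun (monomial \<alpha>)"
proof -
  have "smooth_fun (\<lambda>x. \<Prod>i\<in>UNIV. (x $ i) ^ \<alpha> i)"
    by (intro smooth_fun_prod smooth_fun_power smooth_fun_nth)
  then show ?thesis unfolding monomial_def[abs_def] .
qed

lemma smooth_fun_scale: "smooth_fun f \<Longrightarrow> smooth_fun (\<lambda>x. a * f x)"
  by (intro smooth_fun_mult smooth_fun_const)

lemma smooth_fun_diff: "smooth_fun f \<Longrightarrow> smooth_fun g \<Longrightarrow> smooth_fun (\<lambda>x. f x - g x)"
  using smooth_fun_add[of f "\<lambda>x. (-1) * g x"] smooth_fun_scale[of g "-1"] by simp

lemma smooth_fun_poly: "p \<in> total_degree_polys k \<Longrightarrow> smooth_fun p"
  unfolding total_degree_polys_iff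
  by (auto intro!: smooth_fun_sum smooth_fun_scale smooth_fun_monomial)

section \<open>Derivatives of polynomials of bounded degree\<close>

lemma partial_scale:
  "f differentiable (at x) \<Longrightarrow> partial i (\<lambda>x. a * f x) x = a * partial i f x"
  using partial_mult[of "\<lambda>x. a" x f i] by simp

lemma partial_diff:
  assumes "f differentiable (at x)" "g differentiable (at x)"
  shows "partial i (\<lambda>x. f x - g x) x = partial i f x - partial i g x"
  using partial_eqI[OF has_derivative_diff[OF assms[unfolded frechet_derivative_works]]]
  by (simp add: partial_def)

lemma partial_sum:
  assumes "finite I" "\<And>j. j \<in> I \<Longrightarrow> f j differentiable (at x)"
  shows "partial i (\<lambda>x. \<Sum>j\<in>I. f j x) x = (\<Sum>j\<in>I. partial i (f j) x)"
  using assms by (induction I rule: finite_induct) (auto simp: partial_add differentiable_sum)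

lemma partial_monomial_in_polys:
  assumes "\<alpha> \<in> multi_indices k"
  shows "partial i (monomial \<alpha>) \<in> total_degree_polys k"
proof -
  have D: "(monomial \<alpha> has_derivative
     (\<lambda>y. \<Sum>j\<in>UNIV. (real (\<alpha> j) * (y $ j * (x $ j) ^ (\<alpha> j - 1))) * (\<Prod>l\<in>UNIV - {j}. (x $ l) ^ \<alpha> l))) (at x)" for x
    unfolding monomial_def[abs_def]
    by (rule has_derivative_prod, rule has_derivative_eq_rhs,
        rule has_derivative_power, rule bounded_linear.has_derivative[OF bounded_linear_vec_nth has_derivative_ident])
      (auto simp: fun_eq_iff)
  \<comment> \<open>For \<alpha> i = 0 the truncated exponent \<open>\<alpha> i - 1\<close> is 0,
    and the factor \<open>real (\<alpha> i)\<close> makes the right side vanish as it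
    should.\<close>
  have eq: "partial i (monomial \<alpha>) x = real (\<alpha> i) * monomial (\<alpha>(i := \<alpha> i - 1)) x" for x
  proof -
    have "partial i (monomial \<alpha>) x =
      (\<Sum>j\<in>UNIV. if j = i then real (\<alpha> i) * (x $ i) ^ (\<alpha> i - 1) * (\<Prod>l\<in>UNIV - {i}. (x $ l) ^ \<alpha> l) else 0)"
      unfolding partial_eqI[OF D] by (rule sum.cong) (auto simp: axis_def)
    also have "\<dots> = real (\<alpha> i) * ((x $ i) ^ (\<alpha> i - 1) * (\<Prod>l\<in>UNIV - {i}. (x $ l) ^ \<alpha> l))"
      by simp
    also have "(x $ i) ^ (\<alpha> i - 1) * (\<Prod>l\<in>UNIV - {i}. (x $ l) ^ \<alpha> l) = monomial (\<alpha>(i := \<alpha> i - 1)) x"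
      unfolding monomial_def by (subst prod.remove[of UNIV i]) auto
    finally show ?thesis .
  qed
  have "(\<Sum>j\<in>UNIV. (\<alpha>(i := \<alpha> i - 1)) j) \<le> (\<Sum>j\<in>UNIV. \<alpha> j)"
    by (rule sum_mono) auto
  then have "monomial (\<alpha>(i := \<alpha> i - 1)) \<in> total_degree_polys k"
    using assms unfolding multi_indices_def by (intro monomial_in_polys) auto
  then have "(\<lambda>x. real (\<alpha> i) * monomial (\<alpha>(i := \<alpha> i - 1)) x) \<in> total_degree_polys k"
    by (rule polys_scale)
  moreover have "partial i (monomial \<alpha>) = (\<lambda>x. real (\<alpha> i) * monomial (\<alpha>(i := \<alpha> i - 1)) x)"
    using eq by (rule ext)
  ultimately show ?thesis by metis
qed

lemma partial_poly_expansion: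
  "partial i (\<lambda>x. \<Sum>\<alpha>\<in>multi_indices k. c \<alpha> * monomial \<alpha> x) x
    = (\<Sum>\<alpha>\<in>multi_indices k. c \<alpha> * partial i (monomial \<alpha>) x)"
  by (subst partial_sum)
    (auto simp: smooth_fun_differentiable smooth_fun_monomial partial_scale
      intro!: smooth_fun_differentiable smooth_fun_scale)

lemma partial_in_polys:
  assumes "p \<in> total_degree_polys k" shows "partial i p \<in> total_degree_polys k"
proof -
  obtain c where p: "p = (\<lambda>x. \<Sum>\<alpha>\<in>multi_indices k. c \<alpha> * monomial \<alpha> x)"
    using assms unfolding total_degree_polys_iff by blast
  have "partial i p = (\<lambda>x. \<Sum>\<alpha>\<in>multi_indices k. c \<alpha> * partial i (monomial \<alpha>) x)"
    unfolding p using partial_poly_expansion by blast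
  then show ?thesis by (simp add: partial_monomial_in_polys polys_scale polys_sum)
qed

lemma laplacian_in_polys:
  assumes "p \<in> total_degree_polys k" shows "laplacian p \<in> total_degree_polys k"
  unfolding laplacian_def[abs_def]
  by (intro polys_sum partial_in_polys assms)

subsection \<open>Norm equivalence\<close>

lemma base_digits_unique:
  fixes a d :: "nat \<Rightarrow> nat"
  assumes "(\<Sum>i<n. a i * b ^ i) = (\<Sum>i<n. d i * b ^ i)"
    and "\<And>i. a i < b" "\<And>i. d i < b" and "j < n"
  shows "a j = d j"
  using assms
proof (induction n arbitrary: a d j)
  case (Suc n)
  have e: "(\<Sum>i<Suc n. a i * b ^ i) = a 0 + b * (\<Sum>i<n. a (Suc i) * b ^ i)" for a :: "nat \<Rightarrow> nat"
    by (subst sum.lessThan_Suc_shift) (simp add: sum_distrib_left mult_ac)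
  have eq: "a 0 + b * (\<Sum>i<n. a (Suc i) * b ^ i) = d 0 + b * (\<Sum>i<n. d (Suc i) * b ^ i)"
    using Suc.prems(1) unfolding e .
  have 0: "a 0 = d 0"
    using arg_cong[OF eq, of "\<lambda>x. x mod b"] Suc.prems(2,3)[of 0] by simp
  moreover have "b > 0" using Suc.prems(2)[of 0] by simp
  ultimately have "(\<Sum>i<n. a (Suc i) * b ^ i) = (\<Sum>i<n. d (Suc i) * b ^ i)"
    using eq by simp
  then have "a (Suc i) = d (Suc i)" if "i < n" for i
    using Suc.IH[of "\<lambda>i. a (Suc i)" "\<lambda>i. d (Suc i)" i] Suc.prems(2,3) that by blast
  then show ?case using 0 Suc.prems(4) by (cases j) auto
qed simp

text \<open>Kronecker substitution: along the curve with components \<open>t ^ b ^ e i\<close> distinct monomials of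
  degree less than \<open>b\<close> become distinct powers of \<open>t\<close>.\<close>

lemma poly_coeffs_eq_0:
  fixes c :: "('n::finite \<Rightarrow> nat) \<Rightarrow> real"
  assumes 0: "\<And>x::real^'n. x \<in> ball 0 1 \<Longrightarrow> (\<Sum>\<alpha>\<in>multi_indices k. c \<alpha> * monomial \<alpha> x) = 0"
    and \<alpha>: "\<alpha> \<in> multi_indices k"
  shows "c \<alpha> = 0"
proof -
  define n where "n = CARD('n)"
  obtain e :: "'n \<Rightarrow> nat" where e: "bij_betw e UNIV {..<n}"
    unfolding n_def using ex_bij_betw_finite_nat[of "UNIV :: 'n set"] by (auto simp: atLeast0LessThan)
  define b where "b = Suc k"
  define w where "w \<alpha> = (\<Sum>i\<in>UNIV. \<alpha> i * b ^ e i)" for \<alpha> :: "'n \<Rightarrow> nat"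
  define e' where "e' = inv_into UNIV e"
  have e': "e' (e i) = i" for i using e by (simp add: e'_def bij_betw_def)
  have inj: "\<alpha> = \<beta>" if "\<alpha> \<in> multi_indices k" "\<beta> \<in> multi_indices k" "w \<alpha> = w \<beta>" for \<alpha> \<beta>
  proof
    fix i
    have w: "w \<alpha> = (\<Sum>j<n. \<alpha> (e' j) * b ^ j)" for \<alpha>
      unfolding w_def using sum.reindex_bij_betw[OF e, of "\<lambda>j. \<alpha> (e' j) * b ^ j"] by (simp add: e')
    have "\<alpha> (e' (e i)) = \<beta> (e' (e i))"
      using base_digits_unique[of "\<lambda>j. \<alpha> (e' j)" b n "\<lambda>j. \<beta> (e' j)" "e i"] that e
      by (auto simp: w b_def less_Suc_eq_le multi_indices_le bij_betw_def)
    then show "\<alpha> i = \<beta> i" by (simp add: e')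
  qed
  define q :: "real poly" where "q = (\<Sum>\<alpha>\<in>multi_indices k. monom (c \<alpha>) (w \<alpha>))"
  \<comment> \<open>The curve point has n components of size at most t, so t < 1 / (n + 1) keeps it
    in the unit ball, where the polynomial vanishes. This already gives infinitely many roots of
    \<open>q\<close>.\<close>
  have "poly q t = 0" if t: "0 < t" "t < 1 / (real n + 1)" for t
  proof -
    have n0: "real n > 0" by (simp add: n_def)
    have t1: "t < 1" using less_trans[OF t(2), of 1] n0 by simp
    define x :: "real^'n" where "x = (\<chi> i. t ^ (b ^ e i))"
    have "norm x \<le> (\<Sum>i\<in>UNIV. \<bar>x $ i\<bar>)" by (rule norm_le_l1_cart)
    also have "\<dots> \<le> (\<Sum>i\<in>(UNIV::'n set). t)"
    proof (rule sum_mono)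
      fix i have "t ^ (b ^ e i) \<le> t ^ 1"
        using t t1 by (intro power_decreasing) (auto simp: b_def)
      then show "\<bar>x $ i\<bar> \<le> t" using t by (simp add: x_def)
    qed
    also have "\<dots> = real n * t" by (simp add: n_def)
    also have "\<dots> < 1" using t by (simp add: field_simps)
    finally have "x \<in> ball 0 1" by simp
    moreover have "monomial \<alpha> x = t ^ w \<alpha>" for \<alpha>
      by (simp add: monomial_def x_def w_def power_sum power_mult[symmetric] mult.commute)
    ultimately show ?thesis using 0[of x] by (simp add: q_def poly_sum poly_monom)
  qed
  then have "{0<..<1 / (real n + 1)} \<subseteq> {t. poly q t = 0}" by auto
  moreover have "infinite {0<..<1 / (real n + 1)}" by (rule infinite_Ioo) simp
  ultimately have "q = 0" using poly_roots_finite[of q] finite_subset by blast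
  then have "0 = coeff q (w \<alpha>)" by simp
  also have "\<dots> = (\<Sum>\<beta>\<in>multi_indices k. if \<beta> = \<alpha> then c \<alpha> else 0)"
    unfolding q_def coeff_sum by (rule sum.cong) (use inj \<alpha> in auto)
  also have "\<dots> = c \<alpha>" using \<alpha> by simp
  finally show ?thesis by simp
qed


lemma smooth_fun_continuous: "smooth_fun f \<Longrightarrow> continuous_on S f"
  by (meson continuous_at_imp_continuous_on differentiable_imp_continuous_within smooth_fun_differentiable)

lemma smooth_fun_borel: "smooth_fun f \<Longrightarrow> f \<in> borel_measurable borel"
  by (intro borel_measurable_continuous_onI smooth_fun_continuous)

lemma set_integrable_continuous_bounded:
  fixes f :: "'a::euclidean_space \<Rightarrow> real"
  assumes "continuous_on UNIV f" "bounded S" "S \<in> sets borel"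
  shows "set_integrable lborel S f"
proof -
  obtain a where "S \<subseteq> cbox (-a) a" using assms(2) bounded_subset_cbox_symmetric by blast
  moreover have "set_integrable lborel (cbox (-a) a) f"
    unfolding set_integrable_def using assms(1)
    by (intro borel_integrable_compact) (auto intro: continuous_on_subset)
  ultimately show ?thesis by (rule set_integrable_subset[rotated 2]) (use assms in auto)
qed

lemma set_integral_sum:
  fixes f :: "'i \<Rightarrow> 'a \<Rightarrow> real"
  assumes "\<And>i. i \<in> I \<Longrightarrow> set_integrable M A (f i)"
  shows "(LINT x:A|M. \<Sum>i\<in>I. f i x) = (\<Sum>i\<in>I. LINT x:A|M. f i x)"
  using assms unfolding set_lebesgue_integral_def set_integrable_def
  by (simp add: sum_distrib_left Bochner_Integration.integral_sum)

text \<open>Equivalence of norms in finite dimension: the squared L2 norm is a quadratic form in the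
  coefficients that is positive, hence bounded away from 0, on the compact set of coefficient
  vectors of l1 norm one. Homogeneity gives the rest.\<close>

lemma coeffs_bounded_by_L2:
  "\<exists>C>0. \<forall>c. (\<Sum>\<alpha>\<in>multi_indices k. \<bar>c \<alpha>\<bar>)\<^sup>2 \<le>
     C * (LINT x:ball 0 1|lborel. (\<Sum>\<alpha>\<in>multi_indices k. c \<alpha> * monomial \<alpha> (x::real^'n))\<^sup>2)"
proof -
  let ?I = "multi_indices k :: ('n \<Rightarrow> nat) set"
  define P where "P c x = (\<Sum>\<alpha>\<in>?I. c \<alpha> * monomial \<alpha> x)" for c :: "('n \<Rightarrow> nat) \<Rightarrow> real" and x
  define Q where "Q c = (LINT x:ball 0 1|lborel. (P c x)\<^sup>2)" for c
  define m where "m \<alpha> \<beta> = (LINT x:ball 0 1|lborel. monomial \<alpha> x * monomial \<beta> (x::real^'n))" for \<alpha> \<beta>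
  have cont: "continuous_on S (monomial \<alpha>)" for S and \<alpha> :: "'n \<Rightarrow> nat"
    by (intro smooth_fun_continuous smooth_fun_monomial)
  have contP: "continuous_on S (P c)" for S c
    unfolding P_def by (intro continuous_intros cont)
  have si: "set_integrable lborel (ball 0 1) f" if "continuous_on UNIV f" for f :: "real^'n \<Rightarrow> real"
    using that by (rule set_integrable_continuous_bounded) auto
  \<comment> \<open>Expanded as a quadratic form with the Gram matrix \<open>m\<close>,
    \<open>Q\<close> is visibly continuous in the coefficients.\<close>
  have Q: "Q c = (\<Sum>\<alpha>\<in>?I. \<Sum>\<beta>\<in>?I. c \<alpha> * c \<beta> * m \<alpha> \<beta>)" for c
  proof -
    have "Q c = (LINT x:ball 0 1|lborel. (\<Sum>\<alpha>\<in>?I. \<Sum>\<beta>\<in>?I. c \<alpha> * c \<beta> * (monomial \<alpha> x * monomial \<beta> x)))"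
      unfolding Q_def P_def by (simp add: power2_eq_square sum_product mult_ac)
    also have "\<dots> = (\<Sum>\<alpha>\<in>?I. \<Sum>\<beta>\<in>?I. c \<alpha> * c \<beta> * m \<alpha> \<beta>)"
      unfolding m_def
      by (subst set_integral_sum, intro si continuous_intros cont,
          intro sum.cong refl, subst set_integral_sum, intro si continuous_intros cont,
          intro sum.cong refl, simp)
    finally show ?thesis .
  qed
  \<comment> \<open>Coefficients outside the finite index set are frozen at 0. The surrounding box
    is then a product of compact intervals and points, so compactness holds in the product topology
    although the type of multi-indices is infinite.\<close>
  define K where "K = {c. (\<forall>\<alpha>. c \<alpha> \<in> (if \<alpha> \<in> ?I then {-1..1} else {0})) \<and> (\<Sum>\<alpha>\<in>?I. \<bar>c \<alpha>\<bar>) = (1::real)}"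
  have comp: "compact K"
  proof -
    have "compact (PiE UNIV (\<lambda>\<alpha>. if \<alpha> \<in> ?I then {-1..1} else {0::real}))"
      using compactin_PiE[of "\<lambda>_. euclidean" UNIV "\<lambda>\<alpha>. if \<alpha> \<in> ?I then {-1..1} else {0::real}"]
      by (simp add: euclidean_product_topology)
    moreover have "closed {c. (\<Sum>\<alpha>\<in>?I. \<bar>c \<alpha>\<bar>) = (1::real)}"
      by (intro closed_Collect_eq continuous_intros continuous_on_product_coordinates)
    ultimately have "compact (PiE UNIV (\<lambda>\<alpha>. if \<alpha> \<in> ?I then {-1..1} else {0::real}) \<inter> {c. (\<Sum>\<alpha>\<in>?I. \<bar>c \<alpha>\<bar>) = 1})"
      by (rule compact_Int_closed)
    also have "\<dots> = K" unfolding K_def by (auto simp: PiE_def Pi_def)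
    finally show ?thesis .
  qed
  have contQ: "continuous_on K Q"
    unfolding Q by (intro continuous_intros continuous_on_product_coordinates continuous_on_subset[OF continuous_on_product_coordinates]) auto
  have pos: "Q c > 0" if "c \<in> K" for c
  proof (rule ccontr)
    assume "\<not> Q c > 0"
    moreover have "Q c \<ge> 0" unfolding Q_def set_lebesgue_integral_def by (intro integral_nonneg_AE) auto
    ultimately have "Q c = 0" by simp
    then have "(LINT x|lborel. indicator (ball 0 1) x *\<^sub>R (P c x)\<^sup>2) = 0" unfolding Q_def set_lebesgue_integral_def by simp
    then have ae: "AE x in lborel. indicator (ball 0 1) x *\<^sub>R (P c x)\<^sup>2 = 0"
      by (subst (asm) integral_nonneg_eq_0_iff_AE)
        (use si[of "\<lambda>x. (P c x)\<^sup>2"] contP in \<open>auto simp: set_integrable_def intro!: continuous_intros\<close>)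
    \<comment> \<open>A zero integral makes \<open>P c\<close> vanish almost everywhere in the ball;
      the exceptional set is open, so a null set of this kind is empty.\<close>
    let ?U = "ball 0 1 \<inter> {x. P c x \<noteq> 0}"
    have op: "open ?U" by (intro open_Int open_Collect_neq contP) auto
    have "{x. \<not> indicator (ball 0 1) x *\<^sub>R (P c x)\<^sup>2 = 0} = ?U" by (auto simp: indicator_def)
    then have "emeasure lborel ?U = 0" using ae op
      by (subst (asm) AE_iff_measurable[of ?U]) auto
    then have "negligible ?U" using op
      by (simp add: negligible_iff_null_sets null_sets_completionI null_setsI)
    then have "?U = {}" using op open_not_negligible by blast
    then have "\<And>x. x \<in> ball 0 1 \<Longrightarrow> P c x = 0" by blast
    then have "c \<alpha> = 0" if "\<alpha> \<in> ?I" for \<alpha>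
      unfolding P_def by (rule poly_coeffs_eq_0) (use that in auto)
    then have "(\<Sum>\<alpha>\<in>?I. \<bar>c \<alpha>\<bar>) = 0" by simp
    then show False using \<open>c \<in> K\<close> by (simp add: K_def)
  qed
  obtain q where q: "q > 0" "\<And>c. c \<in> K \<Longrightarrow> q \<le> Q c"
  proof (cases "K = {}")
    case False
    then obtain c0 where "c0 \<in> K" "\<forall>c\<in>K. Q c0 \<le> Q c"
      using continuous_attains_inf[OF comp _ contQ] by blast
    then show ?thesis using that[of "Q c0"] pos by blast
  qed (use that[of 1] in auto)
  have "(\<Sum>\<alpha>\<in>?I. \<bar>c \<alpha>\<bar>)\<^sup>2 \<le> inverse q * Q c" for c
  proof -
    define s where "s = (\<Sum>\<alpha>\<in>?I. \<bar>c \<alpha>\<bar>)"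
    show ?thesis
    proof (cases "s = 0")
      case True
      have "Q c \<ge> 0" unfolding Q_def set_lebesgue_integral_def by (intro integral_nonneg_AE) auto
      then show ?thesis using True q unfolding s_def by simp
    next
      case False
      moreover have "s \<ge> 0" unfolding s_def by (intro sum_nonneg) auto
      ultimately have s: "s > 0" by simp
      define d where "d = (\<lambda>\<alpha>. if \<alpha> \<in> ?I then c \<alpha> / s else 0)"
      have "\<bar>c \<alpha>\<bar> \<le> s" if "\<alpha> \<in> ?I" for \<alpha>
        unfolding s_def using member_le_sum[OF that, of "\<lambda>\<alpha>. \<bar>c \<alpha>\<bar>"] by auto
      then have "c \<alpha> / s \<le> 1 \<and> -1 \<le> c \<alpha> / s" if "\<alpha> \<in> ?I" for \<alpha>
        using that s by (force simp: abs_le_iff divide_le_eq le_divide_eq)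
      moreover have "(\<Sum>\<alpha>\<in>?I. \<bar>d \<alpha>\<bar>) = (\<Sum>\<alpha>\<in>?I. \<bar>c \<alpha>\<bar>) / s"
        unfolding d_def using s by (simp add: sum_divide_distrib)
      then have "(\<Sum>\<alpha>\<in>?I. \<bar>d \<alpha>\<bar>) = 1" using s by (simp add: s_def[symmetric])
      ultimately have "d \<in> K" unfolding K_def d_def using s by auto
      then have "q \<le> Q d" by (rule q(2))
      also have "Q d = Q c / s\<^sup>2"
      proof -
        have "P d x = P c x / s" for x unfolding P_def d_def by (simp add: sum_divide_distrib)
        then show ?thesis unfolding Q_def by (simp add: power_divide)
      qed
      finally show ?thesis using s q(1) unfolding s_def[symmetric] by (simp add: field_simps)
    qed
  qed
  then show ?thesis using q(1) unfolding Q_def P_def by (intro exI[of _ "inverse q"]) auto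
qed

text \<open>The coefficients are controlled by the L2 norm on the unit ball, and the finitely many
  monomials and their first derivatives are bounded on the larger ball. The radius \<open>R\<close>
  may exceed 1: this is how a small ball inside an element controls the whole element.\<close>

lemma poly_sup_bound_unit:
  "\<exists>C>0. \<forall>p\<in>total_degree_polys k. \<forall>x\<in>cball 0 R. \<forall>i.
     (p x)\<^sup>2 \<le> C * (LINT x:ball 0 1|lborel. (p (x::real^'n))\<^sup>2) \<and>
     (partial i p x)\<^sup>2 \<le> C * (LINT x:ball 0 1|lborel. (p x)\<^sup>2)"
proof -
  let ?I = "multi_indices k :: ('n \<Rightarrow> nat) set"
  obtain C where C: "C > 0" "\<And>c. (\<Sum>\<alpha>\<in>?I. \<bar>c \<alpha>\<bar>)\<^sup>2 \<le>
     C * (LINT x:ball 0 1|lborel. (\<Sum>\<alpha>\<in>?I. c \<alpha> * monomial \<alpha> x)\<^sup>2)"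
    using coeffs_bounded_by_L2[of k] by blast
  have "\<exists>B. \<forall>x\<in>cball 0 R. \<bar>f x\<bar> \<le> B" if "smooth_fun f" for f :: "real^'n \<Rightarrow> real"
  proof -
    have "bounded (f ` cball 0 R)"
      using that by (intro compact_imp_bounded compact_continuous_image smooth_fun_continuous) auto
    then show ?thesis unfolding bounded_iff by auto
  qed
  note bex = this
  define b where "b f = (SOME B. \<forall>x\<in>cball 0 R. \<bar>f x\<bar> \<le> B)" for f :: "real^'n \<Rightarrow> real"
  have b: "\<bar>f x\<bar> \<le> b f" if "smooth_fun f" "x \<in> cball 0 R" for f x
    using someI_ex[OF bex[OF that(1)]] that(2) unfolding b_def by blast
  define S where "S = monomial ` ?I \<union> (\<Union>i. (\<lambda>\<alpha>. partial i (monomial \<alpha>)) ` ?I)"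
  have finS: "finite S" unfolding S_def by auto
  have smS: "f \<in> S \<Longrightarrow> smooth_fun f" for f
    unfolding S_def by (auto intro: smooth_fun_monomial smooth_fun_partial)
  define B where "B = (\<Sum>f\<in>S. \<bar>b f\<bar>)"
  have B: "\<bar>f x\<bar> \<le> B" if "f \<in> S" "x \<in> cball 0 R" for f x
  proof -
    have "\<bar>f x\<bar> \<le> b f" using b smS that by blast
    also have "\<dots> \<le> \<bar>b f\<bar>" by simp
    also have "\<dots> \<le> B" unfolding B_def using member_le_sum[OF that(1), of "\<lambda>f. \<bar>b f\<bar>"] finS by auto
    finally show ?thesis .
  qed
  \<comment> \<open>Values and derivatives at once: \<open>F \<alpha>\<close> is either the monomial
    or one of its partial derivatives. The summand 1 keeps the constant positive when
    \<open>B\<close> is 0.\<close>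
  have key: "(\<Sum>\<alpha>\<in>?I. c \<alpha> * F \<alpha> x)\<^sup>2 \<le> (C * B\<^sup>2 + 1) * (LINT x:ball 0 1|lborel. (\<Sum>\<alpha>\<in>?I. c \<alpha> * monomial \<alpha> x)\<^sup>2)"
    if "x \<in> cball 0 R" "\<And>\<alpha>. \<alpha> \<in> ?I \<Longrightarrow> F \<alpha> \<in> S" for F c x
  proof -
    let ?Q = "LINT x:ball 0 1|lborel. (\<Sum>\<alpha>\<in>?I. c \<alpha> * monomial \<alpha> x)\<^sup>2"
    have "?Q \<ge> 0" unfolding set_lebesgue_integral_def by (intro integral_nonneg_AE) auto
    have "\<bar>\<Sum>\<alpha>\<in>?I. c \<alpha> * F \<alpha> x\<bar> \<le> (\<Sum>\<alpha>\<in>?I. \<bar>c \<alpha> * F \<alpha> x\<bar>)" by (rule sum_abs)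
    also have "\<dots> \<le> (\<Sum>\<alpha>\<in>?I. \<bar>c \<alpha>\<bar> * B)"
      using B that by (intro sum_mono) (auto simp: abs_mult intro!: mult_left_mono)
    finally have "\<bar>\<Sum>\<alpha>\<in>?I. c \<alpha> * F \<alpha> x\<bar> \<le> (\<Sum>\<alpha>\<in>?I. \<bar>c \<alpha>\<bar>) * B" by (simp add: sum_distrib_right)
    then have "(\<Sum>\<alpha>\<in>?I. c \<alpha> * F \<alpha> x)\<^sup>2 \<le> ((\<Sum>\<alpha>\<in>?I. \<bar>c \<alpha>\<bar>) * B)\<^sup>2"
      by (metis abs_ge_zero power_mono power2_abs)
    also have "\<dots> \<le> (C * ?Q) * B\<^sup>2"
      unfolding power_mult_distrib using C(2) by (intro mult_right_mono) auto
    also have "\<dots> \<le> (C * B\<^sup>2 + 1) * ?Q" using \<open>?Q \<ge> 0\<close> by (simp add: algebra_simps)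
    finally show ?thesis .
  qed
  show ?thesis
  proof (intro exI[of _ "C * B\<^sup>2 + 1"] conjI ballI allI)
    show "C * B\<^sup>2 + 1 > 0" using C(1) by (simp add: add_nonneg_pos)
    fix p :: "real^'n \<Rightarrow> real" and x :: "real^'n" and i assume p: "p \<in> total_degree_polys k" and x: "x \<in> cball 0 R"
    then obtain c where c: "p = (\<lambda>x. \<Sum>\<alpha>\<in>?I. c \<alpha> * monomial \<alpha> x)"
      unfolding total_degree_polys_iff by blast
    show "(p x)\<^sup>2 \<le> (C * B\<^sup>2 + 1) * (LINT x:ball 0 1|lborel. (p x)\<^sup>2)"
      unfolding c by (rule key[OF x]) (auto simp: S_def)
    show "(partial i p x)\<^sup>2 \<le> (C * B\<^sup>2 + 1) * (LINT x:ball 0 1|lborel. (p x)\<^sup>2)"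
      unfolding c partial_poly_expansion by (rule key[OF x]) (auto simp: S_def)
  qed
qed

lemma set_integral_ball_scale:
  fixes f :: "real^'n \<Rightarrow> real"
  assumes "continuous_on UNIV f" "\<rho> > 0"
  shows "(LINT x:ball a \<rho>|lborel. f x) = \<rho> ^ CARD('n) * (LINT y:ball 0 1|lborel. f (a + \<rho> *\<^sub>R y))"
proof -
  have [measurable]: "ball a \<rho> \<in> sets borel" by simp
  have [measurable]: "f \<in> borel_measurable borel" using assms by (intro borel_measurable_continuous_onI)
  have "(LINT x|lborel. indicator (ball a \<rho>) x *\<^sub>R f x) =
    (LINT x|density (distr lborel borel (\<lambda>y. a + \<rho> *\<^sub>R y)) (\<lambda>_. ennreal (\<rho> ^ CARD('n))). indicator (ball a \<rho>) x *\<^sub>R f x)"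
    using lborel_affine[of \<rho> a] assms(2) by simp
  also have "\<dots> = (LINT x|distr lborel borel (\<lambda>y. a + \<rho> *\<^sub>R y). \<rho> ^ CARD('n) *\<^sub>R (indicator (ball a \<rho>) x *\<^sub>R f x))"
    by (rule integral_density) (use assms(2) in simp_all)
  also have "\<dots> = (LINT y|lborel. \<rho> ^ CARD('n) *\<^sub>R (indicator (ball a \<rho>) (a + \<rho> *\<^sub>R y) *\<^sub>R f (a + \<rho> *\<^sub>R y)))"
    by (rule integral_distr)
      (auto simp: assms intro!: borel_measurable_continuous_onI[OF assms(1)] borel_measurable_scaleR borel_measurable_indicator)
  also have "\<dots> = (LINT y|lborel. \<rho> ^ CARD('n) *\<^sub>R (indicator (ball 0 1) y *\<^sub>R f (a + \<rho> *\<^sub>R y)))"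
    using assms(2) by (intro Bochner_Integration.integral_cong) (auto simp: indicator_def dist_norm field_simps)
  finally show ?thesis unfolding set_lebesgue_integral_def by simp
qed

text \<open>Pulling back by y -> a + \<rho> y, the integral picks up the factor \<rho>^n and each
  derivative the factor \<rho>, which explains the exponents n and n + 2. The constant is that of
  the unit ball, independent of \<open>a\<close> and \<rho>.\<close>

lemma poly_sup_bound:
  "\<exists>C>0. \<forall>p\<in>total_degree_polys k. \<forall>a::real^'n. \<forall>\<rho>>0. \<forall>x\<in>cball a (R * \<rho>). \<forall>i.
     (p x)\<^sup>2 * \<rho> ^ CARD('n) \<le> C * (LINT x:ball a \<rho>|lborel. (p (x::real^'n))\<^sup>2) \<and>
     (partial i p x)\<^sup>2 * \<rho> ^ (CARD('n) + 2) \<le> C * (LINT x:ball a \<rho>|lborel. (p x)\<^sup>2)"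
proof -
  obtain C where C: "C > 0" "\<And>p x i. p\<in>total_degree_polys k \<Longrightarrow> x\<in>cball 0 R \<Longrightarrow>
     (p x)\<^sup>2 \<le> C * (LINT x:ball 0 1|lborel. (p (x::real^'n))\<^sup>2) \<and>
     (partial i p x)\<^sup>2 \<le> C * (LINT x:ball 0 1|lborel. (p x)\<^sup>2)"
    using poly_sup_bound_unit[of k R] by blast
  show ?thesis
  proof (intro exI[of _ C] conjI ballI allI impI C(1))
    fix p :: "real^'n \<Rightarrow> real" and a :: "real^'n" and \<rho> :: real and x i
    assume p: "p \<in> total_degree_polys k" and \<rho>: "\<rho> > 0" and x: "x \<in> cball a (R * \<rho>)"
    define q where "q y = p (a + \<rho> *\<^sub>R y)" for y
    define y where "y = (x - a) /\<^sub>R \<rho>"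
    have y: "y \<in> cball 0 R" "a + \<rho> *\<^sub>R y = x"
      using x \<rho> by (auto simp: y_def dist_norm norm_minus_commute divide_le_eq divide_inverse_commute[symmetric])
    have q: "q \<in> total_degree_polys k"
      unfolding q_def by (rule polys_affine[OF p]) (simp add: linear_scaleR)
    have I: "(LINT x:ball a \<rho>|lborel. (p x)\<^sup>2) = \<rho> ^ CARD('n) * (LINT y:ball 0 1|lborel. (q y)\<^sup>2)"
      unfolding q_def
      by (rule set_integral_ball_scale) (use \<rho> p in \<open>auto intro!: smooth_fun_continuous smooth_fun_power intro: smooth_fun_poly\<close>)
    have "(p has_derivative frechet_derivative p (at x)) (at (a + \<rho> *\<^sub>R y))"
      using smooth_fun_differentiable[OF smooth_fun_poly[OF p]] frechet_derivative_works y by metis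
    then have "(q has_derivative (\<lambda>h. frechet_derivative p (at x) (\<rho> *\<^sub>R h))) (at y)"
      unfolding q_def by (rule has_derivative_compose[rotated]) (auto intro!: derivative_eq_intros)
    then have "partial i q y = frechet_derivative p (at x) (\<rho> *\<^sub>R axis i 1)"
      by (rule partial_eqI)
    also have "\<dots> = \<rho> * partial i p x"
      unfolding partial_def
      using smooth_fun_differentiable[OF smooth_fun_poly[OF p]]
      by (simp add: linear_frechet_derivative linear_scale)
    finally have pq: "partial i q y = \<rho> * partial i p x" .
    show "(p x)\<^sup>2 * \<rho> ^ CARD('n) \<le> C * (LINT x:ball a \<rho>|lborel. (p x)\<^sup>2)"
      using C(2)[OF q y(1), of i] \<rho> unfolding I by (simp add: q_def y(2) mult.commute mult.left_commute)
    show "(partial i p x)\<^sup>2 * \<rho> ^ (CARD('n) + 2) \<le> C * (LINT x:ball a \<rho>|lborel. (p x)\<^sup>2)"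
      using C(2)[OF q y(1), of i] \<rho> unfolding I pq
      by (simp add: power_mult_distrib power_add power2_eq_square mult_ac)
  qed
qed

subsection \<open>The polynomial representing a piecewise polynomial function on an element\<close>

lemma real_polynomial_function_poly:
  fixes p :: "real^'n \<Rightarrow> real"
  assumes "p \<in> total_degree_polys k" shows "real_polynomial_function p"
proof -
  obtain c where p: "p = (\<lambda>x. \<Sum>\<alpha>\<in>multi_indices k. c \<alpha> * monomial \<alpha> x)"
    using assms unfolding total_degree_polys_iff by blast
  have "real_polynomial_function (monomial \<alpha>)" for \<alpha> :: "'n \<Rightarrow> nat"
    unfolding monomial_def[abs_def]
    by (intro real_polynomial_function_prod real_polynomial_function_power) 
      (auto intro: real_polynomial_function.intros(1) bounded_linear_vec_nth)
  then show ?thesis unfolding p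
    by (intro real_polynomial_function_sum real_polynomial_function.intros(2,4)) auto
qed

text \<open>On the line from a point of the open set through x the polynomial has one variable and
  vanishes on an interval, so all its coefficients are zero.\<close>

lemma real_polynomial_function_eq_0:
  fixes p :: "'a::euclidean_space \<Rightarrow> real"
  assumes "real_polynomial_function p" "open U" "U \<noteq> {}" "\<And>x. x \<in> U \<Longrightarrow> p x = 0"
  shows "p x = 0"
proof -
  obtain a r where a: "r > 0" "ball a r \<subseteq> U" using assms(2,3) open_contains_ball by blast
  define q where "q t = p (a + t *\<^sub>R (x - a))" for t
  have "real_polynomial_function (p \<circ> (\<lambda>t. a + t *\<^sub>R (x - a)))"
    by (intro real_polynomial_function_compose assms polynomial_function_add polynomial_function_const)
      (simp add: polynomial_function_bounded_linear bounded_linear_scaleR_left)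
  then obtain c n where c: "q = (\<lambda>t. \<Sum>i\<le>n. c i * t ^ i)"
    unfolding real_polynomial_function_iff_sum by (auto simp: q_def o_def fun_eq_iff)
  define \<eta> where "\<eta> = r / (norm (x - a) + 1)"
  have \<eta>: "\<eta> > 0" using a by (simp add: \<eta>_def add_nonneg_pos)
  have "q t = 0" if "t \<in> {0<..<\<eta>}" for t
  proof -
    have "t * norm (x - a) \<le> t * (norm (x - a) + 1)" using that by simp
    also have "\<dots> < r" using that pos_less_divide_eq[of "norm (x - a) + 1" t r]
      by (simp add: \<eta>_def add_nonneg_pos)
    finally have "a + t *\<^sub>R (x - a) \<in> ball a r" using that by (simp add: dist_norm)
    then show ?thesis using assms(4) a(2) unfolding q_def by blast
  qed
  then have "{0<..<\<eta>} \<subseteq> {t. (\<Sum>i\<le>n. c i * t ^ i) = 0}" using c by (auto simp: fun_eq_iff)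
  then have "infinite {t. (\<Sum>i\<le>n. c i * t ^ i) = 0}" using infinite_Ioo[OF \<eta>] finite_subset by blast
  then have "\<forall>i\<le>n. c i = 0" using polyfun_finite_roots[of c n] by blast
  then have "q 1 = 0" unfolding c by simp
  then show ?thesis by (simp add: q_def)
qed

text \<open>Nonempty interior makes the choice in \<open>local_poly\<close> unique, so any
  polynomial that agrees with \<open>v\<close> on the element may replace it.\<close>

lemma local_poly_eq:
  fixes p :: "real^'n \<Rightarrow> real"
  assumes "real_polynomial_function p" "\<And>x. x \<in> T \<Longrightarrow> v x = p x" "interior T \<noteq> {}"
  shows "local_poly T v = p"
proof
  fix x
  have "real_polynomial_function (local_poly T v) \<and> (\<forall>x\<in>T. local_poly T v x = v x)"
    unfolding local_poly_def by (rule someI[of _ p]) (use assms in auto)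
  then have "real_polynomial_function (\<lambda>x. local_poly T v x - p x)"
    and *: "\<And>x. x \<in> T \<Longrightarrow> local_poly T v x - p x = 0"
    using assms(1,2) by (auto intro: real_polynomial_function_diff)
  from this(1) have "local_poly T v x - p x = 0"
    by (rule real_polynomial_function_eq_0[where U = "interior T"])
      (use assms(3) * interior_subset in auto)
  then show "local_poly T v x = p x" by simp
qed

section \<open>Integration along a direction\<close>

lemma lborel_integral_translate:
  fixes f :: "'a::euclidean_space \<Rightarrow> real"
  assumes "f \<in> borel_measurable borel"
  shows "(LINT x|lborel. f (c + x)) = (LINT x|lborel. f x)"
proof -
  have "(LINT x|lborel. f x) = (LINT x|distr lborel borel ((+) c). f x)"
    by (simp add: lborel_distr_plus)
  also have "\<dots> = (LINT x|lborel. f (c + x))"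
    by (rule integral_distr) (use assms in auto)
  finally show ?thesis by simp
qed

lemma lborel_integrable_translate:
  fixes f :: "'a::euclidean_space \<Rightarrow> real"
  assumes "integrable lborel f"
  shows "integrable lborel (\<lambda>x. f (c + x))"
proof -
  have "integrable (distr lborel borel ((+) c)) f"
    using assms by (simp add: lborel_distr_plus)
  then show ?thesis by (subst (asm) integrable_distr_eq) (use assms in auto)
qed

lemma nn_integral_translate:
  fixes f :: "'a::euclidean_space \<Rightarrow> ennreal"
  assumes "f \<in> borel_measurable borel"
  shows "(\<integral>\<^sup>+x. f (c + x) \<partial>lborel) = (\<integral>\<^sup>+x. f x \<partial>lborel)"
proof -
  have "(\<integral>\<^sup>+x. f x \<partial>lborel) = (\<integral>\<^sup>+x. f x \<partial>distr lborel borel ((+) c))"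
    by (simp add: lborel_distr_plus)
  also have "\<dots> = (\<integral>\<^sup>+x. f (c + x) \<partial>lborel)"
    by (rule nn_integral_distr) (use assms in auto)
  finally show ?thesis by simp
qed

text \<open>The difference quotients of \<open>w\<close> have integral zero by translation invariance.\<close>

lemma integral_directional_derivative_0:
  fixes w d :: "'a::euclidean_space \<Rightarrow> real"
  assumes w: "integrable lborel w" "w \<in> borel_measurable borel" "\<And>x. R < norm x \<Longrightarrow> w x = 0"
    and lip: "\<And>x t. \<bar>w (x + t *\<^sub>R v) - w x\<bar> \<le> L * \<bar>t\<bar>"
    and d: "d \<in> borel_measurable borel"
      "AE x in lborel. ((\<lambda>t. (w (x + t *\<^sub>R v) - w x) / t) \<longlongrightarrow> d x) (at 0)"
  shows "integrable lborel d" "(LINT x|lborel. d x) = 0"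
proof -
  define h where "h j = 1 / (real j + 1)" for j :: nat
  have h: "h j > 0" "h j \<le> 1" for j by (auto simp: h_def)
  have h0: "filterlim h (at 0) sequentially"
  proof -
    have "h \<longlonglongrightarrow> 0" unfolding h_def using LIMSEQ_inverse_real_of_nat by (simp add: inverse_eq_divide add.commute)
    then show ?thesis unfolding filterlim_at using h(1) by (auto simp: less_imp_neq[symmetric])
  qed
  define s where "s j x = (w (x + h j *\<^sub>R v) - w x) / h j" for j x
  \<comment> \<open>The step sizes are at most 1, so the quotients vanish outside the ball enlarged
    by \<open>norm v\<close>, and one multiple of an indicator dominates all of them.\<close>
  let ?b = "\<lambda>x. indicator (cball 0 (R + norm v)) x * L"
  have [measurable]: "s j \<in> borel_measurable borel" for j
    using w(2) unfolding s_def by measurable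
  have lim: "AE x in lborel. (\<lambda>j. s j x) \<longlonglongrightarrow> d x"
    using d(2)
  proof eventually_elim
    case (elim x)
    then show ?case unfolding s_def by (rule filterlim_compose[OF _ h0])
  qed
  have bound: "norm (s j x) \<le> ?b x" for j x
  proof (cases "x \<in> cball 0 (R + norm v)")
    case True
    have "\<bar>s j x\<bar> = \<bar>w (x + h j *\<^sub>R v) - w x\<bar> / h j" using h(1)[of j] by (simp add: s_def)
    also have "\<dots> \<le> L" using lip[of x "h j"] h(1)[of j] by (simp add: divide_le_eq)
    finally show ?thesis using True by simp
  next
    case False
    then have n: "norm x > R + norm v" by simp
    then have "w x = 0" using norm_ge_zero[of v] by (intro w(3)) linarith
    moreover have "w (x + h j *\<^sub>R v) = 0"
    proof (rule w(3))
      have "norm (h j *\<^sub>R v) \<le> norm v" using h[of j] by (simp add: mult_left_le_one_le)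
      then show "R < norm (x + h j *\<^sub>R v)" using n norm_triangle_ineq4[of "x + h j *\<^sub>R v" "h j *\<^sub>R v"] by simp
    qed
    moreover have "0 \<le> L" using lip[of 0 1] abs_ge_zero[of "w (0 + 1 *\<^sub>R v) - w 0"] by linarith
    ultimately show ?thesis by (simp add: s_def)
  qed
  have ib: "integrable lborel ?b"
    by (intro integrable_mult_left) (auto intro!: integrable_real_indicator emeasure_lborel_cball_finite)
  have "integrable lborel (\<lambda>x. w (h j *\<^sub>R v + x))" for j
    by (rule lborel_integrable_translate) fact
  then have s0: "(LINT x|lborel. s j x) = 0" for j
    unfolding s_def using w lborel_integral_translate[OF w(2), of "h j *\<^sub>R v"]
    by (simp add: add.commute)
  show "integrable lborel d"
    by (rule integrable_dominated_convergence[OF _ _ ib lim]) (use d bound in auto)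
  have "(\<lambda>j. LINT x|lborel. s j x) \<longlonglongrightarrow> (LINT x|lborel. d x)"
    by (rule integral_dominated_convergence[OF _ _ ib lim]) (use d bound in auto)
  then show "(LINT x|lborel. d x) = 0" unfolding s0 using LIMSEQ_unique tendsto_const by metis
qed

section \<open>Orthogonal projection onto a hyperplane and Fubini in its normal direction\<close>

definition prj :: "'a::real_inner \<Rightarrow> 'a \<Rightarrow> 'a \<Rightarrow> 'a" where
  "prj a n x = x - ((x - a) \<bullet> n) *\<^sub>R n"

definition slab :: "'a::real_inner \<Rightarrow> 'a \<Rightarrow> 'a set" where
  "slab a n = {x. 0 \<le> (x - a) \<bullet> n \<and> (x - a) \<bullet> n \<le> 1}"

lemma prj_inner: "norm n = 1 \<Longrightarrow> (prj a n x - a) \<bullet> n = 0"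
  by (simp add: prj_def inner_diff_left dot_square_norm)

lemma prj_shift: "norm n = 1 \<Longrightarrow> prj a n (x + s *\<^sub>R n) = prj a n x"
  by (simp add: prj_def inner_diff_left inner_add_left dot_square_norm algebra_simps)

lemma prj_eq: "(x - a) \<bullet> n = 0 \<Longrightarrow> prj a n x = x"
  by (simp add: prj_def)

lemma prj_prj: "norm n = 1 \<Longrightarrow> prj a n (prj a n x) = prj a n x"
  by (simp add: prj_eq prj_inner)

lemma prj_plus_inner: "norm n = 1 \<Longrightarrow> (prj a n x + s *\<^sub>R n - a) \<bullet> n = s"
  using prj_inner[of n a x] by (simp add: inner_diff_left inner_add_left dot_square_norm)

lemma norm_decompose:
  assumes "norm n = 1"
  shows "(norm (x - a))\<^sup>2 = (norm (prj a n x - a))\<^sup>2 + ((x - a) \<bullet> n)\<^sup>2"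
proof -
  let ?y = "prj a n x - a" and ?s = "(x - a) \<bullet> n"
  have e: "x - a = ?y + ?s *\<^sub>R n" by (simp add: prj_def)
  have "(norm (x - a))\<^sup>2 = (?y + ?s *\<^sub>R n) \<bullet> (?y + ?s *\<^sub>R n)"
    unfolding power2_norm_eq_inner e[symmetric] ..
  also have "\<dots> = ?y \<bullet> ?y + ?s * ?s * (n \<bullet> n)"
    using prj_inner[OF assms, of a x] by (simp add: inner_add_left inner_add_right inner_commute)
  also have "n \<bullet> n = 1" using assms by (simp add: dot_square_norm)
  finally show ?thesis by (simp add: power2_norm_eq_inner[of "prj a n x - a"] power2_eq_square[of "_ \<bullet> _"])
qed

lemma prj_measurable [measurable]: "prj a n \<in> borel_measurable (borel :: 'a::euclidean_space measure)"
  unfolding prj_def by measurable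

lemma closed_slab: "closed (slab a (n::'a::euclidean_space))"
  unfolding slab_def by (intro closed_Collect_conj closed_Collect_le continuous_intros)

lemma slab_measurable [measurable]: "slab a (n::'a::euclidean_space) \<in> sets borel"
  by (simp add: closed_slab)

text \<open>Fubini's theorem with respect to the direction \<open>n\<close> and its orthogonal complement, in which
  the slab of height one replaces the hyperplane. Both factors of the product are moved by
  translations only, so no rotation of coordinates is needed.\<close>

lemma nn_integral_slab:
  fixes F :: "'a::euclidean_space \<Rightarrow> ennreal"
  assumes n: "norm n = 1" and [measurable]: "F \<in> borel_measurable borel"
  shows "(\<integral>\<^sup>+x. indicator (slab a n) x * (\<integral>\<^sup>+s. F (prj a n x + s *\<^sub>R n) \<partial>lborel) \<partial>lborel)
    = (\<integral>\<^sup>+x. F x \<partial>lborel)"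
proof -
  \<comment> \<open>Replacing s by (x - a) \<bullet> n + r starts the line at x instead of its
    projection, which removes the projection from the integrand.\<close>
  have "(\<integral>\<^sup>+s. F (prj a n x + s *\<^sub>R n) \<partial>lborel) = (\<integral>\<^sup>+r. F (x + r *\<^sub>R n) \<partial>lborel)" for x
  proof -
    have "(\<integral>\<^sup>+s. F (prj a n x + s *\<^sub>R n) \<partial>lborel)
      = (\<integral>\<^sup>+r. F (prj a n x + ((x - a) \<bullet> n + r) *\<^sub>R n) \<partial>lborel)"
      by (rule nn_integral_translate[symmetric, where f = "\<lambda>s. F (prj a n x + s *\<^sub>R n)"]) measurable
    then show ?thesis by (simp add: prj_def algebra_simps)
  qed
  then have "(\<integral>\<^sup>+x. indicator (slab a n) x * (\<integral>\<^sup>+s. F (prj a n x + s *\<^sub>R n) \<partial>lborel) \<partial>lborel)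
    = (\<integral>\<^sup>+x. (\<integral>\<^sup>+r. indicator (slab a n) x * F (x + r *\<^sub>R n) \<partial>lborel) \<partial>lborel)"
    by (simp add: nn_integral_cmult)
  also have "\<dots> = (\<integral>\<^sup>+r. (\<integral>\<^sup>+x. indicator (slab a n) x * F (x + r *\<^sub>R n) \<partial>lborel) \<partial>lborel)"
    by (rule lborel_pair.Fubini') measurable
  also have "\<dots> = (\<integral>\<^sup>+r. (\<integral>\<^sup>+x. indicator (slab a n) (x - r *\<^sub>R n) * F x \<partial>lborel) \<partial>lborel)"
  proof (rule nn_integral_cong)
    fix r :: real
    show "(\<integral>\<^sup>+x. indicator (slab a n) x * F (x + r *\<^sub>R n) \<partial>lborel)
      = (\<integral>\<^sup>+x. indicator (slab a n) (x - r *\<^sub>R n) * F x \<partial>lborel)"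
      using nn_integral_translate[of "\<lambda>x. indicator (slab a n) (x - r *\<^sub>R n) * F x" "r *\<^sub>R n"]
      by (simp add: add.commute)
  qed
  also have "\<dots> = (\<integral>\<^sup>+x. (\<integral>\<^sup>+r. indicator (slab a n) (x - r *\<^sub>R n) * F x \<partial>lborel) \<partial>lborel)"
    by (rule lborel_pair.Fubini') measurable
  also have "\<dots> = (\<integral>\<^sup>+x. F x \<partial>lborel)"
  proof (rule nn_integral_cong)
    fix x :: 'a
    \<comment> \<open>The admissible r fill an interval of length 1; this is why the slab has height
      one.\<close>
    have "(\<integral>\<^sup>+r. indicator (slab a n) (x - r *\<^sub>R n) * F x \<partial>lborel)
      = (\<integral>\<^sup>+r. F x * indicator {(x - a) \<bullet> n - 1..(x - a) \<bullet> n} r \<partial>lborel)"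
      by (rule nn_integral_cong)
        (use n in \<open>auto simp: slab_def indicator_def inner_diff_left dot_square_norm\<close>)
    also have "\<dots> = F x" by (simp add: nn_integral_cmult_indicator)
    finally show "(\<integral>\<^sup>+r. indicator (slab a n) (x - r *\<^sub>R n) * F x \<partial>lborel) = F x" .
  qed
  finally show ?thesis .
qed

text \<open>As an equality of measures, the Fubini identity passes from nonnegative functions to
  integrable real ones.\<close>

lemma lborel_eq_distr_slab:
  fixes n :: "'a::euclidean_space"
  assumes "norm n = 1"
  shows "lborel = distr (density (lborel \<Otimes>\<^sub>M lborel) (\<lambda>(x, s). indicator (slab a n) x)) borel
    (\<lambda>(x, s). prj a n x + s *\<^sub>R n)" (is "_ = ?M")
proof (rule measure_eqI)
  fix A :: "'a set" assume "A \<in> sets lborel"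
  then have [measurable]: "A \<in> sets borel" by simp
  have meas: "(\<lambda>z. indicator (slab a n) (fst z) * indicator A (prj a n (fst z) + snd z *\<^sub>R n) :: ennreal)
    \<in> borel_measurable (lborel \<Otimes>\<^sub>M (lborel :: real measure))"
    unfolding prj_def by measurable
  have "emeasure ?M A = (\<integral>\<^sup>+z. indicator A z \<partial>?M)" by simp
  also have "\<dots> = (\<integral>\<^sup>+z. indicator (slab a n) (fst z) * indicator A (prj a n (fst z) + snd z *\<^sub>R n) \<partial>(lborel \<Otimes>\<^sub>M lborel))"
    by (subst nn_integral_distr, simp, measurable)
      (subst nn_integral_density, measurable, simp add: case_prod_beta)
  also have "\<dots> = (\<integral>\<^sup>+x. \<integral>\<^sup>+s. indicator (slab a n) x * indicator A (prj a n x + s *\<^sub>R n) \<partial>lborel \<partial>lborel)"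
    using lborel.nn_integral_fst[OF meas] by simp
  also have "\<dots> = (\<integral>\<^sup>+x. indicator (slab a n) x * (\<integral>\<^sup>+s. indicator A (prj a n x + s *\<^sub>R n) \<partial>lborel) \<partial>lborel)"
    by (simp add: nn_integral_cmult)
  also have "\<dots> = (\<integral>\<^sup>+x. indicator A x \<partial>lborel)"
    by (rule nn_integral_slab) (use assms in auto)
  finally show "emeasure lborel A = emeasure ?M A" by simp
qed simp

lemma integral_slab:
  fixes F :: "'a::euclidean_space \<Rightarrow> real"
  assumes n: "norm n = 1" and F: "integrable lborel F"
  shows "(LINT x|lborel. F x) = (LINT x:slab a n|lborel. (LINT s|lborel. F (prj a n x + s *\<^sub>R n)))"
proof -
  have [measurable]: "F \<in> borel_measurable borel" using F by auto
  let ?D = "density (lborel \<Otimes>\<^sub>M lborel) (\<lambda>z::'a \<times> real. ennreal (indicator (slab a n) (fst z)))"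
  have eq: "lborel = distr ?D borel (\<lambda>z. prj a n (fst z) + snd z *\<^sub>R n)"
    using lborel_eq_distr_slab[OF n, of a] by (simp add: case_prod_beta' ennreal_indicator)
  have i1: "integrable ?D (\<lambda>z. F (prj a n (fst z) + snd z *\<^sub>R n))"
    using F by (subst (asm) eq, subst (asm) integrable_distr_eq) measurable
  have i2: "integrable (lborel \<Otimes>\<^sub>M lborel) (\<lambda>z. indicator (slab a n) (fst z) *\<^sub>R F (prj a n (fst z) + snd z *\<^sub>R n))"
    using i1 by (subst (asm) integrable_density) auto
  have "(LINT x|lborel. F x) = (LINT z|?D. F (prj a n (fst z) + snd z *\<^sub>R n))"
    by (subst eq, rule integral_distr) measurable
  also have "\<dots> = (LINT z|(lborel \<Otimes>\<^sub>M lborel). indicator (slab a n) (fst z) *\<^sub>R F (prj a n (fst z) + snd z *\<^sub>R n))"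
    by (rule integral_density) auto
  also have "\<dots> = (LINT x|lborel. LINT s|lborel. indicator (slab a n) x *\<^sub>R F (prj a n x + s *\<^sub>R n))"
    using lborel_pair.integral_fst'[OF i2] by simp
  finally show ?thesis unfolding set_lebesgue_integral_def by simp
qed

text \<open>The integral of \<open>g\<close> over the hyperplane through \<open>a\<close> orthogonal to \<open>n\<close>.\<close>

definition plane_integral :: "'a::euclidean_space \<Rightarrow> 'a \<Rightarrow> ('a \<Rightarrow> real) \<Rightarrow> real" where
  "plane_integral a n g = (LINT x:slab a n|lborel. g (prj a n x))"

text \<open>Converts volume integrals into integrals over the hyperplane when the integrand splits
  into a tangential and a normal factor, as indicators of cylinders do.\<close>

lemma integral_product_slab:
  fixes g :: "'a::euclidean_space \<Rightarrow> real"
  assumes n: "norm n = 1"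
    and "integrable lborel (\<lambda>x. g (prj a n x) * \<kappa> ((x - a) \<bullet> n))"
  shows "(LINT x|lborel. g (prj a n x) * \<kappa> ((x - a) \<bullet> n))
    = plane_integral a n g * (LINT s|lborel. \<kappa> s)"
proof -
  have "(LINT x|lborel. g (prj a n x) * \<kappa> ((x - a) \<bullet> n))
    = (LINT x:slab a n|lborel. g (prj a n x) * (LINT s|lborel. \<kappa> s))"
    unfolding integral_slab[OF assms(1,2), of a]
    by (simp add: prj_shift prj_prj prj_plus_inner n)
  then show ?thesis unfolding plane_integral_def by simp
qed

section \<open>Smooth functions of bounded support\<close>

text \<open>Vanishing outside some ball, without reference to the closure of the support: in this
  form the property passes directly to products and derivatives.\<close>

definition bounded_support :: "('a::real_normed_vector \<Rightarrow> real) \<Rightarrow> bool" where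
  "bounded_support f \<longleftrightarrow> (\<exists>R. \<forall>x. R < norm x \<longrightarrow> f x = 0)"

lemma partial_eq_0:
  assumes "open U" "x \<in> U" "\<And>y. y \<in> U \<Longrightarrow> f y = 0"
  shows "partial i f x = 0"
proof -
  have "((\<lambda>y. 0) has_derivative (\<lambda>h. 0)) (at x)" by simp
  then have "(f has_derivative (\<lambda>h. 0)) (at x)"
    by (rule has_derivative_transform_within_open[OF _ assms(1,2)]) (simp add: assms(3))
  then show ?thesis by (rule partial_eqI)
qed

lemma bounded_support_partial:
  fixes f :: "real^'n \<Rightarrow> real"
  assumes "bounded_support f" shows "bounded_support (partial i f)"
proof -
  obtain R where R: "\<And>x. R < norm x \<Longrightarrow> f x = 0" using assms unfolding bounded_support_def by blast
  have "partial i f x = 0" if "R < norm x" for x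
    by (rule partial_eq_0[of "{x. R < norm x}"]) (use that R in \<open>auto intro!: open_Collect_less continuous_intros\<close>)
  then show ?thesis unfolding bounded_support_def by blast
qed

lemma bounded_support_mult:
  "bounded_support f \<Longrightarrow> bounded_support (\<lambda>x. g x * f x)" "bounded_support f \<Longrightarrow> bounded_support (\<lambda>x. f x * g x)"
  unfolding bounded_support_def by (metis mult_zero_right, metis mult_zero_left)

lemma bounded_support_bounded:
  fixes f :: "'a::euclidean_space \<Rightarrow> real"
  assumes "bounded_support f" "continuous_on UNIV f"
  shows "\<exists>B\<ge>0. \<forall>x. \<bar>f x\<bar> \<le> B"
proof -
  obtain R where R: "\<And>x. R < norm x \<Longrightarrow> f x = 0" using assms(1) unfolding bounded_support_def by blast
  have "bounded (f ` cball 0 R)"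
    by (intro compact_imp_bounded compact_continuous_image continuous_on_subset[OF assms(2)]) auto
  then obtain B where "\<forall>x\<in>cball 0 R. \<bar>f x\<bar> \<le> B" unfolding bounded_iff by auto
  then have B: "\<And>x. norm x \<le> R \<Longrightarrow> \<bar>f x\<bar> \<le> B" by auto
  have "\<bar>f x\<bar> \<le> \<bar>B\<bar>" for x using B[of x] R[of x] by (cases "norm x \<le> R") auto
  then show ?thesis by (intro exI[of _ "\<bar>B\<bar>"]) auto
qed

lemma bounded_support_integrable:
  fixes f :: "'a::euclidean_space \<Rightarrow> real"
  assumes "bounded_support f" "continuous_on UNIV f"
  shows "integrable lborel f"
proof -
  obtain R where R: "\<And>x. R < norm x \<Longrightarrow> f x = 0" using assms(1) unfolding bounded_support_def by blast
  have "set_integrable lborel (cball 0 R) f"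
    by (rule set_integrable_continuous_bounded) (use assms in auto)
  then show ?thesis unfolding set_integrable_def
    by (rule Bochner_Integration.integrable_cong[THEN iffD1, rotated 2]) (auto simp: indicator_def R)
qed

lemma smooth_fun_lipschitz:
  fixes f :: "real^'n \<Rightarrow> real"
  assumes "smooth_fun f" "bounded_support f"
  shows "\<exists>L\<ge>0. \<forall>x y. \<bar>f x - f y\<bar> \<le> L * norm (x - y)"
proof -
  have "\<forall>i. \<exists>B\<ge>0. \<forall>x. \<bar>partial i f x\<bar> \<le> B"
    using bounded_support_bounded[OF bounded_support_partial[OF assms(2)] smooth_fun_continuous[OF smooth_fun_partial[OF assms(1)]]]
    by blast
  then obtain B where B: "\<And>i. B i \<ge> 0" "\<And>i x. \<bar>partial i f x\<bar> \<le> B i" by metis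
  define L where "L = (\<Sum>i\<in>UNIV. B i)"
  have D: "(f has_derivative (\<lambda>h. \<Sum>i\<in>UNIV. h $ i * partial i f x)) (at x within UNIV)" for x
    using has_derivative_partial[OF smooth_fun_differentiable[OF assms(1)]] .
  have on: "onorm (\<lambda>h. \<Sum>i\<in>UNIV. h $ i * partial i f x) \<le> L" for x
  proof (rule onorm_le)
    fix h :: "real^'n"
    have "norm (\<Sum>i\<in>UNIV. h $ i * partial i f x) \<le> (\<Sum>i\<in>UNIV. norm h * B i)"
      by (rule sum_norm_le) (auto simp: abs_mult intro!: mult_mono B component_le_norm_cart)
    also have "\<dots> = L * norm h"
      unfolding L_def sum_distrib_right by (rule sum.cong) auto
    finally show "norm (\<Sum>i\<in>UNIV. h $ i * partial i f x) \<le> L * norm h" .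
  qed
  have "norm (f x - f y) \<le> L * norm (x - y)" for x y
    by (rule differentiable_bound[OF convex_UNIV D on]) auto
  moreover have "L \<ge> 0" unfolding L_def by (intro sum_nonneg B)
  ultimately show ?thesis by auto
qed

lemma has_real_derivative_along:
  assumes "smooth_fun f"
  shows "((\<lambda>t. f (x + t *\<^sub>R v)) has_real_derivative (\<Sum>i\<in>UNIV. v $ i * partial i f (x + t *\<^sub>R v))) (at t)"
proof -
  have "((\<lambda>t. f (x + t *\<^sub>R v)) has_derivative
    (\<lambda>h. \<Sum>i\<in>UNIV. (h *\<^sub>R v) $ i * partial i f (x + t *\<^sub>R v))) (at t)"
    by (rule has_derivative_compose[OF _ has_derivative_partial[OF smooth_fun_differentiable[OF assms]]])
      (auto intro!: derivative_eq_intros)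
  then show ?thesis unfolding has_field_derivative_def
    by (rule has_derivative_eq_rhs) (simp add: fun_eq_iff sum_distrib_left mult_ac)
qed

lemma smooth_quotient_tendsto:
  assumes "smooth_fun f"
  shows "((\<lambda>t. (f (x + t *\<^sub>R v) - f x) / t) \<longlongrightarrow> (\<Sum>i\<in>UNIV. v $ i * partial i f x)) (at 0)"
  using has_real_derivative_along[OF assms, of x v 0] by (simp add: DERIV_def)

section \<open>The divergence theorem on a half space\<close>

definition halfspace :: "'a::real_inner \<Rightarrow> 'a \<Rightarrow> 'a set" where
  "halfspace a n = {x. (x - a) \<bullet> n \<le> 0}"

lemma halfspace_measurable [measurable]: "halfspace a (n::'a::euclidean_space) \<in> sets borel"
  unfolding halfspace_def by (intro borel_closed closed_Collect_le continuous_intros)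

lemma smooth_indicator_integrable:
  fixes f :: "real^'n \<Rightarrow> real"
  assumes "smooth_fun f" "bounded_support f" "A \<in> sets borel"
  shows "set_integrable lborel A f"
  unfolding set_integrable_def
  by (rule integrable_mult_indicator)
    (use bounded_support_integrable[OF assms(2) smooth_fun_continuous[OF assms(1)]] assms(3) in auto)

text \<open>Fubini along \<open>n\<close> reduces the integral to lines, and on each of them it is
  the fundamental theorem of calculus on the half line that ends at the hyperplane.\<close>

lemma halfspace_normal_derivative:
  fixes w :: "real^'n \<Rightarrow> real"
  assumes w: "smooth_fun w" "bounded_support w" and n: "norm n = 1"
  shows "(LINT x:halfspace a n|lborel. \<Sum>i\<in>UNIV. n $ i * partial i w x) = plane_integral a n w"
proof -
  let ?D = "\<lambda>x. \<Sum>i\<in>UNIV. n $ i * partial i w x"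
  have D: "smooth_fun ?D" "bounded_support ?D"
  proof -
    show "smooth_fun ?D" by (intro smooth_fun_sum smooth_fun_scale smooth_fun_partial w)
    obtain R where "\<And>x. R < norm x \<Longrightarrow> w x = 0" using w(2) unfolding bounded_support_def by blast
    then have "partial i w x = 0" if "R < norm x" for x i
      by (intro partial_eq_0[of "{x. R < norm x}"]) (use that in \<open>auto intro!: open_Collect_less continuous_intros\<close>)
    then show "bounded_support ?D" unfolding bounded_support_def by (intro exI[of _ R]) simp
  qed
  obtain R where R: "\<And>x. R < norm x \<Longrightarrow> w x = 0" using w(2) unfolding bounded_support_def by blast
  have "(LINT x:halfspace a n|lborel. ?D x) = (LINT x:slab a n|lborel.
    LINT s|lborel. indicator (halfspace a n) (prj a n x + s *\<^sub>R n) *\<^sub>R ?D (prj a n x + s *\<^sub>R n))"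
    unfolding set_lebesgue_integral_def[of _ "halfspace a n"]
    using smooth_indicator_integrable[OF D, of "halfspace a n"]
    by (intro integral_slab n) (auto simp: set_integrable_def)
  moreover have "(LINT s|lborel. indicator (halfspace a n) (prj a n x + s *\<^sub>R n) *\<^sub>R ?D (prj a n x + s *\<^sub>R n))
    = w (prj a n x)" for x
  proof -
    let ?y = "prj a n x"
    \<comment> \<open>For s below -|B| + 1 the line has left the ball of radius R. The extra unit
      makes w vanish at the lower endpoint -|B| itself and on a neighbourhood of every s below it,
      so that the derivative vanishes there as well.\<close>
    define B where "B = R + norm ?y + 1"
    have out: "w (?y + s *\<^sub>R n) = 0" if "s < - \<bar>B\<bar> + 1" for s
    proof (rule R)
      have "norm (s *\<^sub>R n) \<le> norm (?y + s *\<^sub>R n) + norm ?y"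
        using norm_triangle_ineq4[of "?y + s *\<^sub>R n" ?y] by simp
      moreover have "norm (s *\<^sub>R n) \<ge> - s" using n by simp
      ultimately show "R < norm (?y + s *\<^sub>R n)" using that unfolding B_def by linarith
    qed
    have D0: "?D (?y + s *\<^sub>R n) = 0" if "s < - \<bar>B\<bar>" for s
    proof -
      have "((\<lambda>t. w (?y + t *\<^sub>R n)) has_real_derivative 0) (at s)"
        by (rule DERIV_cong_ev[THEN iffD2, OF refl _ refl DERIV_const[of 0]])
          (auto simp: eventually_nhds out that intro!: exI[of _ "{..< - \<bar>B\<bar> + 1}"] less_trans[OF that])
      then show ?thesis using has_real_derivative_along[OF w(1), of ?y n s] DERIV_unique by blast
    qed
    have "(LINT s|lborel. indicator (halfspace a n) (?y + s *\<^sub>R n) *\<^sub>R ?D (?y + s *\<^sub>R n))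
      = (LINT s|lborel. ?D (?y + s *\<^sub>R n) * indicator {- \<bar>B\<bar>..0} s)"
      by (rule Bochner_Integration.integral_cong)
        (auto simp: halfspace_def prj_plus_inner n indicator_def D0 not_le)
    also have "\<dots> = w (?y + 0 *\<^sub>R n) - w (?y + (- \<bar>B\<bar>) *\<^sub>R n)"
      by (rule integral_FTC_Icc_real[where F = "\<lambda>s. w (?y + s *\<^sub>R n)"])
        (auto intro!: has_real_derivative_along w continuous_intros
           isCont_o2[OF _ continuous_on_interior[OF smooth_fun_continuous[OF D(1)], of _ UNIV, simplified]])
    also have "\<dots> = w ?y" using out[of "- \<bar>B\<bar>"] by simp
    finally show ?thesis .
  qed
  ultimately show ?thesis unfolding plane_integral_def by simp
qed

text \<open>A translation parallel to the boundary plane maps the half space to itself. Hence the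
  truncated function, although discontinuous, is Lipschitz in this direction, and its difference
  quotients have integral zero.\<close>

lemma halfspace_tangential_derivative:
  fixes w :: "real^'n \<Rightarrow> real"
  assumes w: "smooth_fun w" "bounded_support w" and v: "v \<bullet> n = 0"
  shows "(LINT x:halfspace a n|lborel. \<Sum>i\<in>UNIV. v $ i * partial i w x) = 0"
proof -
  let ?w = "\<lambda>x. indicator (halfspace a n) x *\<^sub>R w x"
  obtain L where L: "L \<ge> 0" "\<And>x y. \<bar>w x - w y\<bar> \<le> L * norm (x - y)" using smooth_fun_lipschitz[OF w] by blast
  obtain R where R: "\<And>x. R < norm x \<Longrightarrow> w x = 0" using w(2) unfolding bounded_support_def by blast
  have inv: "indicator (halfspace a n) (x + t *\<^sub>R v) = (indicator (halfspace a n) x :: real)" for x t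
    using v by (simp add: indicator_def halfspace_def inner_diff_left inner_add_left)
  have [measurable]: "w \<in> borel_measurable borel" "partial i w \<in> borel_measurable borel" for i
    using w by (auto intro: smooth_fun_borel smooth_fun_partial)
  show ?thesis unfolding set_lebesgue_integral_def
  proof (rule integral_directional_derivative_0[where w = ?w and v = v and L = "L * norm v" and R = R])
    show "integrable lborel ?w"
      using smooth_indicator_integrable[OF w, of "halfspace a n"] by (simp add: set_integrable_def)
    show "\<bar>?w (x + t *\<^sub>R v) - ?w x\<bar> \<le> L * norm v * \<bar>t\<bar>" for x t
    proof -
      have "?w (x + t *\<^sub>R v) - ?w x = indicator (halfspace a n) x * (w (x + t *\<^sub>R v) - w x)"
        unfolding inv by (simp add: algebra_simps)
      moreover have "\<bar>w (x + t *\<^sub>R v) - w x\<bar> \<le> L * norm v * \<bar>t\<bar>"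
        using L(2)[of "x + t *\<^sub>R v" x] by (simp add: mult_ac)
      ultimately show ?thesis using L(1) by (auto simp: indicator_def)
    qed
    have "((\<lambda>t. (?w (x + t *\<^sub>R v) - ?w x) / t) \<longlongrightarrow>
      indicator (halfspace a n) x *\<^sub>R (\<Sum>i\<in>UNIV. v $ i * partial i w x)) (at 0)" for x
    proof -
      have "(\<lambda>t. (?w (x + t *\<^sub>R v) - ?w x) / t) = (\<lambda>t. indicator (halfspace a n) x * ((w (x + t *\<^sub>R v) - w x) / t))"
        unfolding inv by (simp add: algebra_simps diff_divide_distrib)
      then show ?thesis using tendsto_mult[OF tendsto_const smooth_quotient_tendsto[OF w(1), of x v], of "indicator (halfspace a n) x"] by simp
    qed
    then show "AE x in lborel. ((\<lambda>t. (?w (x + t *\<^sub>R v) - ?w x) / t) \<longlongrightarrow>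
      indicator (halfspace a n) x *\<^sub>R (\<Sum>i\<in>UNIV. v $ i * partial i w x)) (at 0)" by simp
  qed (use R in auto)
qed

text \<open>The coordinate direction is n_i n plus a tangential vector, and only the normal part
  contributes.\<close>

lemma halfspace_partial:
  fixes w :: "real^'n \<Rightarrow> real"
  assumes w: "smooth_fun w" "bounded_support w" and n: "norm n = 1"
  shows "(LINT x:halfspace a n|lborel. partial i w x) = n $ i * plane_integral a n w"
proof -
  define v where "v = axis i 1 - (n $ i) *\<^sub>R n"
  have v: "v \<bullet> n = 0"
    using n by (simp add: v_def inner_diff_left inner_axis' dot_square_norm)
  have si: "set_integrable lborel (halfspace a n) (\<lambda>x. \<Sum>i\<in>UNIV. u $ i * partial i w x)" for u
  proof -
    have "set_integrable lborel (halfspace a n) (\<lambda>x. u $ i * partial i w x)" for i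
      using smooth_indicator_integrable[OF smooth_fun_partial[OF w(1)] bounded_support_partial[OF w(2)], of "halfspace a n"]
      by (intro set_integrable_mult_right) auto
    then show ?thesis unfolding set_integrable_def scaleR_sum_right
      by (intro Bochner_Integration.integrable_sum) auto
  qed
  have "partial i w x = n $ i * (\<Sum>i\<in>UNIV. n $ i * partial i w x) + (\<Sum>i\<in>UNIV. v $ i * partial i w x)" for x
  proof -
    have "(\<Sum>j\<in>UNIV. v $ j * partial j w x) = (\<Sum>j\<in>UNIV. (if j = i then partial i w x else 0)) - (\<Sum>j\<in>UNIV. n $ i * (n $ j * partial j w x))"
      unfolding sum_subtractf[symmetric] v_def by (rule sum.cong) (auto simp: axis_def algebra_simps)
    then show ?thesis by (simp add: sum_distrib_left)
  qed
  then have "(LINT x:halfspace a n|lborel. partial i w x) =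
    (LINT x:halfspace a n|lborel. n $ i * (\<Sum>i\<in>UNIV. n $ i * partial i w x) + (\<Sum>i\<in>UNIV. v $ i * partial i w x))"
    by metis
  also have "\<dots> = n $ i * (LINT x:halfspace a n|lborel. (\<Sum>i\<in>UNIV. n $ i * partial i w x))
     + (LINT x:halfspace a n|lborel. \<Sum>i\<in>UNIV. v $ i * partial i w x)"
    using si by (subst set_integral_add) auto
  finally show ?thesis
    unfolding halfspace_normal_derivative[OF w n] halfspace_tangential_derivative[OF w v] by simp
qed

definition grad :: "(real^'n \<Rightarrow> real) \<Rightarrow> real^'n \<Rightarrow> real^'n" where
  "grad f x = (\<chi> i. partial i f x)"

lemma grad_inner: "grad f x \<bullet> grad g x = (\<Sum>i\<in>UNIV. partial i f x * partial i g x)"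
  by (simp add: grad_def inner_vec_def)

lemma halfspace_Green:
  fixes q \<phi> :: "real^'n \<Rightarrow> real"
  assumes q: "smooth_fun q" and \<phi>: "smooth_fun \<phi>" "bounded_support \<phi>" and n: "norm n = 1"
  shows "(LINT x:halfspace a n|lborel. grad q x \<bullet> grad \<phi> x) =
    plane_integral a n (\<lambda>x. (\<Sum>i\<in>UNIV. n $ i * partial i q x) * \<phi> x)
    - (LINT x:halfspace a n|lborel. laplacian q x * \<phi> x)"
proof -
  let ?H = "halfspace a n"
  have sq: "smooth_fun (partial i q)" for i using q by (rule smooth_fun_partial)
  have sw: "smooth_fun (\<lambda>x. partial i q x * \<phi> x)" "bounded_support (\<lambda>x. partial i q x * \<phi> x)" for i
    using smooth_fun_mult[OF sq \<phi>(1)] bounded_support_mult(1)[OF \<phi>(2)] by auto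
  have i1: "set_integrable lborel ?H (\<lambda>x. partial i q x * partial i \<phi> x)" for i
    by (intro smooth_indicator_integrable smooth_fun_mult sq smooth_fun_partial \<phi> bounded_support_mult bounded_support_partial) simp
  have i2: "set_integrable lborel ?H (\<lambda>x. partial i (partial i q) x * \<phi> x)" for i
    by (intro smooth_indicator_integrable smooth_fun_mult sq smooth_fun_partial \<phi> bounded_support_mult) simp
  have "(LINT x:?H|lborel. partial i q x * partial i \<phi> x) + (LINT x:?H|lborel. partial i (partial i q) x * \<phi> x)
    = n $ i * plane_integral a n (\<lambda>x. partial i q x * \<phi> x)" for i
  proof -
    have "partial i (\<lambda>x. partial i q x * \<phi> x) x = partial i q x * partial i \<phi> x + partial i (partial i q) x * \<phi> x" for x
      by (intro partial_mult smooth_fun_differentiable sq \<phi>)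
    then have "partial i (\<lambda>x. partial i q x * \<phi> x) = (\<lambda>x. partial i q x * partial i \<phi> x + partial i (partial i q) x * \<phi> x)"
      by (rule ext)
    then show ?thesis
      using halfspace_partial[OF sw(1)[of i] sw(2)[of i] n, of a i] set_integral_add(2)[OF i1 i2, of i i] by simp
  qed
  then have "(\<Sum>i\<in>UNIV. (LINT x:?H|lborel. partial i q x * partial i \<phi> x) + (LINT x:?H|lborel. partial i (partial i q) x * \<phi> x))
    = (\<Sum>i\<in>UNIV. n $ i * plane_integral a n (\<lambda>x. partial i q x * \<phi> x))" by simp
  moreover have "(LINT x:?H|lborel. grad q x \<bullet> grad \<phi> x) = (\<Sum>i\<in>UNIV. LINT x:?H|lborel. partial i q x * partial i \<phi> x)"
    unfolding grad_inner by (intro set_integral_sum i1)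
  moreover have "(LINT x:?H|lborel. laplacian q x * \<phi> x) = (\<Sum>i\<in>UNIV. LINT x:?H|lborel. partial i (partial i q) x * \<phi> x)"
    unfolding laplacian_def sum_distrib_right by (intro set_integral_sum i2)
  moreover have "plane_integral a n (\<lambda>x. (\<Sum>i\<in>UNIV. n $ i * partial i q x) * \<phi> x)
    = (\<Sum>i\<in>UNIV. n $ i * plane_integral a n (\<lambda>x. partial i q x * \<phi> x))"
  proof -
    have "set_integrable lborel (slab a n) (\<lambda>x. partial i q (prj a n x) * \<phi> (prj a n x))" for i
    proof -
      obtain R where R: "\<And>x. R < norm x \<Longrightarrow> \<phi> x = 0" using \<phi>(2) unfolding bounded_support_def by blast
      have c: "continuous_on UNIV (\<lambda>x. partial i q (prj a n x) * \<phi> (prj a n x))"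
        unfolding prj_def
        by (intro continuous_intros continuous_on_compose2[OF smooth_fun_continuous[OF sq, of UNIV]]
            continuous_on_compose2[OF smooth_fun_continuous[OF \<phi>(1), of UNIV]]) auto
      \<comment> \<open>Composed with the projection, \<phi> is constant along \<open>n\<close> and
        no longer has bounded support; its part in the slab lies in the ball of radius R + 1, the 1
        being the height of the slab.\<close>
      let ?S = "slab a n \<inter> cball 0 (R + 1)"
      have "set_integrable lborel ?S (\<lambda>x. partial i q (prj a n x) * \<phi> (prj a n x))"
        by (rule set_integrable_continuous_bounded[OF c]) (auto intro: bounded_subset[OF bounded_cball])
      then show ?thesis unfolding set_integrable_def
      proof (rule Bochner_Integration.integrable_cong[THEN iffD1, OF refl, rotated])
        fix x
        show "indicator ?S x *\<^sub>R (partial i q (prj a n x) * \<phi> (prj a n x)) = indicator (slab a n) x *\<^sub>R (partial i q (prj a n x) * \<phi> (prj a n x))"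
        proof (cases "x \<in> slab a n \<and> \<phi> (prj a n x) \<noteq> 0")
          case True
          then have "norm (prj a n x) \<le> R" using R not_le by blast
          moreover have "x = prj a n x + ((x - a) \<bullet> n) *\<^sub>R n" by (simp add: prj_def)
          then have "norm x \<le> norm (prj a n x) + \<bar>(x - a) \<bullet> n\<bar> * norm n" by (metis norm_triangle_ineq norm_scaleR)
          ultimately have "norm x \<le> R + 1" using True n unfolding slab_def by auto
          then show ?thesis using True by (simp add: indicator_def)
        qed (auto simp: indicator_def)
      qed
    qed
    then have "set_integrable lborel (slab a n) (\<lambda>x. n $ i * (partial i q (prj a n x) * \<phi> (prj a n x)))" for i
      by (intro set_integrable_mult_right) auto
    then show ?thesis unfolding plane_integral_def sum_distrib_right mult.assoc
      by (subst set_integral_sum) auto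
  qed
  ultimately show ?thesis by (simp add: sum.distrib)
qed

section \<open>Integration by parts on the whole space\<close>

lemma integral_partial_0:
  fixes w :: "real^'n \<Rightarrow> real"
  assumes w: "smooth_fun w" "bounded_support w"
  shows "(LINT x|lborel. partial i w x) = 0"
proof -
  obtain L where L: "L \<ge> 0" "\<And>x y. \<bar>w x - w y\<bar> \<le> L * norm (x - y)" using smooth_fun_lipschitz[OF w] by blast
  obtain R where R: "\<And>x. R < norm x \<Longrightarrow> w x = 0" using w(2) unfolding bounded_support_def by blast
  have q: "((\<lambda>t. (w (x + t *\<^sub>R axis i 1) - w x) / t) \<longlongrightarrow> partial i w x) (at 0)" for x
  proof -
    have "(\<Sum>j\<in>UNIV. axis i 1 $ j * partial j w x) = (\<Sum>j\<in>UNIV. if j = i then partial i w x else 0)"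
      by (rule sum.cong) (auto simp: axis_def)
    then show ?thesis using smooth_quotient_tendsto[OF w(1), of x "axis i 1"] by simp
  qed
  have lip: "\<bar>w (x + t *\<^sub>R axis i 1) - w x\<bar> \<le> L * \<bar>t\<bar>" for x t
    using L(2)[of "x + t *\<^sub>R axis i 1" x] by simp
  show ?thesis
    by (rule integral_directional_derivative_0[where w = w and v = "axis i 1" and L = L and R = R])
      (use R lip q in \<open>auto intro: bounded_support_integrable smooth_fun_continuous smooth_fun_borel smooth_fun_partial w simp: abs_mult norm_axis_1\<close>)
qed

lemma Green_whole_space:
  fixes q \<phi> :: "real^'n \<Rightarrow> real"
  assumes q: "smooth_fun q" and \<phi>: "smooth_fun \<phi>" "bounded_support \<phi>"
  shows "(LINT x|lborel. grad q x \<bullet> grad \<phi> x) = - (LINT x|lborel. laplacian q x * \<phi> x)"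
proof -
  have sq: "smooth_fun (partial i q)" for i using q by (rule smooth_fun_partial)
  have I: "integrable lborel f" if "smooth_fun f" "bounded_support f" for f :: "real^'n \<Rightarrow> real"
    using that by (intro bounded_support_integrable smooth_fun_continuous)
  have i1: "integrable lborel (\<lambda>x. partial i q x * partial i \<phi> x)" for i
    by (intro I smooth_fun_mult sq smooth_fun_partial \<phi> bounded_support_mult bounded_support_partial)
  have i2: "integrable lborel (\<lambda>x. partial i (partial i q) x * \<phi> x)" for i
    by (intro I smooth_fun_mult sq smooth_fun_partial \<phi> bounded_support_mult)
  have "(LINT x|lborel. partial i q x * partial i \<phi> x) + (LINT x|lborel. partial i (partial i q) x * \<phi> x) = 0" for i
  proof -
    have "partial i (\<lambda>x. partial i q x * \<phi> x) x = partial i q x * partial i \<phi> x + partial i (partial i q) x * \<phi> x" for x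
      by (intro partial_mult smooth_fun_differentiable sq \<phi>)
    then show ?thesis
      using integral_partial_0[of "\<lambda>x. partial i q x * \<phi> x" i] smooth_fun_mult[OF sq \<phi>(1)] bounded_support_mult(1)[OF \<phi>(2)]
        Bochner_Integration.integral_add[OF i1 i2, of i i] by simp
  qed
  then have "(\<Sum>i\<in>UNIV. (LINT x|lborel. partial i q x * partial i \<phi> x) + (LINT x|lborel. partial i (partial i q) x * \<phi> x)) = 0"
    by simp
  then show ?thesis unfolding grad_inner laplacian_def sum_distrib_right
    using i1 i2 by (simp add: Bochner_Integration.integral_sum sum.distrib)
qed

section \<open>Square integrable functions\<close>

lemma square_integrable_inner:
  assumes "square_integrable \<mu> f" "square_integrable \<mu> g"
  shows "integrable \<mu> (\<lambda>x. f x \<bullet> g x)"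
proof (rule Bochner_Integration.integrable_bound)
  show "integrable \<mu> (\<lambda>x. (norm (f x))\<^sup>2 + (norm (g x))\<^sup>2)"
    using assms by (auto simp: square_integrable_def)
  show "(\<lambda>x. f x \<bullet> g x) \<in> borel_measurable \<mu>"
    using assms by (auto simp: square_integrable_def)
  have "\<bar>f x \<bullet> g x\<bar> \<le> (norm (f x))\<^sup>2 + (norm (g x))\<^sup>2" for x
  proof -
    have "\<bar>f x \<bullet> g x\<bar> \<le> norm (f x) * norm (g x)" by (rule Cauchy_Schwarz_ineq2)
    moreover have "2 * norm (f x) * norm (g x) \<le> (norm (f x))\<^sup>2 + (norm (g x))\<^sup>2"
      by (rule sum_squares_bound)
    moreover have "0 \<le> norm (f x) * norm (g x)" by simp
    ultimately show ?thesis by linarith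
  qed
  then show "AE x in \<mu>. norm (f x \<bullet> g x) \<le> norm ((norm (f x))\<^sup>2 + (norm (g x))\<^sup>2)"
    by (auto intro: order_trans)
qed

lemma square_integrable_scale: "square_integrable \<mu> f \<Longrightarrow> square_integrable \<mu> (\<lambda>x. c *\<^sub>R f x)"
  by (auto simp: square_integrable_def power_mult_distrib)

lemma square_integrable_diff:
  assumes "square_integrable \<mu> f" "square_integrable \<mu> g"
  shows "square_integrable \<mu> (\<lambda>x. f x - g x)"
proof -
  have "(norm (f x - g x))\<^sup>2 = (norm (f x))\<^sup>2 + (norm (g x))\<^sup>2 - 2 * (f x \<bullet> g x)" for x
    by (simp add: power2_norm_eq_inner inner_diff_left inner_diff_right inner_commute)
  then show ?thesis
    using assms square_integrable_inner[OF assms] by (auto simp: square_integrable_def)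
qed

lemma integral_Cauchy_Schwarz:
  assumes f: "square_integrable \<mu> f" and g: "square_integrable \<mu> g"
  shows "(LINT x|\<mu>. f x \<bullet> g x)\<^sup>2 \<le> (LINT x|\<mu>. (norm (f x))\<^sup>2) * (LINT x|\<mu>. (norm (g x))\<^sup>2)"
proof -
  define A B C where "A = (LINT x|\<mu>. (norm (f x))\<^sup>2)" and "B = (LINT x|\<mu>. f x \<bullet> g x)"
    and "C = (LINT x|\<mu>. (norm (g x))\<^sup>2)"
  have q: "0 \<le> A - 2 * t * B + t\<^sup>2 * C" for t
  proof -
    have "(norm (f x - t *\<^sub>R g x))\<^sup>2 = (norm (f x))\<^sup>2 - 2 * t * (f x \<bullet> g x) + t\<^sup>2 * (norm (g x))\<^sup>2" for x
      unfolding power2_norm_eq_inner power2_eq_square[of t]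
      by (simp add: inner_diff_left inner_diff_right inner_commute algebra_simps)
    then have "(LINT x|\<mu>. (norm (f x - t *\<^sub>R g x))\<^sup>2) = A - 2 * t * B + t\<^sup>2 * C"
      using f g square_integrable_inner[OF f g] unfolding A_def B_def C_def square_integrable_def by simp
    moreover have "0 \<le> (LINT x|\<mu>. (norm (f x - t *\<^sub>R g x))\<^sup>2)" by (rule integral_nonneg_AE) auto
    ultimately show ?thesis by simp
  qed
  have "C \<ge> 0" unfolding C_def by (rule integral_nonneg_AE) auto
  have "B\<^sup>2 \<le> A * C"
  proof (cases "C = 0")
    case True
    have "B = 0"
    proof (rule ccontr)
      assume "B \<noteq> 0"
      \<comment> \<open>For C = 0 the quadratic is linear in t, and this t gives it the value
        -1.\<close>
      then show False using q[of "(A + 1) / (2 * B)"] True by simp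
    qed
    then show ?thesis using True by simp
  next
    case False
    then show ?thesis using q[of "B / C"] \<open>C \<ge> 0\<close> by (simp add: field_simps power2_eq_square)
  qed
  then show ?thesis unfolding A_def B_def C_def .
qed

lemma integral_Cauchy_Schwarz_sqrt:
  assumes "square_integrable \<mu> f" "square_integrable \<mu> g"
  shows "\<bar>LINT x|\<mu>. f x \<bullet> g x\<bar> \<le> l2_norm \<mu> f * l2_norm \<mu> g"
  using real_sqrt_le_mono[OF integral_Cauchy_Schwarz[OF assms]]
  by (simp add: l2_norm_def real_sqrt_mult)

text \<open>Completeness of Lebesgue measure: the part of a preimage inside a null set is
  measurable. The data \<open>f\<close> are prescribed on the interiors of the elements only, so
  measurability has to come from an almost everywhere equal function.\<close>

lemma borel_measurable_AE_eq:
  fixes f g :: "'a::euclidean_space \<Rightarrow> 'b::topological_space"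
  assumes f: "f \<in> borel_measurable lebesgue" and eq: "AE x in lebesgue. f x = g x"
  shows "g \<in> borel_measurable lebesgue"
proof (rule measurableI)
  fix A :: "'b set" assume A: "A \<in> sets borel"
  obtain N where N: "N \<in> null_sets lebesgue" "{x. f x \<noteq> g x} \<subseteq> N"
    using eq unfolding eventually_ae_filter by auto
  have "g -` A \<inter> N \<in> sets lebesgue"
    by (metis N(1) inf_le2 negligible_iff_null_sets negligible_imp_sets negligible_subset)
  moreover have "f -` A \<in> sets lebesgue" using measurable_sets[OF f A] by simp
  then have "f -` A - N \<in> sets lebesgue" using N(1) by auto
  moreover have "g -` A \<inter> space lebesgue = (f -` A - N) \<union> (g -` A \<inter> N)"
  proof -
    have "f x = g x" if "x \<notin> N" for x using N(2) that by blast
    then show ?thesis by auto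
  qed
  ultimately show "g -` A \<inter> space lebesgue \<in> sets lebesgue" by (metis sets.Un)
qed simp

lemma lebesgue_on_measurable_iff:
  fixes f :: "'a::euclidean_space \<Rightarrow> 'b::euclidean_space"
  assumes "S \<in> sets lebesgue"
  shows "f \<in> borel_measurable (lebesgue_on S) \<longleftrightarrow> (\<lambda>x. indicator S x *\<^sub>R f x) \<in> borel_measurable lebesgue"
  using assms by (simp add: borel_measurable_restrict_space_iff)

lemma LINT_lebesgue_on:
  fixes f :: "'a::euclidean_space \<Rightarrow> real"
  assumes "S \<in> sets borel" "f \<in> borel_measurable borel"
  shows "(LINT x|lebesgue_on S. f x) = (LINT x:S|lborel. f x)"
  using assms unfolding set_lebesgue_integral_def
  by (subst integral_restrict_space) (auto intro!: integral_completion)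

lemma square_integrable_bounded:
  fixes h :: "'a::euclidean_space \<Rightarrow> 'b::euclidean_space"
  assumes "S \<in> lmeasurable" "h \<in> borel_measurable (lebesgue_on S)" "\<And>x. x \<in> S \<Longrightarrow> norm (h x) \<le> B"
  shows "square_integrable (lebesgue_on S) h"
proof -
  interpret finite_measure "lebesgue_on S" by (rule finite_measure_lebesgue_on[OF assms(1)])
  have "norm ((norm (h x))\<^sup>2) \<le> B\<^sup>2" if "x \<in> S" for x
    using assms(3)[OF that] by (simp add: power_mono)
  then have "integrable (lebesgue_on S) (\<lambda>x. (norm (h x))\<^sup>2)"
    using assms(2) by (intro integrable_const_bound[where B = "B\<^sup>2"]) auto
  then show ?thesis using assms(2) by (simp add: square_integrable_def)
qed

section \<open>Test functions\<close>

lemma test_functionsI: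
  assumes "smooth_fun \<phi>" "compact K" "K \<subseteq> \<Omega>" "\<And>x. x \<notin> K \<Longrightarrow> \<phi> x = 0"
  shows "\<phi> \<in> test_functions \<Omega>"
proof -
  have "closure {x. \<phi> x \<noteq> 0} \<subseteq> K"
    by (rule closure_minimal) (use assms in \<open>auto intro: compact_imp_closed\<close>)
  moreover from this have "compact (closure {x. \<phi> x \<noteq> 0})"
    using assms(2) by (metis closed_closure compact_Int_closed inf.absorb_iff2)
  ultimately show ?thesis using assms unfolding test_functions_def smooth_fun_def by auto
qed

lemma test_functions_smooth: "\<phi> \<in> test_functions \<Omega> \<Longrightarrow> smooth_fun \<phi>"
  unfolding test_functions_def smooth_fun_def by auto

lemma test_functions_outside: "\<phi> \<in> test_functions \<Omega> \<Longrightarrow> x \<notin> \<Omega> \<Longrightarrow> \<phi> x = 0"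
  unfolding test_functions_def using closure_subset[of "{x. \<phi> x \<noteq> 0}"] by auto

lemma test_functions_partial:
  assumes "\<phi> \<in> test_functions \<Omega>" shows "partial i \<phi> \<in> test_functions \<Omega>"
proof (rule test_functionsI)
  let ?K = "closure {x. \<phi> x \<noteq> 0}"
  show "compact ?K" "?K \<subseteq> \<Omega>" using assms unfolding test_functions_def by auto
  show "smooth_fun (partial i \<phi>)" using assms by (intro smooth_fun_partial test_functions_smooth)
  fix x assume "x \<notin> ?K"
  then show "partial i \<phi> x = 0"
    by (intro partial_eq_0[of "- ?K"]) (use closure_subset[of "{x. \<phi> x \<noteq> 0}"] in \<open>auto intro: open_Compl\<close>)
qed

lemma test_functions_bounded_support:
  fixes \<phi> :: "real^'n \<Rightarrow> real"
  assumes "\<phi> \<in> test_functions \<Omega>" shows "bounded_support \<phi>"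
proof -
  have "bounded (closure {x. \<phi> x \<noteq> 0})"
    using assms unfolding test_functions_def by (auto intro: compact_imp_bounded)
  then have "bounded {x. \<phi> x \<noteq> 0}" using bounded_subset closure_subset by blast
  then obtain R where R: "\<forall>x\<in>{x. \<phi> x \<noteq> 0}. norm x \<le> R" unfolding bounded_iff by blast
  show ?thesis unfolding bounded_support_def
  proof (intro exI[of _ R] allI impI)
    fix x :: "real^'n" assume "R < norm x"
    then show "\<phi> x = 0" using R by (cases "\<phi> x = 0") auto
  qed
qed

lemma borel_measurable_lebesgue_on_borel:
  "f \<in> borel_measurable borel \<Longrightarrow> f \<in> borel_measurable (lebesgue_on S)"
  by (intro measurable_restrict_space1) (simp add: measurable_completion)

lemma smooth_square_integrable:
  fixes f :: "real^'n \<Rightarrow> real"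
  assumes "smooth_fun f" "bounded_support f" "S \<in> lmeasurable"
  shows "square_integrable (lebesgue_on S) f"
proof -
  obtain B where "\<forall>x. \<bar>f x\<bar> \<le> B"
    using bounded_support_bounded[OF assms(2) smooth_fun_continuous[OF assms(1)]] by blast
  then show ?thesis
    by (intro square_integrable_bounded[where B = B] assms borel_measurable_lebesgue_on_borel smooth_fun_borel) auto
qed

lemma norm_grad_le:
  "norm (grad f x) \<le> (\<Sum>i\<in>UNIV. \<bar>partial i f x\<bar>)"
  using norm_le_l1_cart[of "grad f x"] by (simp add: grad_def)

lemma grad_borel:
  fixes f :: "real^'n \<Rightarrow> real"
  assumes "smooth_fun f" shows "grad f \<in> borel_measurable borel"
proof -
  have "continuous_on UNIV (grad f)"
    unfolding grad_def[abs_def]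
    by (intro continuous_on_vec_lambda smooth_fun_continuous smooth_fun_partial assms)
  then show ?thesis by (rule borel_measurable_continuous_onI)
qed

lemma smooth_grad_square_integrable:
  fixes f :: "real^'n \<Rightarrow> real"
  assumes "smooth_fun f" "bounded_support f" "S \<in> lmeasurable"
  shows "square_integrable (lebesgue_on S) (grad f)"
proof -
  have "\<forall>i. \<exists>B\<ge>0. \<forall>x. \<bar>partial i f x\<bar> \<le> B"
    using bounded_support_bounded[OF bounded_support_partial[OF assms(2)] smooth_fun_continuous[OF smooth_fun_partial[OF assms(1)]]]
    by blast
  then obtain B where B: "\<And>i x. \<bar>partial i f x\<bar> \<le> B i" by metis
  have "norm (grad f x) \<le> (\<Sum>i\<in>UNIV. B i)" for x
    using norm_grad_le[of f x] sum_mono[of UNIV "\<lambda>i. \<bar>partial i f x\<bar>" B] B by fastforce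
  then show ?thesis
    by (intro square_integrable_bounded[where B = "\<Sum>i\<in>UNIV. B i"] assms borel_measurable_lebesgue_on_borel grad_borel)
qed

lemma smooth_fun_norm2:
  fixes A :: "real^'n \<Rightarrow> real^'m"
  assumes "\<And>i. smooth_fun (\<lambda>x. A x $ i)"
  shows "smooth_fun (\<lambda>x. (norm (A x))\<^sup>2)"
  unfolding power2_norm_eq_inner inner_vec_def inner_real_def
  by (intro smooth_fun_sum smooth_fun_mult assms)

lemma smooth_fun_dist2: "smooth_fun (\<lambda>x. (norm (x - a))\<^sup>2)"
  by (rule smooth_fun_norm2) (auto intro: smooth_fun_diff smooth_fun_nth smooth_fun_const)

section \<open>The fundamental lemma of the calculus of variations\<close>

text \<open>Instead of a mollification, bumps over a finite cover of \<open>K\<close> by balls of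
  radius \<open>r m\<close> are summed to a function w that is at least some \<beta> > 0 on
  \<open>K\<close>. Applying \<open>bump\<close> to (m + 1) w / \<beta> keeps the values in [0, 1]
  and makes them at least exp(-1/(m+1)) on \<open>K\<close>, which tends to 1.\<close>

lemma smooth_approximation_of_indicator:
  fixes K :: "(real^'n) set"
  assumes "compact K" "open \<Omega>" "K \<subseteq> \<Omega>"
  obtains \<phi> where "\<And>m::nat. \<phi> m \<in> test_functions \<Omega>" "\<And>m x. 0 \<le> \<phi> m x \<and> \<phi> m x \<le> 1"
    "\<And>x. (\<lambda>m. \<phi> m x) \<longlonglongrightarrow> indicator K x"
proof -
  obtain d where d: "d > 0" "(\<Union>x\<in>K. cball x d) \<subseteq> \<Omega>"
    using compact_subset_open_imp_cball_epsilon_subset[OF assms] .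
  define r where "r m = d / (real m + 1)" for m :: nat
  have r: "r m > 0" "r m \<le> d" for m using d(1) by (auto simp: r_def divide_le_eq field_simps)
  have r0: "r \<longlonglongrightarrow> 0"
    unfolding r_def using tendsto_mult[OF tendsto_const[of d] LIMSEQ_inverse_real_of_nat]
    by (simp add: divide_inverse add.commute)
  have "\<exists>\<phi>. \<phi> \<in> test_functions \<Omega> \<and> (\<forall>x. 0 \<le> \<phi> x \<and> \<phi> x \<le> 1) \<and>
    (\<forall>x\<in>K. exp (- (1 / (real m + 1))) \<le> \<phi> x) \<and> (\<forall>x. (\<forall>c\<in>K. r m \<le> dist c x) \<longrightarrow> \<phi> x = 0)" for m
  proof -
    have "K \<subseteq> (\<Union>c\<in>K. ball c (r m))" using r by auto
    then obtain F where F: "F \<subseteq> K" "finite F" "K \<subseteq> (\<Union>c\<in>F. ball c (r m))"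
      using compactE_image[OF assms(1), of K "\<lambda>c. ball c (r m)"] by auto
    define w where "w x = (\<Sum>c\<in>F. bump ((r m)\<^sup>2 - (norm (x - c))\<^sup>2))" for x
    have sw: "smooth_fun w" unfolding w_def
      by (intro smooth_fun_sum smooth_fun_bump smooth_fun_diff smooth_fun_const smooth_fun_dist2)
    have pos: "w x > 0" if "x \<in> K" for x
    proof -
      have "x \<in> (\<Union>c\<in>F. ball c (r m))" using F(3) that by blast
      then obtain c where c: "c \<in> F" "dist c x < r m" by auto
      then have "(norm (x - c))\<^sup>2 < (r m)\<^sup>2" by (intro power_strict_mono) (auto simp: dist_norm norm_minus_commute)
      then have "0 < bump ((r m)\<^sup>2 - (norm (x - c))\<^sup>2)" by (simp add: bump_pos_iff)
      also have "\<dots> \<le> w x" unfolding w_def using F(2) c(1)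
        by (intro member_le_sum) (auto simp: bump_nonneg)
      finally show ?thesis .
    qed
    obtain \<beta> where \<beta>: "\<beta> > 0" "\<And>x. x \<in> K \<Longrightarrow> \<beta> \<le> w x"
    proof (cases "K = {}")
      case False
      then obtain x0 where "x0 \<in> K" "\<forall>x\<in>K. w x0 \<le> w x"
        using continuous_attains_inf[OF assms(1) _ smooth_fun_continuous[OF sw]] by blast
      then show ?thesis using that[of "w x0"] pos by blast
    qed (use that[of 1] in auto)
    define \<phi> where "\<phi> x = bump ((real m + 1) / \<beta> * w x)" for x
    have w0: "w x = 0" if "\<And>c. c \<in> F \<Longrightarrow> r m \<le> dist c x" for x
      unfolding w_def
    proof (rule sum.neutral, rule ballI)
      fix c assume "c \<in> F"
      then have "(r m)\<^sup>2 \<le> (norm (x - c))\<^sup>2"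
        using that[of c] r[of m] by (intro power_mono) (auto simp: dist_norm norm_minus_commute)
      then show "bump ((r m)\<^sup>2 - (norm (x - c))\<^sup>2) = 0" by (simp add: bump_eq_0_iff)
    qed
    have "\<phi> \<in> test_functions \<Omega>"
    proof (rule test_functionsI)
      show "smooth_fun \<phi>" unfolding \<phi>_def by (intro smooth_fun_bump smooth_fun_scale sw)
      show "compact (\<Union>c\<in>F. cball c (r m))" using F by auto
      show "(\<Union>c\<in>F. cball c (r m)) \<subseteq> \<Omega>"
      proof
        fix x assume "x \<in> (\<Union>c\<in>F. cball c (r m))"
        then have "x \<in> (\<Union>c\<in>K. cball c d)" using F(1) r(2)[of m] by force
        then show "x \<in> \<Omega>" using d(2) by blast
      qed
      fix x assume "x \<notin> (\<Union>c\<in>F. cball c (r m))"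
      then have "w x = 0" by (intro w0) auto
      then show "\<phi> x = 0" by (simp add: \<phi>_def bump_eq_0_iff)
    qed
    moreover have "exp (- (1 / (real m + 1))) \<le> \<phi> x" if "x \<in> K" for x
    proof -
      have "real m + 1 = (real m + 1) / \<beta> * \<beta>" using \<beta>(1) by simp
      also have "\<dots> \<le> (real m + 1) / \<beta> * w x" using \<beta> that by (intro mult_left_mono) auto
      finally have "bump (real m + 1) \<le> \<phi> x" unfolding \<phi>_def by (rule bump_mono)
      then show ?thesis by (simp add: bump_eq)
    qed
    moreover have "\<phi> x = 0" if "\<forall>c\<in>K. r m \<le> dist c x" for x
    proof -
      have "w x = 0" by (rule w0) (use that F(1) in blast)
      then show ?thesis unfolding \<phi>_def by (simp add: bump_eq_0_iff)
    qed
    ultimately show ?thesis by (intro exI[of _ \<phi>]) (auto simp: \<phi>_def bump_nonneg bump_le_1)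
  qed
  then obtain \<phi> where \<phi>: "\<And>m. \<phi> m \<in> test_functions \<Omega>" "\<And>m x. 0 \<le> \<phi> m x \<and> \<phi> m x \<le> 1"
    "\<And>m x. x \<in> K \<Longrightarrow> exp (- (1 / (real m + 1))) \<le> \<phi> m x"
    "\<And>m x. (\<forall>c\<in>K. r m \<le> dist c x) \<Longrightarrow> \<phi> m x = 0" by metis
  have "(\<lambda>m. \<phi> m x) \<longlonglongrightarrow> indicator K x" for x
  proof (cases "x \<in> K")
    case True
    have "(\<lambda>m. 1 / (real m + 1)) \<longlonglongrightarrow> 0"
      using LIMSEQ_inverse_real_of_nat by (simp add: inverse_eq_divide add.commute)
    then have "(\<lambda>m. exp (- (1 / (real m + 1)))) \<longlonglongrightarrow> exp (- 0)"
      by (intro tendsto_exp tendsto_minus)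
    then have "(\<lambda>m. exp (- (1 / (real m + 1)))) \<longlonglongrightarrow> 1" by simp
    then have "(\<lambda>m. \<phi> m x) \<longlonglongrightarrow> 1"
      by (rule tendsto_sandwich[OF _ _ _ tendsto_const[of 1], rotated 2]) (use \<phi> True in auto)
    then show ?thesis using True by simp
  next
    case False
    have "open (- K)" using assms(1) by (simp add: compact_imp_closed open_Compl)
    then obtain \<delta> where \<delta>: "\<delta> > 0" "ball x \<delta> \<subseteq> - K" using False open_contains_ball by blast
    have "eventually (\<lambda>m. r m < \<delta>) sequentially" using order_tendstoD(2)[OF r0 \<delta>(1)] .
    then have "eventually (\<lambda>m. \<phi> m x = 0) sequentially"
    proof eventually_elim
      case (elim m)
      have "r m \<le> dist c x" if "c \<in> K" for c
      proof -
        have "c \<notin> ball x \<delta>" using \<delta>(2) that by blast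
        then show ?thesis using elim by (simp add: dist_commute)
      qed
      then show ?case using \<phi>(4) by blast
    qed
    then show ?thesis using False by (simp add: tendsto_eventually)
  qed
  then show ?thesis using that \<phi> by blast
qed

text \<open>Testing with smooth approximations of indicators shows that the integral of g over every
  compact subset of \<Omega> is zero. By inner regularity the sets where g is positive or negative
  are exhausted by closed, hence here compact, sets up to arbitrarily small measure, so they are
  null.\<close>

lemma fundamental_lemma_calculus_of_variations:
  fixes g :: "real^'n \<Rightarrow> real"
  assumes \<Omega>: "open \<Omega>" "bounded \<Omega>" and g: "integrable (lebesgue_on \<Omega>) g"
    and 0: "\<And>\<phi>. \<phi> \<in> test_functions \<Omega> \<Longrightarrow> (LINT x|lebesgue_on \<Omega>. g x * \<phi> x) = 0"
  shows "AE x in lebesgue_on \<Omega>. g x = 0"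
proof -
  have \<Omega>m: "\<Omega> \<in> sets lebesgue" using \<Omega>(1) by auto
  define G where "G x = indicator \<Omega> x * g x" for x
  have G: "integrable lebesgue G"
    using g \<Omega>m unfolding G_def by (simp add: integrable_restrict_space)
  have Gm [measurable]: "G \<in> borel_measurable lebesgue" using G by auto
  have K0: "(LINT x|lebesgue. indicator K x * G x) = 0" if K: "compact K" "K \<subseteq> \<Omega>" for K
  proof -
    obtain \<phi> where \<phi>: "\<And>m::nat. \<phi> m \<in> test_functions \<Omega>" "\<And>m x. 0 \<le> \<phi> m x \<and> \<phi> m x \<le> 1"
      "\<And>x. (\<lambda>m. \<phi> m x) \<longlonglongrightarrow> indicator K x"
      using smooth_approximation_of_indicator[OF K(1) \<Omega>(1) K(2)] by blast
    have [measurable]: "\<phi> m \<in> borel_measurable lebesgue" for m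
      using smooth_fun_borel[OF test_functions_smooth[OF \<phi>(1)]] by (simp add: measurable_completion)
    have [measurable]: "K \<in> sets lebesgue" using K(1) by (simp add: compact_imp_closed)
    have "(\<lambda>m. LINT x|lebesgue. \<phi> m x * G x) \<longlonglongrightarrow> (LINT x|lebesgue. indicator K x * G x)"
    proof (rule integral_dominated_convergence)
      show "integrable lebesgue (\<lambda>x. \<bar>G x\<bar>)" using G by simp
      show "AE x in lebesgue. (\<lambda>m. \<phi> m x * G x) \<longlonglongrightarrow> indicator K x * G x"
        by (intro AE_I2 tendsto_mult \<phi> tendsto_const)
      show "AE x in lebesgue. norm (\<phi> m x * G x) \<le> \<bar>G x\<bar>" for m
        using \<phi>(2)[of m] by (auto simp: abs_mult intro!: mult_left_le_one_le)
    qed measurable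
    moreover have "(LINT x|lebesgue. \<phi> m x * G x) = 0" for m
      using 0[OF \<phi>(1)[of m]] \<Omega>m unfolding G_def
      by (simp add: integral_restrict_space mult_ac)
    ultimately show ?thesis by (simp add: LIMSEQ_const_iff)
  qed
  \<comment> \<open>The factor s treats both signs at once, through s = 1 and s = -1.\<close>
  have half: "{x. 0 < s * G x} \<in> null_sets lebesgue" if s: "s \<noteq> 0" for s :: real
  proof (rule null_setsI)
    let ?A = "{x. 0 < s * G x}"
    have "(\<lambda>x. s * G x) \<in> borel_measurable lebesgue" by measurable
    from measurable_sets[OF this, of "{0<..}"] show Am: "?A \<in> sets lebesgue"
      by (simp add: vimage_def)
    have sub: "?A \<subseteq> \<Omega>" by (auto simp: G_def indicator_def)
    have "emeasure lebesgue ?A \<le> ennreal e" if e: "0 < e" for e :: real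
    proof -
      obtain T where T: "closed T" "T \<subseteq> ?A" "?A - T \<in> lmeasurable" "emeasure lebesgue (?A - T) < ennreal e"
        using sets_lebesgue_inner_closed[OF Am e] by blast
      have comp: "compact T" "T \<subseteq> \<Omega>"
        using T sub \<Omega>(2) by (auto intro: bounded_subset simp: compact_eq_bounded_closed)
      have Tm [measurable]: "T \<in> sets lebesgue" using T(1) by simp
      have "(LINT x|lebesgue. indicator T x * (s * G x)) = s * (LINT x|lebesgue. indicator T x * G x)"
        by (simp add: mult.left_commute)
      then have "(LINT x|lebesgue. indicator T x * (s * G x)) = 0" using K0[OF comp] by simp
      moreover have "integrable lebesgue (\<lambda>x. indicator T x * (s * G x))"
        using integrable_mult_indicator[OF Tm, of "\<lambda>x. s * G x"] G by simp
      moreover have "AE x in lebesgue. 0 \<le> indicator T x * (s * G x)"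
        using T(2) by (auto simp: indicator_def intro!: AE_I2 less_imp_le)
      ultimately have "AE x in lebesgue. indicator T x * (s * G x) = 0"
        using integral_nonneg_eq_0_iff_AE by blast
      then have "AE x in lebesgue. x \<notin> T"
        by eventually_elim (use T(2) in \<open>auto simp: indicator_def split: if_splits\<close>)
      then have "emeasure lebesgue T = 0" using Tm by (simp add: AE_iff_null_sets null_setsD1)
      moreover have "emeasure lebesgue ?A \<le> emeasure lebesgue T + emeasure lebesgue (?A - T)"
        using emeasure_subadditive[of T lebesgue "?A - T"] Tm Am T(2) by (simp add: Un_absorb1 Un_Diff_cancel)
      ultimately show ?thesis using T(4) by simp
    qed
    then show "emeasure lebesgue ?A = 0"
      by (metis ennreal_0 ennreal_le_epsilon le_zero_eq add.left_neutral)
  qed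
  have "AE x in lebesgue. \<not> 0 < 1 * G x" "AE x in lebesgue. \<not> 0 < -1 * G x"
    using AE_not_in[OF half[of 1]] AE_not_in[OF half[of "-1"]] by auto
  then have "AE x in lebesgue. G x = 0" by eventually_elim auto
  then have "AE x in lebesgue. x \<in> \<Omega> \<longrightarrow> g x = 0" by eventually_elim (auto simp: G_def)
  then show ?thesis using \<Omega>m by (simp add: AE_restrict_space_iff)
qed

section \<open>Weak gradients\<close>

lemma open_bounded_lmeasurable: "open \<Omega> \<Longrightarrow> bounded \<Omega> \<Longrightarrow> (\<Omega>::(real^'n) set) \<in> lmeasurable"
  by (simp add: lmeasurable_open)

lemma square_integrable_nth:
  fixes g :: "real^'n \<Rightarrow> real^'n"
  assumes "square_integrable \<mu> g" shows "square_integrable \<mu> (\<lambda>x. g x $ i)"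
proof -
  have "(\<lambda>x. g x \<bullet> axis i 1) \<in> borel_measurable \<mu>"
    using assms by (auto simp: square_integrable_def)
  then have m: "(\<lambda>x. g x $ i) \<in> borel_measurable \<mu>" by (simp add: inner_axis)
  moreover have "integrable \<mu> (\<lambda>x. (norm (g x $ i))\<^sup>2)"
    by (rule Bochner_Integration.integrable_bound[where f = "\<lambda>x. (norm (g x))\<^sup>2"])
      (use assms m in \<open>auto simp: square_integrable_def abs_le_square_iff[symmetric] component_le_norm_cart\<close>)
  ultimately show ?thesis by (simp add: square_integrable_def)
qed

lemma square_integrable_integrable:
  fixes f :: "'a::euclidean_space \<Rightarrow> real"
  assumes "S \<in> lmeasurable" "square_integrable (lebesgue_on S) f"
  shows "integrable (lebesgue_on S) f"
  using square_integrable_inner[OF assms(2) square_integrable_bounded[OF assms(1), of "\<lambda>_. 1" 1]]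
  by simp

lemma weak_grad_unique:
  fixes \<Omega> :: "(real^'n) set"
  assumes \<Omega>: "open \<Omega>" "bounded \<Omega>" and g: "is_weak_grad \<Omega> v g" and h: "is_weak_grad \<Omega> v h"
  shows "AE x in lebesgue_on \<Omega>. g x = h x"
proof -
  note lm = open_bounded_lmeasurable[OF \<Omega>]
  have sq: "square_integrable (lebesgue_on \<Omega>) (\<lambda>x. g x $ i)" "square_integrable (lebesgue_on \<Omega>) (\<lambda>x. h x $ i)" for i
    using g h by (auto simp: is_weak_grad_def intro: square_integrable_nth)
  have "AE x in lebesgue_on \<Omega>. g x $ i - h x $ i = 0" for i
  proof (rule fundamental_lemma_calculus_of_variations[OF \<Omega>])
    show "integrable (lebesgue_on \<Omega>) (\<lambda>x. g x $ i - h x $ i)"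
      using square_integrable_integrable[OF lm sq(1)] square_integrable_integrable[OF lm sq(2)] by simp
    fix \<phi> assume \<phi>: "\<phi> \<in> test_functions \<Omega>"
    have sp: "square_integrable (lebesgue_on \<Omega>) \<phi>"
      by (intro smooth_square_integrable lm test_functions_smooth[OF \<phi>] test_functions_bounded_support[OF \<phi>])
    have "(LINT x|lebesgue_on \<Omega>. g x $ i * \<phi> x) = (LINT x|lebesgue_on \<Omega>. h x $ i * \<phi> x)"
    proof -
      have "- (LINT x|lebesgue_on \<Omega>. g x $ i * \<phi> x) = - (LINT x|lebesgue_on \<Omega>. h x $ i * \<phi> x)"
        using g h \<phi> unfolding is_weak_grad_def by simp
      then show ?thesis by simp
    qed
    then show "(LINT x|lebesgue_on \<Omega>. (g x $ i - h x $ i) * \<phi> x) = 0"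
      using square_integrable_inner[OF sq(1) sp, of i] square_integrable_inner[OF sq(2) sp, of i]
      by (simp add: left_diff_distrib)
  qed
  then have "AE x in lebesgue_on \<Omega>. \<forall>i. g x $ i - h x $ i = 0" by (simp add: AE_all_countable)
  then show ?thesis by eventually_elim (simp add: vec_eq_iff)
qed

lemma weak_grad_AE:
  assumes "open \<Omega>" "bounded \<Omega>" "is_weak_grad \<Omega> v g"
  shows "is_weak_grad \<Omega> v (weak_grad \<Omega> v)" "AE x in lebesgue_on \<Omega>. weak_grad \<Omega> v x = g x"
proof -
  show *: "is_weak_grad \<Omega> v (weak_grad \<Omega> v)" unfolding weak_grad_def by (rule someI[of "is_weak_grad \<Omega> v" g]) (fact assms(3))
  show "AE x in lebesgue_on \<Omega>. weak_grad \<Omega> v x = g x" by (rule weak_grad_unique[OF assms(1,2) * assms(3)])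
qed

lemma is_weak_grad_measurable: "is_weak_grad \<Omega> v g \<Longrightarrow> g \<in> borel_measurable (lebesgue_on \<Omega>)"
  unfolding is_weak_grad_def square_integrable_def by auto

text \<open>Uniqueness up to null sets makes the choice in \<open>weak_grad\<close> immaterial, so
  an explicit weak gradient can be used to compute the norms.\<close>

lemma h1_seminorm_eq:
  assumes "open \<Omega>" "bounded \<Omega>" "is_weak_grad \<Omega> v g"
  shows "h1_seminorm \<Omega> v = l2_norm (lebesgue_on \<Omega>) g"
  unfolding h1_seminorm_def l2_norm_def
proof (intro arg_cong[where f = sqrt] integral_cong_AE)
  note w = weak_grad_AE[OF assms]
  show "AE x in lebesgue_on \<Omega>. (norm (weak_grad \<Omega> v x))\<^sup>2 = (norm (g x))\<^sup>2"
    using w(2) by eventually_elim simp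
qed (use is_weak_grad_measurable[OF weak_grad_AE(1)[OF assms]] is_weak_grad_measurable[OF assms(3)] in auto)

lemma l2_inner_weak_grad_eq:
  assumes "open \<Omega>" "bounded \<Omega>" "is_weak_grad \<Omega> v g" "is_weak_grad \<Omega> w h"
  shows "l2_inner (lebesgue_on \<Omega>) (weak_grad \<Omega> v) (weak_grad \<Omega> w) = l2_inner (lebesgue_on \<Omega>) g h"
  unfolding l2_inner_def
proof (intro integral_cong_AE)
  show "AE x in lebesgue_on \<Omega>. weak_grad \<Omega> v x \<bullet> weak_grad \<Omega> w x = g x \<bullet> h x"
    using weak_grad_AE(2)[OF assms(1,2,3)] weak_grad_AE(2)[OF assms(1,2,4)] by eventually_elim simp
qed (use is_weak_grad_measurable[OF weak_grad_AE(1)[OF assms(1,2,3)]] is_weak_grad_measurable[OF weak_grad_AE(1)[OF assms(1,2,4)]]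
    is_weak_grad_measurable[OF assms(3)] is_weak_grad_measurable[OF assms(4)] in auto)

lemma is_weak_grad_diff:
  fixes \<Omega> :: "(real^'n) set"
  assumes \<Omega>: "open \<Omega>" "bounded \<Omega>" and v: "is_weak_grad \<Omega> v g" "square_integrable (lebesgue_on \<Omega>) v"
    and w: "is_weak_grad \<Omega> w h" "square_integrable (lebesgue_on \<Omega>) w"
  shows "is_weak_grad \<Omega> (\<lambda>x. v x - w x) (\<lambda>x. g x - h x)"
  unfolding is_weak_grad_def
proof (intro conjI ballI allI)
  show "square_integrable (lebesgue_on \<Omega>) (\<lambda>x. g x - h x)"
    using v(1) w(1) unfolding is_weak_grad_def by (intro square_integrable_diff) auto
  fix \<phi> i assume \<phi>: "\<phi> \<in> test_functions \<Omega>"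
  note lm = open_bounded_lmeasurable[OF \<Omega>]
  have sp: "square_integrable (lebesgue_on \<Omega>) \<phi>" "square_integrable (lebesgue_on \<Omega>) (partial i \<phi>)"
    using \<phi> test_functions_partial[OF \<phi>]
    by (auto intro!: smooth_square_integrable lm test_functions_smooth test_functions_bounded_support)
  have sq: "square_integrable (lebesgue_on \<Omega>) (\<lambda>x. g x $ i)" "square_integrable (lebesgue_on \<Omega>) (\<lambda>x. h x $ i)"
    using v w by (auto simp: is_weak_grad_def intro: square_integrable_nth)
  show "(LINT x|lebesgue_on \<Omega>. (v x - w x) * partial i \<phi> x) = - (LINT x|lebesgue_on \<Omega>. (g x - h x) $ i * \<phi> x)"
    using v(1) w(1) \<phi> square_integrable_inner[OF sq(1) sp(1)] square_integrable_inner[OF sq(2) sp(1)]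
      square_integrable_inner[OF v(2) sp(2)] square_integrable_inner[OF w(2) sp(2)]
    unfolding is_weak_grad_def by (simp add: left_diff_distrib)
qed

lemma test_functions_weak_grad:
  fixes \<Omega> :: "(real^'n) set"
  assumes \<Omega>: "open \<Omega>" "bounded \<Omega>" and \<phi>: "\<phi> \<in> test_functions \<Omega>"
  shows "is_weak_grad \<Omega> \<phi> (grad \<phi>)"
  unfolding is_weak_grad_def
proof (intro conjI ballI allI)
  note lm = open_bounded_lmeasurable[OF \<Omega>]
  note s\<phi> = test_functions_smooth[OF \<phi>] test_functions_bounded_support[OF \<phi>]
  show "square_integrable (lebesgue_on \<Omega>) (grad \<phi>)"
    by (intro smooth_grad_square_integrable lm s\<phi>)
  fix \<theta> i assume \<theta>: "\<theta> \<in> test_functions \<Omega>"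
  note s\<theta> = test_functions_smooth[OF \<theta>] test_functions_bounded_support[OF \<theta>]
  have I: "integrable lborel f" if "smooth_fun f" "bounded_support f" for f :: "real^'n \<Rightarrow> real"
    using that by (intro bounded_support_integrable smooth_fun_continuous)
  have i1: "integrable lborel (\<lambda>x. \<phi> x * partial i \<theta> x)" "integrable lborel (\<lambda>x. partial i \<phi> x * \<theta> x)"
    by (intro I smooth_fun_mult smooth_fun_partial s\<phi> s\<theta> bounded_support_mult bounded_support_partial)+
  have "partial i (\<lambda>x. \<phi> x * \<theta> x) = (\<lambda>x. \<phi> x * partial i \<theta> x + partial i \<phi> x * \<theta> x)"
    by (intro ext partial_mult smooth_fun_differentiable s\<phi> s\<theta>)
  then have 0: "(LINT x|lborel. \<phi> x * partial i \<theta> x) = - (LINT x|lborel. partial i \<phi> x * \<theta> x)"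
    using integral_partial_0[of "\<lambda>x. \<phi> x * \<theta> x" i] smooth_fun_mult[OF s\<phi>(1) s\<theta>(1)] bounded_support_mult(1)[OF s\<theta>(2), of \<phi>]
      Bochner_Integration.integral_add[OF i1] by simp
  have L: "(LINT x|lebesgue_on \<Omega>. f x) = (LINT x|lborel. f x)"
    if "f \<in> borel_measurable borel" "\<And>x. x \<notin> \<Omega> \<Longrightarrow> f x = 0" for f :: "real^'n \<Rightarrow> real"
  proof -
    have "(LINT x|lebesgue_on \<Omega>. f x) = (LINT x:\<Omega>|lborel. f x)"
      by (rule LINT_lebesgue_on) (use that \<Omega> in auto)
    also have "\<dots> = (LINT x|lborel. f x)"
      unfolding set_lebesgue_integral_def
      by (rule Bochner_Integration.integral_cong) (auto simp: indicator_def that)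
    finally show ?thesis .
  qed
  have "(LINT x|lebesgue_on \<Omega>. \<phi> x * partial i \<theta> x) = (LINT x|lborel. \<phi> x * partial i \<theta> x)"
    by (rule L) (auto intro!: smooth_fun_borel smooth_fun_mult smooth_fun_partial s\<phi> s\<theta> simp: test_functions_outside[OF \<phi>])
  moreover have "(LINT x|lebesgue_on \<Omega>. partial i \<phi> x * \<theta> x) = (LINT x|lborel. partial i \<phi> x * \<theta> x)"
    by (rule L) (auto intro!: smooth_fun_borel smooth_fun_mult smooth_fun_partial s\<phi> s\<theta> simp: test_functions_outside[OF \<theta>])
  ultimately show "(LINT x|lebesgue_on \<Omega>. \<phi> x * partial i \<theta> x) = - (LINT x|lebesgue_on \<Omega>. grad \<phi> x $ i * \<theta> x)"
    using 0 by (simp add: grad_def)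
qed

lemma test_functions_H1:
  assumes "open \<Omega>" "bounded \<Omega>" "\<phi> \<in> test_functions \<Omega>" shows "\<phi> \<in> H1 \<Omega>"
  unfolding H1_def
  using test_functions_weak_grad[OF assms] smooth_square_integrable[OF test_functions_smooth[OF assms(3)]
    test_functions_bounded_support[OF assms(3)] open_bounded_lmeasurable[OF assms(1,2)]] by blast

text \<open>A test function is approximated by itself. What remains is the seminorm of the zero
  function, which is not 0 by definition since \<open>weak_grad\<close> is a choice.\<close>

lemma test_functions_H10:
  assumes "open \<Omega>" "bounded \<Omega>" "\<phi> \<in> test_functions \<Omega>" shows "\<phi> \<in> H10 \<Omega>"
proof -
  have "is_weak_grad \<Omega> (\<lambda>x. 0) (\<lambda>x. 0)"
    unfolding is_weak_grad_def by (simp add: square_integrable_def)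
  then have "h1_seminorm \<Omega> (\<lambda>x. 0) = 0"
    by (subst h1_seminorm_eq[OF assms(1,2)]) (auto simp: l2_norm_def)
  then have "\<exists>\<theta>\<in>test_functions \<Omega>. (l2_norm (lebesgue_on \<Omega>) (\<lambda>x. \<phi> x - \<theta> x))\<^sup>2 + (h1_seminorm \<Omega> (\<lambda>x. \<phi> x - \<theta> x))\<^sup>2 < \<delta>\<^sup>2"
    if "\<delta> > 0" for \<delta> :: real
    using assms(3) that by (intro bexI[of _ \<phi>]) (auto simp: l2_norm_def)
  then show ?thesis using test_functions_H1[OF assms] unfolding H10_def by blast
qed

section \<open>The weak gradient of a continuous piecewise smooth function\<close>

text \<open>Off the interiors of the elements the value is 0, so no side has to be chosen on a face;
  within the domain this concerns a null set only.\<close>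

definition pw_grad :: "(real^'n) set set \<Rightarrow> ((real^'n) set \<Rightarrow> real^'n \<Rightarrow> real) \<Rightarrow> real^'n \<Rightarrow> real^'n" where
  "pw_grad \<T> p x = (\<Sum>T\<in>\<T>. indicator (interior T) x *\<^sub>R grad (p T) x)"

lemma sum_indicator_interior:
  fixes F :: "'a::euclidean_space set \<Rightarrow> 'b::real_vector"
  assumes "finite \<T>" "T \<in> \<T>" "x \<in> interior T"
    and "\<And>S T. S \<in> \<T> \<Longrightarrow> T \<in> \<T> \<Longrightarrow> S \<noteq> T \<Longrightarrow> interior S \<inter> interior T = {}"
  shows "(\<Sum>S\<in>\<T>. indicator (interior S) x *\<^sub>R F S) = F T"
proof -
  have "x \<notin> interior S" if "S \<in> \<T>" "S \<noteq> T" for S using assms that by blast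
  then have "(\<Sum>S\<in>\<T>. indicator (interior S) x *\<^sub>R F S) = (\<Sum>S\<in>\<T>. if S = T then F T else 0)"
    using assms(3) by (intro sum.cong) (auto simp: indicator_def)
  then show ?thesis using assms(1,2) by simp
qed

lemma pw_grad_interior:
  assumes "finite \<T>" "T \<in> \<T>" "x \<in> interior T"
    and "\<And>S T. S \<in> \<T> \<Longrightarrow> T \<in> \<T> \<Longrightarrow> S \<noteq> T \<Longrightarrow> interior S \<inter> interior T = {}"
  shows "pw_grad \<T> p x = grad (p T) x"
  unfolding pw_grad_def by (rule sum_indicator_interior[OF assms])

text \<open>Along the segment from y to x the closed pieces induce a finite closed cover of an
  interval, where Lipschitz bounds on the pieces combine without loss in the constant.\<close>

lemma lipschitz_piecewise:
  fixes w :: "'a::euclidean_space \<Rightarrow> real"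
  assumes "finite \<C>" "\<And>S. S \<in> \<C> \<Longrightarrow> closed S" "\<Union>\<C> = UNIV" "L \<ge> 0"
    and lip: "\<And>S x y. S \<in> \<C> \<Longrightarrow> x \<in> S \<Longrightarrow> y \<in> S \<Longrightarrow> \<bar>w x - w y\<bar> \<le> L * norm (x - y)"
  shows "\<bar>w x - w y\<bar> \<le> L * norm (x - y)"
proof -
  define \<gamma> where "\<gamma> t = y + t *\<^sub>R (x - y)" for t
  have cl: "closed (\<gamma> -` S)" if "S \<in> \<C>" for S
    unfolding \<gamma>_def by (intro closed_vimage assms that continuous_intros)
  have "(L * norm (x - y))-lipschitz_on {0..1} (w \<circ> \<gamma>)"
  proof (rule lipschitz_on_closed_Union[where I = \<C> and U = "\<lambda>S. \<gamma> -` S"])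
    fix S assume S: "S \<in> \<C>"
    show "(L * norm (x - y))-lipschitz_on (\<gamma> -` S) (w \<circ> \<gamma>)"
    proof (rule lipschitz_onI)
      fix s t assume "s \<in> \<gamma> -` S" "t \<in> \<gamma> -` S"
      then have "\<bar>w (\<gamma> s) - w (\<gamma> t)\<bar> \<le> L * norm (\<gamma> s - \<gamma> t)" using lip[OF S] by simp
      also have "\<gamma> s - \<gamma> t = (s - t) *\<^sub>R (x - y)" by (simp add: \<gamma>_def algebra_simps)
      finally show "dist ((w \<circ> \<gamma>) s) ((w \<circ> \<gamma>) t) \<le> L * norm (x - y) * dist s t"
        by (simp add: dist_norm mult_ac)
    qed (use assms(4) in simp)
  next
    have "\<gamma> t \<in> \<Union>\<C>" for t using assms(3) by simp
    then show "{0..1} \<subseteq> (\<Union>S\<in>\<C>. \<gamma> -` S)" by blast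
  qed (use assms cl in auto)
  from lipschitz_onD[OF this, of 1 0] show ?thesis by (simp add: \<gamma>_def dist_norm)
qed

text \<open>Boundary terms on single elements are avoided: v \<phi> is Lipschitz on the whole space,
  and its difference quotients have integral zero and converge off the element boundaries to the
  piecewise derivative. Contributions of faces cancel implicitly because v is single valued
  there.\<close>

lemma piecewise_weak_grad:
  fixes \<Omega> :: "(real^'n) set"
  assumes \<Omega>: "open \<Omega>" "bounded \<Omega>" and \<T>: "finite \<T>" "\<Union>\<T> = closure \<Omega>"
    and cl: "\<And>T. T \<in> \<T> \<Longrightarrow> closed T" and neg: "\<And>T. T \<in> \<T> \<Longrightarrow> negligible (frontier T)"
    and disj: "\<And>S T. S \<in> \<T> \<Longrightarrow> T \<in> \<T> \<Longrightarrow> S \<noteq> T \<Longrightarrow> interior S \<inter> interior T = {}"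
    and v: "continuous_on (closure \<Omega>) v" and p: "\<And>T x. T \<in> \<T> \<Longrightarrow> x \<in> T \<Longrightarrow> v x = p T x"
    and sp: "\<And>T. T \<in> \<T> \<Longrightarrow> smooth_fun (p T)"
  shows "is_weak_grad \<Omega> v (pw_grad \<T> p)"
  unfolding is_weak_grad_def
proof (intro conjI ballI allI)
  note lm = open_bounded_lmeasurable[OF \<Omega>]
  have meas: "pw_grad \<T> p \<in> borel_measurable borel"
    unfolding pw_grad_def[abs_def]
    by (intro borel_measurable_sum borel_measurable_scaleR borel_measurable_indicator grad_borel sp) auto
  have "\<exists>B. \<forall>x\<in>closure \<Omega>. norm (grad (p T) x) \<le> B" if "T \<in> \<T>" for T
  proof -
    have "continuous_on (closure \<Omega>) (grad (p T))"
      unfolding grad_def[abs_def]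
      by (intro continuous_on_vec_lambda smooth_fun_continuous smooth_fun_partial sp that)
    then have "bounded (grad (p T) ` closure \<Omega>)"
      using \<Omega>(2) by (intro compact_imp_bounded compact_continuous_image) (auto simp: compact_eq_bounded_closed)
    then show ?thesis unfolding bounded_iff by auto
  qed
  then obtain B where B: "\<And>T x. T \<in> \<T> \<Longrightarrow> x \<in> closure \<Omega> \<Longrightarrow> norm (grad (p T) x) \<le> B T" by metis
  show "square_integrable (lebesgue_on \<Omega>) (pw_grad \<T> p)"
  proof (rule square_integrable_bounded[OF lm])
    fix x assume "x \<in> \<Omega>"
    then have x: "x \<in> closure \<Omega>" using closure_subset by blast
    show "norm (pw_grad \<T> p x) \<le> (\<Sum>T\<in>\<T>. B T)"
      unfolding pw_grad_def
    proof (rule sum_norm_le)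
      fix T assume "T \<in> \<T>"
      then show "norm (indicator (interior T) x *\<^sub>R grad (p T) x) \<le> B T"
        using B[OF _ x, of T] order_trans[OF norm_ge_zero B[OF _ x, of T]] by (auto simp: indicator_def)
    qed
  qed (rule borel_measurable_lebesgue_on_borel[OF meas])
  fix \<phi> i assume \<phi>: "\<phi> \<in> test_functions \<Omega>"
  note s\<phi> = test_functions_smooth[OF \<phi>] test_functions_bounded_support[OF \<phi>]
  let ?w = "\<lambda>x. v x * \<phi> x"
  have sT: "smooth_fun (\<lambda>x. p T x * \<phi> x)" "bounded_support (\<lambda>x. p T x * \<phi> x)" if "T \<in> \<T>" for T
    using smooth_fun_mult[OF sp[OF that] s\<phi>(1)] bounded_support_mult(1)[OF s\<phi>(2)] by auto
  have "\<exists>L\<ge>0. \<forall>x y. \<bar>p T x * \<phi> x - p T y * \<phi> y\<bar> \<le> L * norm (x - y)" if "T \<in> \<T>" for T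
    by (rule smooth_fun_lipschitz[OF sT[OF that]])
  then obtain LT where LT: "\<And>T. T \<in> \<T> \<Longrightarrow> LT T \<ge> 0"
    "\<And>T x y. T \<in> \<T> \<Longrightarrow> \<bar>p T x * \<phi> x - p T y * \<phi> y\<bar> \<le> LT T * norm (x - y)" by metis
  define L where "L = (\<Sum>T\<in>\<T>. LT T)"
  have L0: "L \<ge> 0" unfolding L_def by (intro sum_nonneg LT)
  \<comment> \<open>The complement of \<Omega>, where \<phi> vanishes, completes the elements to a
    finite closed cover of the whole space.\<close>
  have wlip: "\<bar>?w x - ?w y\<bar> \<le> L * norm (x - y)" for x y
  proof (rule lipschitz_piecewise[where \<C> = "insert (- \<Omega>) \<T>"])
    show "\<Union>(insert (- \<Omega>) \<T>) = UNIV" using \<T>(2) closure_subset by auto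
    fix S x y assume S: "S \<in> insert (- \<Omega>) \<T>" and xy: "x \<in> S" "y \<in> S"
    show "\<bar>?w x - ?w y\<bar> \<le> L * norm (x - y)"
    proof (cases "S \<in> \<T>")
      case True
      then have "\<bar>?w x - ?w y\<bar> \<le> LT S * norm (x - y)" using LT(2) p xy by simp
      also have "\<dots> \<le> L * norm (x - y)"
        unfolding L_def using member_le_sum[OF True, of LT] LT(1) \<T>(1) by (intro mult_right_mono) auto
      finally show ?thesis .
    next
      case False
      then show ?thesis using S xy L0 by (simp add: test_functions_outside[OF \<phi>])
    qed
  qed (use \<T>(1) \<Omega>(1) cl L0 in auto)
  have "continuous_on UNIV ?w"
    by (rule lipschitz_on_continuous_on[of L], rule lipschitz_onI) (use wlip L0 in \<open>auto simp: dist_norm\<close>)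
  moreover have "bounded_support ?w" by (rule bounded_support_mult(1)[OF s\<phi>(2)])
  ultimately have w: "integrable lborel ?w" "?w \<in> borel_measurable borel"
    by (auto intro: bounded_support_integrable borel_measurable_continuous_onI)
  obtain R where R: "\<And>x. R < norm x \<Longrightarrow> \<phi> x = 0" using s\<phi>(2) unfolding bounded_support_def by blast
  define d1 where "d1 x = (\<Sum>T\<in>\<T>. indicator (interior T) x *\<^sub>R (p T x * partial i \<phi> x))" for x
  define d2 where "d2 x = (\<Sum>T\<in>\<T>. indicator (interior T) x *\<^sub>R (partial i (p T) x * \<phi> x))" for x
  have I: "set_integrable lborel (interior T) (\<lambda>x. p T x * partial i \<phi> x)"
    "set_integrable lborel (interior T) (\<lambda>x. partial i (p T) x * \<phi> x)" if "T \<in> \<T>" for T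
    by (intro smooth_indicator_integrable smooth_fun_mult sp smooth_fun_partial s\<phi> that
        bounded_support_mult(1) bounded_support_partial; simp)+
  have d12: "integrable lborel d1" "integrable lborel d2"
    unfolding d1_def d2_def using I by (auto simp: set_integrable_def intro!: Bochner_Integration.integrable_sum)
  have d12m [measurable]: "d1 \<in> borel_measurable borel" "d2 \<in> borel_measurable borel"
    using d12 by auto
  have aefr: "AE x in lborel. x \<notin> (\<Union>T\<in>\<T>. frontier T)"
  proof -
    have "negligible (\<Union>T\<in>\<T>. frontier T)" using \<T>(1) neg by (intro negligible_Union) auto
    moreover have "(\<Union>T\<in>\<T>. frontier T) \<in> sets lborel" using \<T>(1) by (auto intro!: sets.finite_UN)
    ultimately have "(\<Union>T\<in>\<T>. frontier T) \<in> null_sets lborel"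
      by (simp add: negligible_iff_null_sets null_sets_completion_iff)
    then show ?thesis by (rule AE_not_in)
  qed
  have cases: "(\<exists>T\<in>\<T>. x \<in> interior T) \<or> (x \<notin> closure \<Omega>)" if "x \<notin> (\<Union>T\<in>\<T>. frontier T)" for x
  proof (rule disjCI)
    assume "\<not> x \<notin> closure \<Omega>"
    then obtain T where "T \<in> \<T>" "x \<in> T" using \<T>(2) by blast
    then show "\<exists>T\<in>\<T>. x \<in> interior T"
      using that cl[of T] unfolding frontier_def by (auto simp: closure_closed)
  qed
  have out: "d1 x = 0" "d2 x = 0" if "x \<notin> closure \<Omega>" for x
  proof -
    have "x \<notin> interior T" if "T \<in> \<T>" for T using that \<open>x \<notin> closure \<Omega>\<close> \<T>(2) interior_subset by blast
    then show "d1 x = 0" "d2 x = 0" unfolding d1_def d2_def by auto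
  qed
  have ins: "d1 x = v x * partial i \<phi> x" "d2 x = pw_grad \<T> p x $ i * \<phi> x" if "T \<in> \<T>" "x \<in> interior T" for T x
    using sum_indicator_interior[OF \<T>(1) that disj, of "\<lambda>T. p T x * partial i \<phi> x"]
      sum_indicator_interior[OF \<T>(1) that disj, of "\<lambda>T. partial i (p T) x * \<phi> x"]
      pw_grad_interior[OF \<T>(1) that disj, of p] p[OF that(1)] that(2) interior_subset[of T]
    unfolding d1_def d2_def by (auto simp: grad_def)
  \<comment> \<open>Off the element boundaries v \<phi> agrees near x with a smooth function, either
    \<open>p T\<close> times \<phi> or 0.\<close>
  have quot: "((\<lambda>t. (?w (x + t *\<^sub>R axis i 1) - ?w x) / t) \<longlongrightarrow> d1 x + d2 x) (at 0)"
    if "x \<notin> (\<Union>T\<in>\<T>. frontier T)" for x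
  proof -
    have key: "((\<lambda>t. (?w (x + t *\<^sub>R axis i 1) - ?w x) / t) \<longlongrightarrow> c) (at 0)"
      if U: "open U" "x \<in> U" "\<And>y. y \<in> U \<Longrightarrow> ?w y = q y" and q: "smooth_fun q" "partial i q x = c" for U q c
    proof -
      have "(\<Sum>j\<in>UNIV. axis i 1 $ j * partial j q x) = (\<Sum>j\<in>UNIV. if j = i then partial i q x else 0)"
        by (rule sum.cong) (auto simp: axis_def)
      then have lim: "((\<lambda>t. (q (x + t *\<^sub>R axis i 1) - q x) / t) \<longlongrightarrow> c) (at 0)"
        using smooth_quotient_tendsto[OF q(1), of x "axis i 1"] q(2) by simp
      have "((\<lambda>t. x + t *\<^sub>R axis i 1) \<longlongrightarrow> x + 0 *\<^sub>R axis i 1) (at (0::real))"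
        by (intro tendsto_intros)
      then have "eventually (\<lambda>t::real. x + t *\<^sub>R axis i 1 \<in> U) (at 0)"
        using U(1,2) by (auto dest: topological_tendstoD)
      then have "eventually (\<lambda>t. (q (x + t *\<^sub>R axis i 1) - q x) / t = (?w (x + t *\<^sub>R axis i 1) - ?w x) / t) (at 0)"
        by eventually_elim (use U(2,3) in auto)
      then show ?thesis using lim by (rule Lim_transform_eventually[rotated])
    qed
    from cases[OF that] show ?thesis
    proof
      assume "\<exists>T\<in>\<T>. x \<in> interior T"
      then obtain T where T: "T \<in> \<T>" "x \<in> interior T" by blast
      have "partial i (\<lambda>x. p T x * \<phi> x) x = p T x * partial i \<phi> x + partial i (p T) x * \<phi> x"
        by (intro partial_mult smooth_fun_differentiable sp T s\<phi>)
      also have "\<dots> = d1 x + d2 x"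
      proof -
        have "x \<in> T" using T(2) interior_subset by blast
        then show ?thesis
          using ins[OF T] p[OF T(1), of x] pw_grad_interior[OF \<T>(1) T disj, of p] by (simp add: grad_def)
      qed
      finally show ?thesis
        by (rule key[OF open_interior T(2) _ sT(1)[OF T(1)], rotated]) (use p[OF T(1)] interior_subset in auto)
    next
      assume x: "x \<notin> closure \<Omega>"
      have "\<phi> y = 0" if "y \<in> - closure \<Omega>" for y
        using that closure_subset[of \<Omega>] by (intro test_functions_outside[OF \<phi>]) auto
      moreover have "open (- closure \<Omega>)" by auto
      ultimately show ?thesis
        by (intro key[of "- closure \<Omega>" "\<lambda>x. 0"]) (use x in \<open>auto simp: out smooth_fun_const\<close>)
    qed
  qed
  have "(LINT x|lborel. d1 x + d2 x) = 0"
  proof (rule integral_directional_derivative_0(2)[where w = ?w and v = "axis i 1" and L = L and R = R])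
    show "\<bar>?w (x + t *\<^sub>R axis i 1) - ?w x\<bar> \<le> L * \<bar>t\<bar>" for x t
      using wlip[of "x + t *\<^sub>R axis i 1" x] by simp
    show "AE x in lborel. ((\<lambda>t. (?w (x + t *\<^sub>R axis i 1) - ?w x) / t) \<longlongrightarrow> d1 x + d2 x) (at 0)"
      using aefr by eventually_elim (rule quot)
  qed (use w R in auto)
  then have 0: "(LINT x|lborel. d1 x) = - (LINT x|lborel. d2 x)" using d12 by simp
  \<comment> \<open>Passage from the completed measure on \<Omega> to \<open>lborel\<close>: F and
    the Borel function d agree off the element boundaries.\<close>
  have conv: "(LINT x|lebesgue_on \<Omega>. F x) = (LINT x|lborel. d x)"
    if F: "F \<in> borel_measurable (lebesgue_on \<Omega>)" and d [measurable]: "d \<in> borel_measurable borel"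
      and ins: "\<And>T x. T \<in> \<T> \<Longrightarrow> x \<in> interior T \<Longrightarrow> d x = F x" and out: "\<And>x. x \<notin> closure \<Omega> \<Longrightarrow> d x = 0"
      and F0: "\<And>x. x \<notin> \<Omega> \<Longrightarrow> F x = 0" for F d :: "real^'n \<Rightarrow> real"
  proof -
    have \<Omega>s: "\<Omega> \<inter> space lebesgue \<in> sets lebesgue" using \<Omega>(1) by auto
    have "(LINT x|lebesgue_on \<Omega>. F x) = (LINT x|lebesgue. indicator \<Omega> x *\<^sub>R F x)"
      by (rule integral_restrict_space[OF \<Omega>s])
    also have "\<dots> = (LINT x|lebesgue. d x)"
    proof (rule integral_cong_AE)
      show "(\<lambda>x. indicator \<Omega> x *\<^sub>R F x) \<in> borel_measurable lebesgue"
        using F \<Omega>s by (simp add: lebesgue_on_measurable_iff)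
      show "d \<in> borel_measurable lebesgue" by (rule measurable_completion) simp
      show "AE x in lebesgue. indicator \<Omega> x *\<^sub>R F x = d x"
        using AE_completion[OF aefr]
      proof eventually_elim
        case (elim x)
        have "indicator \<Omega> x *\<^sub>R F x = F x" using F0[of x] by (auto simp: indicator_def)
        moreover have "F x = d x" using cases[OF elim] ins out F0 closure_subset[of \<Omega>] by fastforce
        ultimately show ?case by simp
      qed
    qed
    also have "\<dots> = (LINT x|lborel. d x)" by (rule integral_completion) simp
    finally show ?thesis .
  qed
  have pm: "partial i \<phi> \<in> borel_measurable (lebesgue_on \<Omega>)" "\<phi> \<in> borel_measurable (lebesgue_on \<Omega>)"
    by (intro borel_measurable_lebesgue_on_borel smooth_fun_borel smooth_fun_partial s\<phi>)+
  have vm: "v \<in> borel_measurable (lebesgue_on \<Omega>)"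
    by (rule continuous_imp_measurable_on_sets_lebesgue)
      (use continuous_on_subset[OF v closure_subset] \<Omega>(1) in auto)
  have "(LINT x|lebesgue_on \<Omega>. v x * partial i \<phi> x) = (LINT x|lborel. d1 x)"
    by (rule conv[OF borel_measurable_times[OF vm pm(1)] d12m(1)])
      (auto simp: ins out test_functions_outside[OF test_functions_partial[OF \<phi>]])
  moreover have "(\<lambda>x. pw_grad \<T> p x $ i) \<in> borel_measurable borel"
    using borel_measurable_inner[OF meas borel_measurable_const[of "axis i 1"]] by (simp add: inner_axis)
  then have "(LINT x|lebesgue_on \<Omega>. pw_grad \<T> p x $ i * \<phi> x) = (LINT x|lborel. d2 x)"
    by (intro conv[OF borel_measurable_times[OF borel_measurable_lebesgue_on_borel pm(2)] d12m(2)])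
      (auto simp: ins out test_functions_outside[OF \<phi>])
  ultimately show "(LINT x|lebesgue_on \<Omega>. v x * partial i \<phi> x) = - (LINT x|lebesgue_on \<Omega>. pw_grad \<T> p x $ i * \<phi> x)"
    using 0 by simp
qed

section \<open>Geometry of the mesh elements\<close>

definition cylinder :: "'a::real_inner \<Rightarrow> 'a \<Rightarrow> real \<Rightarrow> real \<Rightarrow> 'a set" where
  "cylinder a n \<rho> \<delta> = {x. norm (prj a n x - a) \<le> \<rho> \<and> \<bar>(x - a) \<bullet> n\<bar> \<le> \<delta>}"

lemma cylinder_subset_cball:
  assumes "norm n = 1" shows "cylinder a n \<rho> \<delta> \<subseteq> cball a (\<rho> + \<delta>)"
proof
  fix x assume x: "x \<in> cylinder a n \<rho> \<delta>"
  have "x - a = (prj a n x - a) + ((x - a) \<bullet> n) *\<^sub>R n" by (simp add: prj_def)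
  then have "norm (x - a) \<le> norm (prj a n x - a) + norm (((x - a) \<bullet> n) *\<^sub>R n)"
    by (metis norm_triangle_ineq)
  then show "x \<in> cball a (\<rho> + \<delta>)"
    using x assms by (auto simp: cylinder_def dist_norm norm_minus_commute)
qed

lemma closed_cylinder: "closed (cylinder a (n::'a::euclidean_space) \<rho> \<delta>)"
  unfolding cylinder_def prj_def by (intro closed_Collect_conj closed_Collect_le continuous_intros)

lemma bounded_cylinder: "norm n = 1 \<Longrightarrow> bounded (cylinder a (n::'a::euclidean_space) \<rho> \<delta>)"
  by (rule bounded_subset[OF bounded_cball cylinder_subset_cball])

lemma fmeasurable_closed_bounded:
  fixes S :: "'a::euclidean_space set"
  assumes "closed S" "bounded S" shows "S \<in> fmeasurable lborel"
  using emeasure_bounded_finite[OF assms(2)] assms(1) by (auto simp: fmeasurable_def)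

text \<open>By Fubini the volume is 2 \<delta> times a cross-section factor \<open>P\<close>. The
  latter is estimated from the case \<delta> = \<rho>, where the cylinder fits into a ball of radius
  2 \<rho>, so that no volume in dimension n - 1 has to be computed.\<close>

lemma measure_cylinder_le:
  fixes n :: "'a::euclidean_space"
  assumes n: "norm n = 1" and "\<rho> > 0" "\<delta> \<ge> 0"
  shows "measure lborel (cylinder a n \<rho> \<delta>) \<le> unit_ball_vol (DIM('a)) * 2 ^ DIM('a) * \<rho> ^ (DIM('a) - 1) * \<delta>"
proof -
  define P where "P = plane_integral a n (\<lambda>y. indicator {y. norm (y - a) \<le> \<rho>} y)"
  have m: "measure lborel (cylinder a n \<rho> \<delta>) = P * (2 * \<delta>)" if "\<delta> \<ge> 0" for \<delta>
  proof -
    have fin: "emeasure lborel (cylinder a n \<rho> \<delta>) < \<infinity>"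
      using emeasure_bounded_finite[OF bounded_cylinder[OF n]] .
    have eq: "indicator (cylinder a n \<rho> \<delta>) x =
      (indicator {y. norm (y - a) \<le> \<rho>} (prj a n x) * indicator {-\<delta>..\<delta>} ((x - a) \<bullet> n) :: real)" for x
      by (auto simp: indicator_def cylinder_def)
    have i: "integrable lborel (indicator (cylinder a n \<rho> \<delta>) :: 'a \<Rightarrow> real)"
      using fin by (intro integrable_real_indicator) (auto simp: closed_cylinder)
    have "measure lborel (cylinder a n \<rho> \<delta>) = (LINT x|lborel. indicator (cylinder a n \<rho> \<delta>) x)"
      by simp
    also have "\<dots> = P * (LINT s|lborel. indicator {-\<delta>..\<delta>} s)"
      using i unfolding eq P_def by (intro integral_product_slab n)
    also have "(LINT s|lborel. indicator {-\<delta>..\<delta>} s) = 2 * \<delta>" using that by simp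
    finally show ?thesis .
  qed
  have "P * (2 * \<rho>) = measure lborel (cylinder a n \<rho> \<rho>)" using m[of \<rho>] assms by simp
  also have "\<dots> \<le> measure lborel (cball a (2 * \<rho>))"
    using cylinder_subset_cball[OF n, of a \<rho> \<rho>]
    by (intro measure_mono_fmeasurable fmeasurable_closed_bounded) (auto simp: closed_cylinder)
  also have "\<dots> = unit_ball_vol (DIM('a)) * (2 * \<rho>) ^ DIM('a)" using assms by (intro content_cball) auto
  also have "(2 * \<rho>) ^ DIM('a) = 2 ^ DIM('a) * \<rho> ^ (DIM('a) - 1) * \<rho>"
    using power_minus_mult[OF DIM_positive[where 'a = 'a], of \<rho>] by (simp add: power_mult_distrib mult.assoc)
  finally have "(2 * P) * \<rho> \<le> (unit_ball_vol (DIM('a)) * 2 ^ DIM('a) * \<rho> ^ (DIM('a) - 1)) * \<rho>"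
    by (simp add: mult_ac)
  then have "2 * P \<le> unit_ball_vol (DIM('a)) * 2 ^ DIM('a) * \<rho> ^ (DIM('a) - 1)"
    using assms(2) by simp
  then have "2 * P * \<delta> \<le> unit_ball_vol (DIM('a)) * 2 ^ DIM('a) * \<rho> ^ (DIM('a) - 1) * \<delta>"
    using assms(3) by (intro mult_right_mono) auto
  then show ?thesis using m[OF assms(3)] by (simp add: mult_ac)
qed

lemma prj_norm_le:
  assumes "norm n = 1" shows "norm (prj a n x - a) \<le> norm (x - a)"
proof -
  have "(norm (prj a n x - a))\<^sup>2 \<le> (norm (x - a))\<^sup>2"
    unfolding norm_decompose[OF assms, of x a] by simp
  then show ?thesis by (rule power2_le_imp_le) simp
qed

text \<open>Used in the reverse direction: an element whose volume is comparable to a power of its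
  diameter cannot be thin in any direction.\<close>

lemma measure_le_width:
  fixes T :: "'a::euclidean_space set"
  assumes T: "compact T" "T \<noteq> {}" and n: "norm n = 1" and h: "diameter T > 0"
    and w: "\<And>x y. x \<in> T \<Longrightarrow> y \<in> T \<Longrightarrow> (x - y) \<bullet> n \<le> w"
  shows "measure lebesgue T \<le> unit_ball_vol (DIM('a)) * 2 ^ DIM('a) * diameter T ^ (DIM('a) - 1) * w"
proof -
  obtain a where a: "a \<in> T" using T(2) by blast
  have "T \<subseteq> cylinder a n (diameter T) w"
  proof
    fix x assume x: "x \<in> T"
    have "norm (prj a n x - a) \<le> norm (x - a)" by (rule prj_norm_le[OF n])
    also have "\<dots> \<le> diameter T"
      using diameter_bounded_bound[OF compact_imp_bounded[OF T(1)] x a] by (simp add: dist_norm)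
    finally show "x \<in> cylinder a n (diameter T) w"
      using w[OF x a] w[OF a x] by (auto simp: cylinder_def abs_le_iff inner_diff_left)
  qed
  then have "measure lborel T \<le> measure lborel (cylinder a n (diameter T) w)"
    by (intro measure_mono_fmeasurable fmeasurable_closed_bounded closed_cylinder bounded_cylinder n)
      (auto simp: T(1) compact_imp_closed)
  also have "\<dots> \<le> unit_ball_vol (DIM('a)) * 2 ^ DIM('a) * diameter T ^ (DIM('a) - 1) * w"
    using w[OF a a] h n by (intro measure_cylinder_le) auto
  finally show ?thesis using T(1) by (simp add: measure_completion compact_imp_closed)
qed

text \<open>A centrally symmetric set has a central point with \<open>K = 2\<close>, and the barycentre of an
  \<open>n\<close>-simplex is a central point with \<open>K = n + 1\<close>.\<close>

definition central_point :: "real \<Rightarrow> 'a::real_vector set \<Rightarrow> 'a \<Rightarrow> bool" where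
  "central_point K T a \<longleftrightarrow> (\<forall>x\<in>T. \<exists>y\<in>T. K *\<^sub>R a = x + (K - 1) *\<^sub>R y)"

text \<open>Suppose a unit vector \<nu> separates z from \<open>T\<close>. Writing K a = x1 + (K -
  1) y with x1 maximal for \<nu> puts \<open>a\<close> at height at least w / K above the minimum
  over \<open>T\<close>, and a point closer to \<open>a\<close> than that cannot lie below the
  minimum.\<close>

lemma central_point_ball:
  fixes T :: "'a::euclidean_space set"
  assumes T: "compact T" "convex T" "T \<noteq> {}" and K: "K \<ge> 1" "central_point K T a"
    and width: "\<And>n. norm n = 1 \<Longrightarrow> \<exists>x\<in>T. \<exists>y\<in>T. w \<le> (x - y) \<bullet> n"
  shows "ball a (w / K) \<subseteq> T"
proof
  fix z assume z: "z \<in> ball a (w / K)"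
  show "z \<in> T"
  proof (rule ccontr)
    assume "z \<notin> T"
    then obtain \<nu> b where \<nu>: "\<nu> \<bullet> z < b" "\<And>x. x \<in> T \<Longrightarrow> \<nu> \<bullet> x > b"
      using separating_hyperplane_closed_point[OF T(2) compact_imp_closed[OF T(1)], of z] by blast
    have cont: "continuous_on T (\<lambda>x. \<nu> \<bullet> x)" by (intro continuous_intros)
    obtain x0 where x0: "x0 \<in> T" "\<And>x. x \<in> T \<Longrightarrow> \<nu> \<bullet> x0 \<le> \<nu> \<bullet> x"
      using continuous_attains_inf[OF T(1,3) cont] by blast
    obtain x1 where x1: "x1 \<in> T" "\<And>x. x \<in> T \<Longrightarrow> \<nu> \<bullet> x \<le> \<nu> \<bullet> x1"
      using continuous_attains_sup[OF T(1,3) cont] by blast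
    have "\<nu> \<noteq> 0" using \<nu>(1) \<nu>(2)[OF x0(1)] by auto
    then have n\<nu>: "norm \<nu> > 0" by simp
    obtain x y where xy: "x \<in> T" "y \<in> T" "w \<le> (x - y) \<bullet> (\<nu> /\<^sub>R norm \<nu>)"
      using width[of "\<nu> /\<^sub>R norm \<nu>"] n\<nu> by auto
    have "w * norm \<nu> \<le> (x - y) \<bullet> \<nu>"
      using mult_right_mono[OF xy(3), of "norm \<nu>"] n\<nu> by (simp add: field_simps)
    also have "\<dots> \<le> \<nu> \<bullet> x1 - \<nu> \<bullet> x0"
      using x0(2)[OF xy(2)] x1(2)[OF xy(1)] by (simp add: inner_diff_right inner_commute)
    finally have w: "w * norm \<nu> \<le> \<nu> \<bullet> x1 - \<nu> \<bullet> x0" .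
    obtain y where y: "y \<in> T" "K *\<^sub>R a = x1 + (K - 1) *\<^sub>R y" using K(2) x1(1) unfolding central_point_def by blast
    have "K * (\<nu> \<bullet> a) = \<nu> \<bullet> (K *\<^sub>R a)" by simp
    also have "\<dots> = \<nu> \<bullet> x1 + (K - 1) * (\<nu> \<bullet> y)" unfolding y(2) by (simp add: inner_add_right)
    also have "\<dots> \<ge> \<nu> \<bullet> x1 + (K - 1) * (\<nu> \<bullet> x0)" using x0(2)[OF y(1)] K(1) by (simp add: mult_left_mono)
    finally have "K * (\<nu> \<bullet> a) \<ge> K * (\<nu> \<bullet> x0) + w * norm \<nu>" using w by (simp add: algebra_simps)
    then have 1: "w * norm \<nu> \<le> K * (\<nu> \<bullet> (a - x0))" by (simp add: inner_diff_right right_diff_distrib)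
    have "\<nu> \<bullet> (a - z) \<le> norm \<nu> * norm (a - z)" by (rule norm_cauchy_schwarz)
    also have "\<dots> < norm \<nu> * (w / K)"
      by (rule mult_strict_left_mono) (use z n\<nu> in \<open>auto simp: dist_norm\<close>)
    finally have "K * (\<nu> \<bullet> (a - z)) < w * norm \<nu>" using K(1) by (simp add: field_simps)
    then have "K * (\<nu> \<bullet> (a - z)) < K * (\<nu> \<bullet> (a - x0))" using 1 by linarith
    then have "\<nu> \<bullet> x0 < \<nu> \<bullet> z" using K(1) by (simp add: inner_diff_right)
    then show False using \<nu>(1) \<nu>(2)[OF x0(1)] by linarith
  qed
qed

lemma simplex_central_point:
  fixes T :: "'a::euclidean_space set"
  assumes "finite V" "T = convex hull V" "card V = Suc m" "m > 0"
  shows "central_point (real m + 1) T ((1 / (real m + 1)) *\<^sub>R (\<Sum>v\<in>V. v))"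
  unfolding central_point_def
proof
  fix x assume "x \<in> T"
  then obtain u where u: "\<forall>v\<in>V. 0 \<le> u v" "sum u V = 1" "(\<Sum>v\<in>V. u v *\<^sub>R v) = x"
    using assms convex_hull_finite[OF assms(1)] by auto
  \<comment> \<open>The weights (1 - u v) / m are nonnegative since u v is at most 1, and they sum
    to 1 since there are m + 1 vertices.\<close>
  define y where "y = (\<Sum>v\<in>V. ((1 - u v) / real m) *\<^sub>R v)"
  have "u v \<le> 1" if "v \<in> V" for v using member_le_sum[OF that, of u] u assms(1) by auto
  moreover have "(\<Sum>v\<in>V. (1 - u v) / real m) = 1"
    using assms(3,4) u(2) by (simp add: sum_divide_distrib[symmetric] sum_subtractf)
  ultimately have "y \<in> T"
    unfolding assms(2) convex_hull_finite[OF assms(1)] y_def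
    by (intro CollectI exI[of _ "\<lambda>v. (1 - u v) / real m"]) (use assms(4) in auto)
  moreover have "(real m + 1) *\<^sub>R ((1 / (real m + 1)) *\<^sub>R (\<Sum>v\<in>V. v)) = x + (real m + 1 - 1) *\<^sub>R y"
  proof -
    have "(real m + 1 - 1) *\<^sub>R y = (\<Sum>v\<in>V. (1 - u v) *\<^sub>R v)"
      unfolding y_def scaleR_sum_right using assms(4) by (intro sum.cong) auto
    then show ?thesis unfolding u(3)[symmetric]
      by (simp add: sum.distrib[symmetric] scaleR_left_diff_distrib)
  qed
  ultimately show "\<exists>y\<in>T. (real m + 1) *\<^sub>R ((1 / (real m + 1)) *\<^sub>R (\<Sum>v\<in>V. v)) = x + (real m + 1 - 1) *\<^sub>R y"
    by blast
qed

lemma parallelotope_central_point: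
  fixes A :: "real^'n \<Rightarrow> real^'n"
  assumes "linear A" "T = (\<lambda>x. a + A x) ` cbox 0 1"
  shows "central_point 2 T (a + A (\<chi> i. 1 / 2))"
  unfolding central_point_def
proof
  interpret linear A by fact
  fix x assume "x \<in> T"
  then obtain x' where x': "x = a + A x'" "x' \<in> cbox 0 1" using assms(2) by blast
  have "a + A (1 - x') \<in> T"
    unfolding assms(2) using x'(2) by (intro imageI) (auto simp: mem_box_cart)
  moreover have "2 *\<^sub>R (a + A (\<chi> i. 1 / 2)) = x + (2 - 1) *\<^sub>R (a + A (1 - x'))"
  proof -
    have "(\<chi> i. 1 / 2) + (\<chi> i. 1 / 2) = (1::real^'n)" by (simp add: vec_eq_iff)
    then have "A (\<chi> i. 1 / 2) + A (\<chi> i. 1 / 2) = A 1" by (metis add)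
    then show ?thesis by (simp add: x'(1) diff scaleR_2)
  qed
  ultimately show "\<exists>y\<in>T. 2 *\<^sub>R (a + A (\<chi> i. 1 / 2)) = x + (2 - 1) *\<^sub>R y" by blast
qed

text \<open>The reflected point is pulled towards \<open>a\<close>. In this way parallelotopes,
  which have the constant 2, share the constant n + 1 of the simplices.\<close>

lemma central_point_mono:
  assumes "central_point 2 T a" "convex T" "K \<ge> 2" "a \<in> T"
  shows "central_point K T a"
  unfolding central_point_def
proof
  fix x assume "x \<in> T"
  then obtain y where y: "y \<in> T" "2 *\<^sub>R a = x + y" using assms(1) unfolding central_point_def by auto
  define z where "z = (1 / (K - 1)) *\<^sub>R y + (1 - 1 / (K - 1)) *\<^sub>R a"
  have "z \<in> T" unfolding z_def
    by (rule convexD[OF assms(2) y(1) assms(4)]) (use assms(3) in \<open>auto simp: divide_le_eq\<close>)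
  moreover have "(K - 1) *\<^sub>R z = y + (K - 2) *\<^sub>R a"
    unfolding z_def scaleR_add_right using assms(3) by (simp add: algebra_simps scaleR_2)
  then have "x + (K - 1) *\<^sub>R z = (x + y) + (K - 2) *\<^sub>R a" by simp
  then have "x + (K - 1) *\<^sub>R z = (2 + (K - 2)) *\<^sub>R a" unfolding y(2)[symmetric] scaleR_left_distrib .
  then have "K *\<^sub>R a = x + (K - 1) *\<^sub>R z" by simp
  ultimately show "\<exists>y\<in>T. K *\<^sub>R a = x + (K - 1) *\<^sub>R y" by blast
qed

text \<open>Since slices of \<open>T\<close> parallel to \<open>E\<close> fit into translates of \<open>E\<close>, the facet contains the
  orthogonal projection of a large ball in \<open>T\<close> up to translation.\<close>

definition sliced_by :: "'a::real_inner set \<Rightarrow> 'a set \<Rightarrow> 'a \<Rightarrow> bool" where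
  "sliced_by T E \<nu> \<longleftrightarrow> (\<forall>b\<in>T. \<exists>u. \<forall>x\<in>T. x \<bullet> \<nu> = b \<bullet> \<nu> \<longrightarrow> x - u \<in> E)"

text \<open>The height over \<open>E\<close> depends only on the weight u of the opposite vertex z,
  so a slice consists of points u z + v e with fixed u and v. Translation by u (z - e0) turns them
  into u e0 + v e, which lies in the convex set \<open>E\<close>.\<close>

lemma simplex_sliced:
  fixes T :: "'a::euclidean_space set"
  assumes "z \<in> V" "T = convex hull V" "E = convex hull (V - {z})" "E \<noteq> {}"
    and "T \<inter> {x. x \<bullet> \<nu> = c} = E" "interior T \<noteq> {}" "\<nu> \<noteq> 0"
  shows "sliced_by T E \<nu>"
  unfolding sliced_by_def
proof
  have V: "V = insert z (V - {z})" using assms(1) by blast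
  have "V - {z} \<noteq> {}" using assms(3,4) by auto
  then have T: "x \<in> T \<longleftrightarrow> (\<exists>u\<ge>0. \<exists>v\<ge>0. \<exists>e. u + v = 1 \<and> e \<in> E \<and> x = u *\<^sub>R z + v *\<^sub>R e)" for x
    unfolding assms(2,3) by (subst V, subst convex_hull_insert) auto
  have Ec: "e \<bullet> \<nu> = c" if "e \<in> E" for e using that assms(5) by blast
  have val: "(u *\<^sub>R z + v *\<^sub>R e) \<bullet> \<nu> = c + u * (z \<bullet> \<nu> - c)" if "e \<in> E" "u + v = 1" for u v e
  proof -
    have v: "v = 1 - u" using that by simp
    show ?thesis unfolding v using Ec[OF that(1)] by (simp add: inner_add_left algebra_simps)
  qed
  \<comment> \<open>Otherwise T would lie in a hyperplane and have empty interior.\<close>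
  have zc: "z \<bullet> \<nu> \<noteq> c"
  proof
    assume "z \<bullet> \<nu> = c"
    then have "T \<subseteq> {x. \<nu> \<bullet> x = c}" using T val by (auto simp: inner_commute)
    then have "interior T \<subseteq> interior {x. \<nu> \<bullet> x = c}" by (rule interior_mono)
    then show False using assms(6,7) by simp
  qed
  obtain e0 where e0: "e0 \<in> E" using assms(4) by blast
  have convE: "convex E" unfolding assms(3) by (rule convex_convex_hull)
  fix b assume "b \<in> T"
  then obtain u v e where b: "u \<ge> 0" "v \<ge> 0" "u + v = 1" "e \<in> E" "b = u *\<^sub>R z + v *\<^sub>R e" unfolding T by blast
  show "\<exists>w. \<forall>x\<in>T. x \<bullet> \<nu> = b \<bullet> \<nu> \<longrightarrow> x - w \<in> E"
  proof (intro exI[of _ "u *\<^sub>R (z - e0)"] ballI impI)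
    fix x assume "x \<in> T" and eq: "x \<bullet> \<nu> = b \<bullet> \<nu>"
    then obtain u' v' e' where x: "u' \<ge> 0" "v' \<ge> 0" "u' + v' = 1" "e' \<in> E" "x = u' *\<^sub>R z + v' *\<^sub>R e'" unfolding T by blast
    have "u' = u" using eq zc unfolding x(5) b(5) by (simp add: val x b)
    then have "v' = v" using x(3) b(3) by simp
    have "x - u *\<^sub>R (z - e0) = u *\<^sub>R e0 + v *\<^sub>R e'"
      unfolding x(5) \<open>u' = u\<close> \<open>v' = v\<close> by (simp add: algebra_simps)
    also have "\<dots> \<in> E" by (rule convexD[OF convE e0 x(4) b(1,2,3)])
    finally show "x - u *\<^sub>R (z - e0) \<in> E" .
  qed
qed

lemma affine_hull_hyperplane:
  fixes E :: "'a::euclidean_space set"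
  assumes "E \<subseteq> {x. x \<bullet> \<nu> = c}" "\<nu> \<noteq> 0" "aff_dim E = int DIM('a) - 1"
  shows "affine hull E = {x. x \<bullet> \<nu> = c}"
proof -
  have e: "{x. x \<bullet> \<nu> = c} = {x. \<nu> \<bullet> x = c}" by (simp add: inner_commute)
  have "affine hull E \<subseteq> {x. x \<bullet> \<nu> = c}"
    by (rule hull_minimal) (use assms(1) in \<open>auto simp: e affine_hyperplane\<close>)
  moreover have "aff_dim (affine hull E) = aff_dim {x. x \<bullet> \<nu> = c}"
    using assms(2,3) by (simp add: e aff_dim_hyperplane)
  moreover have "affine hull E \<noteq> {}"
  proof
    assume "affine hull E = {}"
    then have "aff_dim E = -1" by (simp add: aff_dim_empty)
    then show False using assms(3) DIM_positive[where 'a = 'a] by linarith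
  qed
  ultimately show ?thesis
    by (intro affine_dim_equal) (auto simp: e affine_hyperplane affine_affine_hull)
qed

text \<open>In cube coordinates the supporting functional is a linear form with weights
  \<open>w i\<close>. Every coordinate of nonzero weight is constant on the face where the form is
  maximal, and dimension n - 1 leaves room for exactly one such coordinate.\<close>

lemma parallelotope_facet:
  fixes A :: "real^'n \<Rightarrow> real^'n"
  assumes A: "linear A" "inj A" and T: "T = (\<lambda>x. a + A x) ` cbox 0 1"
    and E: "T \<inter> {x. x \<bullet> \<nu> = c} = E" "T \<subseteq> {x. x \<bullet> \<nu> \<le> c}" "\<nu> \<noteq> 0" "aff_dim E = int CARD('n) - 1"
  obtains i k where "k = 0 \<or> k = 1" "E = (\<lambda>x. a + A x) ` {x\<in>cbox 0 1. x $ i = k}" "sliced_by T E \<nu>"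
proof -
  interpret linear A by fact
  have E0: "E \<noteq> {}" using E(4) by (auto simp: aff_dim_empty)
  define w where "w i = A (axis i 1) \<bullet> \<nu>" for i
  have val: "A x \<bullet> \<nu> = (\<Sum>i\<in>UNIV. x $ i * w i)" for x
  proof -
    have "A x = A (\<Sum>i\<in>UNIV. x $ i *\<^sub>R axis i 1)" using basis_expansion[of x] by (simp add: scalar_mult_eq_scaleR)
    then show ?thesis by (simp add: sum scale w_def inner_sum_left)
  qed
  have cube: "x \<in> cbox 0 1 \<longleftrightarrow> (\<forall>i. 0 \<le> x $ i \<and> x $ i \<le> 1)" for x :: "real^'n"
    by (auto simp: mem_box_cart)
  have lin_i: "x \<in> cbox 0 1 \<Longrightarrow> 0 \<le> t \<Longrightarrow> t \<le> 1 \<Longrightarrow> (x + (t - x $ i) *\<^sub>R axis i 1) \<in> cbox 0 1" for x :: "real^'n" and t i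
    unfolding cube by (auto simp: axis_def)
  \<comment> \<open>The endpoint of [0, 1] at which the contribution of coordinate i to the
    functional is maximal.\<close>
  define K where "K i = (if w i > 0 then 1 else 0 :: real)" for i
  have Ecoord: "x $ i = K i" if "a + A x \<in> E" "x \<in> cbox 0 1" "w i \<noteq> 0" for x i
  proof -
    have ec: "(a + A x) \<bullet> \<nu> = c" using that(1) E(1) by blast
    have "a + A (x + (K i - x $ i) *\<^sub>R axis i 1) \<in> T"
      unfolding T by (intro imageI lin_i[OF that(2)]) (auto simp: K_def)
    then have "(a + A (x + (K i - x $ i) *\<^sub>R axis i 1)) \<bullet> \<nu> \<le> c" using E(2) by blast
    then have "(K i - x $ i) * w i \<le> 0"
      using ec by (simp add: add scale inner_add_left w_def)
    moreover have "0 \<le> x $ i" "x $ i \<le> 1" using that(2) unfolding cube by auto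
    ultimately show ?thesis using that(3) by (auto simp: K_def mult_le_0_iff split: if_splits)
  qed
  obtain i where i: "w i \<noteq> 0"
  proof (rule ccontr)
    assume "\<not> thesis"
    then have "w i = 0" for i using that by blast
    then have "A x \<bullet> \<nu> = 0" for x using val by simp
    moreover have "surj A" using linear_injective_imp_surjective[OF A] by blast
    then obtain x where "A x = \<nu>" by (metis surj_def)
    ultimately show False using E(3) by (metis inner_eq_zero_iff)
  qed
  have aff: "affine hull E = {x. x \<bullet> \<nu> = c}"
    by (rule affine_hull_hyperplane) (use E in auto)
  have uniq: "w j = 0" if "j \<noteq> i" for j
  proof (rule ccontr)
    assume wj: "w j \<noteq> 0"
    obtain e0 where e0: "e0 \<in> E" using E0 by blast
    then obtain x0 where x0: "e0 = a + A x0" "x0 \<in> cbox 0 1" using E(1) T by blast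
    \<comment> \<open>This direction leaves the functional unchanged but moves coordinate i. It is
      therefore tangent to the affine hull of \<open>E\<close>, on which coordinate i is constant: a
      contradiction.\<close>
    define d where "d = (1 / w i) *\<^sub>R axis i 1 - (1 / w j) *\<^sub>R (axis j 1 :: real^'n)"
    obtain B where B: "linear B" "B \<circ> A = id" using linear_injective_left_inverse[OF A] by blast
    interpret B: linear B by fact
    have BA: "B (A x) = x" for x using B(2) by (metis comp_apply id_apply)
    have "A d \<bullet> \<nu> = 0" using i wj by (simp add: d_def diff scale inner_diff_left w_def)
    then have "e0 + A d \<in> affine hull E" unfolding aff using e0 E(1) by (auto simp: inner_add_left)
    moreover have "E \<subseteq> {y. axis i 1 \<bullet> B (y - a) = K i}"
    proof
      fix y assume y: "y \<in> E"
      then obtain x where x: "y = a + A x" "x \<in> cbox 0 1" using E(1) T by blast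
      then show "y \<in> {y. axis i 1 \<bullet> B (y - a) = K i}"
        using Ecoord[of x i] y i by (simp add: BA inner_axis')
    qed
    moreover have "affine {y. axis i 1 \<bullet> B (y - a) = K i}"
      unfolding affine_def
    proof (intro ballI allI impI)
      fix x y :: "real^'n" and u v :: real
      assume x: "x \<in> {y. axis i 1 \<bullet> B (y - a) = K i}" and y: "y \<in> {y. axis i 1 \<bullet> B (y - a) = K i}" and uv: "u + v = 1"
      have "a = u *\<^sub>R a + v *\<^sub>R a" using uv by (metis scaleR_left_distrib scaleR_one)
      moreover have "u *\<^sub>R (x - a) + v *\<^sub>R (y - a) = u *\<^sub>R x + v *\<^sub>R y - (u *\<^sub>R a + v *\<^sub>R a)"
        by (simp add: algebra_simps)
      ultimately have "u *\<^sub>R x + v *\<^sub>R y - a = u *\<^sub>R (x - a) + v *\<^sub>R (y - a)" by simp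
      then have "axis i 1 \<bullet> B (u *\<^sub>R x + v *\<^sub>R y - a) = u * K i + v * K i"
        using x y by (simp add: B.add B.scale inner_add_right)
      also have "\<dots> = K i" using uv by (metis distrib_right mult_1)
      finally show "u *\<^sub>R x + v *\<^sub>R y \<in> {y. axis i 1 \<bullet> B (y - a) = K i}" by simp
    qed
    ultimately have "axis i 1 \<bullet> B (e0 + A d - a) = K i" using hull_minimal by blast
    moreover have "e0 + A d - a = A (x0 + d)" by (simp add: x0(1) add)
    ultimately have "(x0 + d) $ i = K i" by (simp add: BA inner_axis')
    moreover have "x0 $ i = K i" using Ecoord[of x0 i] e0 x0 i by simp
    ultimately have "d $ i = 0" by simp
    then show False using i that by (simp add: d_def axis_def)
  qed
  have val': "A x \<bullet> \<nu> = x $ i * w i" for x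
  proof -
    have "(\<Sum>j\<in>UNIV. x $ j * w j) = (\<Sum>j\<in>UNIV. if j = i then x $ i * w i else 0)"
      by (rule sum.cong) (use uniq in auto)
    then show ?thesis using val by simp
  qed
  obtain x0 where x0: "a + A x0 \<in> E" "x0 \<in> cbox 0 1" using E0 E(1) T by blast
  have x0i: "x0 $ i = K i" using Ecoord[OF x0 i] .
  have c: "c = a \<bullet> \<nu> + K i * w i" using x0(1) E(1) val' x0i by (auto simp: inner_add_left)
  have Eeq: "E = (\<lambda>x. a + A x) ` {x\<in>cbox 0 1. x $ i = K i}"
    unfolding E(1)[symmetric] T c using i by (auto simp: inner_add_left val')
  moreover have "sliced_by T E \<nu>"
    unfolding sliced_by_def
  proof
    fix b assume "b \<in> T"
    then obtain b' where b': "b = a + A b'" using T by blast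
    show "\<exists>u. \<forall>x\<in>T. x \<bullet> \<nu> = b \<bullet> \<nu> \<longrightarrow> x - u \<in> E"
    proof (intro exI[of _ "A ((b' $ i - K i) *\<^sub>R axis i 1)"] ballI impI)
      fix x assume "x \<in> T" and eq: "x \<bullet> \<nu> = b \<bullet> \<nu>"
      then obtain x' where x': "x = a + A x'" "x' \<in> cbox 0 1" using T by blast
      have "x' $ i = b' $ i" using eq i by (simp add: x'(1) b' inner_add_left val')
      then have "x - A ((b' $ i - K i) *\<^sub>R axis i 1) = a + A (x' + (K i - x' $ i) *\<^sub>R axis i 1)"
        by (simp add: x'(1) add scale diff scaleR_left_diff_distrib)
      moreover have "x' + (K i - x' $ i) *\<^sub>R axis i 1 \<in> {x\<in>cbox 0 1. x $ i = K i}"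
        using lin_i[OF x'(2), of "K i" i] by (auto simp: K_def)
      ultimately show "x - A ((b' $ i - K i) *\<^sub>R axis i 1) \<in> E" unfolding Eeq by blast
    qed
  qed
  ultimately show ?thesis using that[of "K i" i] unfolding K_def by auto
qed

section \<open>Simplices and parallelotopes as mesh elements\<close>

definition is_element :: "(real^'n) set \<Rightarrow> bool" where
  "is_element T \<longleftrightarrow> is_simplex T \<or> is_parallelotope T"

lemma is_element_polytope:
  fixes T :: "(real^'n) set"
  assumes "is_element T" shows "polytope T"
proof -
  have "polytope T" if "is_simplex T"
    using that unfolding is_simplex_def simplex polytope_def by blast
  moreover have "polytope T" if para: "is_parallelotope T"
  proof -
    obtain a and A :: "real^'n \<Rightarrow> real^'n" where A: "linear A" "inj A" "T = (\<lambda>x. a + A x) ` cbox 0 1"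
      using para unfolding is_parallelotope_def by blast
    have "T = (+) a ` A ` cbox 0 1" unfolding A(3) by (simp add: image_image)
    then show ?thesis using A(1) by (simp add: polytope_translation_eq polytope_linear_image polytope_interval)
  qed
  ultimately show ?thesis using assms unfolding is_element_def by blast
qed

lemma is_element_interior:
  fixes T :: "(real^'n) set"
  assumes "is_element T" shows "interior T \<noteq> {}"
proof -
  have "interior T \<noteq> {}" if "is_simplex T"
  proof -
    have dim: "aff_dim T = int CARD('n)" using that unfolding is_simplex_def by (rule aff_dim_simplex)
    then have "affine hull T = UNIV" using aff_dim_eq_full[of T] by simp
    then have "rel_interior T = interior T" by (rule rel_interior_interior)
    moreover have "T \<noteq> {}" using dim by (auto simp: aff_dim_empty)
    moreover have "convex T" using that is_element_polytope polytope_imp_convex unfolding is_element_def by blast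
    ultimately show ?thesis using rel_interior_eq_empty by metis
  qed
  moreover have "interior T \<noteq> {}" if para: "is_parallelotope T"
  proof -
    obtain a and A :: "real^'n \<Rightarrow> real^'n" where A: "linear A" "inj A" "T = (\<lambda>x. a + A x) ` cbox 0 1"
      using para unfolding is_parallelotope_def by blast
    have "T = (+) a ` A ` cbox 0 1" unfolding A(3) by (simp add: image_image)
    then have "interior T = (+) a ` A ` interior (cbox 0 1)"
      using A by (simp add: interior_translation interior_injective_linear_image)
    moreover have "(\<chi> i. 1 / 2) \<in> box 0 (1::real^'n)" by (simp add: mem_box_cart)
    ultimately show ?thesis by (auto simp: interior_cbox)
  qed
  ultimately show ?thesis using assms unfolding is_element_def by blast
qed

lemma is_element_convex: "is_element T \<Longrightarrow> convex T"
  and is_element_compact: "is_element T \<Longrightarrow> compact T"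
  using is_element_polytope polytope_imp_convex polytope_imp_compact by blast+

lemma is_element_diameter: assumes "is_element T" shows "diameter T > 0"
proof -
  obtain x where "x \<in> interior T" using is_element_interior[OF assms] by blast
  then obtain r where r: "r > 0" "ball x r \<subseteq> T" unfolding mem_interior by blast
  have "diameter (ball x r) \<le> diameter T"
    by (rule diameter_subset[OF r(2) compact_imp_bounded[OF is_element_compact[OF assms]]])
  moreover have "diameter (ball x r) = 2 * r" using r(1) diameter_ball[of x r] by simp
  ultimately show ?thesis using r(1) by linarith
qed

lemma is_element_central_point:
  fixes T :: "(real^'n) set"
  assumes "is_element T" "CARD('n) \<ge> 2"
  shows "\<exists>a. central_point (real CARD('n) + 1) T a"
proof -
  have "\<exists>a. central_point (real CARD('n) + 1) T a" if simp: "is_simplex T"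
  proof -
    obtain V where "finite V" "int (card V) = int CARD('n) + 1" "T = convex hull V"
      using simp unfolding is_simplex_def simplex by blast
    then show ?thesis using simplex_central_point[of V T "CARD('n)"] by (auto simp: zero_less_card_finite)
  qed
  moreover have "\<exists>a. central_point (real CARD('n) + 1) T a" if para: "is_parallelotope T"
  proof -
    obtain a and A :: "real^'n \<Rightarrow> real^'n" where A: "linear A" "inj A" "T = (\<lambda>x. a + A x) ` cbox 0 1"
      using para unfolding is_parallelotope_def by blast
    have "a + A (\<chi> i. 1 / 2) \<in> T" unfolding A(3) by (intro imageI) (simp add: mem_box_cart)
    then show ?thesis
      by (intro exI[of _ "a + A (\<chi> i. 1 / 2)"] central_point_mono[OF parallelotope_central_point[OF A(1,3)]]
          is_element_convex[OF assms(1)]) (use assms(2) in auto)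
  qed
  ultimately show ?thesis using assms(1) unfolding is_element_def by blast
qed

text \<open>From volume to inradius: the volume bound forces width at least h / (C0 \<omega>) in
  every direction, and the central point turns this width into a radius at the cost of the factor n
  + 1. The cap 1 / 2 on c serves later arithmetic.\<close>

lemma element_contains_ball:
  fixes C0 :: real
  assumes n2: "CARD('n) \<ge> 2" and C0: "C0 > 0"
  shows "\<exists>c>0. c \<le> 1 / 2 \<and> (\<forall>T :: (real^'n) set. is_element T \<and> inverse C0 * diameter T ^ CARD('n) \<le> measure lebesgue T
    \<longrightarrow> (\<exists>b. ball b (c * diameter T) \<subseteq> T))"
proof -
  define N where "N = real CARD('n) + 1"
  define \<omega> where "\<omega> = unit_ball_vol CARD('n) * 2 ^ CARD('n)"
  have \<omega>: "\<omega> > 0" unfolding \<omega>_def by (simp add: unit_ball_vol_pos)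
  have N: "N \<ge> 1" by (simp add: N_def)
  define c where "c = min (1 / 2) (1 / (C0 * \<omega>) / N)"
  have c: "c > 0" "c \<le> 1 / 2" "c \<le> 1 / (C0 * \<omega>) / N" using C0 \<omega> N by (auto simp: c_def)
  have "\<exists>b. ball b (c * diameter T) \<subseteq> T"
    if el: "is_element T" and vol: "inverse C0 * diameter T ^ CARD('n) \<le> measure lebesgue T" for T :: "(real^'n) set"
  proof -
    define h where "h = diameter T"
    have h: "h > 0" unfolding h_def by (rule is_element_diameter[OF el])
    note comp = is_element_compact[OF el]
    have ne: "T \<noteq> {}" using is_element_interior[OF el] interior_subset by blast
    obtain b where b: "central_point N T b" using is_element_central_point[OF el n2] unfolding N_def by blast
    have "ball b ((h / (C0 * \<omega>)) / N) \<subseteq> T"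
    proof (rule central_point_ball[OF comp is_element_convex[OF el] ne N b])
      fix n :: "real^'n" assume n: "norm n = 1"
      have cont: "continuous_on T (\<lambda>x. x \<bullet> n)" by (intro continuous_intros)
      obtain x where x: "x \<in> T" "\<And>z. z \<in> T \<Longrightarrow> z \<bullet> n \<le> x \<bullet> n"
        using continuous_attains_sup[OF comp ne cont] by blast
      obtain y where y: "y \<in> T" "\<And>z. z \<in> T \<Longrightarrow> y \<bullet> n \<le> z \<bullet> n"
        using continuous_attains_inf[OF comp ne cont] by blast
      have "measure lebesgue T \<le> unit_ball_vol (DIM(real^'n)) * 2 ^ DIM(real^'n) * diameter T ^ (DIM(real^'n) - 1) * ((x - y) \<bullet> n)"
      proof (rule measure_le_width[OF comp ne n])
        show "diameter T > 0" using h unfolding h_def .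
        fix u v assume "u \<in> T" "v \<in> T"
        then show "(u - v) \<bullet> n \<le> (x - y) \<bullet> n" using x(2)[of u] y(2)[of v] by (simp add: inner_diff_left)
      qed
      then have "measure lebesgue T \<le> \<omega> * h ^ (CARD('n) - 1) * ((x - y) \<bullet> n)" by (simp add: \<omega>_def h_def)
      then have "inverse C0 * h ^ CARD('n) \<le> \<omega> * h ^ (CARD('n) - 1) * ((x - y) \<bullet> n)"
        using vol by (simp add: h_def)
      moreover have "h ^ CARD('n) = h ^ (CARD('n) - 1) * h" using power_minus_mult[of "CARD('n)" h] by simp
      ultimately have "h ^ (CARD('n) - 1) * (inverse C0 * h) \<le> h ^ (CARD('n) - 1) * (\<omega> * ((x - y) \<bullet> n))"
        by (simp add: mult_ac)
      then have "inverse C0 * h \<le> \<omega> * ((x - y) \<bullet> n)" using h by simp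
      then have "h / (C0 * \<omega>) \<le> (x - y) \<bullet> n" using C0 \<omega> by (simp add: field_simps)
      then show "\<exists>x\<in>T. \<exists>y\<in>T. h / (C0 * \<omega>) \<le> (x - y) \<bullet> n" using x y by blast
    qed
    moreover have "c * h \<le> (h / (C0 * \<omega>)) / N"
      using mult_right_mono[OF c(3), of h] h by (simp add: mult_ac)
    ultimately show ?thesis unfolding h_def using subset_ball[of "c * diameter T"] by (meson order_trans)
  qed
  then show ?thesis using c by blast
qed

subsection \<open>Facets\<close>

definition outward_normal :: "'a::real_inner set \<Rightarrow> 'a set \<Rightarrow> 'a \<Rightarrow> bool" where
  "outward_normal T E \<nu> \<longleftrightarrow> norm \<nu> = 1 \<and> (\<exists>c. T \<subseteq> {x. x \<bullet> \<nu> \<le> c} \<and> T \<inter> {x. x \<bullet> \<nu> = c} = E)"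

lemma element_facet:
  fixes T :: "(real^'n) set"
  assumes el: "is_element T" and E: "E facet_of T"
  shows "\<exists>\<nu>. outward_normal T E \<nu> \<and> sliced_by T E \<nu>"
proof -
  obtain a b where ab: "a \<noteq> 0" "T \<subseteq> {x. a \<bullet> x \<le> b}" "E = T \<inter> {x. a \<bullet> x = b}"
    using facet_of_polyhedron[OF polytope_imp_polyhedron[OF is_element_polytope[OF el]] E] by blast
  define \<nu> where "\<nu> = a /\<^sub>R norm a"
  define c where "c = b / norm a"
  have \<nu>: "norm \<nu> = 1" using ab(1) by (simp add: \<nu>_def)
  have val: "x \<bullet> \<nu> = (a \<bullet> x) / norm a" for x by (simp add: \<nu>_def inner_commute divide_inverse mult.commute)
  have T: "T \<subseteq> {x. x \<bullet> \<nu> \<le> c}" using ab(1,2) by (auto simp: val c_def divide_le_cancel)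
  have E': "T \<inter> {x. x \<bullet> \<nu> = c} = E" unfolding ab(3) using ab(1) by (auto simp: val c_def)
  have \<nu>0: "\<nu> \<noteq> 0" using \<nu> by auto
  have ne: "E \<noteq> {}" using E by (simp add: facet_of_def)
  have dim: "aff_dim E = int CARD('n) - 1"
    using E aff_dim_nonempty_interior[OF is_element_interior[OF el]] by (simp add: facet_of_def)
  have "sliced_by T E \<nu>"
    using el unfolding is_element_def
  proof
    assume "is_simplex T"
    then obtain V where V: "finite V" "\<not> affine_dependent V" "T = convex hull V"
      unfolding is_simplex_def simplex by blast
    then obtain z where "z \<in> V" "E = convex hull (V - {z})"
      using E facet_of_convex_hull_affine_independent[OF V(2)] by auto
    then show ?thesis
      by (intro simplex_sliced[OF _ V(3) _ ne E' is_element_interior[OF el] \<nu>0]) auto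
  next
    assume "is_parallelotope T"
    then obtain a and A :: "real^'n \<Rightarrow> real^'n" where A: "linear A" "inj A" "T = (\<lambda>x. a + A x) ` cbox 0 1"
      unfolding is_parallelotope_def by blast
    show ?thesis
      by (rule parallelotope_facet[OF A E' T \<nu>0 dim])
  qed
  then show ?thesis using \<nu> T E' unfolding outward_normal_def by blast
qed

text \<open>The bound 3 n + 1 is crude but common: simplices have at most n + 1 facets,
  parallelotopes at most 2 n.\<close>

lemma card_faces:
  fixes T :: "(real^'n) set"
  assumes el: "is_element T"
  shows "finite (faces T)" "card (faces T) \<le> 3 * CARD('n) + 1"
proof -
  have "finite (faces T) \<and> card (faces T) \<le> 3 * CARD('n) + 1"
    using el unfolding is_element_def
  proof
    assume "is_simplex T"
    then obtain V where V: "finite V" "\<not> affine_dependent V" "int (card V) = int CARD('n) + 1" "T = convex hull V"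
      unfolding is_simplex_def simplex by blast
    have sub: "faces T \<subseteq> (\<lambda>u. convex hull (V - {u})) ` V"
      unfolding faces_def V(4) facet_of_convex_hull_affine_independent[OF V(2)] by auto
    have "card (faces T) \<le> card V"
      using card_mono[OF finite_imageI[OF V(1)] sub] card_image_le[OF V(1)] le_trans by blast
    then show ?thesis using V(1,3) finite_subset[OF sub] by auto
  next
    assume "is_parallelotope T"
    then obtain a and A :: "real^'n \<Rightarrow> real^'n" where A: "linear A" "inj A" "T = (\<lambda>x. a + A x) ` cbox 0 1"
      unfolding is_parallelotope_def by blast
    let ?g = "\<lambda>(i, k). (\<lambda>x. a + A x) ` {x\<in>cbox 0 1. x $ i = (k::real)}"
    have "faces T \<subseteq> ?g ` (UNIV \<times> {0, 1})"
    proof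
      fix E assume "E \<in> faces T"
      then have E: "E facet_of T" by (simp add: faces_def)
      obtain \<nu> where "outward_normal T E \<nu>" using element_facet[OF el E] by blast
      then obtain c where \<nu>: "norm \<nu> = 1" "T \<subseteq> {x. x \<bullet> \<nu> \<le> c}" "T \<inter> {x. x \<bullet> \<nu> = c} = E"
        unfolding outward_normal_def by blast
      have dim: "aff_dim E = int CARD('n) - 1"
        using E aff_dim_nonempty_interior[OF is_element_interior[OF el]] by (simp add: facet_of_def)
      have \<nu>0: "\<nu> \<noteq> 0" using \<nu>(1) by auto
      obtain i k where "k = 0 \<or> k = 1" "E = (\<lambda>x. a + A x) ` {x\<in>cbox 0 1. x $ i = k}"
        by (rule parallelotope_facet[OF A \<nu>(3,2) \<nu>0 dim]) (erule (1) that)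
      then show "E \<in> ?g ` (UNIV \<times> {0, 1})" by (intro image_eqI[of _ _ "(i, k)"]) auto
    qed
    moreover have "finite (UNIV \<times> {0, 1::real} :: ('n \<times> real) set)" by simp
    ultimately have "finite (faces T)" "card (faces T) \<le> card (UNIV \<times> {0, 1::real} :: ('n \<times> real) set)"
      by (meson finite_imageI finite_subset, meson card_image_le card_mono finite_imageI le_trans)
    then show ?thesis by (simp add: card_cartesian_product)
  qed
  then show "finite (faces T)" "card (faces T) \<le> 3 * CARD('n) + 1" by auto
qed

text \<open>The slice of the ball through its centre and parallel to \<open>E\<close> is moved into
  \<open>E\<close> by the translation from \<open>sliced_by\<close>, so the facet contains a disc of
  the same radius.\<close>

lemma facet_center:
  fixes T :: "'a::real_inner set"
  assumes \<nu>: "outward_normal T E \<nu>" "sliced_by T E \<nu>" and b: "ball b \<rho> \<subseteq> T" "\<rho> > 0"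
  shows "\<exists>a\<in>E. \<forall>y. (y - a) \<bullet> \<nu> = 0 \<and> norm (y - a) < \<rho> \<longrightarrow> y \<in> E"
proof -
  have "b \<in> T" using b by auto
  then obtain u where u: "\<And>x. x \<in> T \<Longrightarrow> x \<bullet> \<nu> = b \<bullet> \<nu> \<Longrightarrow> x - u \<in> E"
    using \<nu>(2) unfolding sliced_by_def by blast
  have "y \<in> E" if "(y - (b - u)) \<bullet> \<nu> = 0" "norm (y - (b - u)) < \<rho>" for y
  proof -
    have "y + u \<in> ball b \<rho>" using that(2) by (simp add: dist_norm norm_minus_commute algebra_simps)
    then have "y + u \<in> T" using b(1) by blast
    moreover have "(y + u) \<bullet> \<nu> = b \<bullet> \<nu>" using that(1) by (simp add: inner_diff_left inner_add_left)
    ultimately have "y + u - u \<in> E" by (rule u)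
    then show ?thesis by simp
  qed
  moreover have "b - u \<in> E" using u[OF \<open>b \<in> T\<close>] by simp
  ultimately show ?thesis by blast
qed

section \<open>Half balls at a facet and the comparison of neighbouring elements\<close>

lemma outward_normal_inner:
  assumes "outward_normal T E \<nu>" "a \<in> E"
  shows "\<And>x. x \<in> T \<Longrightarrow> (x - a) \<bullet> \<nu> \<le> 0" "\<And>x. x \<in> E \<longleftrightarrow> x \<in> T \<and> (x - a) \<bullet> \<nu> = 0"
  using assms unfolding outward_normal_def by (auto simp: inner_diff_left)

text \<open>The ray from b through x is prolonged to a point e of the plane of \<open>E\<close>. As
  b has depth at least \<rho> below this plane and x depth at most r, the point e is close to
  \<open>a\<close> and belongs to the disc in \<open>E\<close>; then x lies between e and b. The
  second condition on r is the resulting bound for the distance of e from \<open>a\<close>.\<close>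

lemma half_ball_subset:
  fixes T :: "'a::real_inner set"
  assumes T: "convex T" "\<And>x y. x \<in> T \<Longrightarrow> y \<in> T \<Longrightarrow> norm (x - y) \<le> h"
    and \<nu>: "outward_normal T E \<nu>" and a: "a \<in> E" and b: "ball b \<rho> \<subseteq> T" "\<rho> > 0"
    and rel: "\<And>y. (y - a) \<bullet> \<nu> = 0 \<Longrightarrow> norm (y - a) < \<rho>' \<Longrightarrow> y \<in> E"
    and r: "r \<le> \<rho> / 2" "r * (1 + 4 * h / \<rho>) \<le> \<rho>'"
    and x: "norm (x - a) < r" "(x - a) \<bullet> \<nu> \<le> 0"
  shows "x \<in> T"
proof -
  have n1: "norm \<nu> = 1" using \<nu> by (simp add: outward_normal_def)
  note ins = outward_normal_inner[OF \<nu> a]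
  have aT: "a \<in> T" using ins(2) a by blast
  have bT: "b \<in> T" using b by auto
  have r0: "0 \<le> r" using x(1) norm_ge_zero[of "x - a"] by linarith
  have hb: "norm (a - b) \<le> h" using T(2)[OF aT bT] .
  have \<rho>h: "\<rho> \<le> h"
  proof -
    have "\<rho> \<le> h" if "\<rho> > h"
    proof -
      define q where "q = (\<rho> + max h 0) / 2"
      have q: "0 \<le> q" "q < \<rho>" "q > h" using that b(2) by (auto simp: q_def)
      have "b + q *\<^sub>R \<nu> \<in> T" using b(1) q n1 by (auto simp: dist_norm)
      then have "norm ((b + q *\<^sub>R \<nu>) - b) \<le> h" using T(2) bT by blast
      then show ?thesis using q n1 by simp
    qed
    then show ?thesis by linarith
  qed
  have beta: "(b - a) \<bullet> \<nu> \<le> - \<rho>"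
  proof (rule ccontr)
    assume neg: "\<not> (b - a) \<bullet> \<nu> \<le> - \<rho>"
    define q where "q = (\<rho> + max 0 (- ((b - a) \<bullet> \<nu>))) / 2"
    have q: "0 \<le> q" "q < \<rho>" "q > - ((b - a) \<bullet> \<nu>)" using neg b(2) by (auto simp: q_def)
    have "b + q *\<^sub>R \<nu> \<in> T" using b(1) q n1 by (auto simp: dist_norm)
    then have "(b + q *\<^sub>R \<nu> - a) \<bullet> \<nu> \<le> 0" by (rule ins(1))
    then show False using q n1 by (simp add: inner_diff_left inner_add_left dot_square_norm)
  qed
  \<comment> \<open>s and \<beta> are the depths of x and b below the plane of \<open>E\<close>.
    Depth is linear on the segment from e to b, hence the ratio t = s / \<beta>.\<close>
  define s where "s = - ((x - a) \<bullet> \<nu>)"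
  define \<beta> where "\<beta> = - ((b - a) \<bullet> \<nu>)"
  define t where "t = s / \<beta>"
  have \<beta>: "\<beta> \<ge> \<rho>" using beta by (simp add: \<beta>_def)
  have s: "0 \<le> s" "s \<le> r"
  proof -
    show "0 \<le> s" using x(2) by (simp add: s_def)
    have "s \<le> norm (x - a) * norm \<nu>" unfolding s_def using Cauchy_Schwarz_ineq2[of "x - a" \<nu>] by linarith
    then show "s \<le> r" using x(1) n1 by simp
  qed
  have t: "0 \<le> t" "t \<le> r / \<rho>" "t \<le> 1 / 2"
  proof -
    show "0 \<le> t" using s \<beta> b(2) by (simp add: t_def)
    show *: "t \<le> r / \<rho>" unfolding t_def by (rule frac_le) (use s \<beta> b(2) r0 in auto)
    have "r / \<rho> \<le> 1 / 2" using r(1) b(2) by (simp add: divide_le_eq)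
    then show "t \<le> 1 / 2" using * by linarith
  qed
  \<comment> \<open>Solved from x = (1 - t) e + t b.\<close>
  define e where "e = x + (t / (1 - t)) *\<^sub>R (x - b)"
  have ea: "e - a = (x - a) + (t / (1 - t)) *\<^sub>R (x - b)" by (simp add: e_def)
  have t\<beta>: "t * \<beta> = s" using \<beta> b(2) by (simp add: t_def)
  have "(e - a) \<bullet> \<nu> = 0"
  proof -
    have "(x - b) \<bullet> \<nu> = \<beta> - s" by (simp add: \<beta>_def s_def inner_diff_left)
    then have "(e - a) \<bullet> \<nu> = - s + (t / (1 - t)) * (\<beta> - s)"
      unfolding ea by (simp add: inner_add_left s_def)
    also have "\<dots> = 0" using t t\<beta> by (simp add: field_simps)
    finally show ?thesis .
  qed
  moreover have "norm (e - a) < \<rho>'"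
  proof -
    have t1: "t / (1 - t) \<le> 2 * (r / \<rho>)"
    proof -
      have "t / (1 - t) \<le> (r / \<rho>) / (1 / 2)" by (rule frac_le) (use t in auto)
      then show ?thesis by (simp add: mult.commute)
    qed
    have "norm (x - b) \<le> norm (x - a) + norm (a - b)" using norm_triangle_ineq[of "x - a" "a - b"] by simp
    then have xb: "norm (x - b) \<le> 2 * h" using x(1) r(1) hb \<rho>h b(2) by linarith
    have "norm (e - a) \<le> norm (x - a) + (t / (1 - t)) * norm (x - b)"
      unfolding ea using norm_triangle_ineq[of "x - a" "(t / (1 - t)) *\<^sub>R (x - b)"] t by simp
    also have "\<dots> < r + (2 * (r / \<rho>)) * (2 * h)"
      using x(1) by (intro add_less_le_mono mult_mono t1 xb) (use r0 b(2) in auto)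
    also have "\<dots> = r * (1 + 4 * h / \<rho>)" by (simp add: algebra_simps)
    finally show ?thesis using r(2) by linarith
  qed
  ultimately have "e \<in> E" by (rule rel)
  then have "e \<in> T" using ins(2) by blast
  moreover have "x = (1 - t) *\<^sub>R e + t *\<^sub>R b"
  proof -
    have "(1 - t) *\<^sub>R e = (1 - t) *\<^sub>R x + t *\<^sub>R (x - b)" using t by (simp add: e_def scaleR_add_right)
    then show ?thesis by (simp add: algebra_simps)
  qed
  ultimately show "x \<in> T" using T(1) bT t by (simp add: convexD)
qed

text \<open>The component d of \<mu> orthogonal to \<nu> is itself a direction in the plane. A small
  multiple of it is orthogonal to \<mu> by assumption, which forces d = 0.\<close>

lemma unit_vectors_parallel:
  fixes \<mu> \<nu> :: "'a::real_inner"
  assumes "norm \<mu> = 1" "norm \<nu> = 1" "\<rho> > 0"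
    and orth: "\<And>y. (y - a) \<bullet> \<nu> = 0 \<Longrightarrow> norm (y - a) < \<rho> \<Longrightarrow> (y - a) \<bullet> \<mu> = 0"
  shows "\<mu> = \<nu> \<or> \<mu> = - \<nu>"
proof -
  define d where "d = \<mu> - (\<mu> \<bullet> \<nu>) *\<^sub>R \<nu>"
  have d\<nu>: "d \<bullet> \<nu> = 0" using assms(2) by (simp add: d_def inner_diff_left dot_square_norm)
  define m where "m = norm d + 1"
  define t where "t = \<rho> / 2 / m"
  have nd: "m > 0" by (simp add: m_def add_nonneg_pos)
  have t: "t > 0" using assms(3) nd by (simp add: t_def)
  have "t * norm d \<le> t * m" using t by (intro mult_left_mono) (auto simp: m_def)
  also have "\<dots> = \<rho> / 2" using nd by (simp add: t_def)
  finally have "norm (t *\<^sub>R d) < \<rho>" using t assms(3) by simp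
  then have "(t *\<^sub>R d) \<bullet> \<mu> = 0" using orth[of "a + t *\<^sub>R d"] d\<nu> by simp
  then have "d \<bullet> \<mu> = 0" using t by simp
  moreover have "d \<bullet> d = d \<bullet> \<mu> - (\<mu> \<bullet> \<nu>) * (d \<bullet> \<nu>)" by (simp add: d_def inner_diff_left inner_diff_right inner_commute algebra_simps)
  ultimately have "d = 0" using d\<nu> by simp
  then have \<mu>: "\<mu> = (\<mu> \<bullet> \<nu>) *\<^sub>R \<nu>" by (simp add: d_def)
  then have "norm \<mu> = \<bar>\<mu> \<bullet> \<nu>\<bar> * norm \<nu>" by (metis norm_scaleR)
  then have "\<bar>\<mu> \<bullet> \<nu>\<bar> = 1" using assms by simp
  then show ?thesis using \<mu> by (metis abs_eq_iff' scaleR_minus1_left scaleR_one abs_if minus_equation_iff)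
qed



text \<open>Equal normals would put the same half ball into both sets, and with it the ball of
  radius r / 2 around a - (r / 2) \<nu>, contrary to the disjoint interiors.\<close>

lemma outward_normal_opposite:
  fixes S T :: "'a::real_inner set"
  assumes S: "outward_normal S E \<nu>" "\<And>x. norm (x - a) < r \<Longrightarrow> (x - a) \<bullet> \<nu> \<le> 0 \<Longrightarrow> x \<in> S"
    and T: "outward_normal T E \<mu>" "\<And>x. norm (x - a) < r \<Longrightarrow> (x - a) \<bullet> \<mu> \<le> 0 \<Longrightarrow> x \<in> T"
    and r: "r > 0" and a: "a \<in> E" and disj: "interior S \<inter> interior T = {}"
    and rel: "\<And>y. (y - a) \<bullet> \<nu> = 0 \<Longrightarrow> norm (y - a) < r \<Longrightarrow> y \<in> E"
  shows "\<mu> = - \<nu>"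
proof -
  have n1: "norm \<nu> = 1" "norm \<mu> = 1" using S(1) T(1) by (auto simp: outward_normal_def)
  have "\<mu> = \<nu> \<or> \<mu> = - \<nu>"
    by (rule unit_vectors_parallel[OF n1(2,1) r]) (use rel outward_normal_inner(2)[OF T(1) a] in blast)
  moreover have "\<mu> \<noteq> \<nu>"
  proof
    assume eq: "\<mu> = \<nu>"
    define x where "x = a - (r / 2) *\<^sub>R \<nu>"
    have "ball x (r / 2) \<subseteq> {x. norm (x - a) < r \<and> (x - a) \<bullet> \<nu> \<le> 0}"
    proof
      fix y assume "y \<in> ball x (r / 2)"
      then have y: "norm (y - x) < r / 2" by (simp add: dist_norm norm_minus_commute)
      have e: "y - a = (y - x) - (r / 2) *\<^sub>R \<nu>" by (simp add: x_def)
      have "norm (y - a) \<le> norm (y - x) + norm ((r / 2) *\<^sub>R \<nu>)" unfolding e by (rule norm_triangle_ineq4)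
      then have "norm (y - a) < r" using y n1 r by simp
      moreover have "(y - x) \<bullet> \<nu> \<le> norm (y - x) * norm \<nu>" by (rule norm_cauchy_schwarz)
      then have "(y - a) \<bullet> \<nu> \<le> 0" unfolding e using y n1 by (simp add: inner_diff_left dot_square_norm)
      ultimately show "y \<in> {x. norm (x - a) < r \<and> (x - a) \<bullet> \<nu> \<le> 0}" by simp
    qed
    then have "ball x (r / 2) \<subseteq> S" "ball x (r / 2) \<subseteq> T" using S(2) T(2) unfolding eq by blast+
    then have "x \<in> interior S" "x \<in> interior T" using r by (auto simp: mem_interior intro!: exI[of _ "r / 2"])
    then show False using disj by blast
  qed
  ultimately show ?thesis by blast
qed

text \<open>The ball of radius \<open>c * diameter S\<close> around \<open>a\<close>, halved by \<open>E\<close>, is to carry the support of the test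
  function for the jump across \<open>E\<close>.\<close>

definition face_data :: "real \<Rightarrow> 'a::euclidean_space set \<Rightarrow> 'a set \<Rightarrow> 'a set \<Rightarrow> 'a \<Rightarrow> 'a \<Rightarrow> bool" where
  "face_data c S T E a \<nu> \<longleftrightarrow> outward_normal S E \<nu> \<and> outward_normal T E (- \<nu>) \<and> a \<in> E \<and>
     c * diameter S \<le> diameter T \<and> c * diameter T \<le> diameter S \<and>
     (\<forall>x. norm (x - a) < c * diameter S \<and> (x - a) \<bullet> \<nu> \<le> 0 \<longrightarrow> x \<in> S) \<and>
     (\<forall>x. norm (x - a) < c * diameter S \<and> 0 \<le> (x - a) \<bullet> \<nu> \<longrightarrow> x \<in> T) \<and>
     (\<forall>x. norm (x - a) < c * diameter S \<and> (x - a) \<bullet> \<nu> = 0 \<longrightarrow> x \<in> E)"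

text \<open>Dimension at least 2 provides a direction inside the plane, and the disc then contains a
  point of \<open>E\<close> at distance \<rho> / 2 from \<open>a\<close>. Applied to both elements
  at a face, this makes their diameters comparable.\<close>

lemma facet_diameter_le:
  fixes S T :: "(real^'n) set"
  assumes n2: "CARD('n) \<ge> 2" and \<rho>: "\<rho> > 0" and T: "bounded T" "E \<subseteq> T" "a \<in> E"
    and rel: "\<And>y. (y - a) \<bullet> \<nu> = 0 \<Longrightarrow> norm (y - a) < \<rho> \<Longrightarrow> y \<in> E"
  shows "\<rho> / 2 \<le> diameter T"
proof -
  obtain d where d: "d \<noteq> 0" "orthogonal \<nu> d" using orthogonal_to_vector_exists[of \<nu>] n2 by auto
  define y where "y = a + (\<rho> / 2 / norm d) *\<^sub>R d"
  have "y \<in> E"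
    by (rule rel) (use d \<rho> in \<open>auto simp: y_def orthogonal_def inner_commute\<close>)
  then have "norm (y - a) \<le> diameter T" using diameter_bounded_bound[OF T(1), of y a] T by (auto simp: dist_norm)
  then show ?thesis using d(1) \<rho> by (simp add: y_def)
qed

lemma interior_face_data:
  fixes C0 :: real
  assumes n2: "CARD('n) \<ge> 2" and C0: "C0 > 0"
  shows "\<exists>c>0. c \<le> 1 \<and> (\<forall>(S :: (real^'n) set) T E.
    is_element S \<and> inverse C0 * diameter S ^ CARD('n) \<le> measure lebesgue S \<and>
    is_element T \<and> inverse C0 * diameter T ^ CARD('n) \<le> measure lebesgue T \<and>
    interior S \<inter> interior T = {} \<and> E facet_of S \<and> E facet_of T \<longrightarrow> (\<exists>a \<nu>. face_data c S T E a \<nu>))"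
proof -
  obtain c where c: "c > 0" "c \<le> 1 / 2" and ball: "\<And>T :: (real^'n) set. is_element T \<Longrightarrow>
      inverse C0 * diameter T ^ CARD('n) \<le> measure lebesgue T \<Longrightarrow> \<exists>b. ball b (c * diameter T) \<subseteq> T"
    using element_contains_ball[OF n2 C0] by blast
  define m where "m = 1 + 4 / c"
  \<comment> \<open>The divisor m = 1 + 4 / c is the loss in \<open>half_ball_subset\<close> when h
    / \<rho> = 1 / c. One factor c / 2 serves its condition r \<le> \<rho> / 2, the other converts
    the diameter of S into that of T.\<close>
  define k where "k = (c / 2) * (c / 2) / m"
  have m: "1 \<le> m" using c by (simp add: m_def)
  have cc: "0 < (c / 2) * (c / 2)" using c by simp
  have km: "k * m = (c / 2) * (c / 2)" using m by (simp add: k_def)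
  have k: "k > 0" "k \<le> (c / 2) * (c / 2)" "k * (1 + 4 / c) = (c / 2) * (c / 2)"
  proof -
    show "k > 0" unfolding k_def by (rule divide_pos_pos[OF cc]) (use m in simp)
    then have "k * 1 \<le> k * m" using m by (intro mult_left_mono) auto
    then show "k \<le> (c / 2) * (c / 2)" using km by simp
    show "k * (1 + 4 / c) = (c / 2) * (c / 2)" using km unfolding m_def .
  qed
  have "(c / 2) * (c / 2) \<le> (c / 2) * (1 / 4)" using c by (intro mult_left_mono) auto
  then have k': "k \<le> c / 8" using k(2) by simp
  have kx: "k * x \<le> c * x / 8" if "x > 0" for x
    using mult_right_mono[OF k', of x] that by simp
  show ?thesis
  proof (intro exI[of _ k] conjI allI impI)
    show "k > 0" "k \<le> 1" using k k' c by auto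
    fix S T E :: "(real^'n) set"
    assume *: "is_element S \<and> inverse C0 * diameter S ^ CARD('n) \<le> measure lebesgue S \<and>
      is_element T \<and> inverse C0 * diameter T ^ CARD('n) \<le> measure lebesgue T \<and>
      interior S \<inter> interior T = {} \<and> E facet_of S \<and> E facet_of T"
    define hS hT where "hS = diameter S" and "hT = diameter T"
    have h: "hS > 0" "hT > 0" using * is_element_diameter by (auto simp: hS_def hT_def)
    obtain bS bT where b: "ball bS (c * hS) \<subseteq> S" "ball bT (c * hT) \<subseteq> T"
      using ball * unfolding hS_def hT_def by meson
    obtain \<nu> \<mu> where \<nu>: "outward_normal S E \<nu>" "sliced_by S E \<nu>" and \<mu>: "outward_normal T E \<mu>" "sliced_by T E \<mu>"
      using element_facet * by meson
    have chS: "c * hS > 0" and chT: "c * hT > 0" using c h by auto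
    have bdd: "bounded S" "bounded T" "convex S" "convex T"
      using * is_element_compact is_element_convex compact_imp_bounded by blast+
    have ES: "E \<subseteq> S" "E \<subseteq> T" using * facet_of_imp_subset by blast+
    \<comment> \<open>The centre found from the side of S serves both elements; the centre a' from
      the side of T enters only the comparison of the diameters.\<close>
    obtain a where a: "a \<in> E" "\<And>y. (y - a) \<bullet> \<nu> = 0 \<Longrightarrow> norm (y - a) < c * hS \<Longrightarrow> y \<in> E"
      using facet_center[OF \<nu> b(1) chS] by blast
    obtain a' where a': "a' \<in> E" "\<And>y. (y - a') \<bullet> \<mu> = 0 \<Longrightarrow> norm (y - a') < c * hT \<Longrightarrow> y \<in> E"
      using facet_center[OF \<mu> b(2) chT] by blast
    have cmp: "c * hS / 2 \<le> hT" "c * hT / 2 \<le> hS"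
      using facet_diameter_le[OF n2 chS bdd(2) ES(2) a(1,2)] facet_diameter_le[OF n2 chT bdd(1) ES(1) a'(1,2)]
      unfolding hS_def hT_def by auto
    have dist: "norm (x - y) \<le> diameter S" if "x \<in> S" "y \<in> S" for x y
      using diameter_bounded_bound[OF bdd(1) that] by (simp add: dist_norm)
    have distT: "norm (x - y) \<le> diameter T" if "x \<in> T" "y \<in> T" for x y
      using diameter_bounded_bound[OF bdd(2) that] by (simp add: dist_norm)
    have n1: "norm \<nu> = 1" "norm \<mu> = 1" using \<nu> \<mu> by (auto simp: outward_normal_def)
    have par: "\<mu> = \<nu> \<or> \<mu> = - \<nu>"
      by (rule unit_vectors_parallel[OF n1(2,1) chS]) (use a outward_normal_inner(2)[OF \<mu>(1) a(1)] in blast)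
    define r where "r = k * hS"
    have r0: "r > 0" using k h by (simp add: r_def)
    have cc: "c / 2 \<le> 1" using c by simp
    have inS: "x \<in> S" if "norm (x - a) < r" "(x - a) \<bullet> \<nu> \<le> 0" for x
    proof (rule half_ball_subset[OF bdd(3) dist \<nu>(1) a(1) b(1) chS a(2) _ _ that])
      show "r \<le> c * hS / 2" unfolding r_def using kx[OF h(1)] chS by linarith
      have "r * (1 + 4 * diameter S / (c * hS)) = k * (1 + 4 / c) * hS"
        using h(1) by (simp add: r_def hS_def[symmetric])
      also have "\<dots> = (c / 2) * (c / 2) * hS" unfolding k(3) ..
      also have "\<dots> \<le> (c / 2) * 1 * hS" using c h(1) by (intro mult_right_mono mult_left_mono) auto
      also have "\<dots> \<le> c * hS" using c(1) h(1) by simp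
      finally show "r * (1 + 4 * diameter S / (c * hS)) \<le> c * hS" .
    qed
    have relT: "y \<in> E" if "(y - a) \<bullet> \<mu> = 0" "norm (y - a) < c * hS" for y
      using a(2)[of y] that par by (auto simp: inner_minus_right)
    have inT: "x \<in> T" if "norm (x - a) < r" "(x - a) \<bullet> \<mu> \<le> 0" for x
    proof (rule half_ball_subset[OF bdd(4) distT \<mu>(1) a(1) b(2) chT relT _ _ that])
      have "k * hS \<le> (c / 2) * (c * hS / 2)"
        using mult_right_mono[OF k(2), of hS] h(1) by simp
      also have "\<dots> \<le> (c / 2) * hT" using cmp(1) c(1) h by (intro mult_mono) auto
      finally show "r \<le> c * hT / 2" by (simp add: r_def)
      have "r * (1 + 4 * diameter T / (c * hT)) = k * (1 + 4 / c) * hS"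
        using h(2) by (simp add: r_def hT_def[symmetric])
      also have "\<dots> = (c / 2) * (c / 2) * hS" unfolding k(3) ..
      also have "\<dots> \<le> (c / 2) * 1 * hS" using c h(1) by (intro mult_right_mono mult_left_mono) auto
      also have "\<dots> \<le> c * hS" using c(1) h(1) by simp
      finally show "r * (1 + 4 * diameter T / (c * hT)) \<le> c * hS" .
    qed
    have krel: "y \<in> E" if "(y - a) \<bullet> \<nu> = 0" "norm (y - a) < r" for y
    proof (rule a(2)[OF that(1)])
      have "r \<le> c * hS" unfolding r_def using kx[OF h(1)] chS by linarith
      then show "norm (y - a) < c * hS" using that(2) by simp
    qed
    have opp: "\<mu> = - \<nu>"
      by (rule outward_normal_opposite[OF \<nu>(1) inS \<mu>(1) inT r0 a(1) _ krel]) (use * in auto)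
    have "k * hS \<le> c * hS / 2" "k * hT \<le> c * hT / 2"
      using kx[OF h(1)] kx[OF h(2)] chS chT by linarith+
    then have "k * hS \<le> hT" "k * hT \<le> hS" using cmp by auto
    then have "face_data k S T E a \<nu>"
      using \<nu>(1) \<mu>(1) inS inT krel a(1) unfolding face_data_def opp r_def hS_def hT_def by auto
    then show "\<exists>a \<nu>. face_data k S T E a \<nu>" by blast
  qed
qed

lemma outward_normal_unique:
  fixes T :: "(real^'n) set"
  assumes "face_data c S T E a \<nu>" "c * diameter S > 0" "outward_normal S E \<mu>"
  shows "\<mu> = \<nu>"
proof -
  let ?r = "c * diameter S"
  have n1: "norm \<nu> = 1" "norm \<mu> = 1" using assms by (auto simp: face_data_def outward_normal_def)
  have a: "a \<in> E" and rel: "\<And>y. (y - a) \<bullet> \<nu> = 0 \<Longrightarrow> norm (y - a) < ?r \<Longrightarrow> y \<in> E"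
    and inS: "\<And>x. norm (x - a) < ?r \<Longrightarrow> (x - a) \<bullet> \<nu> \<le> 0 \<Longrightarrow> x \<in> S"
    using assms(1) unfolding face_data_def by auto
  have "\<mu> = \<nu> \<or> \<mu> = - \<nu>"
    by (rule unit_vectors_parallel[OF n1(2,1) assms(2)])
      (use rel outward_normal_inner(2)[OF assms(3) a] in blast)
  moreover have "\<mu> \<noteq> - \<nu>"
  proof
    assume eq: "\<mu> = - \<nu>"
    have "a - (?r / 2) *\<^sub>R \<nu> \<in> S"
      by (rule inS) (use n1 assms(2) in \<open>auto simp: dot_square_norm\<close>)
    from outward_normal_inner(1)[OF assms(3) a this] show False
      unfolding eq using n1 assms(2) by (simp add: dot_square_norm)
  qed
  ultimately show ?thesis by blast
qed

text \<open>The outward normals of three elements at a common facet would be pairwise opposite,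
  which is impossible. Hence a facet determines its two elements.\<close>

lemma three_elements_contradiction:
  fixes S T U :: "(real^'n) set"
  assumes "face_data c S T E a \<nu>" "face_data c S U E a' \<nu>'" "face_data c T U E a'' \<nu>''"
    and "c * diameter S > 0" "c * diameter T > 0"
  shows False
proof -
  have "outward_normal S E \<nu>'" "outward_normal U E (- \<nu>')" "outward_normal U E (- \<nu>'')" "outward_normal T E (- \<nu>)"
    using assms unfolding face_data_def by auto
  have "\<nu>' = \<nu>" by (rule outward_normal_unique[OF assms(1,4)]) fact
  have "\<nu>'' = - \<nu>" using outward_normal_unique[OF assms(3,5) \<open>outward_normal T E (- \<nu>)\<close>] by simp
  obtain x where x: "x \<in> U" "(x - a') \<bullet> \<nu> > 0"
  proof -
    let ?r = "c * diameter S"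
    have n1: "norm \<nu> = 1" using assms(1) by (auto simp: face_data_def outward_normal_def)
    have "a' + (?r / 2) *\<^sub>R \<nu> \<in> U"
      using assms(2,4) n1 unfolding face_data_def \<open>\<nu>' = \<nu>\<close> by (auto simp: dot_square_norm)
    then show ?thesis using that[of "a' + (?r / 2) *\<^sub>R \<nu>"] n1 assms(4) by (simp add: dot_square_norm)
  qed
  have "a' \<in> E" using assms(2) by (simp add: face_data_def)
  then have "(x - a') \<bullet> \<nu> \<le> 0"
    using outward_normal_inner(1)[OF \<open>outward_normal U E (- \<nu>'')\<close> _ x(1)] by (simp add: \<open>\<nu>'' = - \<nu>\<close>)
  then show False using x(2) by simp
qed

section \<open>Lipschitz domains\<close>

text \<open>Slits are excluded: the points just below the graph at a boundary point are not in the
  closure. It follows that a ball covered by two closed elements lies in the open domain, so that a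
  face bubble is a test function.\<close>

lemma lipschitz_boundary_interior_closure:
  fixes \<Omega> :: "(real^'n) set"
  assumes "open \<Omega>" "lipschitz_boundary \<Omega>"
  shows "interior (closure \<Omega>) = \<Omega>"
proof
  show "\<Omega> \<subseteq> interior (closure \<Omega>)" using assms(1) closure_subset by (rule interior_maximal[rotated])
  show "interior (closure \<Omega>) \<subseteq> \<Omega>"
  proof
    fix x assume x: "x \<in> interior (closure \<Omega>)"
    show "x \<in> \<Omega>"
    proof (rule ccontr)
      assume nx: "x \<notin> \<Omega>"
      then have "x \<in> frontier \<Omega>" using x interior_subset assms(1) by (auto simp: frontier_def interior_open)
      then obtain r e g L where r: "r > 0" "norm e = 1" "L-lipschitz_on {z. z \<bullet> e = 0} g"
        "\<And>y. y \<in> ball x r \<Longrightarrow> y \<in> \<Omega> \<longleftrightarrow> g (y - (y \<bullet> e) *\<^sub>R e) < y \<bullet> e"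
        using assms(2) unfolding lipschitz_boundary_def by blast
      obtain s where s: "s > 0" "ball x s \<subseteq> closure \<Omega>" using x unfolding mem_interior by blast
      define t where "t = min r s / 2"
      have t: "t > 0" "t < r" "t < s" using r(1) s(1) by (auto simp: t_def)
      define y where "y = x - t *\<^sub>R e"
      have ee: "e \<bullet> e = 1" using r(2) by (simp add: dot_square_norm)
      have yp: "y - (y \<bullet> e) *\<^sub>R e = x - (x \<bullet> e) *\<^sub>R e" by (simp add: y_def inner_diff_left ee algebra_simps)
      have dy: "norm (y - x) = t" using t r(2) by (simp add: y_def)
      have "x \<bullet> e \<le> g (x - (x \<bullet> e) *\<^sub>R e)" using r(1,4) nx by (meson centre_in_ball not_le)
      then have lt: "y \<bullet> e < g (y - (y \<bullet> e) *\<^sub>R e)" unfolding yp using t by (simp add: y_def inner_diff_left ee)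
      have "y \<in> closure \<Omega>" using s(2) dy t by (auto simp: dist_norm norm_minus_commute)
      have cont: "continuous_on UNIV (\<lambda>z. g (z - (z \<bullet> e) *\<^sub>R e) - z \<bullet> e)"
        by (intro continuous_intros continuous_on_compose2[OF lipschitz_on_continuous_on[OF r(3)]])
          (auto simp: inner_diff_left ee)
      have "open {z. 0 < g (z - (z \<bullet> e) *\<^sub>R e) - z \<bullet> e}"
        by (intro open_Collect_less cont continuous_on_const)
      then have "open (ball x r \<inter> {z. 0 < g (z - (z \<bullet> e) *\<^sub>R e) - z \<bullet> e})" by auto
      moreover have "y \<in> ball x r \<inter> {z. 0 < g (z - (z \<bullet> e) *\<^sub>R e) - z \<bullet> e}"
        using lt dy t by (simp add: dist_norm norm_minus_commute)
      ultimately obtain z where "z \<in> \<Omega>" "z \<in> ball x r" "0 < g (z - (z \<bullet> e) *\<^sub>R e) - z \<bullet> e"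
        using \<open>y \<in> closure \<Omega>\<close> unfolding closure_iff_nhds_not_empty by blast
      then show False using r(4)[of z] by simp
    qed
  qed
qed

section \<open>Cut-off functions\<close>

text \<open>The linear map \<open>B\<close> selects the directions to be cut off: the identity for a
  ball, the tangential or the normal projection for the two factors of the face bubble.\<close>

definition cutoff :: "(real^'n \<Rightarrow> real^'n) \<Rightarrow> real^'n \<Rightarrow> real \<Rightarrow> real^'n \<Rightarrow> real" where
  "cutoff B a \<rho> x = bump (1 - (norm (B (x - a)))\<^sup>2 / \<rho>\<^sup>2)"

lemma smooth_fun_linear_nth:
  fixes B :: "real^'n \<Rightarrow> real^'m"
  assumes "linear B" shows "smooth_fun (\<lambda>x. B (x - a) $ i)"
proof -
  have "linear (\<lambda>x. B x $ i)"
    using linear_compose[OF assms bounded_linear.linear[OF bounded_linear_vec_nth[of i]]] by (simp add: o_def)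
  then have "smooth_fun (\<lambda>x. B x $ i)" by (rule smooth_fun_poly[OF polys_linear])
  then have "smooth_fun (\<lambda>x. B x $ i - B a $ i)" by (intro smooth_fun_diff smooth_fun_const)
  then show ?thesis using linear_diff[OF assms] by simp
qed

lemma cutoff_smooth: "linear B \<Longrightarrow> smooth_fun (cutoff B a \<rho>)"
  unfolding cutoff_def[abs_def] divide_inverse mult.commute[of _ "inverse _"]
  by (intro smooth_fun_bump smooth_fun_diff smooth_fun_const smooth_fun_scale smooth_fun_norm2 smooth_fun_linear_nth)

lemma cutoff_range: "0 \<le> cutoff B a \<rho> x" "cutoff B a \<rho> x \<le> 1"
  by (auto simp: cutoff_def bump_nonneg bump_le_1)

lemma cutoff_eq_0: "\<rho> > 0 \<Longrightarrow> \<rho> \<le> norm (B (x - a)) \<Longrightarrow> cutoff B a \<rho> x = 0"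
  by (simp add: cutoff_def bump_eq_0_iff power_mono)

text \<open>At half the radius the argument of \<open>bump\<close> is still at least 1 - 1 /
  4.\<close>

lemma cutoff_ge:
  assumes "\<rho> > 0" "norm (B (x - a)) \<le> \<rho> / 2" shows "bump (3 / 4) \<le> cutoff B a \<rho> x"
proof -
  have "(norm (B (x - a)))\<^sup>2 \<le> (\<rho> / 2)\<^sup>2" using assms by (intro power_mono) auto
  then have "(norm (B (x - a)))\<^sup>2 / \<rho>\<^sup>2 \<le> 1 / 4" using assms(1) by (simp add: divide_le_eq power_divide)
  then show ?thesis unfolding cutoff_def by (intro bump_mono) simp
qed

text \<open>Where the derivative of \<open>bump\<close> does not vanish,
  \<open>norm (B (x - a))\<close> is at most \<rho>, so the quadratic argument has slope at most 2 /
  \<rho>. The bound is uniform over all nonexpansive \<open>B\<close>.\<close>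

lemma cutoff_partial_bound:
  "\<exists>C>0. \<forall>(B :: real^'n \<Rightarrow> real^'n) a \<rho> x i. linear B \<and> (\<forall>h. norm (B h) \<le> norm h) \<and> \<rho> > 0 \<longrightarrow>
     \<bar>partial i (cutoff B a \<rho>) x\<bar> \<le> C / \<rho>"
proof -
  obtain C where C: "C > 0" "\<And>t. \<bar>flat [:0, 0, 1:] t\<bar> \<le> C" using bump_deriv_bounded by blast
  have "\<bar>partial i (cutoff B a \<rho>) x\<bar> \<le> (2 * C) / \<rho>"
    if B: "linear B" "\<And>h. norm (B h) \<le> norm h" and \<rho>: "\<rho> > 0" for B :: "real^'n \<Rightarrow> real^'n" and a \<rho> x i
  proof -
    let ?g = "\<lambda>x. 1 - (norm (B (x - a)))\<^sup>2 / \<rho>\<^sup>2"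
    have bl: "bounded_linear B" using B(1) by (rule linear_conv_bounded_linear[THEN iffD1])
    have DB: "((\<lambda>x. B (x - a)) has_derivative B) (at x)"
      by (rule has_derivative_eq_rhs, rule bounded_linear.has_derivative[OF bl has_derivative_diff[OF has_derivative_ident has_derivative_const]]) simp
    have "((\<lambda>x. 1 - inverse (\<rho>\<^sup>2) * (B (x - a) \<bullet> B (x - a))) has_derivative
      (\<lambda>h. 0 - inverse (\<rho>\<^sup>2) * (B (x - a) \<bullet> B h + B h \<bullet> B (x - a)))) (at x)"
      by (intro has_derivative_diff has_derivative_const has_derivative_mult_right has_derivative_inner DB)
    moreover have "(\<lambda>x. 1 - inverse (\<rho>\<^sup>2) * (B (x - a) \<bullet> B (x - a))) = ?g"
      by (simp add: power2_norm_eq_inner divide_inverse mult.commute)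
    moreover have "(\<lambda>h. 0 - inverse (\<rho>\<^sup>2) * (B (x - a) \<bullet> B h + B h \<bullet> B (x - a))) =
      (\<lambda>h. - (2 * (B (x - a) \<bullet> B h)) / \<rho>\<^sup>2)"
      by (simp add: inner_commute divide_inverse mult.commute)
    ultimately have "(?g has_derivative (\<lambda>h. - (2 * (B (x - a) \<bullet> B h)) / \<rho>\<^sup>2)) (at x)" by simp
    then have "((\<lambda>x. bump (?g x)) has_derivative (\<lambda>h. flat [:0, 0, 1:] (?g x) * (- (2 * (B (x - a) \<bullet> B h)) / \<rho>\<^sup>2))) (at x)"
      by (rule has_derivative_compose[OF _ DERIV_bump[unfolded has_field_derivative_def]])
    then have p: "partial i (cutoff B a \<rho>) x = flat [:0, 0, 1:] (?g x) * (- (2 * (B (x - a) \<bullet> B (axis i 1))) / \<rho>\<^sup>2)"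
      unfolding cutoff_def[abs_def] by (rule partial_eqI)
    show ?thesis
    proof (cases "?g x \<le> 0")
      case True
      then have "flat [:0, 0, 1:] (?g x) = 0" by (simp add: flat_def)
      then show ?thesis unfolding p using C \<rho> by simp
    next
      case False
      then have "(norm (B (x - a)))\<^sup>2 / \<rho>\<^sup>2 < 1" by simp
      then have "(norm (B (x - a)))\<^sup>2 < \<rho>\<^sup>2" using \<rho> by (simp only: divide_less_eq_1_pos zero_less_power)
      then have nB: "norm (B (x - a)) \<le> \<rho>" by (rule power2_le_imp_le[OF less_imp_le]) (use \<rho> in simp)
      have "\<bar>B (x - a) \<bullet> B (axis i 1)\<bar> \<le> norm (B (x - a)) * norm (B (axis i 1))" by (rule Cauchy_Schwarz_ineq2)
      also have "\<dots> \<le> \<rho> * 1" using nB B(2)[of "axis i 1"] \<rho> by (intro mult_mono) auto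
      finally have "\<bar>- (2 * (B (x - a) \<bullet> B (axis i 1))) / \<rho>\<^sup>2\<bar> \<le> 2 * \<rho> / \<rho>\<^sup>2"
        using \<rho> by (simp add: abs_mult divide_right_mono)
      then have "\<bar>partial i (cutoff B a \<rho>) x\<bar> \<le> C * (2 * \<rho> / \<rho>\<^sup>2)"
        unfolding p abs_mult using C by (intro mult_mono) auto
      also have "\<dots> = (2 * C) / \<rho>" using \<rho> by (simp add: power2_eq_square)
      finally show ?thesis .
    qed
  qed
  then show ?thesis using C(1) by (intro exI[of _ "2 * C"]) auto
qed

section \<open>Localised norms\<close>

text \<open>A set integral over the whole space rather than an integral over
  \<open>lebesgue_on A\<close>, so that squared norms over different sets are integrals with respect
  to one measure.\<close>

definition sqnorm_on :: "('a::euclidean_space \<Rightarrow> 'b::euclidean_space) \<Rightarrow> 'a set \<Rightarrow> real" where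
  "sqnorm_on Z A = (LINT x:A|lebesgue. (norm (Z x))\<^sup>2)"

lemma sqnorm_on_nonneg: "0 \<le> sqnorm_on Z A"
  unfolding sqnorm_on_def set_lebesgue_integral_def by (rule integral_nonneg_AE) auto

lemma sqnorm_on_eq: "A \<in> sets lebesgue \<Longrightarrow> sqnorm_on Z A = (LINT x|lebesgue_on A. (norm (Z x))\<^sup>2)"
  unfolding sqnorm_on_def set_lebesgue_integral_def by (simp add: integral_restrict_space)

lemma l2_norm_sqnorm: "A \<in> sets lebesgue \<Longrightarrow> (l2_norm (lebesgue_on A) Z)\<^sup>2 = sqnorm_on Z A"
  unfolding l2_norm_def sqnorm_on_eq by (simp add: integral_nonneg_AE)

lemma square_integrable_set_integrable:
  assumes "square_integrable (lebesgue_on \<Omega>) Z" "\<Omega> \<in> sets lebesgue" "A \<subseteq> \<Omega>" "A \<in> sets lebesgue"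
  shows "set_integrable lebesgue A (\<lambda>x. (norm (Z x))\<^sup>2)"
proof -
  have "set_integrable lebesgue \<Omega> (\<lambda>x. (norm (Z x))\<^sup>2)"
    using assms by (simp add: square_integrable_def set_integrable_def integrable_restrict_space)
  then show ?thesis by (rule set_integrable_subset) (use assms in auto)
qed

lemma sqnorm_on_mono:
  assumes "square_integrable (lebesgue_on \<Omega>) Z" "\<Omega> \<in> sets lebesgue" "A \<subseteq> B" "B \<subseteq> \<Omega>" "A \<in> sets lebesgue" "B \<in> sets lebesgue"
  shows "sqnorm_on Z A \<le> sqnorm_on Z B"
  unfolding sqnorm_on_def set_lebesgue_integral_def
proof (rule integral_mono)
  have "A \<subseteq> \<Omega>" using assms(3,4) by blast
  then show "integrable lebesgue (\<lambda>x. indicator A x *\<^sub>R (norm (Z x))\<^sup>2)"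
    using square_integrable_set_integrable[OF assms(1,2) _ assms(5)] by (simp add: set_integrable_def)
  show "integrable lebesgue (\<lambda>x. indicator B x *\<^sub>R (norm (Z x))\<^sup>2)"
    using square_integrable_set_integrable[OF assms(1,2,4,6)] by (simp add: set_integrable_def)
qed (use assms(3) in \<open>auto simp: indicator_def\<close>)

text \<open>The L2 norm of g is replaced by a sup bound times the root of the volume of
  \<open>A\<close>, the form in which the size of a bubble is known, and the other factor is
  localised to \<open>A\<close>.\<close>

lemma local_Cauchy_Schwarz:
  fixes Z g :: "real^'n \<Rightarrow> 'b::euclidean_space"
  assumes \<Omega>: "\<Omega> \<in> sets lebesgue" and Z: "square_integrable (lebesgue_on \<Omega>) Z"
    and g: "square_integrable (lebesgue_on \<Omega>) g" "\<And>x. x \<notin> A \<Longrightarrow> g x = 0" "\<And>x. norm (g x) \<le> M"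
    and A: "A \<in> lmeasurable" "A \<subseteq> \<Omega>" "measure lebesgue A \<le> V"
  shows "\<bar>LINT x|lebesgue_on \<Omega>. Z x \<bullet> g x\<bar> \<le> sqrt V * (sqrt (sqnorm_on Z A) * M)"
proof -
  have Am: "A \<in> sets lebesgue" using A(1) by auto
  have M: "M \<ge> 0" using order_trans[OF norm_ge_zero g(3)] .
  define Z' where "Z' x = indicator A x *\<^sub>R Z x" for x
  have Am': "A \<in> sets (lebesgue_on \<Omega>)" if "A \<subseteq> \<Omega>" using that Am \<Omega> by (auto simp: sets_restrict_space_iff)
  have Z'm: "Z' \<in> borel_measurable (lebesgue_on \<Omega>)"
    unfolding Z'_def using Z Am'[OF A(2)] by (intro borel_measurable_scaleR borel_measurable_indicator) (auto simp: square_integrable_def)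
  have nZ': "(norm (Z' x))\<^sup>2 = indicator A x * (norm (Z x))\<^sup>2" for x by (simp add: Z'_def indicator_def)
  have iZ: "integrable (lebesgue_on \<Omega>) (\<lambda>x. (norm (Z' x))\<^sup>2)"
  proof (rule Bochner_Integration.integrable_bound)
    show "integrable (lebesgue_on \<Omega>) (\<lambda>x. (norm (Z x))\<^sup>2)" using Z by (simp add: square_integrable_def)
    show "(\<lambda>x. (norm (Z' x))\<^sup>2) \<in> borel_measurable (lebesgue_on \<Omega>)" using Z'm by simp
  qed (auto simp: nZ' indicator_def)
  have sZ': "square_integrable (lebesgue_on \<Omega>) Z'" using Z'm iZ by (simp add: square_integrable_def)
  have "(LINT x|lebesgue_on \<Omega>. (norm (Z' x))\<^sup>2) = (LINT x|lebesgue. indicator \<Omega> x *\<^sub>R (indicator A x * (norm (Z x))\<^sup>2))"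
    using \<Omega> by (simp add: integral_restrict_space nZ')
  also have "\<dots> = sqnorm_on Z A" unfolding sqnorm_on_def set_lebesgue_integral_def
    by (rule Bochner_Integration.integral_cong) (use A(2) in \<open>auto simp: indicator_def\<close>)
  finally have ZA: "(LINT x|lebesgue_on \<Omega>. (norm (Z' x))\<^sup>2) = sqnorm_on Z A" .
  have "(LINT x|lebesgue_on \<Omega>. (norm (g x))\<^sup>2) \<le> (LINT x|lebesgue_on \<Omega>. M\<^sup>2 * indicator A x)"
  proof (rule integral_mono_AE)
    have "integrable lebesgue (\<lambda>x. indicator \<Omega> x *\<^sub>R (indicator A x :: real))"
    proof (rule Bochner_Integration.integrable_cong[THEN iffD1, OF refl])
      show "integrable lebesgue (indicator A :: _ \<Rightarrow> real)" using A(1) by (intro integrable_real_indicator) (auto simp: fmeasurable_def)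
    qed (use A(2) in \<open>auto simp: indicator_def\<close>)
    then have "integrable (lebesgue_on \<Omega>) (indicator A :: _ \<Rightarrow> real)"
      using \<Omega> by (simp add: integrable_restrict_space)
    then show "integrable (lebesgue_on \<Omega>) (\<lambda>x. M\<^sup>2 * indicator A x)" by simp
    show "AE x in lebesgue_on \<Omega>. (norm (g x))\<^sup>2 \<le> M\<^sup>2 * indicator A x"
      using g(2,3) by (auto simp: indicator_def intro!: AE_I2 power_mono)
  qed (use g(1) in \<open>simp add: square_integrable_def\<close>)
  also have "\<dots> = M\<^sup>2 * measure lebesgue A"
  proof -
    have "(LINT x|lebesgue_on \<Omega>. indicator A x) = (LINT x|lebesgue. (indicator A x :: real))"
    proof -
      have "(LINT x|lebesgue_on \<Omega>. indicator A x) = (LINT x|lebesgue. indicator \<Omega> x *\<^sub>R (indicator A x :: real))"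
        using \<Omega> by (intro integral_restrict_space) auto
      also have "\<dots> = (LINT x|lebesgue. indicator A x)"
        by (rule Bochner_Integration.integral_cong) (use A(2) in \<open>auto simp: indicator_def\<close>)
      finally show ?thesis .
    qed
    then show ?thesis by simp
  qed
  also have "\<dots> \<le> M\<^sup>2 * V" using A(3) by (simp add: mult_left_mono)
  finally have gA: "(LINT x|lebesgue_on \<Omega>. (norm (g x))\<^sup>2) \<le> M\<^sup>2 * V" .
  have "(LINT x|lebesgue_on \<Omega>. Z x \<bullet> g x) = (LINT x|lebesgue_on \<Omega>. Z' x \<bullet> g x)"
    by (rule Bochner_Integration.integral_cong) (use g(2) in \<open>auto simp: Z'_def indicator_def\<close>)
  also have "\<bar>\<dots>\<bar> \<le> sqrt (sqnorm_on Z A) * sqrt (LINT x|lebesgue_on \<Omega>. (norm (g x))\<^sup>2)"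
    using integral_Cauchy_Schwarz_sqrt[OF sZ' g(1)] unfolding l2_norm_def ZA .
  also have "\<dots> \<le> sqrt (sqnorm_on Z A) * sqrt (M\<^sup>2 * V)"
    using gA sqnorm_on_nonneg[of Z A] by (intro mult_left_mono) auto
  also have "sqrt (M\<^sup>2 * V) = M * sqrt V" using M by (simp add: real_sqrt_mult)
  finally show ?thesis by (simp add: mult_ac)
qed

lemma residual_bound:
  fixes X :: "real^'n \<Rightarrow> real^'n" and Y :: "real^'n \<Rightarrow> real"
  assumes \<Omega>: "open \<Omega>" "bounded \<Omega>" and X: "square_integrable (lebesgue_on \<Omega>) X" and Y: "square_integrable (lebesgue_on \<Omega>) Y"
    and \<phi>: "\<phi> \<in> test_functions \<Omega>" "\<And>x. x \<notin> A \<Longrightarrow> \<phi> x = 0" "\<And>x. x \<in> A \<Longrightarrow> \<bar>\<phi> x\<bar> \<le> M0" "\<And>x i. x \<in> A \<Longrightarrow> \<bar>partial i \<phi> x\<bar> \<le> M1"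
    and M: "M0 \<ge> 0" "M1 \<ge> 0"
    and A: "compact A" "A \<subseteq> \<Omega>" "measure lebesgue A \<le> V"
  shows "\<bar>(LINT x|lebesgue_on \<Omega>. X x \<bullet> grad \<phi> x) + (LINT x|lebesgue_on \<Omega>. Y x * \<phi> x)\<bar>
    \<le> sqrt V * (sqrt (sqnorm_on X A) * (real CARD('n) * M1) + sqrt (sqnorm_on Y A) * M0)"
proof -
  note lm = open_bounded_lmeasurable[OF \<Omega>]
  have \<Omega>s: "\<Omega> \<in> sets lebesgue" using lm by auto
  note s\<phi> = test_functions_smooth[OF \<phi>(1)] test_functions_bounded_support[OF \<phi>(1)]
  have Al: "A \<in> lmeasurable" using A(1) by (rule lmeasurable_compact)
  have g0: "grad \<phi> x = 0" if "x \<notin> A" for x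
  proof -
    have "partial i \<phi> x = 0" for i
      by (rule partial_eq_0[of "- A"]) (use A(1) that \<phi>(2) in \<open>auto simp: compact_imp_closed intro!: open_Compl\<close>)
    then show ?thesis by (simp add: grad_def vec_eq_iff)
  qed
  have gb: "norm (grad \<phi> x) \<le> real CARD('n) * M1" for x
  proof (cases "x \<in> A")
    case True
    \<comment> \<open>The factor n in the estimate comes from bounding the Euclidean norm by the sum
      of the components.\<close>
    have "norm (grad \<phi> x) \<le> (\<Sum>i\<in>UNIV. \<bar>partial i \<phi> x\<bar>)" by (rule norm_grad_le)
    also have "\<dots> \<le> (\<Sum>i\<in>(UNIV :: 'n set). M1)" using \<phi>(4)[OF True] by (intro sum_mono)
    finally show ?thesis by simp
  qed (use M g0 in simp)
  have pb: "norm (\<phi> x) \<le> M0" for x using \<phi>(2,3) M by (cases "x \<in> A") auto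
  have "\<bar>LINT x|lebesgue_on \<Omega>. X x \<bullet> grad \<phi> x\<bar> \<le> sqrt V * (sqrt (sqnorm_on X A) * (real CARD('n) * M1))"
    by (rule local_Cauchy_Schwarz[OF \<Omega>s X smooth_grad_square_integrable[OF s\<phi> lm] g0 gb Al A(2,3)])
  moreover have "\<bar>LINT x|lebesgue_on \<Omega>. Y x \<bullet> \<phi> x\<bar> \<le> sqrt V * (sqrt (sqnorm_on Y A) * M0)"
    by (rule local_Cauchy_Schwarz[OF \<Omega>s Y smooth_square_integrable[OF s\<phi> lm] \<phi>(2) pb Al A(2,3)])
  ultimately show ?thesis by (simp add: distrib_left)
qed

text \<open>The root of the integral divided by r^n serves as the one scale in which values and,
  after division by r, derivatives of a residual polynomial are measured.\<close>

lemma poly_root_bound: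
  "\<exists>C>0. \<forall>p\<in>total_degree_polys k. \<forall>a::real^'n. \<forall>r>0. \<forall>x\<in>cball a (R * r). \<forall>i.
     \<bar>p x\<bar> \<le> C * sqrt ((LINT x:ball a r|lborel. (p x)\<^sup>2) / r ^ CARD('n)) \<and>
     \<bar>partial i p x\<bar> \<le> C * sqrt ((LINT x:ball a r|lborel. (p x)\<^sup>2) / r ^ CARD('n)) / r"
proof -
  obtain C where C: "C > 0" "\<And>p a \<rho> x i. p\<in>total_degree_polys k \<Longrightarrow> \<rho> > 0 \<Longrightarrow> x\<in>cball a (R * \<rho>) \<Longrightarrow>
     (p x)\<^sup>2 * \<rho> ^ CARD('n) \<le> C * (LINT x:ball a \<rho>|lborel. (p (x::real^'n))\<^sup>2) \<and>
     (partial i p x)\<^sup>2 * \<rho> ^ (CARD('n) + 2) \<le> C * (LINT x:ball a \<rho>|lborel. (p x)\<^sup>2)"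
    using poly_sup_bound[of k R] by blast
  show ?thesis
  proof (intro exI[of _ "sqrt C"] conjI ballI allI impI)
    show "0 < sqrt C" using C(1) by simp
    fix p :: "real^'n \<Rightarrow> real" and a :: "real^'n" and r :: real and x i
    assume p: "p \<in> total_degree_polys k" and r: "r > 0" and x: "x \<in> cball a (R * r)"
    let ?I = "LINT x:ball a r|lborel. (p x)\<^sup>2"
    have "(p x)\<^sup>2 \<le> C * (?I / r ^ CARD('n))"
      using C(2)[OF p r x] r by (simp add: pos_le_divide_eq)
    then have "sqrt ((p x)\<^sup>2) \<le> sqrt (C * (?I / r ^ CARD('n)))" by (rule real_sqrt_le_mono)
    then show "\<bar>p x\<bar> \<le> sqrt C * sqrt (?I / r ^ CARD('n))" by (simp add: real_sqrt_mult real_sqrt_divide)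
    have "(partial i p x * r)\<^sup>2 \<le> C * (?I / r ^ CARD('n))"
      using C(2)[OF p r x, of i] r by (simp add: pos_le_divide_eq power_mult_distrib power_add power2_eq_square mult_ac)
    then have "sqrt ((partial i p x * r)\<^sup>2) \<le> sqrt (C * (?I / r ^ CARD('n)))" by (rule real_sqrt_le_mono)
    then have "\<bar>partial i p x\<bar> * r \<le> sqrt C * sqrt (?I / r ^ CARD('n))" using r by (simp add: real_sqrt_mult real_sqrt_divide abs_mult)
    then show "\<bar>partial i p x\<bar> \<le> sqrt C * sqrt (?I / r ^ CARD('n)) / r" using r by (simp add: pos_le_divide_eq)
  qed
qed

section \<open>Residual equations\<close>

definition pw_fun :: "(real^'n) set set \<Rightarrow> ((real^'n) set \<Rightarrow> real^'n \<Rightarrow> real) \<Rightarrow> real^'n \<Rightarrow> real" where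
  "pw_fun \<T> F x = (\<Sum>T\<in>\<T>. indicator (interior T) x *\<^sub>R F T x)"

text \<open>The error equation common to both problems. In the first problem \<open>\<kappa> = \<epsilon>\<^sup>2\<close> and
  \<open>F = f - \<psi>h\<close>, in the second one \<open>\<kappa> = 1\<close> and \<open>F = \<psi>h\<close>; the functions \<open>X\<close> and \<open>Y\<close> are
  the error terms.\<close>

definition residual_equation ::
    "nat \<Rightarrow> (real^'n) set \<Rightarrow> (real^'n) set set \<Rightarrow> real \<Rightarrow> ((real^'n) set \<Rightarrow> real^'n \<Rightarrow> real) \<Rightarrow>
     ((real^'n) set \<Rightarrow> real^'n \<Rightarrow> real) \<Rightarrow> (real^'n \<Rightarrow> real^'n) \<Rightarrow> (real^'n \<Rightarrow> real) \<Rightarrow> bool" where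
  "residual_equation N \<Omega> \<T> \<kappa> F p X Y \<longleftrightarrow>
     open \<Omega> \<and> bounded \<Omega> \<and> interior (closure \<Omega>) = \<Omega> \<and> finite \<T> \<and> \<Union>\<T> = closure \<Omega> \<and>
     (\<forall>T\<in>\<T>. is_element T \<and> F T \<in> total_degree_polys N \<and> p T \<in> total_degree_polys N) \<and>
     (\<forall>S\<in>\<T>. \<forall>T\<in>\<T>. S \<noteq> T \<longrightarrow> interior S \<inter> interior T = {}) \<and>
     square_integrable (lebesgue_on \<Omega>) X \<and> square_integrable (lebesgue_on \<Omega>) Y \<and>
     (\<forall>\<phi>\<in>test_functions \<Omega>.
        (LINT x|lebesgue_on \<Omega>. pw_fun \<T> F x * \<phi> x) - \<kappa> * (LINT x|lebesgue_on \<Omega>. pw_grad \<T> p x \<bullet> grad \<phi> x)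
        = (LINT x|lebesgue_on \<Omega>. X x \<bullet> grad \<phi> x) + (LINT x|lebesgue_on \<Omega>. Y x * \<phi> x))"

lemma residual_equationD:
  assumes "residual_equation N \<Omega> \<T> \<kappa> F p X Y"
  shows "open \<Omega>" "bounded \<Omega>" "interior (closure \<Omega>) = \<Omega>" "finite \<T>" "\<Union>\<T> = closure \<Omega>"
    "\<And>T. T \<in> \<T> \<Longrightarrow> is_element T" "\<And>T. T \<in> \<T> \<Longrightarrow> F T \<in> total_degree_polys N"
    "\<And>T. T \<in> \<T> \<Longrightarrow> p T \<in> total_degree_polys N"
    "\<And>S T. S \<in> \<T> \<Longrightarrow> T \<in> \<T> \<Longrightarrow> S \<noteq> T \<Longrightarrow> interior S \<inter> interior T = {}"
    "square_integrable (lebesgue_on \<Omega>) X" "square_integrable (lebesgue_on \<Omega>) Y"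
    "\<And>\<phi>. \<phi> \<in> test_functions \<Omega> \<Longrightarrow>
      (LINT x|lebesgue_on \<Omega>. pw_fun \<T> F x * \<phi> x) - \<kappa> * (LINT x|lebesgue_on \<Omega>. pw_grad \<T> p x \<bullet> grad \<phi> x)
        = (LINT x|lebesgue_on \<Omega>. X x \<bullet> grad \<phi> x) + (LINT x|lebesgue_on \<Omega>. Y x * \<phi> x)"
  using assms unfolding residual_equation_def by simp_all

definition strong_residual :: "real \<Rightarrow> ('a \<Rightarrow> real^'n \<Rightarrow> real) \<Rightarrow> ('a \<Rightarrow> real^'n \<Rightarrow> real) \<Rightarrow> 'a \<Rightarrow> real^'n \<Rightarrow> real" where
  "strong_residual \<kappa> F p T x = F T x + \<kappa> * laplacian (p T) x"

lemma strong_residual_poly: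
  "F T \<in> total_degree_polys N \<Longrightarrow> p T \<in> total_degree_polys N \<Longrightarrow> strong_residual \<kappa> F p T \<in> total_degree_polys N"
  unfolding strong_residual_def[abs_def] by (intro polys_add polys_scale laplacian_in_polys)

lemma LINT_lebesgue_on_support:
  fixes f :: "'a::euclidean_space \<Rightarrow> real"
  assumes "f \<in> borel_measurable borel" "\<And>x. x \<notin> \<Omega> \<Longrightarrow> f x = 0" "open \<Omega>"
  shows "(LINT x|lebesgue_on \<Omega>. f x) = (LINT x|lborel. f x)"
proof -
  have "(LINT x|lebesgue_on \<Omega>. f x) = (LINT x:\<Omega>|lborel. f x)"
    by (rule LINT_lebesgue_on) (use assms in auto)
  also have "\<dots> = (LINT x|lborel. f x)"
    unfolding set_lebesgue_integral_def
    by (rule Bochner_Integration.integral_cong) (auto simp: indicator_def assms)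
  finally show ?thesis .
qed

lemma sqnorm_on_lborel:
  fixes R :: "real^'n \<Rightarrow> real"
  assumes "R \<in> borel_measurable borel" "A \<in> sets borel"
  shows "sqnorm_on R A = (LINT x:A|lborel. (R x)\<^sup>2)"
  unfolding sqnorm_on_def set_lebesgue_integral_def
  using assms by (subst integral_completion) auto

lemma sqnorm_on_sup_le:
  fixes R :: "real^'n \<Rightarrow> real"
  assumes "compact T" "continuous_on UNIV R" "\<And>x. x \<in> T \<Longrightarrow> \<bar>R x\<bar> \<le> M" "measure lborel T \<le> V"
  shows "sqnorm_on R T \<le> M\<^sup>2 * V"
proof -
  have Tb: "T \<in> sets borel" "T \<in> fmeasurable lborel"
    using assms(1) fmeasurable_closed_bounded[OF compact_imp_closed compact_imp_bounded] by (auto simp: compact_imp_closed)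
  have "sqnorm_on R T = (LINT x:T|lborel. (R x)\<^sup>2)"
    using assms(2) Tb by (intro sqnorm_on_lborel borel_measurable_continuous_onI)
  also have "\<dots> \<le> (LINT x:T|lborel. M\<^sup>2)"
  proof (rule set_integral_mono)
    show "set_integrable lborel T (\<lambda>x. (R x)\<^sup>2)" "set_integrable lborel T (\<lambda>x. M\<^sup>2)"
      using assms(1,2) Tb by (auto intro!: set_integrable_continuous_bounded continuous_intros simp: compact_imp_bounded)
    show "(R x)\<^sup>2 \<le> M\<^sup>2" if "x \<in> T" for x using assms(3)[OF that] by (metis abs_ge_zero power2_abs power_mono)
  qed
  also have "\<dots> = M\<^sup>2 * measure lborel T" unfolding set_lebesgue_integral_def by simp
  also have "\<dots> \<le> M\<^sup>2 * V" using assms(4) by (intro mult_left_mono) auto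
  finally show ?thesis .
qed

text \<open>Testing with \<phi> = R \<theta>, where \<theta> cuts off to a ball inside T, bounds the
  integral I of R^2 over a smaller ball by the error terms. With s = sqrt (I / r^n), \<phi> has size
  s and its derivatives have size s / r, so that one factor s r^(n/2) cancels. The sup bound for R
  finally passes from the small ball to T.\<close>

lemma element_residual_estimate:
  fixes C0 :: real
  assumes n2: "CARD('n) \<ge> 2" and C0: "C0 > 0"
  shows "\<exists>C>0. \<forall>(\<Omega> :: (real^'n) set) \<T> \<kappa> F p X Y T. residual_equation N \<Omega> \<T> \<kappa> F p X Y \<and> T \<in> \<T> \<and>
     inverse C0 * diameter T ^ CARD('n) \<le> measure lebesgue T \<longrightarrow>
     sqnorm_on (strong_residual \<kappa> F p T) T \<le>
       C * (sqnorm_on X (interior T) / (diameter T)\<^sup>2 + sqnorm_on Y (interior T))"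
proof -
  define n where "n = CARD('n)"
  obtain c where c: "c > 0" "c \<le> 1 / 2" and ball: "\<And>T :: (real^'n) set. is_element T \<Longrightarrow>
      inverse C0 * diameter T ^ n \<le> measure lebesgue T \<Longrightarrow> \<exists>b. ball b (c * diameter T) \<subseteq> T"
    using element_contains_ball[OF n2 C0] unfolding n_def by blast
  \<comment> \<open>With r = c h / 4 the radius (4 / c) r equals h, so the sup bound reaches the
    whole element.\<close>
  obtain C1 where C1: "C1 > 0" "\<And>(R::real^'n \<Rightarrow> real) a r x i. R \<in> total_degree_polys N \<Longrightarrow> r > 0 \<Longrightarrow> x \<in> cball a (4 / c * r) \<Longrightarrow>
     \<bar>R x\<bar> \<le> C1 * sqrt ((LINT x:ball a r|lborel. (R x)\<^sup>2) / r ^ n) \<and>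
     \<bar>partial i R x\<bar> \<le> C1 * sqrt ((LINT x:ball a r|lborel. (R x)\<^sup>2) / r ^ n) / r"
    using poly_root_bound[of N "4 / c"] unfolding n_def by blast
  obtain Cb where Cb: "Cb > 0" "\<And>(B :: real^'n \<Rightarrow> real^'n) a \<rho> x i. linear B \<Longrightarrow> (\<forall>h. norm (B h) \<le> norm h) \<Longrightarrow> \<rho> > 0 \<Longrightarrow>
     \<bar>partial i (cutoff B a \<rho>) x\<bar> \<le> Cb / \<rho>"
    using cutoff_partial_bound by blast
  define \<omega> where "\<omega> = unit_ball_vol (real n)"
  have \<omega>: "\<omega> > 0" unfolding \<omega>_def by (simp add: unit_ball_vol_pos)
  define b0 where "b0 = bump (3 / 4)"
  have b0: "b0 > 0" by (simp add: b0_def bump_pos_iff)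
  define C2 where "C2 = sqrt (\<omega> * 2 ^ n) * (real n * C1 * (Cb + 1)) / b0"
  have n0: "n \<ge> 1" using n2 by (simp add: n_def)
  have C2: "C2 > 0" unfolding C2_def using \<omega> C1 Cb b0 n0 by (intro divide_pos_pos mult_pos_pos) auto
  \<comment> \<open>C1^2 \<omega> (4 / c)^n comes from the sup bound and the volume of a ball around
    T, the factor 2 C2^2 from squaring a sum of two terms, and 16 / c^2 from 1 / r^2 = 16 / (c
    h)^2.\<close>
  define C where "C = C1\<^sup>2 * \<omega> * (4 / c) ^ n * (C2\<^sup>2 * 2 * (16 / c\<^sup>2 + 1))"
  have C: "C > 0" unfolding C_def using C1 \<omega> c C2 by (intro mult_pos_pos) (auto intro: add_pos_pos)
  show ?thesis
  proof (intro exI[of _ C] conjI C allI impI)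
    fix \<Omega> :: "(real^'n) set" and \<T> \<kappa> F p X Y T
    assume asm: "residual_equation N \<Omega> \<T> \<kappa> F p X Y \<and> T \<in> \<T> \<and> inverse C0 * diameter T ^ CARD('n) \<le> measure lebesgue T"
    then have eq: "residual_equation N \<Omega> \<T> \<kappa> F p X Y" and TT: "T \<in> \<T>" and shape: "inverse C0 * diameter T ^ n \<le> measure lebesgue T"
      by (auto simp: n_def)
    note rD = residual_equationD[OF eq]
    note \<Omega> = rD(1-3) and \<T> = rD(4,5) and el = rD(6)[OF TT] and FP = rD(7)[OF TT] rD(8)[OF TT]
      and disj = rD(9) and X = rD(10) and Y = rD(11) and hyp = rD(12)
    define h where "h = diameter T"
    have h: "h > 0" unfolding h_def by (rule is_element_diameter[OF el])
    obtain b where b: "ball b (c * h) \<subseteq> T" using ball[OF el shape] unfolding h_def by blast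
    define r where "r = c * h / 4"
    have r: "r > 0" using c h by (simp add: r_def)
    have hr: "h = 4 / c * r" using c by (simp add: r_def)
    define R where "R = strong_residual \<kappa> F p T"
    have R: "R \<in> total_degree_polys N" unfolding R_def by (rule strong_residual_poly[of F T N p \<kappa>, OF FP])
    note sR = smooth_fun_poly[OF R] and sF = smooth_fun_poly[OF FP(1)] and sp = smooth_fun_poly[OF FP(2)]
    define I where "I = (LINT x:ball b r|lborel. (R x)\<^sup>2)"
    have I0: "I \<ge> 0" unfolding I_def set_lebesgue_integral_def by (rule integral_nonneg_AE) auto
    define s where "s = sqrt (I / r ^ n)"
    have s0: "s \<ge> 0" using I0 r by (simp add: s_def)
    have Is: "I = s\<^sup>2 * r ^ n" using I0 r by (simp add: s_def)
    have Rb: "\<bar>R x\<bar> \<le> C1 * s" "\<bar>partial i R x\<bar> \<le> C1 * s / r" if "x \<in> cball b h" for x i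
      using C1(2)[OF R r, of x b i] that unfolding hr[symmetric] s_def I_def by auto
    have bT: "b \<in> T" using b c h by auto
    have Tsub: "T \<subseteq> cball b h"
      using diameter_bounded_bound[OF compact_imp_bounded[OF is_element_compact[OF el]] bT] by (auto simp: h_def)
    \<comment> \<open>The support has radius 2 r = c h / 2, half that of the ball in T, and is thus
      a compact subset of the interior; on the ball of radius r the cut-off is at least b0.\<close>
    define A where "A = cball b (2 * r)"
    have AT: "A \<subseteq> interior T"
    proof -
      have "2 * r < c * h" using c(1) h by (simp add: r_def)
      then have "A \<subseteq> ball b (c * h)" by (auto simp: A_def)
      then show ?thesis using interior_maximal[OF b open_ball] by blast
    qed
    have Ah: "A \<subseteq> cball b h" using AT interior_subset Tsub by blast
    have T\<Omega>: "interior T \<subseteq> \<Omega>"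
      using interior_mono[of T "closure \<Omega>"] \<T>(2) TT \<Omega>(3) by blast
    define \<theta> where "\<theta> = cutoff (\<lambda>x. x) b (2 * r)"
    define \<phi> where "\<phi> x = R x * \<theta> x" for x
    have lid: "linear (\<lambda>x::real^'n. x)" by (rule linear_id[unfolded id_def])
    have s\<theta>: "smooth_fun \<theta>" unfolding \<theta>_def by (rule cutoff_smooth[OF lid])
    have s\<phi>: "smooth_fun \<phi>" unfolding \<phi>_def[abs_def] by (rule smooth_fun_mult[OF sR s\<theta>])
    have \<theta>0: "\<theta> x = 0" if "x \<notin> A" for x
      unfolding \<theta>_def by (rule cutoff_eq_0) (use that r in \<open>auto simp: A_def dist_norm norm_minus_commute\<close>)
    have \<phi>0: "\<phi> x = 0" if "x \<notin> A" for x by (simp add: \<phi>_def \<theta>0[OF that])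
    have g0: "grad \<phi> x = 0" if "x \<notin> A" for x
    proof -
      have "partial i \<phi> x = 0" for i
        by (rule partial_eq_0[of "- A"]) (use that \<phi>0 in \<open>auto simp: A_def intro!: open_Compl\<close>)
      then show ?thesis by (simp add: grad_def vec_eq_iff)
    qed
    have \<phi>t: "\<phi> \<in> test_functions \<Omega>"
      by (rule test_functionsI[OF s\<phi>, of A]) (use AT T\<Omega> \<phi>0 in \<open>auto simp: A_def\<close>)
    have bs: "bounded_support \<phi>" by (rule test_functions_bounded_support[OF \<phi>t])
    have out: "\<phi> x = 0" "grad \<phi> x = 0" if "x \<notin> \<Omega>" for x using \<phi>0 g0 AT T\<Omega> that by blast+
    have "(LINT x|lebesgue_on \<Omega>. pw_fun \<T> F x * \<phi> x) = (LINT x|lebesgue_on \<Omega>. F T x * \<phi> x)"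
    proof (rule Bochner_Integration.integral_cong[OF refl])
      fix x show "pw_fun \<T> F x * \<phi> x = F T x * \<phi> x"
        using \<phi>0[of x] AT sum_indicator_interior[OF \<T>(1) TT _ disj, of x "\<lambda>T. F T x"] unfolding pw_fun_def by (cases "x \<in> A") auto
    qed
    also have "\<dots> = (LINT x|lborel. F T x * \<phi> x)"
      by (rule LINT_lebesgue_on_support) (use out \<Omega> in \<open>auto intro!: smooth_fun_borel smooth_fun_mult sF s\<phi>\<close>)
    finally have LF: "(LINT x|lebesgue_on \<Omega>. pw_fun \<T> F x * \<phi> x) = (LINT x|lborel. F T x * \<phi> x)" .
    have "(LINT x|lebesgue_on \<Omega>. pw_grad \<T> p x \<bullet> grad \<phi> x) = (LINT x|lebesgue_on \<Omega>. grad (p T) x \<bullet> grad \<phi> x)"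
    proof (rule Bochner_Integration.integral_cong[OF refl])
      fix x show "pw_grad \<T> p x \<bullet> grad \<phi> x = grad (p T) x \<bullet> grad \<phi> x"
        using g0[of x] AT pw_grad_interior[OF \<T>(1) TT _ disj, of x p] by (cases "x \<in> A") auto
    qed
    also have "\<dots> = (LINT x|lborel. grad (p T) x \<bullet> grad \<phi> x)"
      by (rule LINT_lebesgue_on_support) (use out \<Omega> in \<open>auto intro!: borel_measurable_inner grad_borel sp s\<phi>\<close>)
    also have "\<dots> = - (LINT x|lborel. laplacian (p T) x * \<phi> x)" by (rule Green_whole_space[OF sp s\<phi> bs])
    finally have LG: "(LINT x|lebesgue_on \<Omega>. pw_grad \<T> p x \<bullet> grad \<phi> x) = - (LINT x|lborel. laplacian (p T) x * \<phi> x)" .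
    have int: "integrable lborel (\<lambda>x. q x * \<phi> x)" if "smooth_fun q" for q
      by (intro bounded_support_integrable smooth_fun_continuous smooth_fun_mult that s\<phi> bounded_support_mult bs)
    have i1: "integrable lborel (\<lambda>x. F T x * \<phi> x)" by (rule int[OF sF])
    have i2: "integrable lborel (\<lambda>x. laplacian (p T) x * \<phi> x)"
      by (rule int[OF smooth_fun_poly[OF laplacian_in_polys[OF FP(2)]]])
    have L: "(LINT x|lborel. R x * \<phi> x) = (LINT x|lebesgue_on \<Omega>. X x \<bullet> grad \<phi> x) + (LINT x|lebesgue_on \<Omega>. Y x * \<phi> x)"
      using hyp[OF \<phi>t] i1 i2 unfolding LF LG R_def strong_residual_def by (simp add: distrib_right mult.assoc)
    have "b0 * I = (LINT x:ball b r|lborel. b0 * (R x)\<^sup>2)" unfolding I_def by simp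
    also have "\<dots> \<le> (LINT x|lborel. R x * \<phi> x)"
      unfolding set_lebesgue_integral_def
    proof (rule integral_mono)
      have "set_integrable lborel (ball b r) (\<lambda>x. b0 * (R x)\<^sup>2)"
        by (rule set_integrable_continuous_bounded) (auto intro!: smooth_fun_continuous smooth_fun_scale smooth_fun_power sR)
      then show "integrable lborel (\<lambda>x. indicator (ball b r) x *\<^sub>R (b0 * (R x)\<^sup>2))" by (simp add: set_integrable_def)
      show "integrable lborel (\<lambda>x. R x * \<phi> x)" by (rule int[OF sR])
      fix x
      have e: "R x * \<phi> x = (R x)\<^sup>2 * \<theta> x" by (simp add: \<phi>_def power2_eq_square)
      show "indicator (ball b r) x *\<^sub>R (b0 * (R x)\<^sup>2) \<le> R x * \<phi> x"
      proof (cases "x \<in> ball b r")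
        case True
        then have "b0 \<le> \<theta> x" unfolding b0_def \<theta>_def
          by (intro cutoff_ge) (use r in \<open>auto simp: dist_norm norm_minus_commute\<close>)
        then have "b0 * (R x)\<^sup>2 \<le> \<theta> x * (R x)\<^sup>2" by (rule mult_right_mono) simp
        then show ?thesis unfolding e using True by (simp add: mult.commute)
      qed (use cutoff_range(1)[of "\<lambda>x. x" b "2 * r" x] in \<open>simp add: e \<theta>_def\<close>)
    qed
    also have "\<dots> \<le> sqrt (\<omega> * (2 * r) ^ n) * (sqrt (sqnorm_on X A) * (real CARD('n) * (C1 * (Cb + 1) * s / r)) + sqrt (sqnorm_on Y A) * (C1 * s))"
      unfolding L
    proof (rule order_trans[OF abs_ge_self residual_bound[OF \<Omega>(1,2) X Y \<phi>t \<phi>0]])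
      show "C1 * s \<ge> 0" "C1 * (Cb + 1) * s / r \<ge> 0" using C1 Cb s0 r by auto
      show "compact A" "A \<subseteq> \<Omega>" using AT T\<Omega> by (auto simp: A_def)
      show "measure lebesgue A \<le> \<omega> * (2 * r) ^ n"
        using content_cball[of "2 * r" b] r by (simp add: A_def \<omega>_def n_def)
      fix x i assume x: "x \<in> A"
      then have xh: "x \<in> cball b h" using Ah by blast
      have \<theta>1: "\<bar>\<theta> x\<bar> \<le> 1" unfolding \<theta>_def using cutoff_range[of "\<lambda>x. x" b "2 * r" x] by auto
      have "\<bar>\<phi> x\<bar> \<le> (C1 * s) * 1" unfolding \<phi>_def abs_mult by (intro mult_mono Rb[OF xh] \<theta>1) (use C1 s0 in auto)
      then show "\<bar>\<phi> x\<bar> \<le> C1 * s" by simp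
      have "partial i \<phi> x = R x * partial i \<theta> x + partial i R x * \<theta> x"
        unfolding \<phi>_def[abs_def] by (intro partial_mult smooth_fun_differentiable sR s\<theta>)
      then have "\<bar>partial i \<phi> x\<bar> \<le> \<bar>R x\<bar> * \<bar>partial i \<theta> x\<bar> + \<bar>partial i R x\<bar> * \<bar>\<theta> x\<bar>" by (simp add: abs_mult[symmetric])
      also have "\<dots> \<le> (C1 * s) * (Cb / (2 * r)) + (C1 * s / r) * 1"
        by (intro add_mono mult_mono Rb[OF xh] \<theta>1 Cb(2)[OF lid, of "2 * r" i b x, folded \<theta>_def])
          (use C1 s0 r in auto)
      also have "\<dots> \<le> (C1 * s) * (Cb / r) + (C1 * s / r) * 1"
        using C1 s0 r Cb by (intro add_mono mult_left_mono divide_left_mono) auto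
      also have "\<dots> = C1 * (Cb + 1) * s / r" by (simp add: algebra_simps add_divide_distrib)
      finally show "\<bar>partial i \<phi> x\<bar> \<le> C1 * (Cb + 1) * s / r" .
    qed
    finally have main: "b0 * I \<le> sqrt (\<omega> * (2 * r) ^ n) * (sqrt (sqnorm_on X A) * (real n * (C1 * (Cb + 1) * s / r)) + sqrt (sqnorm_on Y A) * (C1 * s))"
      unfolding n_def .
    define x y where "x = sqrt (sqnorm_on X A)" and "y = sqrt (sqnorm_on Y A)"
    have xy: "x \<ge> 0" "y \<ge> 0" unfolding x_def y_def using sqnorm_on_nonneg by auto
    define t where "t = sqrt (r ^ n)"
    have t: "t > 0" "t\<^sup>2 = r ^ n" using r by (auto simp: t_def)
    have "sqrt (\<omega> * (2 * r) ^ n) = sqrt (\<omega> * 2 ^ n) * t" by (simp add: t_def power_mult_distrib real_sqrt_mult mult_ac)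
    then have "b0 * (s\<^sup>2 * t\<^sup>2) \<le> sqrt (\<omega> * 2 ^ n) * t * (x * (real n * (C1 * (Cb + 1) * s / r)) + y * (C1 * s))"
      using main unfolding Is t(2) x_def y_def by simp
    also have "\<dots> \<le> sqrt (\<omega> * 2 ^ n) * t * ((real n * C1 * (Cb + 1)) * s * (x / r + y))"
    proof (rule mult_left_mono)
      have "y * (C1 * s) * 1 \<le> y * (C1 * s) * (real n * (Cb + 1))"
        using xy C1 s0 n0 Cb mult_mono[of 1 "real n" 1 "Cb + 1"] by (intro mult_left_mono) auto
      then show "x * (real n * (C1 * (Cb + 1) * s / r)) + y * (C1 * s) \<le> (real n * C1 * (Cb + 1)) * s * (x / r + y)"
        by (simp add: algebra_simps add_divide_distrib)
      show "0 \<le> sqrt (\<omega> * 2 ^ n) * t" using \<omega> t by simp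
    qed
    also have "\<dots> = b0 * (C2 * s * t * (x / r + y))" using b0 by (simp add: C2_def mult_ac)
    finally have "s * t * (s * t) \<le> s * t * (C2 * (x / r + y))" using b0 by (simp add: power2_eq_square mult_ac)
    \<comment> \<open>Division by s t, which is legitimate unless s t = 0, where the claim is
      trivial.\<close>
    then have "s * t \<le> C2 * (x / r + y)"
    proof (cases "s * t = 0")
      case True
      have "0 \<le> C2 * (x / r + y)" using C2 xy r by simp
      then show ?thesis using True by linarith
    next
      case False
      then have "s * t > 0" using s0 t by (simp add: less_le)
      then show ?thesis using \<open>s * t * (s * t) \<le> s * t * (C2 * (x / r + y))\<close> mult_left_le_imp_le by blast
    qed
    then have "(s * t)\<^sup>2 \<le> (C2 * (x / r + y))\<^sup>2" using s0 t by (intro power_mono) auto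
    also have "\<dots> \<le> C2\<^sup>2 * (2 * ((x / r)\<^sup>2 + y\<^sup>2))"
      unfolding power_mult_distrib using sum_squares_bound[of "x / r" y]
      by (intro mult_left_mono) (auto simp: power2_sum)
    also have "(x / r)\<^sup>2 = sqnorm_on X A * (16 / c\<^sup>2) / h\<^sup>2"
      using c h sqnorm_on_nonneg[of X A] by (simp add: x_def r_def power_divide power_mult_distrib)
    also have "y\<^sup>2 = sqnorm_on Y A" using sqnorm_on_nonneg[of Y A] by (simp add: y_def)
    finally have st: "s\<^sup>2 * r ^ n \<le> C2\<^sup>2 * (2 * (sqnorm_on X A * (16 / c\<^sup>2) / h\<^sup>2 + sqnorm_on Y A))"
      by (simp add: power_mult_distrib t(2))
    have XA: "sqnorm_on X A \<le> sqnorm_on X (interior T)" "sqnorm_on Y A \<le> sqnorm_on Y (interior T)"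
      using \<Omega>(1) AT T\<Omega> by (auto intro!: sqnorm_on_mono[OF X] sqnorm_on_mono[OF Y] simp: A_def)
    have "sqnorm_on R T \<le> (C1 * s)\<^sup>2 * (\<omega> * h ^ n)"
    proof (rule sqnorm_on_sup_le[OF is_element_compact[OF el] smooth_fun_continuous[OF sR]])
      show "\<bar>R x\<bar> \<le> C1 * s" if "x \<in> T" for x using Rb(1) Tsub that by blast
      have "measure lborel T \<le> measure lborel (cball b h)"
        using Tsub is_element_compact[OF el]
        by (intro measure_mono_fmeasurable fmeasurable_closed_bounded) (auto simp: compact_imp_closed)
      then show "measure lborel T \<le> \<omega> * h ^ n" using content_cball[of h b] h by (simp add: \<omega>_def n_def)
    qed
    also have "\<dots> = C1\<^sup>2 * \<omega> * (4 / c) ^ n * (s\<^sup>2 * r ^ n)"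
      by (simp only: hr power_mult_distrib) (simp add: mult_ac)
    also have "\<dots> \<le> C1\<^sup>2 * \<omega> * (4 / c) ^ n * (C2\<^sup>2 * (2 * (sqnorm_on X A * (16 / c\<^sup>2) / h\<^sup>2 + sqnorm_on Y A)))"
      using st \<omega> c by (intro mult_left_mono) auto
    also have "\<dots> \<le> C1\<^sup>2 * \<omega> * (4 / c) ^ n * (C2\<^sup>2 * (2 * ((16 / c\<^sup>2 + 1) * (sqnorm_on X (interior T) / h\<^sup>2 + sqnorm_on Y (interior T)))))"
    proof (intro mult_left_mono)
      have "sqnorm_on X A * (16 / c\<^sup>2) / h\<^sup>2 \<le> (16 / c\<^sup>2 + 1) * (sqnorm_on X (interior T) / h\<^sup>2)"
      proof -
        have "sqnorm_on X A * (16 / c\<^sup>2) / h\<^sup>2 = (16 / c\<^sup>2) * (sqnorm_on X A / h\<^sup>2)" by simp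
        also have "\<dots> \<le> (16 / c\<^sup>2 + 1) * (sqnorm_on X (interior T) / h\<^sup>2)"
          using XA(1) sqnorm_on_nonneg[of X A] by (intro mult_mono divide_right_mono) auto
        finally show ?thesis .
      qed
      moreover have "1 * sqnorm_on Y A \<le> (16 / c\<^sup>2 + 1) * sqnorm_on Y (interior T)"
        using XA(2) sqnorm_on_nonneg[of Y A] by (intro mult_mono) auto
      ultimately show "sqnorm_on X A * (16 / c\<^sup>2) / h\<^sup>2 + sqnorm_on Y A \<le> (16 / c\<^sup>2 + 1) * (sqnorm_on X (interior T) / h\<^sup>2 + sqnorm_on Y (interior T))"
        unfolding distrib_left[of "16 / c\<^sup>2 + 1"] by simp
    qed (use \<omega> c in auto)
    also have "\<dots> = C * (sqnorm_on X (interior T) / h\<^sup>2 + sqnorm_on Y (interior T))" by (simp add: C_def mult_ac)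
    finally show "sqnorm_on (strong_residual \<kappa> F p T) T \<le> C * (sqnorm_on X (interior T) / (diameter T)\<^sup>2 + sqnorm_on Y (interior T))"
      unfolding R_def h_def .
  qed
qed

lemma sqnorm_on_cover:
  assumes Z: "square_integrable (lebesgue_on \<Omega>) Z" "\<Omega> \<in> sets lebesgue"
    and S: "S \<subseteq> \<Omega>" "S \<in> sets lebesgue" and T: "T \<subseteq> \<Omega>" "T \<in> sets lebesgue" and A: "A \<subseteq> \<Omega>" "A \<in> sets lebesgue"
    and ae: "AE x in lebesgue. x \<in> A \<longrightarrow> x \<in> S \<or> x \<in> T"
  shows "sqnorm_on Z A \<le> sqnorm_on Z S + sqnorm_on Z T"
proof -
  have i: "integrable lebesgue (\<lambda>x. indicator B x *\<^sub>R (norm (Z x))\<^sup>2)" if "B \<subseteq> \<Omega>" "B \<in> sets lebesgue" for B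
    using square_integrable_set_integrable[OF Z that] by (simp add: set_integrable_def)
  have "sqnorm_on Z A \<le> (LINT x|lebesgue. indicator S x *\<^sub>R (norm (Z x))\<^sup>2 + indicator T x *\<^sub>R (norm (Z x))\<^sup>2)"
    unfolding sqnorm_on_def set_lebesgue_integral_def
  proof (rule integral_mono_AE[OF i[OF A] Bochner_Integration.integrable_add[OF i[OF S] i[OF T]]])
    show "AE x in lebesgue. indicator A x *\<^sub>R (norm (Z x))\<^sup>2 \<le> indicator S x *\<^sub>R (norm (Z x))\<^sup>2 + indicator T x *\<^sub>R (norm (Z x))\<^sup>2"
      using ae by eventually_elim (auto simp: indicator_def)
  qed
  also have "\<dots> = sqnorm_on Z S + sqnorm_on Z T"
    unfolding sqnorm_on_def set_lebesgue_integral_def using i[OF S] i[OF T] by simp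
  finally show ?thesis .
qed

lemma continuous_set_integrable_lebesgue:
  fixes f :: "'a::euclidean_space \<Rightarrow> real"
  assumes "continuous_on UNIV f" "compact S"
  shows "set_integrable lebesgue S f"
proof -
  have "integrable lborel (\<lambda>x. indicator S x *\<^sub>R f x)"
    using set_integrable_continuous_bounded[OF assms(1), of S] assms(2)
    by (simp add: set_integrable_def compact_imp_bounded compact_imp_closed)
  then show ?thesis unfolding set_integrable_def by (subst integrable_completion) auto
qed

lemma laplacian_diff:
  assumes "smooth_fun f" "smooth_fun g"
  shows "laplacian (\<lambda>x. f x - g x) x = laplacian f x - laplacian g x"
proof -
  have "partial i (\<lambda>x. f x - g x) = (\<lambda>x. partial i f x - partial i g x)" for i
    by (intro ext partial_diff smooth_fun_differentiable assms)
  then show ?thesis unfolding laplacian_def sum_subtractf[symmetric]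
    by (simp add: partial_diff smooth_fun_differentiable smooth_fun_partial assms)
qed

lemma linear_prj: "linear (\<lambda>h. h - (h \<bullet> \<nu>) *\<^sub>R \<nu>)" and linear_normal: "linear (\<lambda>h. (h \<bullet> \<nu>) *\<^sub>R \<nu>)"
  by (auto intro!: linearI simp: inner_add_left algebra_simps)

text \<open>Constant extension along \<nu> is composition with an affine map, so the degree does not
  grow and the extended jump remains subject to the polynomial estimates.\<close>

lemma prj_polys:
  fixes q :: "real^'n \<Rightarrow> real"
  assumes "q \<in> total_degree_polys N"
  shows "(\<lambda>x. q (prj a \<nu> x)) \<in> total_degree_polys N"
proof -
  have "prj a \<nu> x = (a \<bullet> \<nu>) *\<^sub>R \<nu> + (x - (x \<bullet> \<nu>) *\<^sub>R \<nu>)" for x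
    by (simp add: prj_def inner_diff_left algebra_simps)
  then show ?thesis using polys_affine[OF assms linear_prj, of "(a \<bullet> \<nu>) *\<^sub>R \<nu>" \<nu>] by simp
qed

lemma AE_not_hyperplane:
  fixes \<nu> :: "real^'n"
  assumes "norm \<nu> = 1" shows "AE x in lborel. (x - a) \<bullet> \<nu> \<noteq> 0"
proof -
  have e: "{x. (x - a) \<bullet> \<nu> = 0} = {x. \<nu> \<bullet> x = \<nu> \<bullet> a}" by (simp add: inner_diff_left inner_commute[of \<nu>])
  have "negligible {x. \<nu> \<bullet> x = \<nu> \<bullet> a}" using assms by (intro negligible_hyperplane) auto
  moreover have "{x. \<nu> \<bullet> x = \<nu> \<bullet> a} \<in> sets lborel" using closed_hyperplane[of \<nu> "\<nu> \<bullet> a"] by simp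
  ultimately have "{x. (x - a) \<bullet> \<nu> = 0} \<in> null_sets lborel"
    unfolding e by (simp add: negligible_iff_null_sets null_sets_completion_iff)
  then show ?thesis using AE_not_in by fastforce
qed

text \<open>The test function is the normal jump, extended constantly in the direction \<open>\<nu>\<close>, times a cut-off
  of radius \<open>\<rho> = O(diameter S)\<close> in the tangential directions and a cut-off of width \<open>d = O(\<delta>)\<close> in the
  direction \<open>\<nu>\<close>. The width is left free since the weights \<open>\<alpha>\<^sub>E\<close> require \<open>\<delta> = min {h, \<epsilon>}\<close>.\<close>

lemma face_jump_estimate:
  fixes c :: real
  assumes n2: "CARD('n) \<ge> 2" and c: "c > 0" "c \<le> 1"
  shows "\<exists>C>0. \<forall>(\<Omega> :: (real^'n) set) \<T> \<kappa> F p X Y S T E a \<nu> \<delta>. residual_equation N \<Omega> \<T> \<kappa> F p X Y \<and> \<kappa> \<ge> 0 \<and>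
     S \<in> \<T> \<and> T \<in> \<T> \<and> face_data c S T E a \<nu> \<and> 0 < \<delta> \<and> \<delta> \<le> diameter S \<longrightarrow>
     (\<exists>J\<ge>0. (\<forall>x\<in>E. \<bar>\<Sum>i\<in>UNIV. \<nu> $ i * (partial i (p S) x - partial i (p T) x)\<bar> \<le> J) \<and>
       (\<kappa> * J)\<^sup>2 * diameter S ^ (CARD('n) - 1) \<le>
       C * ((sqnorm_on X (interior S) + sqnorm_on X (interior T)) / \<delta> +
         \<delta> * (sqnorm_on Y (interior S) + sqnorm_on Y (interior T) +
              sqnorm_on (strong_residual \<kappa> F p S) S + sqnorm_on (strong_residual \<kappa> F p T) T)))"
proof -
  define n where "n = CARD('n)"
  have n0: "n \<ge> 1" using n2 by (simp add: n_def)
  \<comment> \<open>Below, r = \<rho> / 2 = c h / 8, hence (8 / c) r = h and the sup bound reaches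
    all of \<open>E\<close>.\<close>
  obtain C1 where C1: "C1 > 0" "\<And>(R::real^'n \<Rightarrow> real) a r x i. R \<in> total_degree_polys N \<Longrightarrow> r > 0 \<Longrightarrow> x \<in> cball a (8 / c * r) \<Longrightarrow>
     \<bar>R x\<bar> \<le> C1 * sqrt ((LINT x:ball a r|lborel. (R x)\<^sup>2) / r ^ n) \<and>
     \<bar>partial i R x\<bar> \<le> C1 * sqrt ((LINT x:ball a r|lborel. (R x)\<^sup>2) / r ^ n) / r"
    using poly_root_bound[of N "8 / c"] unfolding n_def by blast
  obtain Cb where Cb: "Cb > 0" "\<And>(B :: real^'n \<Rightarrow> real^'n) a \<rho> x i. linear B \<Longrightarrow> (\<forall>h. norm (B h) \<le> norm h) \<Longrightarrow> \<rho> > 0 \<Longrightarrow>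
     \<bar>partial i (cutoff B a \<rho>) x\<bar> \<le> Cb / \<rho>"
    using cutoff_partial_bound by blast
  define \<omega> where "\<omega> = unit_ball_vol (real n) * 2 ^ n"
  have \<omega>: "\<omega> > 0" unfolding \<omega>_def by (simp add: unit_ball_vol_pos)
  \<comment> \<open>\<open>bump 1\<close> is the value of the normal cut-off on the plane,
    \<open>bump (3 / 4)\<close> bounds the tangential cut-off from below at half the radius, and 2^n
    converts r^n into \<rho>^n.\<close>
  define b0 where "b0 = bump 1 * bump (3 / 4) / 2 ^ n"
  have b0: "b0 > 0" by (simp add: b0_def bump_pos_iff)
  define C2 where "C2 = sqrt \<omega> * (real n * C1 * (2 * Cb + 2)) / b0"
  have C2: "C2 > 0" unfolding C2_def using \<omega> C1 Cb b0 n0 by (intro divide_pos_pos mult_pos_pos) auto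
  \<comment> \<open>(4 / c)^(n - 1) converts \<rho>^(n - 1) into the same power of the diameter, 3
    arises from the square of a sum of three terms, and the last 4 / c from d = c \<delta> /
    4.\<close>
  define C where "C = C1\<^sup>2 * (4 / c) ^ (n - 1) * (3 * C2\<^sup>2) * (4 / c)"
  have C: "C > 0" unfolding C_def using C1 c C2 by (intro mult_pos_pos) auto
  show ?thesis
  proof (rule exI[of _ C], intro conjI C allI impI)
    fix \<Omega> :: "(real^'n) set" and \<T> \<kappa> F p X Y S T E a \<nu> \<delta>
    assume asm: "residual_equation N \<Omega> \<T> \<kappa> F p X Y \<and> \<kappa> \<ge> 0 \<and>
      S \<in> \<T> \<and> T \<in> \<T> \<and> face_data c S T E a \<nu> \<and> 0 < \<delta> \<and> \<delta> \<le> diameter S"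
    then have eq: "residual_equation N \<Omega> \<T> \<kappa> F p X Y" and \<kappa>: "\<kappa> \<ge> 0" and ST: "S \<in> \<T>" "T \<in> \<T>"
      and fd: "face_data c S T E a \<nu>" and \<delta>: "0 < \<delta>" "\<delta> \<le> diameter S" by blast+
    note rD = residual_equationD[OF eq]
    note \<Omega> = rD(1-3) and \<T> = rD(4,5) and disj = rD(9) and X = rD(10) and Y = rD(11) and hyp = rD(12)
    note FP = rD(7)[OF ST(1)] rD(7)[OF ST(2)] rD(8)[OF ST(1)] rD(8)[OF ST(2)]
    note sFP = FP[THEN smooth_fun_poly]
    have \<Omega>s: "\<Omega> \<in> sets lebesgue" using \<Omega>(1) by auto
    note lm = open_bounded_lmeasurable[OF \<Omega>(1,2)]
    define h where "h = diameter S"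
    have h: "h > 0" unfolding h_def using \<delta> by linarith
    have \<nu>: "norm \<nu> = 1" using fd by (simp add: face_data_def outward_normal_def)
    have inS: "x \<in> S" if "norm (x - a) < c * h" "(x - a) \<bullet> \<nu> \<le> 0" for x using fd that by (auto simp: face_data_def h_def)
    have inT: "x \<in> T" if "norm (x - a) < c * h" "0 \<le> (x - a) \<bullet> \<nu>" for x using fd that by (auto simp: face_data_def h_def)
    have aE: "a \<in> E" using fd by (simp add: face_data_def)
    note on = outward_normal_inner[OF _ aE, of S \<nu>]
    have onS: "outward_normal S E \<nu>" using fd by (simp add: face_data_def)
    have ES: "E \<subseteq> S" and Epl: "\<And>x. x \<in> E \<Longrightarrow> (x - a) \<bullet> \<nu> = 0" using on(2)[OF onS] by auto
    have Eh: "E \<subseteq> cball a h"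
    proof
      fix x assume "x \<in> E"
      then show "x \<in> cball a h"
        using diameter_bounded_bound[OF compact_imp_bounded[OF is_element_compact[OF rD(6)[OF ST(1)]]], of a x] ES aE
        by (auto simp: h_def)
    qed
    \<comment> \<open>Since \<delta> \<le> h, also d \<le> \<rho>, and \<rho> + d \<le> c h / 2
      keeps the cylinder strictly inside the ball provided by \<open>face_data\<close>.\<close>
    define \<rho> where "\<rho> = c * h / 4"
    define d where "d = c * \<delta> / 4"
    define r where "r = \<rho> / 2"
    have \<rho>: "\<rho> > 0" and d: "d > 0" "d \<le> \<rho>" and r: "r > 0" "h = 8 / c * r"
      using c h \<delta> by (auto simp: \<rho>_def d_def r_def h_def mult_left_mono)
    define A where "A = cylinder a \<nu> \<rho> d"
    define H where "H = halfspace a \<nu>"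
    have Hm: "H \<in> sets borel" unfolding H_def by (rule halfspace_measurable)
    have Ac: "compact A" unfolding A_def using closed_cylinder bounded_cylinder[OF \<nu>] by (simp add: compact_eq_bounded_closed)
    have AB: "A \<subseteq> ball a (c * h)"
    proof -
      have "0 < c * h" using c h by simp
      then have "\<rho> + d < c * h" using d(2) unfolding \<rho>_def by linarith
      then show ?thesis using cylinder_subset_cball[OF \<nu>, of a \<rho> d] unfolding A_def by auto
    qed
    have AB': "norm (x - a) < c * h" if "x \<in> A" for x using AB that by (auto simp: dist_norm norm_minus_commute)
    have Ah: "A \<subseteq> cball a h"
    proof -
      have "c * h \<le> h" using c h by simp
      then show ?thesis using AB by auto
    qed
    \<comment> \<open>The two half balls cover a ball in the closure of \<Omega>, and the interior
      of this closure is \<Omega> itself.\<close>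
    have B\<Omega>: "ball a (c * h) \<subseteq> \<Omega>"
    proof -
      have "ball a (c * h) \<subseteq> S \<union> T"
      proof
        fix x assume "x \<in> ball a (c * h)"
        then have "norm (x - a) < c * h" by (simp add: dist_norm norm_minus_commute)
        then show "x \<in> S \<union> T" using inS[of x] inT[of x] by (cases "(x - a) \<bullet> \<nu> \<le> 0") auto
      qed
      then have "ball a (c * h) \<subseteq> closure \<Omega>" using \<T>(2) ST by blast
      then have "ball a (c * h) \<subseteq> interior (closure \<Omega>)" by (simp add: interior_maximal)
      then show ?thesis using \<Omega>(3) by simp
    qed
    have A\<Omega>: "A \<subseteq> \<Omega>" using AB B\<Omega> by blast
    have intS: "x \<in> interior S" if "x \<in> A" "(x - a) \<bullet> \<nu> < 0" for x
    proof -
      have "open {x. norm (x - a) < c * h \<and> (x - a) \<bullet> \<nu> < 0}" by (intro open_Collect_conj open_Collect_less continuous_intros)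
      then have "{x. norm (x - a) < c * h \<and> (x - a) \<bullet> \<nu> < 0} \<subseteq> interior S" using inS by (intro interior_maximal) auto
      then show ?thesis using that AB' by blast
    qed
    have intT: "x \<in> interior T" if "x \<in> A" "0 < (x - a) \<bullet> \<nu>" for x
    proof -
      have "open {x. norm (x - a) < c * h \<and> 0 < (x - a) \<bullet> \<nu>}" by (intro open_Collect_conj open_Collect_less continuous_intros)
      then have "{x. norm (x - a) < c * h \<and> 0 < (x - a) \<bullet> \<nu>} \<subseteq> interior T" using inT by (intro interior_maximal) auto
      then show ?thesis using that AB' by blast
    qed
    have int\<Omega>: "interior S \<subseteq> \<Omega>" "interior T \<subseteq> \<Omega>"
      using interior_mono[of S "closure \<Omega>"] interior_mono[of T "closure \<Omega>"] \<T>(2) ST \<Omega>(3) by blast+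
    have aepl: "AE x in lborel. (x - a) \<bullet> \<nu> \<noteq> 0" by (rule AE_not_hyperplane[OF \<nu>])
    \<comment> \<open>Near the face the piecewise polynomial is written as p T everywhere plus q on
      the half space of S. Green's formula on the whole space for p T and on the half space for q
      then leaves a single plane integral, that of the jump.\<close>
    define q where "q x = p S x - p T x" for x
    have sq: "smooth_fun q" unfolding q_def[abs_def] by (intro smooth_fun_diff sFP)
    have pq: "partial i q x = partial i (p S) x - partial i (p T) x" for i x
      unfolding q_def[abs_def] by (intro partial_diff smooth_fun_differentiable sFP)
    define J where "J x = (\<Sum>i\<in>UNIV. \<nu> $ i * partial i q x)" for x
    have JP: "J \<in> total_degree_polys N"
      unfolding J_def[abs_def] pq by (intro polys_sum polys_scale polys_diff partial_in_polys FP)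
    define J' where "J' x = J (prj a \<nu> x)" for x
    have J'P: "J' \<in> total_degree_polys N" unfolding J'_def[abs_def] by (rule prj_polys[OF JP])
    note sJ' = smooth_fun_poly[OF J'P]
    define I where "I = (LINT x:ball a r|lborel. (J' x)\<^sup>2)"
    have I0: "I \<ge> 0" unfolding I_def set_lebesgue_integral_def by (rule integral_nonneg_AE) auto
    define s where "s = sqrt (I / r ^ n)"
    have s0: "s \<ge> 0" using I0 r by (simp add: s_def)
    have Is: "I = s\<^sup>2 * r ^ n" using I0 r by (simp add: s_def)
    have Jb: "\<bar>J' x\<bar> \<le> C1 * s" "\<bar>partial i J' x\<bar> \<le> C1 * s / r" if "x \<in> cball a h" for x i
      using C1(2)[OF J'P r(1), of x a i] that unfolding r(2)[symmetric] s_def I_def by auto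
    let ?B1 = "\<lambda>h. h - (h \<bullet> \<nu>) *\<^sub>R \<nu>" and ?B2 = "\<lambda>h. (h \<bullet> \<nu>) *\<^sub>R \<nu>"
    have B1: "\<forall>h. norm (?B1 h) \<le> norm h"
      using prj_norm_le[OF \<nu>, of 0] by (simp add: prj_def)
    have B2: "\<forall>h. norm (?B2 h) \<le> norm h"
      using Cauchy_Schwarz_ineq2[of _ \<nu>] \<nu> by simp
    define \<beta> where "\<beta> = cutoff ?B1 a \<rho>"
    define \<tau> where "\<tau> = cutoff ?B2 a d"
    have s\<beta>: "smooth_fun \<beta>" and s\<tau>: "smooth_fun \<tau>" unfolding \<beta>_def \<tau>_def
      by (intro cutoff_smooth linear_prj linear_normal)+
    have B1e: "?B1 (x - a) = prj a \<nu> x - a" for x by (simp add: prj_def)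
    define \<phi> where "\<phi> x = J' x * (\<beta> x * \<tau> x)" for x
    have s\<phi>: "smooth_fun \<phi>" unfolding \<phi>_def[abs_def] by (intro smooth_fun_mult sJ' s\<beta> s\<tau>)
    have \<phi>0: "\<phi> x = 0" if "x \<notin> A" for x
    proof -
      have "\<rho> < norm (prj a \<nu> x - a) \<or> d < norm (?B2 (x - a))" using that \<nu> by (auto simp: A_def cylinder_def)
      then have "\<beta> x = 0 \<or> \<tau> x = 0"
        unfolding \<beta>_def \<tau>_def using \<rho> d cutoff_eq_0[of \<rho> ?B1 x a] cutoff_eq_0[of d ?B2 x a] unfolding B1e by linarith
      then show ?thesis by (auto simp: \<phi>_def)
    qed
    have g0: "grad \<phi> x = 0" if "x \<notin> A" for x
    proof -
      have "partial i \<phi> x = 0" for i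
        by (rule partial_eq_0[of "- A"]) (use that \<phi>0 Ac in \<open>auto intro!: open_Compl compact_imp_closed\<close>)
      then show ?thesis by (simp add: grad_def vec_eq_iff)
    qed
    have \<phi>t: "\<phi> \<in> test_functions \<Omega>"
      by (rule test_functionsI[OF s\<phi> Ac A\<Omega> \<phi>0])
    have bs: "bounded_support \<phi>" by (rule test_functions_bounded_support[OF \<phi>t])
    have out: "\<phi> x = 0" "grad \<phi> x = 0" if "x \<notin> \<Omega>" for x using \<phi>0 g0 A\<Omega> that by blast+
    let ?RS = "strong_residual \<kappa> F p S" and ?RT = "strong_residual \<kappa> F p T"
    have RP: "?RS \<in> total_degree_polys N" "?RT \<in> total_degree_polys N"
      using strong_residual_poly[of F S N p \<kappa>] strong_residual_poly[of F T N p \<kappa>] FP by auto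
    note sR = RP[THEN smooth_fun_poly]
    \<comment> \<open>The strong residual of whichever side contains x, split in the same
      way.\<close>
    define Rw where "Rw x = ?RT x + indicator H x *\<^sub>R (?RS x - ?RT x)" for x
    have Rwm: "Rw \<in> borel_measurable borel" unfolding Rw_def[abs_def]
      by (intro borel_measurable_add borel_measurable_scaleR borel_measurable_diff borel_measurable_indicator smooth_fun_borel sR Hm)
    have int: "integrable lborel (\<lambda>x. u x * \<phi> x)" "set_integrable lborel H (\<lambda>x. u x * \<phi> x)" if "smooth_fun u" for u
      by (intro bounded_support_integrable smooth_fun_continuous smooth_indicator_integrable smooth_fun_mult that s\<phi> bounded_support_mult bs Hm)+
    have pw: "(LINT x|lborel. (u x + indicator H x *\<^sub>R w x) * \<phi> x) = (LINT x|lborel. u x * \<phi> x) + (LINT x:H|lborel. w x * \<phi> x)"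
      if "smooth_fun u" "smooth_fun w" for u w
    proof -
      have "(u x + indicator H x *\<^sub>R w x) * \<phi> x = u x * \<phi> x + indicator H x *\<^sub>R (w x * \<phi> x)" for x by (simp add: algebra_simps)
      then show ?thesis using int(1)[OF that(1)] int(2)[OF that(2)]
        unfolding set_integrable_def set_lebesgue_integral_def by simp
    qed
    have ind: "indicator H x = (if (x - a) \<bullet> \<nu> \<le> 0 then 1 else 0 :: real)" for x by (auto simp: H_def halfspace_def)
    have LF: "(LINT x|lebesgue_on \<Omega>. pw_fun \<T> F x * \<phi> x) = (LINT x|lborel. F T x * \<phi> x) + (LINT x:H|lborel. (F S x - F T x) * \<phi> x)"
    proof -
      have pwm: "pw_fun \<T> F \<in> borel_measurable borel"
        unfolding pw_fun_def[abs_def]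
        by (intro borel_measurable_sum borel_measurable_scaleR borel_measurable_indicator smooth_fun_borel smooth_fun_poly[OF rD(7)]) auto
      have "(LINT x|lebesgue_on \<Omega>. pw_fun \<T> F x * \<phi> x) = (LINT x|lborel. pw_fun \<T> F x * \<phi> x)"
        by (rule LINT_lebesgue_on_support[OF borel_measurable_times[OF pwm smooth_fun_borel[OF s\<phi>]]]) (use out \<Omega> in auto)
      also have "\<dots> = (LINT x|lborel. (F T x + indicator H x *\<^sub>R (F S x - F T x)) * \<phi> x)"
      proof (rule integral_cong_AE)
        show "AE x in lborel. pw_fun \<T> F x * \<phi> x = (F T x + indicator H x *\<^sub>R (F S x - F T x)) * \<phi> x"
          using aepl
        proof eventually_elim
          case (elim x)
          show ?case
          proof (cases "x \<in> A")
            case True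
            then have "pw_fun \<T> F x = F T x + indicator H x *\<^sub>R (F S x - F T x)"
              using elim intS[OF True] intT[OF True] sum_indicator_interior[OF \<T>(1) ST(1) _ disj, of x "\<lambda>T. F T x"]
                sum_indicator_interior[OF \<T>(1) ST(2) _ disj, of x "\<lambda>T. F T x"]
              unfolding ind pw_fun_def by (cases "(x - a) \<bullet> \<nu> < 0") auto
            then show ?thesis by simp
          qed (simp add: \<phi>0)
        qed
        show "(\<lambda>x. (F T x + indicator H x *\<^sub>R (F S x - F T x)) * \<phi> x) \<in> borel_measurable lborel"
          using smooth_fun_borel[OF sFP(1)] smooth_fun_borel[OF sFP(2)] smooth_fun_borel[OF s\<phi>] Hm by measurable
      qed (use pwm smooth_fun_borel[OF s\<phi>] in measurable)
      also have "\<dots> = (LINT x|lborel. F T x * \<phi> x) + (LINT x:H|lborel. (F S x - F T x) * \<phi> x)"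
        by (intro pw smooth_fun_diff sFP)
      finally show ?thesis .
    qed
    have gq: "grad q x = grad (p S) x - grad (p T) x" for x by (simp add: grad_def vec_eq_iff pq)
    have LG: "(LINT x|lebesgue_on \<Omega>. pw_grad \<T> p x \<bullet> grad \<phi> x) =
      (LINT x|lborel. grad (p T) x \<bullet> grad \<phi> x) + (LINT x:H|lborel. grad q x \<bullet> grad \<phi> x)"
    proof -
      have gm: "grad \<phi> \<in> borel_measurable borel" "grad (p T) \<in> borel_measurable borel" "grad q \<in> borel_measurable borel"
        by (intro grad_borel s\<phi> sFP sq)+
      have pwm: "pw_grad \<T> p \<in> borel_measurable borel"
        unfolding pw_grad_def[abs_def]
        by (intro borel_measurable_sum borel_measurable_scaleR borel_measurable_indicator grad_borel smooth_fun_poly[OF rD(8)]) auto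
      have "(LINT x|lebesgue_on \<Omega>. pw_grad \<T> p x \<bullet> grad \<phi> x) = (LINT x|lborel. pw_grad \<T> p x \<bullet> grad \<phi> x)"
        by (rule LINT_lebesgue_on_support[OF borel_measurable_inner[OF pwm gm(1)]]) (use out \<Omega> in auto)
      also have "\<dots> = (LINT x|lborel. grad (p T) x \<bullet> grad \<phi> x + indicator H x *\<^sub>R (grad q x \<bullet> grad \<phi> x))"
      proof (rule integral_cong_AE)
        show "AE x in lborel. pw_grad \<T> p x \<bullet> grad \<phi> x = grad (p T) x \<bullet> grad \<phi> x + indicator H x *\<^sub>R (grad q x \<bullet> grad \<phi> x)"
          using aepl
        proof eventually_elim
          case (elim x)
          show ?case
          proof (cases "x \<in> A")
            case True
            then show ?thesis
              using elim intS[OF True] intT[OF True] pw_grad_interior[OF \<T>(1) ST(1) _ disj, of x p]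
                pw_grad_interior[OF \<T>(1) ST(2) _ disj, of x p]
              unfolding ind gq by (cases "(x - a) \<bullet> \<nu> < 0") (auto simp: inner_diff_left)
          qed (simp add: g0)
        qed
      qed (use gm pwm Hm in measurable)
      also have "\<dots> = (LINT x|lborel. grad (p T) x \<bullet> grad \<phi> x) + (LINT x:H|lborel. grad q x \<bullet> grad \<phi> x)"
      proof -
        have sg: "smooth_fun (\<lambda>x. grad u x \<bullet> grad \<phi> x)" if "smooth_fun u" for u
          unfolding grad_inner by (intro smooth_fun_sum smooth_fun_mult smooth_fun_partial that s\<phi>)
        have bg: "bounded_support (\<lambda>x. grad u x \<bullet> grad \<phi> x)" for u
        proof -
          obtain R where R: "\<forall>x\<in>A. norm x \<le> R" using compact_imp_bounded[OF Ac] unfolding bounded_iff by blast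
          have "grad \<phi> x = 0" if "R < norm x" for x
          proof (rule g0)
            show "x \<notin> A" using R that by auto
          qed
          then show ?thesis unfolding bounded_support_def by (intro exI[of _ R]) auto
        qed
        have "integrable lborel (\<lambda>x. grad (p T) x \<bullet> grad \<phi> x)"
          by (intro bounded_support_integrable smooth_fun_continuous sg bg sFP)
        moreover have "set_integrable lborel H (\<lambda>x. grad q x \<bullet> grad \<phi> x)"
          by (intro smooth_indicator_integrable sg bg sq Hm)
        ultimately show ?thesis unfolding set_integrable_def set_lebesgue_integral_def by simp
      qed
      finally show ?thesis .
    qed
    \<comment> \<open>P is to be bounded from below by the square of the jump and, after
      multiplication by \<kappa>, from above by the errors and the strong residuals.\<close>
    define P where "P = plane_integral a \<nu> (\<lambda>x. J x * \<phi> x)"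
    have G1: "(LINT x|lborel. grad (p T) x \<bullet> grad \<phi> x) = - (LINT x|lborel. laplacian (p T) x * \<phi> x)"
      by (rule Green_whole_space[OF sFP(4) s\<phi> bs])
    have G2: "(LINT x:H|lborel. grad q x \<bullet> grad \<phi> x) = P - (LINT x:H|lborel. laplacian q x * \<phi> x)"
      unfolding H_def P_def J_def by (rule halfspace_Green[OF sq s\<phi> bs \<nu>])
    have sl: "smooth_fun (laplacian (p T))" "smooth_fun (laplacian (p S))"
      by (rule smooth_fun_poly[OF laplacian_in_polys[OF FP(4)]], rule smooth_fun_poly[OF laplacian_in_polys[OF FP(3)]])
    have lq: "laplacian q x = laplacian (p S) x - laplacian (p T) x" for x
      unfolding q_def[abs_def] by (intro laplacian_diff sFP)
    have slq: "smooth_fun (laplacian q)" using smooth_fun_diff[OF sl(2,1)] lq by (metis (no_types, lifting) ext)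
    have "(LINT x|lborel. Rw x * \<phi> x) = (LINT x|lborel. ?RT x * \<phi> x) + (LINT x:H|lborel. (?RS x - ?RT x) * \<phi> x)"
      unfolding Rw_def by (intro pw smooth_fun_diff sR)
    also have "(LINT x|lborel. ?RT x * \<phi> x) = (LINT x|lborel. F T x * \<phi> x) + \<kappa> * (LINT x|lborel. laplacian (p T) x * \<phi> x)"
      using int(1)[OF sFP(2)] int(1)[OF sl(1)] by (simp add: strong_residual_def distrib_right mult.assoc)
    also have "(LINT x:H|lborel. (?RS x - ?RT x) * \<phi> x) = (LINT x:H|lborel. (F S x - F T x) * \<phi> x + \<kappa> * (laplacian q x * \<phi> x))"
      by (simp add: strong_residual_def lq algebra_simps)
    also have "\<dots> = (LINT x:H|lborel. (F S x - F T x) * \<phi> x) + \<kappa> * (LINT x:H|lborel. laplacian q x * \<phi> x)"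
      using int(2)[OF smooth_fun_diff[OF sFP(1,2)]] int(2)[OF slq] by (subst set_integral_add(2)) auto
    finally have RwL: "(LINT x|lborel. Rw x * \<phi> x) = (LINT x|lebesgue_on \<Omega>. pw_fun \<T> F x * \<phi> x)
      - \<kappa> * (LINT x|lebesgue_on \<Omega>. pw_grad \<T> p x \<bullet> grad \<phi> x) + \<kappa> * P"
      unfolding LF LG G1 G2 by (simp add: algebra_simps)
    have "(LINT x|lebesgue_on \<Omega>. Rw x \<bullet> \<phi> x) = (LINT x|lborel. Rw x * \<phi> x)"
      unfolding inner_real_def
      by (rule LINT_lebesgue_on_support[OF borel_measurable_times[OF Rwm smooth_fun_borel[OF s\<phi>]]]) (use out \<Omega> in auto)
    then have \<kappa>P: "\<kappa> * P = (LINT x|lebesgue_on \<Omega>. Rw x \<bullet> \<phi> x)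
      - ((LINT x|lebesgue_on \<Omega>. X x \<bullet> grad \<phi> x) + (LINT x|lebesgue_on \<Omega>. Y x * \<phi> x))"
      using RwL hyp[OF \<phi>t] by simp
    define V where "V = \<omega> * \<rho> ^ (n - 1) * d"
    have VA: "measure lebesgue A \<le> V"
      using measure_cylinder_le[OF \<nu> \<rho>, of d a] d closed_cylinder[of a \<nu> \<rho> d]
      by (simp add: A_def V_def \<omega>_def n_def measure_completion)
    \<comment> \<open>Each cut-off contributes Cb / d, and the derivative of J' contributes 1 / r =
      2 / \<rho> \<le> 2 / d: the normal width is the smallest scale and dominates.\<close>
    define M1 where "M1 = C1 * s * (2 * Cb + 2) / d"
    have M: "C1 * s \<ge> 0" "M1 \<ge> 0" unfolding M1_def using C1 s0 Cb d by auto
    have bb: "\<bar>\<beta> x\<bar> \<le> 1" "\<bar>\<tau> x\<bar> \<le> 1" for x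
      unfolding \<beta>_def \<tau>_def using cutoff_range[of ?B1 a \<rho> x] cutoff_range[of ?B2 a d x] by auto
    have \<phi>b: "\<bar>\<phi> x\<bar> \<le> C1 * s" if "x \<in> A" for x
    proof -
      have "\<bar>\<phi> x\<bar> \<le> (C1 * s) * (1 * 1)" unfolding \<phi>_def abs_mult
        by (intro mult_mono Jb bb) (use M Ah that in auto)
      then show ?thesis by simp
    qed
    have \<phi>b0: "norm (\<phi> x) \<le> C1 * s" for x using \<phi>b \<phi>0 M by (cases "x \<in> A") auto
    have d\<phi>: "\<bar>partial i \<phi> x\<bar> \<le> M1" if "x \<in> A" for x i
    proof -
      have xh: "x \<in> cball a h" using Ah that by blast
      have "partial i \<phi> x = J' x * (\<beta> x * partial i \<tau> x + partial i \<beta> x * \<tau> x) + partial i J' x * (\<beta> x * \<tau> x)"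
        unfolding \<phi>_def[abs_def]
        by (subst partial_mult, (intro smooth_fun_differentiable sJ' smooth_fun_mult s\<beta> s\<tau>)+,
            subst partial_mult, (intro smooth_fun_differentiable s\<beta> s\<tau>)+, simp)
      then have "\<bar>partial i \<phi> x\<bar> \<le> \<bar>J' x\<bar> * (\<bar>\<beta> x\<bar> * \<bar>partial i \<tau> x\<bar> + \<bar>partial i \<beta> x\<bar> * \<bar>\<tau> x\<bar>) + \<bar>partial i J' x\<bar> * (\<bar>\<beta> x\<bar> * \<bar>\<tau> x\<bar>)"
      proof -
        assume e: "partial i \<phi> x = J' x * (\<beta> x * partial i \<tau> x + partial i \<beta> x * \<tau> x) + partial i J' x * (\<beta> x * \<tau> x)"
        have "\<bar>J' x * (\<beta> x * partial i \<tau> x + partial i \<beta> x * \<tau> x)\<bar> \<le> \<bar>J' x\<bar> * (\<bar>\<beta> x * partial i \<tau> x\<bar> + \<bar>partial i \<beta> x * \<tau> x\<bar>)"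
          unfolding abs_mult[of "J' x"] by (intro mult_left_mono abs_triangle_ineq) simp
        moreover have "\<bar>partial i \<phi> x\<bar> \<le> \<bar>J' x * (\<beta> x * partial i \<tau> x + partial i \<beta> x * \<tau> x)\<bar> + \<bar>partial i J' x * (\<beta> x * \<tau> x)\<bar>"
          unfolding e by (rule abs_triangle_ineq)
        ultimately show ?thesis unfolding abs_mult by linarith
      qed
      also have "\<dots> \<le> (C1 * s) * (1 * (Cb / d) + (Cb / d) * 1) + (C1 * s / r) * (1 * 1)"
      proof (intro add_mono mult_mono Jb[OF xh] bb)
        show "\<bar>partial i \<tau> x\<bar> \<le> Cb / d" unfolding \<tau>_def by (rule Cb(2)[OF linear_normal B2 d(1)])
        have "\<bar>partial i \<beta> x\<bar> \<le> Cb / \<rho>" unfolding \<beta>_def by (rule Cb(2)[OF linear_prj B1 \<rho>])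
        also have "\<dots> \<le> Cb / d" using Cb d \<rho> by (intro divide_left_mono) auto
        finally show "\<bar>partial i \<beta> x\<bar> \<le> Cb / d" .
      qed (use M Cb d r s0 C1 in auto)
      also have "C1 * s / r \<le> C1 * s * 2 / d"
      proof -
        have "C1 * s / r = C1 * s * 2 / \<rho>" by (simp add: r_def)
        also have "\<dots> \<le> C1 * s * 2 / d" using M d \<rho> by (intro divide_left_mono) auto
        finally show ?thesis .
      qed
      finally show ?thesis unfolding M1_def by (simp add: algebra_simps add_divide_distrib)
    qed
    have sRw: "square_integrable (lebesgue_on \<Omega>) Rw"
    proof -
      have bnd: "\<exists>B. \<forall>x\<in>\<Omega>. \<bar>u x\<bar> \<le> B" if "smooth_fun u" for u
      proof -
        have "bounded (u ` closure \<Omega>)"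
          using \<Omega>(2) by (intro compact_imp_bounded compact_continuous_image smooth_fun_continuous that) (auto simp: compact_eq_bounded_closed)
        then obtain B where "\<forall>x\<in>closure \<Omega>. \<bar>u x\<bar> \<le> B" unfolding bounded_iff by auto
        then show ?thesis using closure_subset[of \<Omega>] by blast
      qed
      obtain BS where BS: "\<forall>x\<in>\<Omega>. \<bar>?RS x\<bar> \<le> BS" using bnd[OF sR(1)] by blast
      obtain BT where BT: "\<forall>x\<in>\<Omega>. \<bar>?RT x\<bar> \<le> BT" using bnd[OF sR(2)] by blast
      have "norm (Rw x) \<le> max BS BT" if x: "x \<in> \<Omega>" for x
      proof (cases "(x - a) \<bullet> \<nu> \<le> 0")
        case True
        then have "Rw x = ?RS x" unfolding Rw_def ind by simp
        then show ?thesis using BS x by (simp add: max.coboundedI1)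
      next
        case False
        then have "Rw x = ?RT x" unfolding Rw_def ind by simp
        then show ?thesis using BT x by (simp add: max.coboundedI2)
      qed
      then show ?thesis
        by (intro square_integrable_bounded[OF lm borel_measurable_lebesgue_on_borel[OF Rwm]])
    qed
    have Al: "A \<in> lmeasurable" using Ac by (rule lmeasurable_compact)
    have z1: "\<bar>LINT x|lebesgue_on \<Omega>. Rw x \<bullet> \<phi> x\<bar> \<le> sqrt V * (sqrt (sqnorm_on Rw A) * (C1 * s))"
      by (rule local_Cauchy_Schwarz[OF \<Omega>s sRw smooth_square_integrable[OF s\<phi> bs lm] \<phi>0 \<phi>b0 Al A\<Omega> VA])
    have xy1: "\<bar>(LINT x|lebesgue_on \<Omega>. X x \<bullet> grad \<phi> x) + (LINT x|lebesgue_on \<Omega>. Y x * \<phi> x)\<bar>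
      \<le> sqrt V * (sqrt (sqnorm_on X A) * (real n * M1) + sqrt (sqnorm_on Y A) * (C1 * s))"
      unfolding n_def by (rule residual_bound[OF \<Omega>(1,2) X Y \<phi>t \<phi>0 \<phi>b d\<phi> M Ac A\<Omega> VA])
    define x y z where "x = sqrt (sqnorm_on X A)" and "y = sqrt (sqnorm_on Y A)" and "z = sqrt (sqnorm_on Rw A)"
    have xyz: "x \<ge> 0" "y \<ge> 0" "z \<ge> 0" unfolding x_def y_def z_def using sqnorm_on_nonneg by auto
    have up: "\<kappa> * P \<le> sqrt V * (x * (real n * M1) + y * (C1 * s) + z * (C1 * s))"
      using z1 xy1 unfolding \<kappa>P x_def y_def z_def distrib_left by linarith
    \<comment> \<open>J' is constant along \<nu>. Enlarging the ball to a cylinder of height \<rho>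
      therefore bounds I by \<rho> times the plane integral of J^2 over a disc of radius \<rho> / 2.
      On the plane, \<phi> is \<open>bump 1\<close> times J times the tangential cut-off, which is
      at least \<open>bump (3 / 4)\<close> on that disc.\<close>
    have low: "bump 1 * bump (3 / 4) * I \<le> P * \<rho>"
    proof -
      define g where "g y = (J y)\<^sup>2 * indicator {y. norm (y - a) \<le> \<rho> / 2} y" for y
      let ?k = "indicator {- (\<rho> / 2)..\<rho> / 2} :: real \<Rightarrow> real"
      let ?cyl = "cylinder a \<nu> (\<rho> / 2) (\<rho> / 2)"
      have e: "g (prj a \<nu> x) * ?k ((x - a) \<bullet> \<nu>) = indicator ?cyl x *\<^sub>R (J' x)\<^sup>2" for x
        by (auto simp: g_def J'_def cylinder_def indicator_def)
      have contJ2: "continuous_on UNIV (\<lambda>x. (J' x)\<^sup>2)" by (intro smooth_fun_continuous smooth_fun_power sJ')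
      have ic: "set_integrable lborel ?cyl (\<lambda>x. (J' x)\<^sup>2)"
        by (rule set_integrable_continuous_bounded[OF contJ2 bounded_cylinder[OF \<nu>]]) (simp add: closed_cylinder)
      have "I \<le> (LINT x:?cyl|lborel. (J' x)\<^sup>2)"
        unfolding I_def set_lebesgue_integral_def
      proof (rule integral_mono)
        show "integrable lborel (\<lambda>x. indicator ?cyl x *\<^sub>R (J' x)\<^sup>2)" using ic by (simp add: set_integrable_def)
        have "set_integrable lborel (ball a r) (\<lambda>x. (J' x)\<^sup>2)" by (rule set_integrable_continuous_bounded[OF contJ2]) auto
        then show "integrable lborel (\<lambda>x. indicator (ball a r) x *\<^sub>R (J' x)\<^sup>2)" by (simp add: set_integrable_def)
        fix x
        have "x \<in> ?cyl" if "x \<in> ball a r"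
        proof -
          have "norm (x - a) \<le> \<rho> / 2" using that by (simp add: r_def dist_norm norm_minus_commute)
          moreover have "\<bar>(x - a) \<bullet> \<nu>\<bar> \<le> norm (x - a)" using Cauchy_Schwarz_ineq2[of "x - a" \<nu>] \<nu> by simp
          ultimately show ?thesis using prj_norm_le[OF \<nu>, of a x] by (auto simp: cylinder_def)
        qed
        then show "indicator (ball a r) x *\<^sub>R (J' x)\<^sup>2 \<le> indicator ?cyl x *\<^sub>R (J' x)\<^sup>2"
          by (auto simp: indicator_def)
      qed
      also have "\<dots> = (LINT x|lborel. g (prj a \<nu> x) * ?k ((x - a) \<bullet> \<nu>))" unfolding e set_lebesgue_integral_def ..
      also have "\<dots> = plane_integral a \<nu> g * (LINT s|lborel. ?k s)"
        by (rule integral_product_slab[OF \<nu>]) (use ic in \<open>simp add: e set_integrable_def\<close>)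
      also have "(LINT s|lborel. ?k s) = \<rho>" using \<rho> by simp
      finally have 1: "I \<le> plane_integral a \<nu> g * \<rho>" .
      let ?K = "slab a \<nu> \<inter> cylinder a \<nu> \<rho> 1"
      have Kb: "bounded ?K" "?K \<in> sets borel" using bounded_cylinder[OF \<nu>, of a \<rho> 1] closed_cylinder[of a \<nu> \<rho> 1] closed_slab[of a \<nu>]
        by (auto intro: bounded_Int)
      have \<phi>p: "J (prj a \<nu> x) * \<phi> (prj a \<nu> x) = bump 1 * ((J' x)\<^sup>2 * \<beta> x)" for x
      proof -
        have "\<beta> (prj a \<nu> x) = \<beta> x" unfolding \<beta>_def cutoff_def B1e prj_prj[OF \<nu>] ..
        moreover have "\<tau> (prj a \<nu> x) = bump 1" unfolding \<tau>_def cutoff_def prj_inner[OF \<nu>] by simp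
        ultimately show ?thesis by (simp add: \<phi>_def J'_def prj_prj[OF \<nu>] power2_eq_square mult_ac)
      qed
      have sup: "indicator (slab a \<nu>) x *\<^sub>R ((J' x)\<^sup>2 * u) = indicator ?K x *\<^sub>R ((J' x)\<^sup>2 * u)"
        if "norm (prj a \<nu> x - a) \<le> \<rho> \<or> u = 0" for x u
        using that by (auto simp: indicator_def cylinder_def slab_def)
      have i1: "integrable lborel (\<lambda>x. indicator (slab a \<nu>) x *\<^sub>R ((J' x)\<^sup>2 * \<beta> x))"
      proof -
        have "set_integrable lborel ?K (\<lambda>x. (J' x)\<^sup>2 * \<beta> x)"
          by (rule set_integrable_continuous_bounded[OF _ Kb]) (intro smooth_fun_continuous smooth_fun_mult smooth_fun_power sJ' s\<beta>)
        moreover have "indicator (slab a \<nu>) x *\<^sub>R ((J' x)\<^sup>2 * \<beta> x) = indicator ?K x *\<^sub>R ((J' x)\<^sup>2 * \<beta> x)" for x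
          by (rule sup) (use cutoff_eq_0[OF \<rho>, of ?B1 x a] in \<open>unfold \<beta>_def B1e, linarith\<close>)
        ultimately show ?thesis by (simp only: set_integrable_def)
      qed
      have "bump (3 / 4) * plane_integral a \<nu> g = (LINT x|lborel. indicator (slab a \<nu>) x *\<^sub>R (bump (3 / 4) * g (prj a \<nu> x)))"
        unfolding plane_integral_def set_integral_mult_right[symmetric] by (simp only: set_lebesgue_integral_def)
      also have "\<dots> \<le> (LINT x|lborel. indicator (slab a \<nu>) x *\<^sub>R ((J' x)\<^sup>2 * \<beta> x))"
      proof (rule integral_mono[OF _ i1])
        let ?K2 = "slab a \<nu> \<inter> cylinder a \<nu> (\<rho> / 2) 1"
        have Kb2: "bounded ?K2" "?K2 \<in> sets borel" using bounded_cylinder[OF \<nu>, of a "\<rho> / 2" 1] closed_cylinder[of a \<nu> "\<rho> / 2" 1] closed_slab[of a \<nu>]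
          by (auto intro: bounded_Int)
        have "set_integrable lborel ?K2 (\<lambda>x. bump (3 / 4) * (J' x)\<^sup>2)"
          by (rule set_integrable_continuous_bounded[OF _ Kb2]) (intro smooth_fun_continuous smooth_fun_scale smooth_fun_power sJ')
        moreover have "indicator (slab a \<nu>) x *\<^sub>R (bump (3 / 4) * g (prj a \<nu> x)) = indicator ?K2 x *\<^sub>R (bump (3 / 4) * (J' x)\<^sup>2)" for x
          by (auto simp: indicator_def cylinder_def slab_def g_def J'_def)
        ultimately show "integrable lborel (\<lambda>x. indicator (slab a \<nu>) x *\<^sub>R (bump (3 / 4) * g (prj a \<nu> x)))"
          by (simp only: set_integrable_def)
        fix x
        have \<beta>0: "0 \<le> \<beta> x" unfolding \<beta>_def by (rule cutoff_range)
        have "bump (3 / 4) * g (prj a \<nu> x) \<le> (J' x)\<^sup>2 * \<beta> x"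
        proof (cases "norm (prj a \<nu> x - a) \<le> \<rho> / 2")
          case True
          then have "bump (3 / 4) \<le> \<beta> x" unfolding \<beta>_def by (intro cutoff_ge[OF \<rho>]) (simp add: B1e)
          then have "bump (3 / 4) * (J' x)\<^sup>2 \<le> \<beta> x * (J' x)\<^sup>2" by (rule mult_right_mono) simp
          then show ?thesis using True by (simp add: g_def J'_def mult.commute)
        next
          case False
          then have "g (prj a \<nu> x) = 0" by (simp add: g_def)
          then show ?thesis using \<beta>0 by simp
        qed
        then show "indicator (slab a \<nu>) x *\<^sub>R (bump (3 / 4) * g (prj a \<nu> x)) \<le> indicator (slab a \<nu>) x *\<^sub>R ((J' x)\<^sup>2 * \<beta> x)"
          by (rule scaleR_left_mono) simp
      qed
      finally have 2: "bump (3 / 4) * plane_integral a \<nu> g \<le> (LINT x|lborel. indicator (slab a \<nu>) x *\<^sub>R ((J' x)\<^sup>2 * \<beta> x))" .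
      have P: "P = bump 1 * (LINT x|lborel. indicator (slab a \<nu>) x *\<^sub>R ((J' x)\<^sup>2 * \<beta> x))"
        unfolding P_def plane_integral_def \<phi>p set_integral_mult_right by (simp only: set_lebesgue_integral_def)
      have "bump 1 * bump (3 / 4) * I \<le> bump 1 * bump (3 / 4) * (plane_integral a \<nu> g * \<rho>)"
        using 1 bump_nonneg by (intro mult_left_mono) auto
      also have "\<dots> = bump 1 * (bump (3 / 4) * plane_integral a \<nu> g) * \<rho>" by (simp add: mult_ac)
      also have "\<dots> \<le> bump 1 * (LINT x|lborel. indicator (slab a \<nu>) x *\<^sub>R ((J' x)\<^sup>2 * \<beta> x)) * \<rho>"
        using 2 bump_nonneg \<rho> by (intro mult_right_mono mult_left_mono) auto
      finally show ?thesis unfolding P .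
    qed
    define t where "t = sqrt (\<rho> ^ (n - 1))"
    have t: "t > 0" "t\<^sup>2 = \<rho> ^ (n - 1)" using \<rho> by (auto simp: t_def)
    have rn: "r ^ n = t\<^sup>2 * \<rho> / 2 ^ n"
      unfolding t(2) r_def power_divide using power_minus_mult[of n \<rho>] n0 by simp
    have "b0 * (s\<^sup>2 * t\<^sup>2) * \<rho> = bump 1 * bump (3 / 4) * I" unfolding Is rn b0_def by (simp add: mult_ac)
    then have "b0 * (s\<^sup>2 * t\<^sup>2) * \<rho> \<le> P * \<rho>" using low by simp
    then have Pl: "b0 * (s\<^sup>2 * t\<^sup>2) \<le> P" using \<rho> by simp
    have sqV: "sqrt V = sqrt \<omega> * t * sqrt d" unfolding V_def t_def by (simp add: real_sqrt_mult)
    have "\<kappa> * (b0 * (s\<^sup>2 * t\<^sup>2)) \<le> \<kappa> * P" using Pl \<kappa> by (rule mult_left_mono)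
    also have "\<dots> \<le> sqrt \<omega> * t * sqrt d * (x * (real n * M1) + y * (C1 * s) + z * (C1 * s))" using up unfolding sqV .
    also have "\<dots> \<le> sqrt \<omega> * t * sqrt d * ((real n * C1 * (2 * Cb + 2)) * s * (x / d + y + z))"
    proof (rule mult_left_mono)
      have "1 \<le> real n * (2 * Cb + 2)" using mult_mono[of 1 "real n" 1 "2 * Cb + 2"] n0 Cb by simp
      then have "u * (C1 * s) * 1 \<le> u * (C1 * s) * (real n * (2 * Cb + 2))" if "u \<ge> 0" for u
        using that M by (intro mult_left_mono) auto
      from this[OF xyz(2)] this[OF xyz(3)]
      show "x * (real n * M1) + y * (C1 * s) + z * (C1 * s) \<le> (real n * C1 * (2 * Cb + 2)) * s * (x / d + y + z)"
        unfolding M1_def by (simp add: algebra_simps add_divide_distrib)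
      show "0 \<le> sqrt \<omega> * t * sqrt d" using \<omega> t d by simp
    qed
    also have "\<dots> = b0 * (C2 * s * t * (sqrt d * (x / d + y + z)))" using b0 by (simp add: C2_def mult_ac)
    finally have "b0 * (s * t * (\<kappa> * (s * t))) \<le> b0 * (s * t * (C2 * (sqrt d * (x / d + y + z))))"
      by (simp add: power2_eq_square mult_ac)
    then have st0: "s * t * (\<kappa> * (s * t)) \<le> s * t * (C2 * (sqrt d * (x / d + y + z)))" using b0 by simp
    \<comment> \<open>Division by s t as in the estimate on the elements; the factor \<kappa> stays
      with the jump.\<close>
    have "\<kappa> * (s * t) \<le> C2 * (sqrt d * (x / d + y + z))"
    proof (cases "s * t = 0")
      case True
      have "0 \<le> C2 * (sqrt d * (x / d + y + z))" using C2 xyz d by simp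
      moreover have "\<kappa> * (s * t) = 0" unfolding True by simp
      ultimately show ?thesis by linarith
    next
      case False
      then have "s * t > 0" using s0 t by (simp add: less_le)
      then show ?thesis using st0 mult_left_le_imp_le by blast
    qed
    then have "(\<kappa> * (s * t))\<^sup>2 \<le> (C2 * (sqrt d * (x / d + y + z)))\<^sup>2" using s0 t \<kappa> by (intro power_mono) auto
    also have "\<dots> = C2\<^sup>2 * (d * (x / d + y + z)\<^sup>2)" using d by (simp add: power_mult_distrib)
    also have "\<dots> \<le> C2\<^sup>2 * (d * (3 * ((x / d)\<^sup>2 + y\<^sup>2 + z\<^sup>2)))"
    proof -
      have "(u + v + w)\<^sup>2 \<le> 3 * (u\<^sup>2 + v\<^sup>2 + w\<^sup>2)" for u v w :: real
        using sum_squares_bound[of u v] sum_squares_bound[of u w] sum_squares_bound[of v w]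
        by (simp add: power2_eq_square algebra_simps)
      then show ?thesis using d by (intro mult_left_mono) auto
    qed
    also have "\<dots> = 3 * C2\<^sup>2 * (x\<^sup>2 / d + d * (y\<^sup>2 + z\<^sup>2))" using d by (simp add: field_simps power2_eq_square)
    also have "x\<^sup>2 = sqnorm_on X A" unfolding x_def using sqnorm_on_nonneg by simp
    also have "y\<^sup>2 = sqnorm_on Y A" unfolding y_def using sqnorm_on_nonneg by simp
    also have "z\<^sup>2 = sqnorm_on Rw A" unfolding z_def using sqnorm_on_nonneg by simp
    finally have st: "(\<kappa> * (s * t))\<^sup>2 \<le> 3 * C2\<^sup>2 * (sqnorm_on X A / d + d * (sqnorm_on Y A + sqnorm_on Rw A))" .
    \<comment> \<open>The part of the cylinder outside both interiors lies in the plane of the face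
      and is a null set.\<close>
    have cover: "AE x in lebesgue. x \<in> A \<longrightarrow> x \<in> interior S \<or> x \<in> interior T"
      using AE_completion[OF aepl] by eventually_elim (use intS intT in \<open>force simp: neq_iff\<close>)
    have As: "A \<in> sets lebesgue" using Al by auto
    have XA: "sqnorm_on X A \<le> sqnorm_on X (interior S) + sqnorm_on X (interior T)"
      by (rule sqnorm_on_cover[OF X \<Omega>s int\<Omega>(1) _ int\<Omega>(2) _ A\<Omega> As cover]) auto
    have YA: "sqnorm_on Y A \<le> sqnorm_on Y (interior S) + sqnorm_on Y (interior T)"
      by (rule sqnorm_on_cover[OF Y \<Omega>s int\<Omega>(1) _ int\<Omega>(2) _ A\<Omega> As cover]) auto
    have comp: "compact S" "compact T" using rD(6) ST is_element_compact by blast+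
    have RA: "sqnorm_on Rw A \<le> sqnorm_on ?RS S + sqnorm_on ?RT T"
    proof -
      have i: "integrable lebesgue (\<lambda>x. indicator S x *\<^sub>R (norm (?RS x))\<^sup>2)" "integrable lebesgue (\<lambda>x. indicator T x *\<^sub>R (norm (?RT x))\<^sup>2)"
        using continuous_set_integrable_lebesgue[OF smooth_fun_continuous[OF smooth_fun_power[OF sR(1), of 2]] comp(1)]
          continuous_set_integrable_lebesgue[OF smooth_fun_continuous[OF smooth_fun_power[OF sR(2), of 2]] comp(2)]
        by (auto simp: set_integrable_def)
      have "sqnorm_on Rw A \<le> (LINT x|lebesgue. indicator S x *\<^sub>R (norm (?RS x))\<^sup>2 + indicator T x *\<^sub>R (norm (?RT x))\<^sup>2)"
        unfolding sqnorm_on_def set_lebesgue_integral_def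
      proof (rule integral_mono)
        show "integrable lebesgue (\<lambda>x. indicator A x *\<^sub>R (norm (Rw x))\<^sup>2)"
          using square_integrable_set_integrable[OF sRw \<Omega>s A\<Omega> As] by (simp add: set_integrable_def)
        show "integrable lebesgue (\<lambda>x. indicator S x *\<^sub>R (norm (?RS x))\<^sup>2 + indicator T x *\<^sub>R (norm (?RT x))\<^sup>2)"
          using i by simp
        fix x
        show "indicator A x *\<^sub>R (norm (Rw x))\<^sup>2 \<le> indicator S x *\<^sub>R (norm (?RS x))\<^sup>2 + indicator T x *\<^sub>R (norm (?RT x))\<^sup>2"
        proof (cases "x \<in> A")
          case True
          then show ?thesis using inS[OF AB'[OF True]] inT[OF AB'[OF True]]
            unfolding Rw_def ind by (cases "(x - a) \<bullet> \<nu> \<le> 0") auto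
        qed simp
      qed
      also have "\<dots> = sqnorm_on ?RS S + sqnorm_on ?RT T"
        unfolding sqnorm_on_def set_lebesgue_integral_def using i by simp
      finally show ?thesis .
    qed
    define W1 where "W1 = sqnorm_on X (interior S) + sqnorm_on X (interior T)"
    define W2 where "W2 = sqnorm_on Y (interior S) + sqnorm_on Y (interior T) + sqnorm_on ?RS S + sqnorm_on ?RT T"
    have "sqnorm_on X A / d + d * (sqnorm_on Y A + sqnorm_on Rw A) \<le> (4 / c) * (W1 / \<delta> + \<delta> * W2)"
    proof -
      have "sqnorm_on X A / d \<le> W1 / d" using XA d unfolding W1_def by (intro divide_right_mono) auto
      also have "\<dots> = (4 / c) * (W1 / \<delta>)" using c by (simp add: d_def)
      finally have 1: "sqnorm_on X A / d \<le> (4 / c) * (W1 / \<delta>)" .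
      have dd: "d \<le> (4 / c) * \<delta>"
      proof -
        have "d \<le> 1 * \<delta>" unfolding d_def using c \<delta> by (simp add: mult_right_mono)
        also have "\<dots> \<le> (4 / c) * \<delta>" using c \<delta> by (intro mult_right_mono) auto
        finally show ?thesis .
      qed
      have "d * (sqnorm_on Y A + sqnorm_on Rw A) \<le> ((4 / c) * \<delta>) * W2"
        using YA RA dd d c \<delta> sqnorm_on_nonneg[of Y A] sqnorm_on_nonneg[of Rw A] unfolding W2_def by (intro mult_mono) auto
      then show ?thesis using 1 by (simp add: distrib_left mult.assoc)
    qed
    then have st': "(\<kappa> * (s * t))\<^sup>2 \<le> 3 * C2\<^sup>2 * ((4 / c) * (W1 / \<delta> + \<delta> * W2))"
      using C2 by (intro order_trans[OF st] mult_left_mono) auto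
    show "\<exists>J\<ge>0. (\<forall>x\<in>E. \<bar>\<Sum>i\<in>UNIV. \<nu> $ i * (partial i (p S) x - partial i (p T) x)\<bar> \<le> J) \<and>
       (\<kappa> * J)\<^sup>2 * diameter S ^ (CARD('n) - 1) \<le>
       C * ((sqnorm_on X (interior S) + sqnorm_on X (interior T)) / \<delta> +
         \<delta> * (sqnorm_on Y (interior S) + sqnorm_on Y (interior T) + sqnorm_on ?RS S + sqnorm_on ?RT T))"
    \<comment> \<open>The bound holds on all of \<open>E\<close>, although the test function lives
      near \<open>a\<close>: E lies in the ball of radius h around \<open>a\<close>, where J' is
      controlled, and J' is the jump itself on the plane of E.\<close>
    proof (intro exI[of _ "C1 * s"] conjI ballI M(1))
      fix x assume x: "x \<in> E"
      have "J' x = J x" unfolding J'_def using prj_eq[OF Epl[OF x]] by simp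
      then show "\<bar>\<Sum>i\<in>UNIV. \<nu> $ i * (partial i (p S) x - partial i (p T) x)\<bar> \<le> C1 * s"
        using Jb(1)[of x] Eh x unfolding J_def pq by auto
    next
      have "(\<kappa> * (C1 * s))\<^sup>2 * diameter S ^ (CARD('n) - 1) = C1\<^sup>2 * (4 / c) ^ (n - 1) * (\<kappa> * (s * t))\<^sup>2"
      proof -
        have "diameter S = (4 / c) * \<rho>" using c by (simp add: \<rho>_def h_def)
        then show ?thesis unfolding n_def[symmetric] by (simp only: power_mult_distrib t(2)) (simp add: mult_ac)
      qed
      also have "\<dots> \<le> C1\<^sup>2 * (4 / c) ^ (n - 1) * (3 * C2\<^sup>2 * ((4 / c) * (W1 / \<delta> + \<delta> * W2)))"
        using st' c by (intro mult_left_mono) auto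
      also have "\<dots> = C * (W1 / \<delta> + \<delta> * W2)" by (simp add: C_def mult_ac)
      finally show "(\<kappa> * (C1 * s))\<^sup>2 * diameter S ^ (CARD('n) - 1) \<le>
       C * ((sqnorm_on X (interior S) + sqnorm_on X (interior T)) / \<delta> +
         \<delta> * (sqnorm_on Y (interior S) + sqnorm_on Y (interior T) + sqnorm_on ?RS S + sqnorm_on ?RT T))"
        unfolding W1_def W2_def .
    qed
  qed
qed

section \<open>Surface measure and jumps\<close>

text \<open>Measurability is assumed for g only and follows for f by completeness. This admits
  integrands containing data that are prescribed almost everywhere.\<close>

lemma LINT_lebesgue_on_AE_eq:
  fixes f g :: "'a::euclidean_space \<Rightarrow> real"
  assumes S: "S \<in> sets lebesgue" and g: "g \<in> borel_measurable (lebesgue_on S)"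
    and ae: "AE x in lebesgue_on S. f x = g x"
  shows "(LINT x|lebesgue_on S. f x) = (LINT x|lebesgue_on S. g x)"
proof (rule integral_cong_AE[OF _ g ae])
  have "AE x in lebesgue. x \<in> S \<longrightarrow> f x = g x" using ae S by (simp add: AE_restrict_space_iff)
  then have "AE x in lebesgue. indicator S x *\<^sub>R g x = indicator S x *\<^sub>R f x"
    by eventually_elim (auto simp: indicator_def)
  moreover have "(\<lambda>x. indicator S x *\<^sub>R g x) \<in> borel_measurable lebesgue" using g S by (simp add: lebesgue_on_measurable_iff)
  ultimately have "(\<lambda>x. indicator S x *\<^sub>R f x) \<in> borel_measurable lebesgue" by (rule borel_measurable_AE_eq[rotated])
  then show "f \<in> borel_measurable (lebesgue_on S)" using S by (simp add: lebesgue_on_measurable_iff)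
qed

text \<open>The disc in \<open>E\<close> determines the hyperplane, so the arbitrary choice in
  \<open>unit_normal\<close> is the outward normal up to sign, and the sign disappears in the norm
  of a jump.\<close>

lemma face_data_unit_normal:
  fixes S T :: "(real^'n) set"
  assumes fd: "face_data c S T E a \<nu>" and r: "c * diameter S > 0"
  shows "norm (unit_normal E) = 1" "\<And>x y. x \<in> E \<Longrightarrow> y \<in> E \<Longrightarrow> (x - y) \<bullet> unit_normal E = 0"
    "unit_normal E = \<nu> \<or> unit_normal E = - \<nu>"
proof -
  have \<nu>: "norm \<nu> = 1" and onS: "outward_normal S E \<nu>" and a: "a \<in> E"
    and rel: "\<And>x. norm (x - a) < c * diameter S \<Longrightarrow> (x - a) \<bullet> \<nu> = 0 \<Longrightarrow> x \<in> E"
    using fd by (auto simp: face_data_def outward_normal_def)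
  have "(x - y) \<bullet> \<nu> = 0" if "x \<in> E" "y \<in> E" for x y
    using outward_normal_inner(2)[OF onS that(2), of x] that(1) by blast
  then have "norm (unit_normal E) = 1 \<and> (\<forall>x\<in>E. \<forall>y\<in>E. (x - y) \<bullet> unit_normal E = 0)"
    unfolding unit_normal_def using \<nu> by (intro someI[of "\<lambda>n. norm n = 1 \<and> (\<forall>x\<in>E. \<forall>y\<in>E. (x - y) \<bullet> n = 0)" \<nu>]) blast
  then show 1: "norm (unit_normal E) = 1" "\<And>x y. x \<in> E \<Longrightarrow> y \<in> E \<Longrightarrow> (x - y) \<bullet> unit_normal E = 0" by blast+
  show "unit_normal E = \<nu> \<or> unit_normal E = - \<nu>"
    by (rule unit_vectors_parallel[OF 1(1) \<nu> r]) (use 1(2) rel a in blast)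
qed

text \<open>The normal component alone keeps every point of the affine hull at distance at least |t|
  from e + t n, and e attains this distance.\<close>

lemma closest_point_prism:
  fixes E :: "'a::euclidean_space set"
  assumes n: "norm n = 1" "\<And>x y. x \<in> E \<Longrightarrow> y \<in> E \<Longrightarrow> (x - y) \<bullet> n = 0" and e: "e \<in> E"
  shows "closest_point (affine hull E) (e + t *\<^sub>R n) = e"
proof -
  have aff: "(y - e) \<bullet> n = 0" if "y \<in> affine hull E" for y
  proof -
    have eq: "{y. (y - e) \<bullet> n = 0} = {y. n \<bullet> y = n \<bullet> e}" by (simp add: inner_diff_left inner_commute[of n])
    have "E \<subseteq> {y. (y - e) \<bullet> n = 0}" using n(2) e by blast
    then have "affine hull E \<subseteq> {y. (y - e) \<bullet> n = 0}"
      by (rule hull_minimal) (simp add: eq affine_hyperplane)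
    then show ?thesis using that by blast
  qed
  have "e = closest_point (affine hull E) (e + t *\<^sub>R n)"
  proof (rule closest_point_unique)
    show "convex (affine hull E)" "closed (affine hull E)" by (auto simp: affine_imp_convex)
    show "e \<in> affine hull E" using e by (rule hull_inc)
    show "\<forall>z\<in>affine hull E. dist (e + t *\<^sub>R n) e \<le> dist (e + t *\<^sub>R n) z"
    proof
      fix z assume z: "z \<in> affine hull E"
      have "(e + t *\<^sub>R n - z) \<bullet> n = t"
        using aff[OF z] n(1) by (simp add: inner_diff_left inner_add_left dot_square_norm)
      then have "\<bar>t\<bar> \<le> norm (e + t *\<^sub>R n - z) * norm n" using Cauchy_Schwarz_ineq2[of "e + t *\<^sub>R n - z" n] by simp
      then show "dist (e + t *\<^sub>R n) e \<le> dist (e + t *\<^sub>R n) z" using n(1) by (simp add: dist_norm)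
    qed
  qed
  then show ?thesis by simp
qed

text \<open>The prism that defines the surface measure lies in a cylinder of radius h and
  half-height 1, so the surface of \<open>E\<close> is at most a constant times h^(n - 1). The
  closest point map sends the prism back into E, where the sup bound applies.\<close>

lemma surface_l2_norm_le:
  fixes E :: "(real^'n) set"
  assumes n: "norm (unit_normal E) = 1" "\<And>x y. x \<in> E \<Longrightarrow> y \<in> E \<Longrightarrow> (x - y) \<bullet> unit_normal E = 0"
    and E: "compact E" "a \<in> E" "\<And>x. x \<in> E \<Longrightarrow> norm (x - a) \<le> h" "h > 0"
    and g: "g \<in> borel_measurable borel" "\<And>x. x \<in> E \<Longrightarrow> \<bar>g x\<bar> \<le> J"
  shows "(l2_norm (surface_measure E) g)\<^sup>2 \<le> J\<^sup>2 * (unit_ball_vol (real CARD('n)) * 2 ^ CARD('n) * h ^ (CARD('n) - 1))"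
proof -
  let ?n = "unit_normal E"
  define Q where "Q = {x + t *\<^sub>R ?n | x t. x \<in> E \<and> 0 \<le> t \<and> t \<le> 1}"
  define cp where "cp = closest_point (affine hull E)"
  have "Q = (\<lambda>(x, t). x + t *\<^sub>R ?n) ` (E \<times> {0..1})"
    unfolding Q_def by (auto simp: image_iff) blast
  moreover have "compact ((\<lambda>(x, t). x + t *\<^sub>R ?n) ` (E \<times> {0..1}))"
    by (intro compact_continuous_image compact_Times E) (auto simp: case_prod_beta' intro!: continuous_intros)
  ultimately have Qc: "compact Q" by simp
  then have Ql: "Q \<in> lmeasurable" by (rule lmeasurable_compact)
  have "affine hull E \<noteq> {}" using E(2) hull_inc[of a E] by blast
  then have "continuous_on UNIV cp"
    unfolding cp_def by (intro continuous_on_closest_point) (auto simp: affine_imp_convex)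
  then have cpm: "cp \<in> borel_measurable (lebesgue_on Q)"
    by (intro borel_measurable_lebesgue_on_borel borel_measurable_continuous_onI)
  have cpQ: "cp x \<in> E" if "x \<in> Q" for x
    using that closest_point_prism[OF n] unfolding Q_def cp_def by auto
  have QC: "Q \<subseteq> cylinder a ?n h 1"
  proof
    fix x assume "x \<in> Q"
    then obtain e t where x: "x = e + t *\<^sub>R ?n" "e \<in> E" "0 \<le> t" "t \<le> 1" unfolding Q_def by blast
    have ea: "(e - a) \<bullet> ?n = 0" using n(2) x(2) E(2) by blast
    have "prj a ?n x = e" unfolding x(1) prj_shift[OF n(1)] by (rule prj_eq[OF ea])
    moreover have "(x - a) \<bullet> ?n = t" using ea n(1) by (simp add: x(1) inner_diff_left inner_add_left dot_square_norm)
    ultimately show "x \<in> cylinder a ?n h 1" using E(3)[OF x(2)] x(3,4) by (simp add: cylinder_def)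
  qed
  have "(l2_norm (surface_measure E) g)\<^sup>2 = (LINT x|surface_measure E. (norm (g x))\<^sup>2)"
    unfolding l2_norm_def by (simp add: integral_nonneg_AE)
  also have "\<dots> = (LINT x|lebesgue_on Q. (norm (g (cp x)))\<^sup>2)"
    unfolding surface_measure_def Q_def[symmetric] cp_def[symmetric]
    by (rule integral_distr[OF cpm]) (use g(1) in simp)
  also have "\<dots> \<le> (LINT x|lebesgue_on Q. J\<^sup>2)"
  proof (rule integral_mono_AE')
    interpret finite_measure "lebesgue_on Q" by (rule finite_measure_lebesgue_on[OF Ql])
    show "integrable (lebesgue_on Q) (\<lambda>x. J\<^sup>2)" by simp
    have "(norm (g (cp x)))\<^sup>2 \<le> J\<^sup>2" if "x \<in> Q" for x
      using g(2)[OF cpQ[OF that]] by (intro power_mono) auto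
    then show "AE x in lebesgue_on Q. (norm (g (cp x)))\<^sup>2 \<le> J\<^sup>2" by (intro AE_I2) simp
  qed simp
  also have "\<dots> = J\<^sup>2 * measure lebesgue Q" using Ql by (simp add: measure_restrict_space)
  also have "\<dots> \<le> J\<^sup>2 * (unit_ball_vol (real CARD('n)) * 2 ^ CARD('n) * h ^ (CARD('n) - 1))"
  proof (rule mult_left_mono)
    have "measure lborel Q \<le> measure lborel (cylinder a ?n h 1)"
      using QC Qc by (intro measure_mono_fmeasurable fmeasurable_closed_bounded closed_cylinder bounded_cylinder n)
        (auto simp: compact_imp_closed)
    also have "\<dots> \<le> unit_ball_vol (DIM(real^'n)) * 2 ^ DIM(real^'n) * h ^ (DIM(real^'n) - 1) * 1"
      by (rule measure_cylinder_le[OF n(1) E(4)]) simp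
    finally show "measure lebesgue Q \<le> unit_ball_vol (real CARD('n)) * 2 ^ CARD('n) * h ^ (CARD('n) - 1)"
      using Qc by (simp add: measure_completion compact_imp_closed)
  qed simp
  finally show ?thesis .
qed

text \<open>\<open>face_sides\<close> asks only for E = S \<inter> T, which conformity makes a face
  of both elements. That it is a facet follows from its dimension, which is known from another
  element.\<close>

lemma face_of_same_dim_facet:
  fixes S T :: "(real^'n) set"
  assumes "is_element S" "is_element T" "E facet_of S" "E face_of T" shows "E facet_of T"
  using assms(3,4) aff_dim_nonempty_interior[OF is_element_interior[OF assms(1)]]
    aff_dim_nonempty_interior[OF is_element_interior[OF assms(2)]]
  by (simp add: facet_of_def)

section \<open>The two elements at an interior face of a conforming mesh\<close>

definition good_mesh :: "real \<Rightarrow> (real^'n) set set \<Rightarrow> bool" where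
  "good_mesh C0 \<T> \<longleftrightarrow> finite \<T> \<and> (\<forall>T\<in>\<T>. is_element T \<and> inverse C0 * diameter T ^ CARD('n) \<le> measure lebesgue T) \<and>
     (\<forall>S\<in>\<T>. \<forall>T\<in>\<T>. S \<noteq> T \<longrightarrow> interior S \<inter> interior T = {} \<and> (S \<inter> T) face_of S \<and> (S \<inter> T) face_of T)"

lemma mesh_good_mesh: "mesh \<Omega> \<T> \<Longrightarrow> shape_regular C0 \<T> \<Longrightarrow> good_mesh C0 \<T>"
  by (simp add: mesh_def shape_regular_def good_mesh_def is_element_def)

lemma interior_face_neighbour:
  assumes "E \<in> interior_faces \<T>" "E \<in> faces T"
  obtains S where "S \<in> \<T>" "S \<noteq> T" "E facet_of S"
proof -
  obtain S U where SU: "S \<in> \<T>" "U \<in> \<T>" "S \<noteq> U" "E \<in> faces S" "E \<in> faces U"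
    using assms(1) unfolding interior_faces_def by blast
  show thesis
  proof (cases "S = T")
    case True
    then show ?thesis using that[of U] SU by (simp add: faces_def)
  next
    case False
    then show ?thesis using that[of S] SU by (simp add: faces_def)
  qed
qed

lemma facet_of_at_most_two:
  fixes \<T> :: "(real^'n) set set"
  assumes gm: "good_mesh C0 \<T>" and c: "c > 0"
    and data: "\<And>S T E. S \<in> \<T> \<Longrightarrow> T \<in> \<T> \<Longrightarrow> S \<noteq> T \<Longrightarrow> E facet_of S \<Longrightarrow> E facet_of T \<Longrightarrow> \<exists>a \<nu>. face_data c S T E a \<nu>"
    and U: "U1 \<in> \<T>" "U2 \<in> \<T>" "U3 \<in> \<T>" "U1 \<noteq> U2" "U1 \<noteq> U3" "U2 \<noteq> U3"
      "E facet_of U1" "E facet_of U2" "E facet_of U3"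
  shows False
proof -
  obtain a1 \<nu>1 where 1: "face_data c U1 U2 E a1 \<nu>1" using data[OF U(1,2,4,7,8)] by blast
  obtain a2 \<nu>2 where 2: "face_data c U1 U3 E a2 \<nu>2" using data[OF U(1,3,5,7,9)] by blast
  obtain a3 \<nu>3 where 3: "face_data c U2 U3 E a3 \<nu>3" using data[OF U(2,3,6,8,9)] by blast
  have "c * diameter U > 0" if "U \<in> \<T>" for U
    using c is_element_diameter[of U] gm that by (auto simp: good_mesh_def)
  then show False using three_elements_contradiction[OF 1 2 3] U(1,2) by blast
qed

text \<open>The choice can only return S and T in some order, because no third element has E as a
  facet.\<close>

lemma face_sides_eq:
  fixes \<T> :: "(real^'n) set set"
  assumes gm: "good_mesh C0 \<T>" and c: "c > 0"
    and data: "\<And>S T E. S \<in> \<T> \<Longrightarrow> T \<in> \<T> \<Longrightarrow> S \<noteq> T \<Longrightarrow> E facet_of S \<Longrightarrow> E facet_of T \<Longrightarrow> \<exists>a \<nu>. face_data c S T E a \<nu>"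
    and ST: "S \<in> \<T>" "T \<in> \<T>" "S \<noteq> T" "E facet_of S" "E facet_of T" and E: "E \<in> interior_faces \<T>"
  shows "face_sides \<T> E = (S, T) \<or> face_sides \<T> E = (T, S)"
proof -
  obtain S0 T0 where st: "face_sides \<T> E = (S0, T0)" by (cases "face_sides \<T> E")
  have "\<exists>z. case z of (S, T) \<Rightarrow> S \<in> \<T> \<and> T \<in> \<T> \<and> S \<noteq> T \<and> E = S \<inter> T"
    using E unfolding interior_faces_def by auto
  from someI_ex[OF this] have 0: "S0 \<in> \<T>" "T0 \<in> \<T>" "S0 \<noteq> T0" "E = S0 \<inter> T0"
    unfolding face_sides_def[symmetric] st by auto
  have el: "is_element U" if "U \<in> \<T>" for U using gm that by (auto simp: good_mesh_def)
  have "E face_of S0" "E face_of T0" using gm 0 unfolding good_mesh_def by blast+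
  then have f: "E facet_of S0" "E facet_of T0" using face_of_same_dim_facet[OF el[OF ST(1)] _ ST(4)] el 0 by blast+
  note no3 = facet_of_at_most_two[OF gm c data]
  have "S0 = S \<or> S0 = T" using no3[of S T S0] ST 0 f by blast
  moreover have "T0 = S \<or> T0 = T" using no3[of S T T0] ST 0 f by blast
  ultimately show ?thesis using 0(3) st by auto
qed

text \<open>In the jump estimate the strong residuals carry the factor \<delta>. As \<delta> is at
  most the diameter, \<delta> times the element estimate is absorbed by the error terms already
  present, and the pointwise bound on the jump is integrated over \<open>E\<close>.\<close>

lemma face_estimate:
  fixes C0 :: real
  assumes n2: "CARD('n) \<ge> 2" and C0: "C0 > 0"
  shows "\<exists>C>0. \<forall>(\<Omega> :: (real^'n) set) \<T> \<kappa> F v X Y S T E \<delta>.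
     residual_equation N \<Omega> \<T> \<kappa> F (\<lambda>T. local_poly T v) X Y \<and> \<kappa> \<ge> 0 \<and> good_mesh C0 \<T> \<and>
     S \<in> \<T> \<and> T \<in> \<T> \<and> S \<noteq> T \<and> E facet_of S \<and> E facet_of T \<and> E \<in> interior_faces \<T> \<and> 0 < \<delta> \<and> \<delta> \<le> diameter S \<longrightarrow>
     (l2_norm (surface_measure E) (\<lambda>x. \<kappa> * normal_deriv_jump \<T> E v x))\<^sup>2 \<le>
       C * ((sqnorm_on X (interior S) + sqnorm_on X (interior T)) / \<delta> +
         \<delta> * (sqnorm_on Y (interior S) + sqnorm_on Y (interior T)))"
proof -
  obtain c where c: "c > 0" "c \<le> 1" and data: "\<And>(S :: (real^'n) set) T E.
    is_element S \<and> inverse C0 * diameter S ^ CARD('n) \<le> measure lebesgue S \<and>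
    is_element T \<and> inverse C0 * diameter T ^ CARD('n) \<le> measure lebesgue T \<and>
    interior S \<inter> interior T = {} \<and> E facet_of S \<and> E facet_of T \<Longrightarrow> \<exists>a \<nu>. face_data c S T E a \<nu>"
    using interior_face_data[OF n2 C0] by blast
  obtain CA where CA: "CA > 0" "\<And>(\<Omega> :: (real^'n) set) \<T> \<kappa> F p X Y T. residual_equation N \<Omega> \<T> \<kappa> F p X Y \<Longrightarrow> T \<in> \<T> \<Longrightarrow>
     inverse C0 * diameter T ^ CARD('n) \<le> measure lebesgue T \<Longrightarrow>
     sqnorm_on (strong_residual \<kappa> F p T) T \<le> CA * (sqnorm_on X (interior T) / (diameter T)\<^sup>2 + sqnorm_on Y (interior T))"
    using element_residual_estimate[OF n2 C0, of N] by blast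
  obtain CB where CB: "CB > 0" "\<And>(\<Omega> :: (real^'n) set) \<T> \<kappa> F p X Y S T E a \<nu> \<delta>. residual_equation N \<Omega> \<T> \<kappa> F p X Y \<and> \<kappa> \<ge> 0 \<and>
     S \<in> \<T> \<and> T \<in> \<T> \<and> face_data c S T E a \<nu> \<and> 0 < \<delta> \<and> \<delta> \<le> diameter S \<Longrightarrow>
     (\<exists>J\<ge>0. (\<forall>x\<in>E. \<bar>\<Sum>i\<in>UNIV. \<nu> $ i * (partial i (p S) x - partial i (p T) x)\<bar> \<le> J) \<and>
       (\<kappa> * J)\<^sup>2 * diameter S ^ (CARD('n) - 1) \<le>
       CB * ((sqnorm_on X (interior S) + sqnorm_on X (interior T)) / \<delta> +
         \<delta> * (sqnorm_on Y (interior S) + sqnorm_on Y (interior T) +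
              sqnorm_on (strong_residual \<kappa> F p S) S + sqnorm_on (strong_residual \<kappa> F p T) T)))"
    using face_jump_estimate[OF n2 c, of N] by blast
  define \<omega> where "\<omega> = unit_ball_vol (real CARD('n)) * 2 ^ CARD('n)"
  have \<omega>: "\<omega> > 0" unfolding \<omega>_def by (simp add: unit_ball_vol_pos)
  define C where "C = \<omega> * (CB * (1 + CA * (1 + 1 / c\<^sup>2)))"
  have k1: "1 + CA * (1 + 1 / c\<^sup>2) > 0" using CA(1) c by (intro add_pos_pos mult_pos_pos) auto
  have C: "C > 0" unfolding C_def using \<omega> CB(1) k1 by (intro mult_pos_pos)
  show ?thesis
  proof (rule exI[of _ C], intro conjI C allI impI)
    fix \<Omega> :: "(real^'n) set" and \<T> \<kappa> F v X Y S T E \<delta>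
    assume asm: "residual_equation N \<Omega> \<T> \<kappa> F (\<lambda>T. local_poly T v) X Y \<and> \<kappa> \<ge> 0 \<and> good_mesh C0 \<T> \<and>
     S \<in> \<T> \<and> T \<in> \<T> \<and> S \<noteq> T \<and> E facet_of S \<and> E facet_of T \<and> E \<in> interior_faces \<T> \<and> 0 < \<delta> \<and> \<delta> \<le> diameter S"
    let ?p = "\<lambda>T. local_poly T v"
    have eq: "residual_equation N \<Omega> \<T> \<kappa> F ?p X Y" and \<kappa>: "\<kappa> \<ge> 0" and gm: "good_mesh C0 \<T>"
      and ST: "S \<in> \<T>" "T \<in> \<T>" "S \<noteq> T" "E facet_of S" "E facet_of T" "E \<in> interior_faces \<T>" and \<delta>: "0 < \<delta>" "\<delta> \<le> diameter S"
      using asm by blast+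
    have data': "\<exists>a \<nu>. face_data c S T E a \<nu>" if "S \<in> \<T>" "T \<in> \<T>" "S \<noteq> T" "E facet_of S" "E facet_of T" for S T E
      by (rule data) (use gm that in \<open>auto simp: good_mesh_def\<close>)
    obtain a \<nu> where fd: "face_data c S T E a \<nu>" using data' ST by blast
    have shape: "inverse C0 * diameter S ^ CARD('n) \<le> measure lebesgue S" "inverse C0 * diameter T ^ CARD('n) \<le> measure lebesgue T"
      using gm ST by (auto simp: good_mesh_def)
    define h hT where "h = diameter S" and "hT = diameter T"
    have elS: "is_element S" "is_element T" using gm ST by (auto simp: good_mesh_def)
    have h: "h > 0" "hT > 0" unfolding h_def hT_def using is_element_diameter elS by auto
    have ch: "c * diameter S > 0" using c h by (simp add: h_def)
    note un = face_data_unit_normal[OF fd ch]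
    let ?RS = "sqnorm_on (strong_residual \<kappa> F ?p S) S" and ?RT = "sqnorm_on (strong_residual \<kappa> F ?p T) T"
    define xS xT yS yT where "xS = sqnorm_on X (interior S)" and "xT = sqnorm_on X (interior T)"
      and "yS = sqnorm_on Y (interior S)" and "yT = sqnorm_on Y (interior T)"
    have nn: "xS \<ge> 0" "xT \<ge> 0" "yS \<ge> 0" "yT \<ge> 0" unfolding xS_def xT_def yS_def yT_def by (auto intro: sqnorm_on_nonneg)
    obtain J where J: "J \<ge> 0" "\<And>x. x \<in> E \<Longrightarrow> \<bar>\<Sum>i\<in>UNIV. \<nu> $ i * (partial i (?p S) x - partial i (?p T) x)\<bar> \<le> J"
      "(\<kappa> * J)\<^sup>2 * h ^ (CARD('n) - 1) \<le> CB * ((xS + xT) / \<delta> + \<delta> * (yS + yT + ?RS + ?RT))"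
      using CB(2)[of \<Omega> \<T> \<kappa> F ?p X Y S T E a \<nu> \<delta>] eq \<kappa> ST fd \<delta> unfolding h_def xS_def xT_def yS_def yT_def by blast
    have RS: "?RS \<le> CA * (xS / h\<^sup>2 + yS)" and RT: "?RT \<le> CA * (xT / hT\<^sup>2 + yT)"
      using CA(2)[OF eq ST(1) shape(1)] CA(2)[OF eq ST(2) shape(2)] unfolding h_def hT_def xS_def xT_def yS_def yT_def by auto
    have chT: "c * h \<le> hT" using fd unfolding face_data_def h_def hT_def by blast
    \<comment> \<open>From c \<delta> \<le> h and c \<delta> \<le> hT, the latter by the
      comparability of neighbours contained in \<open>face_data\<close>.\<close>
    have dh: "\<delta> / h\<^sup>2 \<le> (1 / c\<^sup>2) / \<delta>" "\<delta> / hT\<^sup>2 \<le> (1 / c\<^sup>2) / \<delta>"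
    proof -
      have "c * \<delta> \<le> c * h" using c \<delta> by (simp add: h_def)
      moreover have "c * h \<le> h" using c h by simp
      ultimately have "c * \<delta> \<le> h" "c * \<delta> \<le> hT" using chT by auto
      then have "(c * \<delta>)\<^sup>2 \<le> h\<^sup>2" "(c * \<delta>)\<^sup>2 \<le> hT\<^sup>2" using c \<delta> by (auto intro!: power_mono)
      then show "\<delta> / h\<^sup>2 \<le> (1 / c\<^sup>2) / \<delta>" "\<delta> / hT\<^sup>2 \<le> (1 / c\<^sup>2) / \<delta>"
        using c \<delta> h by (auto simp: field_simps power2_eq_square)
    qed
    have res: "\<delta> * (CA * (x / k\<^sup>2 + y)) \<le> CA * (1 + 1 / c\<^sup>2) * (x / \<delta> + \<delta> * y)"
      if "x \<ge> 0" "y \<ge> 0" "\<delta> / k\<^sup>2 \<le> (1 / c\<^sup>2) / \<delta>" for x y k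
    proof -
      have "x * (\<delta> / k\<^sup>2) \<le> x * ((1 / c\<^sup>2) / \<delta>)" using that by (intro mult_left_mono) auto
      moreover have "0 \<le> x / \<delta>" "0 \<le> (1 / c\<^sup>2) * (\<delta> * y)" using that \<delta> by auto
      moreover have "x * ((1 / c\<^sup>2) / \<delta>) = (1 / c\<^sup>2) * (x / \<delta>)" by simp
      moreover have "(1 + 1 / c\<^sup>2) * (x / \<delta> + \<delta> * y) = x / \<delta> + \<delta> * y + (1 / c\<^sup>2) * (x / \<delta>) + (1 / c\<^sup>2) * (\<delta> * y)"
        by (simp only: distrib_left distrib_right mult_1 add.assoc) 
      ultimately have "x * (\<delta> / k\<^sup>2) + \<delta> * y \<le> (1 + 1 / c\<^sup>2) * (x / \<delta> + \<delta> * y)"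
        by linarith
      from mult_left_mono[OF this, of CA] CA(1) show ?thesis by (simp add: algebra_simps)
    qed
    have "\<delta> * (yS + yT + ?RS + ?RT) \<le> \<delta> * (yS + yT) + \<delta> * (CA * (xS / h\<^sup>2 + yS)) + \<delta> * (CA * (xT / hT\<^sup>2 + yT))"
      using mult_left_mono[OF RS, of \<delta>] mult_left_mono[OF RT, of \<delta>] \<delta> by (simp add: distrib_left)
    also have "\<dots> \<le> \<delta> * (yS + yT) + CA * (1 + 1 / c\<^sup>2) * (xS / \<delta> + \<delta> * yS) + CA * (1 + 1 / c\<^sup>2) * (xT / \<delta> + \<delta> * yT)"
      using res[OF nn(1,3) dh(1)] res[OF nn(2,4) dh(2)] by linarith
    finally have "(xS + xT) / \<delta> + \<delta> * (yS + yT + ?RS + ?RT) \<le> (1 + CA * (1 + 1 / c\<^sup>2)) * ((xS + xT) / \<delta> + \<delta> * (yS + yT))"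
      by (simp add: algebra_simps add_divide_distrib)
    then have J': "(\<kappa> * J)\<^sup>2 * h ^ (CARD('n) - 1) \<le> CB * ((1 + CA * (1 + 1 / c\<^sup>2)) * ((xS + xT) / \<delta> + \<delta> * (yS + yT)))"
      using CB(1) by (intro order_trans[OF J(3)] mult_left_mono) auto
    have sp: "smooth_fun (?p U)" if "U \<in> \<T>" for U using residual_equationD(8)[OF eq that] by (rule smooth_fun_poly)
    have fr: "frechet_derivative (?p U) (at x) u = (\<Sum>i\<in>UNIV. u $ i * partial i (?p U) x)" if "U \<in> \<T>" for U x u
      by (rule frechet_derivative_partial[OF smooth_fun_differentiable[OF sp[OF that]]])
    \<comment> \<open>The order of the two sides and the direction of the normal are arbitrary
      choices; each affects only the sign.\<close>
    have jump: "\<bar>normal_deriv_jump \<T> E v x\<bar> = \<bar>\<Sum>i\<in>UNIV. \<nu> $ i * (partial i (?p S) x - partial i (?p T) x)\<bar>" for x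
    proof -
      define DS where "DS = (\<Sum>i\<in>UNIV. \<nu> $ i * partial i (?p S) x)"
      define DT where "DT = (\<Sum>i\<in>UNIV. \<nu> $ i * partial i (?p T) x)"
      have fS: "frechet_derivative (?p S) (at x) \<nu> = DS" "frechet_derivative (?p S) (at x) (- \<nu>) = - DS"
        and fT: "frechet_derivative (?p T) (at x) \<nu> = DT" "frechet_derivative (?p T) (at x) (- \<nu>) = - DT"
        unfolding fr[OF ST(1)] fr[OF ST(2)] DS_def DT_def by (auto simp: sum_negf)
      have "(\<Sum>i\<in>UNIV. \<nu> $ i * (partial i (?p S) x - partial i (?p T) x)) = DS - DT"
        by (simp add: right_diff_distrib sum_subtractf DS_def DT_def)
      moreover have "\<bar>normal_deriv_jump \<T> E v x\<bar> = \<bar>DS - DT\<bar>"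
      proof -
        have "\<bar>normal_deriv_jump \<T> E v x\<bar> = \<bar>DS - DT\<bar>" if "face_sides \<T> E = (S, T)"
          using un(3) by (elim disjE) (simp_all add: normal_deriv_jump_def that fS fT)
        moreover have "\<bar>normal_deriv_jump \<T> E v x\<bar> = \<bar>DS - DT\<bar>" if "face_sides \<T> E = (T, S)"
          using un(3) by (elim disjE) (simp_all add: normal_deriv_jump_def that fS fT)
        ultimately show ?thesis using face_sides_eq[OF gm c(1) data' ST] by blast
      qed
      ultimately show ?thesis by simp
    qed
    have jm: "(\<lambda>x. \<kappa> * normal_deriv_jump \<T> E v x) \<in> borel_measurable borel"
    proof -
      have m: "(\<lambda>x. frechet_derivative (?p U) (at x) u) \<in> borel_measurable borel" if "U \<in> \<T>" for U u
        unfolding fr[OF that] by (intro smooth_fun_borel smooth_fun_sum smooth_fun_scale smooth_fun_partial sp that)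
      have "fst (face_sides \<T> E) \<in> \<T>" "snd (face_sides \<T> E) \<in> \<T>"
        using face_sides_eq[OF gm c(1) data' ST] ST by auto
      then show ?thesis unfolding normal_deriv_jump_def
        by (intro borel_measurable_times borel_measurable_const borel_measurable_diff m)
    qed
    have aE: "a \<in> E" using fd by (simp add: face_data_def)
    have ES: "E \<subseteq> S" "E face_of S" using ST(4) facet_of_imp_subset facet_of_imp_face_of by blast+
    have cE: "compact E" using face_of_imp_compact[OF is_element_convex[OF elS(1)] is_element_compact[OF elS(1)] ES(2)] .
    have Eh: "norm (x - a) \<le> h" if "x \<in> E" for x
      using diameter_bounded_bound[OF compact_imp_bounded[OF is_element_compact[OF elS(1)]], of x a] that ES(1) aE
      by (auto simp: h_def dist_norm)
    have "(l2_norm (surface_measure E) (\<lambda>x. \<kappa> * normal_deriv_jump \<T> E v x))\<^sup>2 \<le> (\<kappa> * J)\<^sup>2 * (\<omega> * h ^ (CARD('n) - 1))"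
      unfolding \<omega>_def
    proof (rule surface_l2_norm_le[OF un(1,2) cE aE Eh h(1) jm])
      fix x assume "x \<in> E"
      then show "\<bar>\<kappa> * normal_deriv_jump \<T> E v x\<bar> \<le> \<kappa> * J"
        unfolding abs_mult jump using J(2)[of x] \<kappa> by (intro mult_mono) auto
    qed
    also have "\<dots> = \<omega> * ((\<kappa> * J)\<^sup>2 * h ^ (CARD('n) - 1))" by simp
    also have "\<dots> \<le> \<omega> * (CB * ((1 + CA * (1 + 1 / c\<^sup>2)) * ((xS + xT) / \<delta> + \<delta> * (yS + yT))))"
      using J' \<omega> by (intro mult_left_mono) auto
    also have "\<dots> = C * ((xS + xT) / \<delta> + \<delta> * (yS + yT))" by (simp add: C_def mult.assoc)
    finally show "(l2_norm (surface_measure E) (\<lambda>x. \<kappa> * normal_deriv_jump \<T> E v x))\<^sup>2 \<le>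
       C * ((sqnorm_on X (interior S) + sqnorm_on X (interior T)) / \<delta> +
         \<delta> * (sqnorm_on Y (interior S) + sqnorm_on Y (interior T)))"
      unfolding xS_def xT_def yS_def yT_def .
  qed
qed

section \<open>Summation over the mesh\<close>

text \<open>Pairs (T, E) are mapped to (neighbour of T across E, E). The map is injective, since at
  most two elements share a facet, so the neighbour terms sum to no more than the own terms; each
  element then occurs at most 3 n + 1 times.\<close>

lemma sum_interior_faces_le:
  fixes \<T> :: "(real^'n) set set" and g :: "(real^'n) set \<Rightarrow> real"
  assumes n2: "CARD('n) \<ge> 2" and C0: "C0 > 0" and gm: "good_mesh C0 \<T>"
    and g: "\<And>T. T \<in> \<T> \<Longrightarrow> 0 \<le> g T" and K: "K \<ge> 0"
    and a: "\<And>S T E. S \<in> \<T> \<Longrightarrow> T \<in> \<T> \<Longrightarrow> S \<noteq> T \<Longrightarrow> E facet_of S \<Longrightarrow> E facet_of T \<Longrightarrow> E \<in> interior_faces \<T> \<Longrightarrow>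
      a S E \<le> K * (g S + g T)"
  shows "(\<Sum>T\<in>\<T>. \<Sum>E\<in>faces T \<inter> interior_faces \<T>. a T E) \<le> 2 * K * real (3 * CARD('n) + 1) * (\<Sum>T\<in>\<T>. g T)"
proof -
  obtain c where c: "c > 0" "c \<le> 1" and data: "\<And>(S :: (real^'n) set) T E.
    is_element S \<and> inverse C0 * diameter S ^ CARD('n) \<le> measure lebesgue S \<and>
    is_element T \<and> inverse C0 * diameter T ^ CARD('n) \<le> measure lebesgue T \<and>
    interior S \<inter> interior T = {} \<and> E facet_of S \<and> E facet_of T \<Longrightarrow> \<exists>a \<nu>. face_data c S T E a \<nu>"
    using interior_face_data[OF n2 C0] by blast
  have el: "is_element U" if "U \<in> \<T>" for U using gm that by (auto simp: good_mesh_def)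
  have fin: "finite \<T>" using gm by (simp add: good_mesh_def)
  have data': "\<exists>a \<nu>. face_data c S T E a \<nu>" if "S \<in> \<T>" "T \<in> \<T>" "S \<noteq> T" "E facet_of S" "E facet_of T" for S T E
    by (rule data) (use gm that in \<open>auto simp: good_mesh_def\<close>)
  note no3 = facet_of_at_most_two[OF gm c(1) data']
  define D where "D = Sigma \<T> (\<lambda>T. faces T \<inter> interior_faces \<T>)"
  have finF: "finite (faces T \<inter> interior_faces \<T>)" if "T \<in> \<T>" for T using card_faces(1)[OF el[OF that]] by simp
  have finD: "finite D" unfolding D_def using fin finF by auto
  have "\<forall>z\<in>D. \<exists>S. S \<in> \<T> \<and> S \<noteq> fst z \<and> snd z facet_of S"
  proof
    fix z assume "z \<in> D"
    then have "snd z \<in> interior_faces \<T>" "snd z \<in> faces (fst z)" by (auto simp: D_def)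
    then show "\<exists>S. S \<in> \<T> \<and> S \<noteq> fst z \<and> snd z facet_of S"
      by (rule interior_face_neighbour) blast
  qed
  then obtain nb where nb: "\<And>z. z \<in> D \<Longrightarrow> nb z \<in> \<T> \<and> nb z \<noteq> fst z \<and> snd z facet_of nb z" by metis
  have Df: "fst z \<in> \<T>" "snd z facet_of fst z" "snd z \<in> interior_faces \<T>" if "z \<in> D" for z
    using that unfolding D_def faces_def by auto
  define m where "m z = (nb z, snd z)" for z
  \<comment> \<open>Two different elements with the same neighbour across the same face would be the
    first two of three elements sharing it.\<close>
  have inj: "inj_on m D"
  proof (rule inj_onI)
    fix y z assume yz: "y \<in> D" "z \<in> D" "m y = m z"
    then have e: "nb y = nb z" "snd y = snd z" by (auto simp: m_def)
    have "fst y = fst z"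
    proof (rule ccontr)
      assume ne: "fst y \<noteq> fst z"
      show False
        by (rule no3[of "fst y" "fst z" "nb y" "snd y"])
          (use ne Df[OF yz(1)] Df[OF yz(2)] nb[OF yz(1)] nb[OF yz(2)] e in auto)
    qed
    then show "y = z" using e by (simp add: prod_eq_iff)
  qed
  have mD: "m ` D \<subseteq> D"
    using nb Df unfolding D_def faces_def m_def by auto
  have "(\<Sum>T\<in>\<T>. \<Sum>E\<in>faces T \<inter> interior_faces \<T>. a T E) = (\<Sum>z\<in>D. a (fst z) (snd z))"
    unfolding D_def using fin finF by (subst sum.Sigma) (auto simp: case_prod_beta')
  also have "\<dots> \<le> (\<Sum>z\<in>D. K * (g (fst z) + g (nb z)))"
    using a nb Df by (intro sum_mono) metis
  also have "\<dots> = K * ((\<Sum>z\<in>D. g (fst z)) + (\<Sum>z\<in>D. g (nb z)))"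
    by (simp add: sum.distrib sum_distrib_left distrib_left)
  also have "\<dots> \<le> K * ((\<Sum>z\<in>D. g (fst z)) + (\<Sum>z\<in>D. g (fst z)))"
  proof (intro mult_left_mono add_left_mono K)
    have "(\<Sum>z\<in>D. g (nb z)) = (\<Sum>z\<in>m ` D. g (fst z))" unfolding sum.reindex[OF inj] o_def by (simp add: m_def)
    also have "\<dots> \<le> (\<Sum>z\<in>D. g (fst z))" by (rule sum_mono2[OF finD mD]) (use g Df in auto)
    finally show "(\<Sum>z\<in>D. g (nb z)) \<le> (\<Sum>z\<in>D. g (fst z))" .
  qed
  also have "\<dots> = 2 * K * (\<Sum>z\<in>D. g (fst z))" by simp
  also have "(\<Sum>z\<in>D. g (fst z)) = (\<Sum>T\<in>\<T>. \<Sum>E\<in>faces T \<inter> interior_faces \<T>. g T)"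
    unfolding D_def using fin finF by (subst sum.Sigma) (auto simp: case_prod_beta')
  also have "\<dots> \<le> (\<Sum>T\<in>\<T>. real (3 * CARD('n) + 1) * g T)"
  proof (rule sum_mono)
    fix T assume T: "T \<in> \<T>"
    have "card (faces T \<inter> interior_faces \<T>) \<le> card (faces T)" using card_faces(1)[OF el[OF T]] by (intro card_mono) auto
    also have "\<dots> \<le> 3 * CARD('n) + 1" by (rule card_faces(2)[OF el[OF T]])
    finally have "real (card (faces T \<inter> interior_faces \<T>)) * g T \<le> real (3 * CARD('n) + 1) * g T"
      using g[OF T] by (intro mult_right_mono) (auto simp del: of_nat_add of_nat_mult)
    then show "(\<Sum>E\<in>faces T \<inter> interior_faces \<T>. g T) \<le> real (3 * CARD('n) + 1) * g T" by simp
  qed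
  also have "\<dots> = real (3 * CARD('n) + 1) * (\<Sum>T\<in>\<T>. g T)" by (simp add: sum_distrib_left)
  finally show ?thesis using K by (simp add: mult_left_mono mult.assoc)
qed

lemma sum_sqnorm_on_le:
  assumes Z: "square_integrable (lebesgue_on \<Omega>) Z" "\<Omega> \<in> sets lebesgue" and fin: "finite \<T>"
    and sub: "\<And>T. T \<in> \<T> \<Longrightarrow> interior T \<subseteq> \<Omega>"
    and disj: "\<And>S T. S \<in> \<T> \<Longrightarrow> T \<in> \<T> \<Longrightarrow> S \<noteq> T \<Longrightarrow> interior S \<inter> interior T = {}"
  shows "(\<Sum>T\<in>\<T>. sqnorm_on Z (interior T)) \<le> sqnorm_on Z \<Omega>"
proof -
  have i: "integrable lebesgue (\<lambda>x. indicator (interior T) x *\<^sub>R (norm (Z x))\<^sup>2)" if "T \<in> \<T>" for T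
    using square_integrable_set_integrable[OF Z sub[OF that]] by (simp add: set_integrable_def)
  have "(\<Sum>T\<in>\<T>. sqnorm_on Z (interior T)) = (LINT x|lebesgue. (\<Sum>T\<in>\<T>. indicator (interior T) x *\<^sub>R (norm (Z x))\<^sup>2))"
    unfolding sqnorm_on_def set_lebesgue_integral_def using i by (intro Bochner_Integration.integral_sum[symmetric])
  also have "\<dots> \<le> sqnorm_on Z \<Omega>"
    unfolding sqnorm_on_def set_lebesgue_integral_def
  proof (rule integral_mono)
    show "integrable lebesgue (\<lambda>x. \<Sum>T\<in>\<T>. indicator (interior T) x *\<^sub>R (norm (Z x))\<^sup>2)"
      using i by (intro Bochner_Integration.integrable_sum)
    show "integrable lebesgue (\<lambda>x. indicator \<Omega> x *\<^sub>R (norm (Z x))\<^sup>2)"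
      using square_integrable_set_integrable[OF Z subset_refl Z(2)] by (simp add: set_integrable_def)
    fix x
    show "(\<Sum>T\<in>\<T>. indicator (interior T) x *\<^sub>R (norm (Z x))\<^sup>2) \<le> indicator \<Omega> x *\<^sub>R (norm (Z x))\<^sup>2"
    proof (cases "\<exists>T\<in>\<T>. x \<in> interior T")
      case True
      then obtain T where T: "T \<in> \<T>" "x \<in> interior T" by blast
      have "(\<Sum>T\<in>\<T>. indicator (interior T) x *\<^sub>R (norm (Z x))\<^sup>2) = (norm (Z x))\<^sup>2"
        by (rule sum_indicator_interior[OF fin T disj])
      then show ?thesis using sub[OF T(1)] T(2) by (auto simp: indicator_def)
    next
      case False
      then have "(\<Sum>T\<in>\<T>. indicator (interior T) x *\<^sub>R (norm (Z x))\<^sup>2) = 0" by (intro sum.neutral) auto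
      then show ?thesis by simp
    qed
  qed
  finally show ?thesis .
qed

section \<open>Estimates of the indicators\<close>

lemma l2_norm_AE_eq:
  fixes w R :: "real^'n \<Rightarrow> real"
  assumes "T \<in> sets lebesgue" "R \<in> borel_measurable borel" "AE x in lebesgue_on T. w x = R x"
  shows "(l2_norm (lebesgue_on T) w)\<^sup>2 = sqnorm_on R T"
proof -
  have "(l2_norm (lebesgue_on T) w)\<^sup>2 = (LINT x|lebesgue_on T. (norm (w x))\<^sup>2)"
    unfolding l2_norm_def by (simp add: integral_nonneg_AE)
  also have "\<dots> = (LINT x|lebesgue_on T. (norm (R x))\<^sup>2)"
  proof (rule LINT_lebesgue_on_AE_eq[OF assms(1)])
    show "(\<lambda>x. (norm (R x))\<^sup>2) \<in> borel_measurable (lebesgue_on T)"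
      using borel_measurable_lebesgue_on_borel[OF assms(2), of T] by simp
    show "AE x in lebesgue_on T. (norm (w x))\<^sup>2 = (norm (R x))\<^sup>2" using assms(3) by eventually_elim simp
  qed
  also have "\<dots> = sqnorm_on R T" using assms(1) by (simp add: sqnorm_on_eq)
  finally show ?thesis .
qed

text \<open>With \<delta> = min {h, \<epsilon>} the squared weight is \<delta> / \<epsilon>^2, the
  factor that turns the jump estimate for this \<delta> into the energy norm.\<close>

lemma alpha_face_sq:
  assumes "\<epsilon> > 0" "diameter T > 0"
  shows "(alpha_face \<epsilon> T)\<^sup>2 = min (diameter T) \<epsilon> / \<epsilon>\<^sup>2"
proof -
  have m: "min (diameter T / \<epsilon>) 1 = min (diameter T) \<epsilon> / \<epsilon>" using assms by (auto simp: min_def divide_le_eq)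
  have "(alpha_face \<epsilon> T)\<^sup>2 = (\<epsilon> powr (-1/2))\<^sup>2 * (min (diameter T / \<epsilon>) 1 powr (1/2))\<^sup>2"
    by (simp add: alpha_face_def power_mult_distrib)
  also have "(\<epsilon> powr (-1/2))\<^sup>2 = inverse \<epsilon>"
    using assms by (simp add: powr_minus powr_half_sqrt power_inverse)
  also have "(min (diameter T / \<epsilon>) 1 powr (1/2))\<^sup>2 = min (diameter T / \<epsilon>) 1"
    using assms by (simp add: powr_half_sqrt)
  finally show ?thesis unfolding m by (simp add: power2_eq_square divide_inverse mult_ac)
qed

lemma sqnorm_on_scaleR: "sqnorm_on (\<lambda>x. a *\<^sub>R Z x) A = a\<^sup>2 * sqnorm_on Z A"
  unfolding sqnorm_on_def by (simp add: power_mult_distrib)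

lemma residual_interior_subset:
  assumes "residual_equation N \<Omega> \<T> \<kappa> F p X Y" "T \<in> \<T>" shows "interior T \<subseteq> \<Omega>"
  using interior_mono[of T "closure \<Omega>"] residual_equationD(3,5)[OF assms(1)] assms(2) by blast

lemma eta_psi_sum_le:
  fixes C0 :: real
  assumes n2: "CARD('n) \<ge> 2" and C0: "C0 > 0"
  shows "\<exists>C>0. \<forall>(\<Omega> :: (real^'n) set) \<T> \<epsilon> f v F Z Y.
     residual_equation N \<Omega> \<T> (\<epsilon>\<^sup>2) F (\<lambda>T. local_poly T v) (\<lambda>x. \<epsilon>\<^sup>2 *\<^sub>R Z x) Y \<and> good_mesh C0 \<T> \<and>
     square_integrable (lebesgue_on \<Omega>) Z \<and> 0 < \<epsilon> \<and>
     (\<forall>T\<in>\<T>. AE x in lebesgue_on T. f x + \<epsilon>\<^sup>2 * laplacian (local_poly T v) x - v x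
        = strong_residual (\<epsilon>\<^sup>2) F (\<lambda>T. local_poly T v) T x) \<longrightarrow>
     (\<Sum>T\<in>\<T>. (eta_psi \<epsilon> \<T> f v T)\<^sup>2) \<le> C * (\<epsilon>\<^sup>2 * sqnorm_on Z \<Omega> + sqnorm_on Y \<Omega>)"
proof -
  obtain CE where CE: "CE > 0" "\<And>(\<Omega> :: (real^'n) set) \<T> \<kappa> F p X Y T. residual_equation N \<Omega> \<T> \<kappa> F p X Y \<Longrightarrow> T \<in> \<T> \<Longrightarrow>
     inverse C0 * diameter T ^ CARD('n) \<le> measure lebesgue T \<Longrightarrow>
     sqnorm_on (strong_residual \<kappa> F p T) T \<le> CE * (sqnorm_on X (interior T) / (diameter T)\<^sup>2 + sqnorm_on Y (interior T))"
    using element_residual_estimate[OF n2 C0, of N] by blast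
  obtain CF where CF: "CF > 0" "\<And>(\<Omega> :: (real^'n) set) \<T> \<kappa> F v X Y S T E \<delta>.
     residual_equation N \<Omega> \<T> \<kappa> F (\<lambda>T. local_poly T v) X Y \<and> \<kappa> \<ge> 0 \<and> good_mesh C0 \<T> \<and>
     S \<in> \<T> \<and> T \<in> \<T> \<and> S \<noteq> T \<and> E facet_of S \<and> E facet_of T \<and> E \<in> interior_faces \<T> \<and> 0 < \<delta> \<and> \<delta> \<le> diameter S \<Longrightarrow>
     (l2_norm (surface_measure E) (\<lambda>x. \<kappa> * normal_deriv_jump \<T> E v x))\<^sup>2 \<le>
       CF * ((sqnorm_on X (interior S) + sqnorm_on X (interior T)) / \<delta> +
         \<delta> * (sqnorm_on Y (interior S) + sqnorm_on Y (interior T)))"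
    using face_estimate[OF n2 C0, of N] by blast
  define M where "M = real (3 * CARD('n) + 1)"
  have M: "M > 0" by (simp add: M_def)
  define C where "C = CE + CF * M"
  have C: "C > 0" unfolding C_def using CE(1) CF(1) M by (intro add_pos_pos mult_pos_pos)
  show ?thesis
  proof (rule exI[of _ C], intro conjI C allI impI)
    fix \<Omega> :: "(real^'n) set" and \<T> \<epsilon> f and v :: "real^'n \<Rightarrow> real" and F and Z :: "real^'n \<Rightarrow> real^'n" and Y :: "real^'n \<Rightarrow> real"
    let ?p = "\<lambda>T. local_poly T v" and ?X = "\<lambda>x. \<epsilon>\<^sup>2 *\<^sub>R Z x"
    assume asm: "residual_equation N \<Omega> \<T> (\<epsilon>\<^sup>2) F ?p ?X Y \<and> good_mesh C0 \<T> \<and>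
     square_integrable (lebesgue_on \<Omega>) Z \<and> 0 < \<epsilon> \<and>
     (\<forall>T\<in>\<T>. AE x in lebesgue_on T. f x + \<epsilon>\<^sup>2 * laplacian (local_poly T v) x - v x = strong_residual (\<epsilon>\<^sup>2) F ?p T x)"
    then have eq: "residual_equation N \<Omega> \<T> (\<epsilon>\<^sup>2) F ?p ?X Y" and gm: "good_mesh C0 \<T>"
      and Z: "square_integrable (lebesgue_on \<Omega>) Z" and \<epsilon>: "0 < \<epsilon>"
      and res: "\<And>T. T \<in> \<T> \<Longrightarrow> AE x in lebesgue_on T. f x + \<epsilon>\<^sup>2 * laplacian (local_poly T v) x - v x = strong_residual (\<epsilon>\<^sup>2) F ?p T x"
      by blast+
    note rD = residual_equationD[OF eq]
    have \<Omega>s: "\<Omega> \<in> sets lebesgue" using rD(1) by auto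
    define g where "g T = \<epsilon>\<^sup>2 * sqnorm_on Z (interior T) + sqnorm_on Y (interior T)" for T
    have g0: "0 \<le> g T" for T unfolding g_def by (intro add_nonneg_nonneg mult_nonneg_nonneg sqnorm_on_nonneg) auto
    have el: "is_element T" if "T \<in> \<T>" for T by (rule rD(6)[OF that])
    have h: "diameter T > 0" if "T \<in> \<T>" for T by (rule is_element_diameter[OF el[OF that]])
    define a where "a T E = (alpha_face \<epsilon> T)\<^sup>2 * (l2_norm (surface_measure E) (\<lambda>x. \<epsilon>\<^sup>2 * normal_deriv_jump \<T> E v x))\<^sup>2" for T E :: "(real^'n) set"
    define e where "e T = (alpha_elem \<epsilon> T)\<^sup>2 * (l2_norm (lebesgue_on T) (\<lambda>x. f x + \<epsilon>\<^sup>2 * laplacian (local_poly T v) x - v x))\<^sup>2" for T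
    have eta: "(eta_psi \<epsilon> \<T> f v T)\<^sup>2 = e T + 1/2 * (\<Sum>E\<in>faces T \<inter> interior_faces \<T>. a T E)" for T
      unfolding eta_psi_def e_def a_def by (intro real_sqrt_pow2 add_nonneg_nonneg mult_nonneg_nonneg sum_nonneg) auto
    have eT: "e T \<le> CE * g T" if T: "T \<in> \<T>" for T
    proof -
      have shape: "inverse C0 * diameter T ^ CARD('n) \<le> measure lebesgue T" using gm T by (auto simp: good_mesh_def)
      have "compact T" by (rule is_element_compact[OF el[OF T]])
      then have Tl: "T \<in> sets lebesgue" by (simp add: compact_imp_closed)
      have "strong_residual (\<epsilon>\<^sup>2) F ?p T \<in> total_degree_polys N" by (rule strong_residual_poly[of F T N ?p, OF rD(7)[OF T] rD(8)[OF T]])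
      then have Rm: "strong_residual (\<epsilon>\<^sup>2) F ?p T \<in> borel_measurable borel" by (intro smooth_fun_borel smooth_fun_poly)
      have "e T = (alpha_elem \<epsilon> T)\<^sup>2 * sqnorm_on (strong_residual (\<epsilon>\<^sup>2) F ?p T) T"
        unfolding e_def l2_norm_AE_eq[OF Tl Rm res[OF T]] ..
      also have "\<dots> \<le> (alpha_elem \<epsilon> T)\<^sup>2 * (CE * ((\<epsilon>\<^sup>2)\<^sup>2 * sqnorm_on Z (interior T) / (diameter T)\<^sup>2 + sqnorm_on Y (interior T)))"
        using CE(2)[OF eq T shape] unfolding sqnorm_on_scaleR by (intro mult_left_mono) auto
      \<comment> \<open>The weight is distributed so that both coefficients, (alpha \<epsilon> /
        h)^2 and alpha^2, are at most 1.\<close>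
      also have "\<dots> = CE * ((alpha_elem \<epsilon> T * \<epsilon> / diameter T)\<^sup>2 * (\<epsilon>\<^sup>2 * sqnorm_on Z (interior T)) + (alpha_elem \<epsilon> T)\<^sup>2 * sqnorm_on Y (interior T))"
        by (simp add: power_mult_distrib power_divide power2_eq_square[of "\<epsilon>\<^sup>2"] algebra_simps)
      also have "\<dots> \<le> CE * (1 * (\<epsilon>\<^sup>2 * sqnorm_on Z (interior T)) + 1 * sqnorm_on Y (interior T))"
      proof (intro mult_left_mono add_mono mult_right_mono)
        have al: "0 \<le> alpha_elem \<epsilon> T" "alpha_elem \<epsilon> T \<le> 1" "alpha_elem \<epsilon> T \<le> diameter T / \<epsilon>"
          using h[OF T] \<epsilon> by (auto simp: alpha_elem_def)
        have "alpha_elem \<epsilon> T * \<epsilon> / diameter T \<le> 1" using al(3) \<epsilon> h[OF T] by (simp add: field_simps)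
        then show "(alpha_elem \<epsilon> T * \<epsilon> / diameter T)\<^sup>2 \<le> 1"
          using al(1) \<epsilon> h[OF T] by (intro power_le_one) auto
        show "(alpha_elem \<epsilon> T)\<^sup>2 \<le> 1" using al by (intro power_le_one)
      qed (use CE(1) in \<open>auto simp: sqnorm_on_nonneg\<close>)
      finally show ?thesis unfolding g_def by simp
    qed
    have aT: "a S E \<le> CF * (g S + g T)"
      if "S \<in> \<T>" "T \<in> \<T>" "S \<noteq> T" "E facet_of S" "E facet_of T" "E \<in> interior_faces \<T>" for S T E
    proof -
      \<comment> \<open>\<delta> belongs to the element S that carries the weight. The face estimate
        admits every \<delta> up to the diameter of its first element, so it can be applied from
        either side of the face.\<close>
      define \<delta> where "\<delta> = min (diameter S) \<epsilon>"
      have \<delta>: "0 < \<delta>" "\<delta> \<le> diameter S" "\<delta> \<le> \<epsilon>" using h[OF that(1)] \<epsilon> by (auto simp: \<delta>_def)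
      define z y where "z = sqnorm_on Z (interior S) + sqnorm_on Z (interior T)" and "y = sqnorm_on Y (interior S) + sqnorm_on Y (interior T)"
      have zy: "z \<ge> 0" "y \<ge> 0" unfolding z_def y_def by (intro add_nonneg_nonneg sqnorm_on_nonneg)+
      have "(l2_norm (surface_measure E) (\<lambda>x. \<epsilon>\<^sup>2 * normal_deriv_jump \<T> E v x))\<^sup>2 \<le>
        CF * ((sqnorm_on ?X (interior S) + sqnorm_on ?X (interior T)) / \<delta> + \<delta> * (sqnorm_on Y (interior S) + sqnorm_on Y (interior T)))"
        by (rule CF(2)) (use eq gm that \<delta> in auto)
      then have "(l2_norm (surface_measure E) (\<lambda>x. \<epsilon>\<^sup>2 * normal_deriv_jump \<T> E v x))\<^sup>2 \<le> CF * ((\<epsilon>\<^sup>2)\<^sup>2 * z / \<delta> + \<delta> * y)"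
        unfolding sqnorm_on_scaleR z_def y_def by (simp add: distrib_left)
      then have "a S E \<le> (\<delta> / \<epsilon>\<^sup>2) * (CF * ((\<epsilon>\<^sup>2)\<^sup>2 * z / \<delta> + \<delta> * y))"
        unfolding a_def alpha_face_sq[OF \<epsilon> h[OF that(1)]] \<delta>_def[symmetric] using \<delta> by (intro mult_left_mono) auto
      also have "\<dots> = CF * (\<epsilon>\<^sup>2 * z + (\<delta> / \<epsilon>)\<^sup>2 * y)"
        using \<delta> \<epsilon> by (simp add: field_simps power2_eq_square)
      also have "\<dots> \<le> CF * (\<epsilon>\<^sup>2 * z + 1 * y)"
        using CF(1) zy \<delta> \<epsilon> by (intro mult_left_mono add_left_mono mult_right_mono power_le_one) auto
      also have "\<dots> = CF * (g S + g T)" unfolding g_def z_def y_def by (simp add: distrib_left)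
      finally show ?thesis .
    qed
    have gsum: "(\<Sum>T\<in>\<T>. g T) \<le> \<epsilon>\<^sup>2 * sqnorm_on Z \<Omega> + sqnorm_on Y \<Omega>"
    proof -
      have "(\<Sum>T\<in>\<T>. g T) = \<epsilon>\<^sup>2 * (\<Sum>T\<in>\<T>. sqnorm_on Z (interior T)) + (\<Sum>T\<in>\<T>. sqnorm_on Y (interior T))"
        unfolding g_def by (simp add: sum.distrib sum_distrib_left)
      also have "\<dots> \<le> \<epsilon>\<^sup>2 * sqnorm_on Z \<Omega> + sqnorm_on Y \<Omega>"
        by (intro add_mono mult_left_mono sum_sqnorm_on_le[OF Z \<Omega>s rD(4) residual_interior_subset[OF eq] rD(9)]
            sum_sqnorm_on_le[OF rD(11) \<Omega>s rD(4) residual_interior_subset[OF eq] rD(9)]) auto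
      finally show ?thesis .
    qed
    have "(\<Sum>T\<in>\<T>. (eta_psi \<epsilon> \<T> f v T)\<^sup>2) = (\<Sum>T\<in>\<T>. e T) + 1/2 * (\<Sum>T\<in>\<T>. \<Sum>E\<in>faces T \<inter> interior_faces \<T>. a T E)"
      unfolding eta by (simp add: sum.distrib sum_divide_distrib)
    also have "\<dots> \<le> CE * (\<Sum>T\<in>\<T>. g T) + 1/2 * (2 * CF * M * (\<Sum>T\<in>\<T>. g T))"
    proof (intro add_mono mult_left_mono)
      show "(\<Sum>T\<in>\<T>. e T) \<le> CE * (\<Sum>T\<in>\<T>. g T)" unfolding sum_distrib_left by (intro sum_mono eT)
      show "(\<Sum>T\<in>\<T>. \<Sum>E\<in>faces T \<inter> interior_faces \<T>. a T E) \<le> 2 * CF * M * (\<Sum>T\<in>\<T>. g T)"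
        unfolding M_def by (rule sum_interior_faces_le[OF n2 C0 gm g0 _ aT]) (use CF(1) in auto)
    qed simp
    also have "\<dots> = C * (\<Sum>T\<in>\<T>. g T)" by (simp add: C_def algebra_simps)
    also have "\<dots> \<le> C * (\<epsilon>\<^sup>2 * sqnorm_on Z \<Omega> + sqnorm_on Y \<Omega>)" using gsum C by (intro mult_left_mono) auto
    finally show "(\<Sum>T\<in>\<T>. (eta_psi \<epsilon> \<T> f v T)\<^sup>2) \<le> C * (\<epsilon>\<^sup>2 * sqnorm_on Z \<Omega> + sqnorm_on Y \<Omega>)" .
  qed
qed

text \<open>The case \<kappa> = 1 with \<delta> the diameter of the element. The zeroth-order error
  keeps the factor (diameter T)^2, which is absorbed by the bound \<open>D\<close> on the
  diameters.\<close>

lemma eta_u_sum_le: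
  fixes C0 D :: real
  assumes n2: "CARD('n) \<ge> 2" and C0: "C0 > 0"
  shows "\<exists>C>0. \<forall>(\<Omega> :: (real^'n) set) \<T> w v F X Y.
     residual_equation N \<Omega> \<T> 1 F (\<lambda>T. local_poly T v) X Y \<and> good_mesh C0 \<T> \<and> (\<forall>T\<in>\<T>. diameter T \<le> D) \<and>
     (\<forall>T\<in>\<T>. AE x in lebesgue_on T. laplacian (local_poly T v) x + w x
        = strong_residual 1 F (\<lambda>T. local_poly T v) T x) \<longrightarrow>
     (\<Sum>T\<in>\<T>. (eta_u \<T> w v T)\<^sup>2) \<le> C * (sqnorm_on X \<Omega> + sqnorm_on Y \<Omega>)"
proof -
  obtain CE where CE: "CE > 0" "\<And>(\<Omega> :: (real^'n) set) \<T> \<kappa> F p X Y T. residual_equation N \<Omega> \<T> \<kappa> F p X Y \<Longrightarrow> T \<in> \<T> \<Longrightarrow>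
     inverse C0 * diameter T ^ CARD('n) \<le> measure lebesgue T \<Longrightarrow>
     sqnorm_on (strong_residual \<kappa> F p T) T \<le> CE * (sqnorm_on X (interior T) / (diameter T)\<^sup>2 + sqnorm_on Y (interior T))"
    using element_residual_estimate[OF n2 C0, of N] by blast
  obtain CF where CF: "CF > 0" "\<And>(\<Omega> :: (real^'n) set) \<T> \<kappa> F v X Y S T E \<delta>.
     residual_equation N \<Omega> \<T> \<kappa> F (\<lambda>T. local_poly T v) X Y \<and> \<kappa> \<ge> 0 \<and> good_mesh C0 \<T> \<and>
     S \<in> \<T> \<and> T \<in> \<T> \<and> S \<noteq> T \<and> E facet_of S \<and> E facet_of T \<and> E \<in> interior_faces \<T> \<and> 0 < \<delta> \<and> \<delta> \<le> diameter S \<Longrightarrow>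
     (l2_norm (surface_measure E) (\<lambda>x. \<kappa> * normal_deriv_jump \<T> E v x))\<^sup>2 \<le>
       CF * ((sqnorm_on X (interior S) + sqnorm_on X (interior T)) / \<delta> +
         \<delta> * (sqnorm_on Y (interior S) + sqnorm_on Y (interior T)))"
    using face_estimate[OF n2 C0, of N] by blast
  define M where "M = real (3 * CARD('n) + 1)"
  have M: "M > 0" by (simp add: M_def)
  define C where "C = (CE + CF * M) * (1 + D\<^sup>2)"
  have D1: "1 + D\<^sup>2 > 0" by (simp add: add_pos_nonneg)
  have C': "CE + CF * M > 0" using CE(1) CF(1) M by (intro add_pos_pos mult_pos_pos)
  have C: "C > 0" unfolding C_def using C' D1 by (rule mult_pos_pos)
  show ?thesis
  proof (rule exI[of _ C], intro conjI C allI impI)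
    fix \<Omega> :: "(real^'n) set" and \<T> w and v :: "real^'n \<Rightarrow> real" and F and X :: "real^'n \<Rightarrow> real^'n" and Y :: "real^'n \<Rightarrow> real"
    let ?p = "\<lambda>T. local_poly T v"
    assume asm: "residual_equation N \<Omega> \<T> 1 F ?p X Y \<and> good_mesh C0 \<T> \<and> (\<forall>T\<in>\<T>. diameter T \<le> D) \<and>
     (\<forall>T\<in>\<T>. AE x in lebesgue_on T. laplacian (local_poly T v) x + w x = strong_residual 1 F ?p T x)"
    then have eq: "residual_equation N \<Omega> \<T> 1 F ?p X Y" and gm: "good_mesh C0 \<T>" and hD: "\<And>T. T \<in> \<T> \<Longrightarrow> diameter T \<le> D"
      and res: "\<And>T. T \<in> \<T> \<Longrightarrow> AE x in lebesgue_on T. laplacian (local_poly T v) x + w x = strong_residual 1 F ?p T x"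
      by blast+
    note rD = residual_equationD[OF eq]
    have \<Omega>s: "\<Omega> \<in> sets lebesgue" using rD(1) by auto
    define g where "g T = (1 + D\<^sup>2) * (sqnorm_on X (interior T) + sqnorm_on Y (interior T))" for T
    have g0: "0 \<le> g T" for T unfolding g_def using D1 by (intro add_nonneg_nonneg mult_nonneg_nonneg sqnorm_on_nonneg) auto
    have el: "is_element T" if "T \<in> \<T>" for T by (rule rD(6)[OF that])
    have h: "diameter T > 0" if "T \<in> \<T>" for T by (rule is_element_diameter[OF el[OF that]])
    have hD2: "(diameter T)\<^sup>2 \<le> D\<^sup>2" if "T \<in> \<T>" for T using hD[OF that] h[OF that] by (intro power_mono) auto
    have xy: "x + k * y \<le> (1 + D\<^sup>2) * (x + y)" if "x \<ge> 0" "y \<ge> 0" "k \<le> D\<^sup>2" for x y k :: real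
    proof -
      have "k * y \<le> D\<^sup>2 * y" using that by (intro mult_right_mono)
      moreover have "0 \<le> D\<^sup>2 * x" using that by simp
      ultimately show ?thesis unfolding distrib_left distrib_right using that by linarith
    qed
    define a where "a T E = diameter E * (l2_norm (surface_measure E) (normal_deriv_jump \<T> E v))\<^sup>2" for T E :: "(real^'n) set"
    define e where "e T = (diameter T)\<^sup>2 * (l2_norm (lebesgue_on T) (\<lambda>x. laplacian (local_poly T v) x + w x))\<^sup>2" for T
    have Eb: "bounded E" if "T \<in> \<T>" "E \<in> faces T" for T E
      using that facet_of_imp_subset[of E T] compact_imp_bounded[OF is_element_compact[OF el[OF that(1)]]]
      unfolding faces_def by (auto intro: bounded_subset)
    have eta: "(eta_u \<T> w v T)\<^sup>2 = e T + 1/2 * (\<Sum>E\<in>faces T \<inter> interior_faces \<T>. a T E)" if "T \<in> \<T>" for T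
      unfolding eta_u_def e_def a_def
      by (intro real_sqrt_pow2 add_nonneg_nonneg mult_nonneg_nonneg sum_nonneg diameter_ge_0) (use Eb that in auto)
    have eT: "e T \<le> CE * g T" if T: "T \<in> \<T>" for T
    proof -
      have shape: "inverse C0 * diameter T ^ CARD('n) \<le> measure lebesgue T" using gm T by (auto simp: good_mesh_def)
      have "compact T" by (rule is_element_compact[OF el[OF T]])
      then have Tl: "T \<in> sets lebesgue" by (simp add: compact_imp_closed)
      have "strong_residual 1 F ?p T \<in> total_degree_polys N" by (rule strong_residual_poly[of F T N ?p, OF rD(7)[OF T] rD(8)[OF T]])
      then have Rm: "strong_residual 1 F ?p T \<in> borel_measurable borel" by (intro smooth_fun_borel smooth_fun_poly)
      have "e T = (diameter T)\<^sup>2 * sqnorm_on (strong_residual 1 F ?p T) T"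
        unfolding e_def l2_norm_AE_eq[OF Tl Rm res[OF T]] ..
      also have "\<dots> \<le> (diameter T)\<^sup>2 * (CE * (sqnorm_on X (interior T) / (diameter T)\<^sup>2 + sqnorm_on Y (interior T)))"
        using CE(2)[OF eq T shape] by (intro mult_left_mono) auto
      also have "\<dots> = CE * (sqnorm_on X (interior T) + (diameter T)\<^sup>2 * sqnorm_on Y (interior T))"
        using h[OF T] by (simp add: field_simps)
      also have "\<dots> \<le> CE * g T" unfolding g_def using CE(1) xy[OF sqnorm_on_nonneg sqnorm_on_nonneg hD2[OF T]] by (intro mult_left_mono) auto
      finally show ?thesis .
    qed
    have aT: "a S E \<le> CF * (g S + g T)"
      if "S \<in> \<T>" "T \<in> \<T>" "S \<noteq> T" "E facet_of S" "E facet_of T" "E \<in> interior_faces \<T>" for S T E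
    proof -
      define z y where "z = sqnorm_on X (interior S) + sqnorm_on X (interior T)" and "y = sqnorm_on Y (interior S) + sqnorm_on Y (interior T)"
      have zy: "z \<ge> 0" "y \<ge> 0" unfolding z_def y_def by (intro add_nonneg_nonneg sqnorm_on_nonneg)+
      have "(l2_norm (surface_measure E) (\<lambda>x. 1 * normal_deriv_jump \<T> E v x))\<^sup>2 \<le> CF * (z / diameter S + diameter S * y)"
        unfolding z_def y_def by (rule CF(2)) (use eq gm that h in auto)
      then have l: "(l2_norm (surface_measure E) (normal_deriv_jump \<T> E v))\<^sup>2 \<le> CF * (z / diameter S + diameter S * y)" by simp
      \<comment> \<open>The weight of the face is at most the width \<delta> = diameter S of the
        bubble, so it cancels the factor 1 / \<delta> of the gradient term.\<close>
      have "diameter E \<le> diameter S"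
        by (rule diameter_subset[OF facet_of_imp_subset[OF that(4)] compact_imp_bounded[OF is_element_compact[OF el[OF that(1)]]]])
      then have "a S E \<le> diameter S * (CF * (z / diameter S + diameter S * y))"
        unfolding a_def using l h[OF that(1)] by (intro mult_mono) auto
      also have "\<dots> = CF * (z + (diameter S)\<^sup>2 * y)" using h[OF that(1)] by (simp add: field_simps power2_eq_square)
      also have "\<dots> \<le> CF * ((1 + D\<^sup>2) * (z + y))" using CF(1) xy[OF zy hD2[OF that(1)]] by (intro mult_left_mono) auto
      also have "\<dots> = CF * (g S + g T)" unfolding g_def z_def y_def by (simp add: distrib_left)
      finally show ?thesis .
    qed
    have gsum: "(\<Sum>T\<in>\<T>. g T) \<le> (1 + D\<^sup>2) * (sqnorm_on X \<Omega> + sqnorm_on Y \<Omega>)"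
    proof -
      have "(\<Sum>T\<in>\<T>. g T) = (1 + D\<^sup>2) * ((\<Sum>T\<in>\<T>. sqnorm_on X (interior T)) + (\<Sum>T\<in>\<T>. sqnorm_on Y (interior T)))"
        unfolding g_def sum_distrib_left[symmetric] sum.distrib ..
      also have "\<dots> \<le> (1 + D\<^sup>2) * (sqnorm_on X \<Omega> + sqnorm_on Y \<Omega>)"
        using D1 by (intro add_mono mult_left_mono sum_sqnorm_on_le[OF rD(10) \<Omega>s rD(4) residual_interior_subset[OF eq] rD(9)]
            sum_sqnorm_on_le[OF rD(11) \<Omega>s rD(4) residual_interior_subset[OF eq] rD(9)]) auto
      finally show ?thesis .
    qed
    have "(\<Sum>T\<in>\<T>. (eta_u \<T> w v T)\<^sup>2) = (\<Sum>T\<in>\<T>. e T) + 1/2 * (\<Sum>T\<in>\<T>. \<Sum>E\<in>faces T \<inter> interior_faces \<T>. a T E)"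
      using eta by (simp add: sum.distrib sum_divide_distrib)
    also have "\<dots> \<le> CE * (\<Sum>T\<in>\<T>. g T) + 1/2 * (2 * CF * M * (\<Sum>T\<in>\<T>. g T))"
    proof (intro add_mono mult_left_mono)
      show "(\<Sum>T\<in>\<T>. e T) \<le> CE * (\<Sum>T\<in>\<T>. g T)" unfolding sum_distrib_left by (intro sum_mono eT)
      show "(\<Sum>T\<in>\<T>. \<Sum>E\<in>faces T \<inter> interior_faces \<T>. a T E) \<le> 2 * CF * M * (\<Sum>T\<in>\<T>. g T)"
        unfolding M_def by (rule sum_interior_faces_le[OF n2 C0 gm g0 _ aT]) (use CF(1) in auto)
    qed simp
    also have "\<dots> = (CE + CF * M) * (\<Sum>T\<in>\<T>. g T)" by (simp add: algebra_simps)
    also have "\<dots> \<le> (CE + CF * M) * ((1 + D\<^sup>2) * (sqnorm_on X \<Omega> + sqnorm_on Y \<Omega>))" using gsum C' by (intro mult_left_mono) auto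
    finally show "(\<Sum>T\<in>\<T>. (eta_u \<T> w v T)\<^sup>2) \<le> C * (sqnorm_on X \<Omega> + sqnorm_on Y \<Omega>)" by (simp add: C_def mult.assoc)
  qed
qed

section \<open>Finite element functions\<close>

lemma is_element_frontier: "is_element T \<Longrightarrow> negligible (frontier T)"
  by (intro negligible_convex_frontier is_element_convex)

lemma AE_interior:
  fixes T :: "(real^'n) set"
  assumes "is_element T" shows "AE x in lebesgue_on T. x \<in> interior T"
proof -
  have cl: "closed T" using is_element_compact[OF assms] by (rule compact_imp_closed)
  have "AE x in lebesgue. x \<notin> frontier T"
    using is_element_frontier[OF assms] by (intro AE_not_in) (simp add: negligible_iff_null_sets)
  then have "AE x in lebesgue. x \<in> T \<longrightarrow> x \<in> interior T"
    by eventually_elim (use cl in \<open>auto simp: frontier_def\<close>)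
  then show ?thesis using cl by (simp add: AE_restrict_space_iff)
qed

lemma mesh_AE_cover:
  fixes \<Omega> :: "(real^'n) set"
  assumes "open \<Omega>" "finite \<T>" "\<Union>\<T> = closure \<Omega>" "\<And>T. T \<in> \<T> \<Longrightarrow> is_element T"
  shows "AE x in lebesgue_on \<Omega>. \<exists>T\<in>\<T>. x \<in> interior T"
proof -
  have "negligible (\<Union>T\<in>\<T>. frontier T)" using assms is_element_frontier by (intro negligible_Union) auto
  then have "AE x in lebesgue. x \<notin> (\<Union>T\<in>\<T>. frontier T)" by (intro AE_not_in) (simp add: negligible_iff_null_sets)
  then have "AE x in lebesgue. x \<in> \<Omega> \<longrightarrow> (\<exists>T\<in>\<T>. x \<in> interior T)"
  proof eventually_elim
    case (elim x)
    show ?case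
    proof
      assume "x \<in> \<Omega>"
      then have "x \<in> closure \<Omega>" using closure_subset by blast
      then obtain T where T: "T \<in> \<T>" "x \<in> T" using assms(3) by blast
      then have "closed T" using assms(4) is_element_compact compact_imp_closed by blast
      then have "x \<in> interior T" using elim T by (auto simp: frontier_def)
      then show "\<exists>T\<in>\<T>. x \<in> interior T" using T(1) by blast
    qed
  qed
  then show ?thesis using assms(1) by (simp add: AE_restrict_space_iff)
qed

lemma fe_space_facts:
  fixes \<Omega> :: "(real^'n) set"
  assumes \<Omega>: "open \<Omega>" "bounded \<Omega>" and m: "mesh \<Omega> \<T>" and v: "v \<in> fe_space k \<Omega> \<T>"
  shows "\<And>T. T \<in> \<T> \<Longrightarrow> local_poly T v \<in> total_degree_polys (CARD('n) * k)"
    "\<And>T x. T \<in> \<T> \<Longrightarrow> x \<in> T \<Longrightarrow> v x = local_poly T v x"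
    "is_weak_grad \<Omega> v (pw_grad \<T> (\<lambda>T. local_poly T v))"
    "square_integrable (lebesgue_on \<Omega>) v"
proof -
  have el: "is_element T" if "T \<in> \<T>" for T using m that by (auto simp: mesh_def is_element_def)
  have lp: "local_poly T v \<in> total_degree_polys (CARD('n) * k) \<and> (\<forall>x\<in>T. v x = local_poly T v x)" if "T \<in> \<T>" for T
  proof -
    have "\<exists>p\<in>local_space k T. \<forall>x\<in>T. v x = p x" using v that by (simp add: fe_space_def)
    then obtain p where p: "p \<in> local_space k T" "\<forall>x\<in>T. v x = p x" by (elim bexE)
    then have pp: "p \<in> total_degree_polys (CARD('n) * k)" using local_space_subset by blast
    have "local_poly T v = p"
      by (rule local_poly_eq[OF real_polynomial_function_poly[OF pp]]) (use p(2) is_element_interior[OF el[OF that]] in auto)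
    then show ?thesis using pp p(2) by simp
  qed
  then show 1: "\<And>T. T \<in> \<T> \<Longrightarrow> local_poly T v \<in> total_degree_polys (CARD('n) * k)"
    and 2: "\<And>T x. T \<in> \<T> \<Longrightarrow> x \<in> T \<Longrightarrow> v x = local_poly T v x" by blast+
  have cont: "continuous_on (closure \<Omega>) v" using v by (simp add: fe_space_def)
  show "is_weak_grad \<Omega> v (pw_grad \<T> (\<lambda>T. local_poly T v))"
  proof (rule piecewise_weak_grad[OF \<Omega> _ _ _ _ _ cont 2])
    show "finite \<T>" "\<Union>\<T> = closure \<Omega>" using m by (auto simp: mesh_def)
    show "interior S \<inter> interior T = {}" if "S \<in> \<T>" "T \<in> \<T>" "S \<noteq> T" for S T using m that by (auto simp: mesh_def)
    show "closed T" "negligible (frontier T)" if "T \<in> \<T>" for T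
      using is_element_compact[OF el[OF that]] is_element_frontier[OF el[OF that]] by (auto intro: compact_imp_closed)
    show "smooth_fun (local_poly T v)" if "T \<in> \<T>" for T by (rule smooth_fun_poly[OF 1[OF that]])
  qed
  have "bounded (v ` closure \<Omega>)"
    using \<Omega>(2) cont by (intro compact_imp_bounded compact_continuous_image) (auto simp: compact_eq_bounded_closed)
  then obtain B where B: "\<forall>x\<in>closure \<Omega>. \<bar>v x\<bar> \<le> B" unfolding bounded_iff by auto
  have "v \<in> borel_measurable (lebesgue_on \<Omega>)"
    using continuous_on_subset[OF cont closure_subset] \<Omega>(1) by (intro continuous_imp_measurable_on_sets_lebesgue) auto
  then show "square_integrable (lebesgue_on \<Omega>) v"
    by (rule square_integrable_bounded[OF open_bounded_lmeasurable[OF \<Omega>]]) (use B closure_subset[of \<Omega>] in auto)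
qed

lemma l2_inner_test:
  assumes "open \<Omega>" "bounded \<Omega>" "v \<in> H1 \<Omega>" "\<phi> \<in> test_functions \<Omega>"
  shows "l2_inner (lebesgue_on \<Omega>) (weak_grad \<Omega> v) (weak_grad \<Omega> \<phi>) = (LINT x|lebesgue_on \<Omega>. weak_grad \<Omega> v x \<bullet> grad \<phi> x)"
proof -
  obtain g where "is_weak_grad \<Omega> v g" using assms(3) by (auto simp: H1_def)
  then have "is_weak_grad \<Omega> v (weak_grad \<Omega> v)" by (rule weak_grad_AE(1)[OF assms(1,2)])
  from l2_inner_weak_grad_eq[OF assms(1,2) this test_functions_weak_grad[OF assms(1,2,4)]]
  show ?thesis by (simp add: l2_inner_def)
qed

theorem theorem5p4:
  fixes \<Omega> :: "(real^'n) set" and k m :: nat and C0 :: real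
  assumes "CARD('n) = 2 \<or> CARD('n) = 3"
    and "polyhedral_lipschitz_domain \<Omega>"
    and "k \<ge> 1"
    and "C0 > 0"
  shows "\<exists>C9>0. \<exists>C10>0. \<forall>\<T> \<epsilon> f \<psi> u \<psi>h uh.
    mesh \<Omega> \<T> \<and> shape_regular C0 \<T> \<and> 0 < \<epsilon> \<and> \<epsilon> < 1 \<and>
    piecewise_poly m \<T> f \<and>
    \<psi> \<in> H1 \<Omega> \<and> u \<in> H10 \<Omega> \<and>
    (\<forall>\<phi>\<in>H10 \<Omega>.
       \<epsilon>\<^sup>2 * l2_inner (lebesgue_on \<Omega>) (weak_grad \<Omega> \<psi>) (weak_grad \<Omega> \<phi>)
         + l2_inner (lebesgue_on \<Omega>) \<psi> \<phi> = l2_inner (lebesgue_on \<Omega>) f \<phi>) \<and>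
    (\<forall>v\<in>H1 \<Omega>.
       l2_inner (lebesgue_on \<Omega>) (weak_grad \<Omega> u) (weak_grad \<Omega> v)
         = l2_inner (lebesgue_on \<Omega>) \<psi> v) \<and>
    \<psi>h \<in> fe_space k \<Omega> \<T> \<and> uh \<in> fe_space0 k \<Omega> \<T> \<and>
    (\<forall>\<phi>h\<in>fe_space0 k \<Omega> \<T>.
       \<epsilon>\<^sup>2 * l2_inner (lebesgue_on \<Omega>) (weak_grad \<Omega> \<psi>h) (weak_grad \<Omega> \<phi>h)
         + l2_inner (lebesgue_on \<Omega>) \<psi>h \<phi>h = l2_inner (lebesgue_on \<Omega>) f \<phi>h) \<and>
    (\<forall>vh\<in>fe_space k \<Omega> \<T>.
       l2_inner (lebesgue_on \<Omega>) (weak_grad \<Omega> uh) (weak_grad \<Omega> vh)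
         = l2_inner (lebesgue_on \<Omega>) \<psi>h vh) \<longrightarrow>
    C9 * sqrt (\<Sum>T\<in>\<T>. (eta_psi \<epsilon> \<T> f \<psi>h T)\<^sup>2)
      \<le> energy_norm \<Omega> \<epsilon> (\<lambda>x. \<psi> x - \<psi>h x) \<and>
    C10 * sqrt (\<Sum>T\<in>\<T>. (eta_psi \<epsilon> \<T> f \<psi>h T)\<^sup>2 + (eta_u \<T> \<psi>h uh T)\<^sup>2)
      \<le> pair_norm \<Omega> \<epsilon> (\<lambda>x. \<psi> x - \<psi>h x) (\<lambda>x. u x - uh x)"
proof -
  have n2: "CARD('n) \<ge> 2" using assms(1) by auto
  have \<Omega>: "open \<Omega>" "bounded \<Omega>" and "lipschitz_boundary \<Omega>"
    using assms(2) by (auto simp: polyhedral_lipschitz_domain_def)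
  then have ic: "interior (closure \<Omega>) = \<Omega>" by (intro lipschitz_boundary_interior_closure)
  note lm = open_bounded_lmeasurable[OF \<Omega>]
  have \<Omega>s: "\<Omega> \<in> sets lebesgue" using lm by auto
  \<comment> \<open>One degree bound for the finite element functions, of total degree at most n k,
    and for f, of degree at most m.\<close>
  define N where "N = CARD('n) * k + m"
  obtain C1 where C1: "C1 > 0" "\<And>(\<Omega> :: (real^'n) set) \<T> \<epsilon> f v F Z Y.
     residual_equation N \<Omega> \<T> (\<epsilon>\<^sup>2) F (\<lambda>T. local_poly T v) (\<lambda>x. \<epsilon>\<^sup>2 *\<^sub>R Z x) Y \<and> good_mesh C0 \<T> \<and>
     square_integrable (lebesgue_on \<Omega>) Z \<and> 0 < \<epsilon> \<and>
     (\<forall>T\<in>\<T>. AE x in lebesgue_on T. f x + \<epsilon>\<^sup>2 * laplacian (local_poly T v) x - v x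
        = strong_residual (\<epsilon>\<^sup>2) F (\<lambda>T. local_poly T v) T x) \<Longrightarrow>
     (\<Sum>T\<in>\<T>. (eta_psi \<epsilon> \<T> f v T)\<^sup>2) \<le> C1 * (\<epsilon>\<^sup>2 * sqnorm_on Z \<Omega> + sqnorm_on Y \<Omega>)"
    using eta_psi_sum_le[OF n2 assms(4), of N] by blast
  \<comment> \<open>Every element has diameter at most that of \<Omega>. Fixing this bound before
    the mesh keeps the constant independent of the mesh.\<close>
  obtain C2 where C2: "C2 > 0" "\<And>(\<Omega>' :: (real^'n) set) \<T> w v F X Y.
     residual_equation N \<Omega>' \<T> 1 F (\<lambda>T. local_poly T v) X Y \<and> good_mesh C0 \<T> \<and> (\<forall>T\<in>\<T>. diameter T \<le> diameter \<Omega>) \<and>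
     (\<forall>T\<in>\<T>. AE x in lebesgue_on T. laplacian (local_poly T v) x + w x
        = strong_residual 1 F (\<lambda>T. local_poly T v) T x) \<Longrightarrow>
     (\<Sum>T\<in>\<T>. (eta_u \<T> w v T)\<^sup>2) \<le> C2 * (sqnorm_on X \<Omega>' + sqnorm_on Y \<Omega>')"
    using eta_u_sum_le[OF n2 assms(4), of N "diameter \<Omega>"] by blast
  have sqrt_bound: "(1 / sqrt C) * sqrt A \<le> b" if "C > 0" "A \<le> C * b\<^sup>2" "b \<ge> 0" for A b C :: real
  proof -
    have "sqrt A \<le> sqrt (C * b\<^sup>2)" using that by simp
    also have "\<dots> = sqrt C * b" using that by (simp add: real_sqrt_mult)
    finally show ?thesis using that by (simp add: divide_le_eq mult.commute)
  qed
  show ?thesis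
  \<comment> \<open>The summed estimates have the form A \<le> C b^2, whence the constants 1 / sqrt
    C. The error of \<psi> occurs in both estimates, so the pair norm requires C1 + C2.\<close>
  proof (rule exI[of _ "1 / sqrt C1"], rule conjI, use C1(1) in simp,
      rule exI[of _ "1 / sqrt (C1 + C2)"], rule conjI, use C1(1) C2(1) in simp, intro allI impI)
    fix \<T> \<epsilon> f \<psi> u \<psi>h uh
    assume asm: "mesh \<Omega> \<T> \<and> shape_regular C0 \<T> \<and> 0 < \<epsilon> \<and> \<epsilon> < 1 \<and>
    piecewise_poly m \<T> f \<and>
    \<psi> \<in> H1 \<Omega> \<and> u \<in> H10 \<Omega> \<and>
    (\<forall>\<phi>\<in>H10 \<Omega>.
       \<epsilon>\<^sup>2 * l2_inner (lebesgue_on \<Omega>) (weak_grad \<Omega> \<psi>) (weak_grad \<Omega> \<phi>)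
         + l2_inner (lebesgue_on \<Omega>) \<psi> \<phi> = l2_inner (lebesgue_on \<Omega>) f \<phi>) \<and>
    (\<forall>v\<in>H1 \<Omega>.
       l2_inner (lebesgue_on \<Omega>) (weak_grad \<Omega> u) (weak_grad \<Omega> v)
         = l2_inner (lebesgue_on \<Omega>) \<psi> v) \<and>
    \<psi>h \<in> fe_space k \<Omega> \<T> \<and> uh \<in> fe_space0 k \<Omega> \<T> \<and>
    (\<forall>\<phi>h\<in>fe_space0 k \<Omega> \<T>.
       \<epsilon>\<^sup>2 * l2_inner (lebesgue_on \<Omega>) (weak_grad \<Omega> \<psi>h) (weak_grad \<Omega> \<phi>h)
         + l2_inner (lebesgue_on \<Omega>) \<psi>h \<phi>h = l2_inner (lebesgue_on \<Omega>) f \<phi>h) \<and>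
    (\<forall>vh\<in>fe_space k \<Omega> \<T>.
       l2_inner (lebesgue_on \<Omega>) (weak_grad \<Omega> uh) (weak_grad \<Omega> vh)
         = l2_inner (lebesgue_on \<Omega>) \<psi>h vh)"
    then have mesh: "mesh \<Omega> \<T>" and gm: "good_mesh C0 \<T>" and \<epsilon>: "\<epsilon> > 0" and pf: "piecewise_poly m \<T> f"
      and \<psi>: "\<psi> \<in> H1 \<Omega>" and u: "u \<in> H1 \<Omega>"
      and e\<psi>: "\<And>\<phi>. \<phi> \<in> H10 \<Omega> \<Longrightarrow> \<epsilon>\<^sup>2 * l2_inner (lebesgue_on \<Omega>) (weak_grad \<Omega> \<psi>) (weak_grad \<Omega> \<phi>)
         + l2_inner (lebesgue_on \<Omega>) \<psi> \<phi> = l2_inner (lebesgue_on \<Omega>) f \<phi>"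
      and eu: "\<And>v. v \<in> H1 \<Omega> \<Longrightarrow> l2_inner (lebesgue_on \<Omega>) (weak_grad \<Omega> u) (weak_grad \<Omega> v) = l2_inner (lebesgue_on \<Omega>) \<psi> v"
      and \<psi>h: "\<psi>h \<in> fe_space k \<Omega> \<T>" and uh: "uh \<in> fe_space k \<Omega> \<T>"
      using mesh_good_mesh by (auto simp: H10_def fe_space0_def)
    have el: "is_element T" if "T \<in> \<T>" for T using gm that by (auto simp: good_mesh_def)
    have \<T>: "finite \<T>" "\<Union>\<T> = closure \<Omega>" using mesh by (auto simp: mesh_def)
    have disj: "interior S \<inter> interior T = {}" if "S \<in> \<T>" "T \<in> \<T>" "S \<noteq> T" for S T using mesh that by (auto simp: mesh_def)
    note F\<psi> = fe_space_facts[OF \<Omega> mesh \<psi>h] and Fu = fe_space_facts[OF \<Omega> mesh uh]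
    let ?p\<psi> = "\<lambda>T. local_poly T \<psi>h" and ?pu = "\<lambda>T. local_poly T uh"
    have "\<forall>T\<in>\<T>. \<exists>p. p \<in> total_degree_polys m \<and> (\<forall>x\<in>interior T. f x = p x)"
      using pf unfolding piecewise_poly_def by blast
    then obtain pf where pf: "\<And>T. T \<in> \<T> \<Longrightarrow> pf T \<in> total_degree_polys m" "\<And>T x. T \<in> \<T> \<Longrightarrow> x \<in> interior T \<Longrightarrow> f x = pf T x"
      by metis
    have PN: "?p\<psi> T \<in> total_degree_polys N" "?pu T \<in> total_degree_polys N" "pf T \<in> total_degree_polys N" if "T \<in> \<T>" for T
      using polys_mono[OF F\<psi>(1)[OF that], of N] polys_mono[OF Fu(1)[OF that], of N] polys_mono[OF pf(1)[OF that], of N]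
      by (auto simp: N_def)
    define F1 where "F1 T x = pf T x - ?p\<psi> T x" for T x
    have F1: "F1 T \<in> total_degree_polys N" if "T \<in> \<T>" for T
      unfolding F1_def[abs_def] by (intro polys_diff PN that)
    obtain g\<psi> gu where "is_weak_grad \<Omega> \<psi> g\<psi>" "is_weak_grad \<Omega> u gu" using \<psi> u by (auto simp: H1_def)
    then have w\<psi>: "is_weak_grad \<Omega> \<psi> (weak_grad \<Omega> \<psi>)" and wu: "is_weak_grad \<Omega> u (weak_grad \<Omega> u)"
      by (auto intro: weak_grad_AE(1)[OF \<Omega>])
    have s\<psi>: "square_integrable (lebesgue_on \<Omega>) \<psi>" and su: "square_integrable (lebesgue_on \<Omega>) u" using \<psi> u by (auto simp: H1_def)
    let ?G\<psi> = "pw_grad \<T> ?p\<psi>" and ?Gu = "pw_grad \<T> ?pu"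
    define Z where "Z x = weak_grad \<Omega> \<psi> x - ?G\<psi> x" for x
    define X where "X x = weak_grad \<Omega> u x - ?Gu x" for x
    define e where "e x = \<psi> x - \<psi>h x" for x
    \<comment> \<open>In the second problem the known source is \<psi>h while u satisfies the
      equation with \<psi>; the zeroth-order error is therefore \<psi>h - \<psi>, the opposite of e,
      with the same norm.\<close>
    define e' where "e' x = \<psi>h x - \<psi> x" for x
    have wgZ: "is_weak_grad \<Omega> (\<lambda>x. \<psi> x - \<psi>h x) Z"
      unfolding Z_def[abs_def] by (rule is_weak_grad_diff[OF \<Omega> w\<psi> s\<psi> F\<psi>(3,4)])
    have wgX: "is_weak_grad \<Omega> (\<lambda>x. u x - uh x) X"
      unfolding X_def[abs_def] by (rule is_weak_grad_diff[OF \<Omega> wu su Fu(3,4)])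
    have sZ: "square_integrable (lebesgue_on \<Omega>) Z" and sX: "square_integrable (lebesgue_on \<Omega>) X"
      using wgZ wgX by (auto simp: is_weak_grad_def)
    have se: "square_integrable (lebesgue_on \<Omega>) e" "square_integrable (lebesgue_on \<Omega>) e'"
      unfolding e_def[abs_def] e'_def[abs_def] by (intro square_integrable_diff s\<psi> F\<psi>(4))+
    have sW: "square_integrable (lebesgue_on \<Omega>) (weak_grad \<Omega> \<psi>)" "square_integrable (lebesgue_on \<Omega>) (weak_grad \<Omega> u)"
      "square_integrable (lebesgue_on \<Omega>) ?G\<psi>" "square_integrable (lebesgue_on \<Omega>) ?Gu"
      using w\<psi> wu F\<psi>(3) Fu(3) by (auto simp: is_weak_grad_def)
    have cover: "AE x in lebesgue_on \<Omega>. \<exists>T\<in>\<T>. x \<in> interior T" by (rule mesh_AE_cover[OF \<Omega>(1) \<T> el])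
    have pwv: "pw_fun \<T> F x = F T x" if "T \<in> \<T>" "x \<in> interior T" for F T x
      unfolding pw_fun_def by (rule sum_indicator_interior[OF \<T>(1) that disj])
    have pwm: "pw_fun \<T> F \<in> borel_measurable borel" if "\<And>T. T \<in> \<T> \<Longrightarrow> F T \<in> total_degree_polys N" for F
      unfolding pw_fun_def[abs_def]
      by (intro borel_measurable_sum borel_measurable_scaleR borel_measurable_indicator smooth_fun_borel smooth_fun_poly[OF that]) auto
    have vm: "\<psi>h \<in> borel_measurable (lebesgue_on \<Omega>)" using F\<psi>(4) by (simp add: square_integrable_def)
    have test: "square_integrable (lebesgue_on \<Omega>) \<phi>" "square_integrable (lebesgue_on \<Omega>) (grad \<phi>)" "\<phi> \<in> borel_measurable (lebesgue_on \<Omega>)"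
      if "\<phi> \<in> test_functions \<Omega>" for \<phi>
      using smooth_square_integrable[OF test_functions_smooth[OF that] test_functions_bounded_support[OF that] lm]
        smooth_grad_square_integrable[OF test_functions_smooth[OF that] test_functions_bounded_support[OF that] lm]
      by (auto simp: square_integrable_def)
    have base: "open \<Omega> \<and> bounded \<Omega> \<and> interior (closure \<Omega>) = \<Omega> \<and> finite \<T> \<and> \<Union>\<T> = closure \<Omega>"
      using \<Omega> ic \<T> by blast
    have R1: "residual_equation N \<Omega> \<T> (\<epsilon>\<^sup>2) F1 ?p\<psi> (\<lambda>x. \<epsilon>\<^sup>2 *\<^sub>R Z x) e"
      unfolding residual_equation_def
    proof (intro conjI ballI impI)
      fix \<phi> assume \<phi>: "\<phi> \<in> test_functions \<Omega>"
      note t\<phi> = test[OF \<phi>]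
      note I = square_integrable_inner[OF _ t\<phi>(1)] and IG = square_integrable_inner[OF _ t\<phi>(2)]
      have eqn: "\<epsilon>\<^sup>2 * (LINT x|lebesgue_on \<Omega>. weak_grad \<Omega> \<psi> x \<bullet> grad \<phi> x) + (LINT x|lebesgue_on \<Omega>. \<psi> x * \<phi> x) = (LINT x|lebesgue_on \<Omega>. f x * \<phi> x)"
        using e\<psi>[OF test_functions_H10[OF \<Omega> \<phi>]] unfolding l2_inner_test[OF \<Omega> \<psi> \<phi>] by (simp add: l2_inner_def)
      have pm: "pw_fun \<T> F1 \<in> borel_measurable (lebesgue_on \<Omega>)" by (rule borel_measurable_lebesgue_on_borel[OF pwm[OF F1]])
      \<comment> \<open>No measurability of f is given, so f is replaced almost everywhere by a
        measurable piecewise polynomial plus \<psi>h before the integral is split.\<close>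
      have "(LINT x|lebesgue_on \<Omega>. f x * \<phi> x) = (LINT x|lebesgue_on \<Omega>. pw_fun \<T> F1 x * \<phi> x + \<psi>h x * \<phi> x)"
      proof (rule LINT_lebesgue_on_AE_eq[OF \<Omega>s])
        show "(\<lambda>x. pw_fun \<T> F1 x * \<phi> x + \<psi>h x * \<phi> x) \<in> borel_measurable (lebesgue_on \<Omega>)"
          using pm vm t\<phi>(3) by measurable
        show "AE x in lebesgue_on \<Omega>. f x * \<phi> x = pw_fun \<T> F1 x * \<phi> x + \<psi>h x * \<phi> x"
          using cover
        proof eventually_elim
          case (elim x)
          then obtain T where T: "T \<in> \<T>" "x \<in> interior T" by blast
          then have "x \<in> T" using interior_subset by blast
          then have "\<psi>h x = ?p\<psi> T x" by (rule F\<psi>(2)[OF T(1)])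
          then show ?case unfolding pwv[OF T, of F1] pf(2)[OF T] F1_def by (simp add: left_diff_distrib)
        qed
      qed
      also have "\<dots> = (LINT x|lebesgue_on \<Omega>. pw_fun \<T> F1 x * \<phi> x) + (LINT x|lebesgue_on \<Omega>. \<psi>h x * \<phi> x)"
      proof (rule Bochner_Integration.integral_add)
        show "integrable (lebesgue_on \<Omega>) (\<lambda>x. \<psi>h x * \<phi> x)" using I[OF F\<psi>(4)] by simp
        have "\<exists>B. \<forall>x\<in>\<Omega>. \<bar>F1 T x\<bar> \<le> B" if "T \<in> \<T>" for T
        proof -
          have "bounded (F1 T ` closure \<Omega>)"
            using \<Omega>(2) by (intro compact_imp_bounded compact_continuous_image smooth_fun_continuous smooth_fun_poly[OF F1[OF that]])
              (auto simp: compact_eq_bounded_closed)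
          then obtain B where "\<forall>x\<in>closure \<Omega>. \<bar>F1 T x\<bar> \<le> B" unfolding bounded_iff by auto
          then show ?thesis using closure_subset[of \<Omega>] by blast
        qed
        then obtain B where B: "\<And>T x. T \<in> \<T> \<Longrightarrow> x \<in> \<Omega> \<Longrightarrow> \<bar>F1 T x\<bar> \<le> B T" by metis
        have "square_integrable (lebesgue_on \<Omega>) (pw_fun \<T> F1)"
        proof (rule square_integrable_bounded[OF lm pm])
          fix x assume x: "x \<in> \<Omega>"
          show "norm (pw_fun \<T> F1 x) \<le> (\<Sum>T\<in>\<T>. B T)"
            unfolding pw_fun_def
          proof (rule sum_norm_le)
            fix T assume "T \<in> \<T>"
            from B[OF this x] show "norm (indicator (interior T) x *\<^sub>R F1 T x) \<le> B T"
              by (auto simp: indicator_def)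
          qed
        qed
        then show "integrable (lebesgue_on \<Omega>) (\<lambda>x. pw_fun \<T> F1 x * \<phi> x)" using I by fastforce
      qed
      finally have f: "(LINT x|lebesgue_on \<Omega>. f x * \<phi> x) = (LINT x|lebesgue_on \<Omega>. pw_fun \<T> F1 x * \<phi> x) + (LINT x|lebesgue_on \<Omega>. \<psi>h x * \<phi> x)" .
      have Zs: "(LINT x|lebesgue_on \<Omega>. (\<epsilon>\<^sup>2 *\<^sub>R Z x) \<bullet> grad \<phi> x) =
        \<epsilon>\<^sup>2 * ((LINT x|lebesgue_on \<Omega>. weak_grad \<Omega> \<psi> x \<bullet> grad \<phi> x) - (LINT x|lebesgue_on \<Omega>. ?G\<psi> x \<bullet> grad \<phi> x))"
        using IG[OF sW(1)] IG[OF sW(3)] by (simp add: Z_def inner_diff_left)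
      have es: "(LINT x|lebesgue_on \<Omega>. e x * \<phi> x) = (LINT x|lebesgue_on \<Omega>. \<psi> x * \<phi> x) - (LINT x|lebesgue_on \<Omega>. \<psi>h x * \<phi> x)"
        using I[OF s\<psi>] I[OF F\<psi>(4)] by (simp add: e_def left_diff_distrib)
      show "(LINT x|lebesgue_on \<Omega>. pw_fun \<T> F1 x * \<phi> x) - \<epsilon>\<^sup>2 * (LINT x|lebesgue_on \<Omega>. ?G\<psi> x \<bullet> grad \<phi> x) =
        (LINT x|lebesgue_on \<Omega>. (\<epsilon>\<^sup>2 *\<^sub>R Z x) \<bullet> grad \<phi> x) + (LINT x|lebesgue_on \<Omega>. e x * \<phi> x)"
        unfolding Zs es using eqn f by (simp add: algebra_simps)
    qed (use base el disj F1 PN sZ se in \<open>auto intro: square_integrable_scale\<close>)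
    have R2: "residual_equation N \<Omega> \<T> 1 ?p\<psi> ?pu X e'"
      unfolding residual_equation_def
    proof (intro conjI ballI impI)
      fix \<phi> assume \<phi>: "\<phi> \<in> test_functions \<Omega>"
      note t\<phi> = test[OF \<phi>]
      note I = square_integrable_inner[OF _ t\<phi>(1)] and IG = square_integrable_inner[OF _ t\<phi>(2)]
      have eqn: "(LINT x|lebesgue_on \<Omega>. weak_grad \<Omega> u x \<bullet> grad \<phi> x) = (LINT x|lebesgue_on \<Omega>. \<psi> x * \<phi> x)"
        using eu[OF test_functions_H1[OF \<Omega> \<phi>]] unfolding l2_inner_test[OF \<Omega> u \<phi>] by (simp add: l2_inner_def)
      have f: "(LINT x|lebesgue_on \<Omega>. pw_fun \<T> ?p\<psi> x * \<phi> x) = (LINT x|lebesgue_on \<Omega>. \<psi>h x * \<phi> x)"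
      proof (rule LINT_lebesgue_on_AE_eq[OF \<Omega>s])
        show "(\<lambda>x. \<psi>h x * \<phi> x) \<in> borel_measurable (lebesgue_on \<Omega>)" using vm t\<phi>(3) by measurable
        show "AE x in lebesgue_on \<Omega>. pw_fun \<T> ?p\<psi> x * \<phi> x = \<psi>h x * \<phi> x"
          using cover
        proof eventually_elim
          case (elim x)
          then obtain T where T: "T \<in> \<T>" "x \<in> interior T" by blast
          then have "x \<in> T" using interior_subset by blast
          then show ?case using pwv[OF T, of ?p\<psi>] F\<psi>(2)[OF T(1)] by simp
        qed
      qed
      have Xs: "(LINT x|lebesgue_on \<Omega>. X x \<bullet> grad \<phi> x) =
        (LINT x|lebesgue_on \<Omega>. weak_grad \<Omega> u x \<bullet> grad \<phi> x) - (LINT x|lebesgue_on \<Omega>. ?Gu x \<bullet> grad \<phi> x)"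
        using IG[OF sW(2)] IG[OF sW(4)] by (simp add: X_def inner_diff_left)
      have es: "(LINT x|lebesgue_on \<Omega>. e' x * \<phi> x) = (LINT x|lebesgue_on \<Omega>. \<psi>h x * \<phi> x) - (LINT x|lebesgue_on \<Omega>. \<psi> x * \<phi> x)"
        using I[OF s\<psi>] I[OF F\<psi>(4)] by (simp add: e'_def left_diff_distrib)
      show "(LINT x|lebesgue_on \<Omega>. pw_fun \<T> ?p\<psi> x * \<phi> x) - 1 * (LINT x|lebesgue_on \<Omega>. ?Gu x \<bullet> grad \<phi> x) =
        (LINT x|lebesgue_on \<Omega>. X x \<bullet> grad \<phi> x) + (LINT x|lebesgue_on \<Omega>. e' x * \<phi> x)"
        unfolding Xs es f using eqn by simp
    qed (use base el disj PN sX se in auto)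
    have res1: "AE x in lebesgue_on T. f x + \<epsilon>\<^sup>2 * laplacian (?p\<psi> T) x - \<psi>h x = strong_residual (\<epsilon>\<^sup>2) F1 ?p\<psi> T x" if T: "T \<in> \<T>" for T
      using AE_interior[OF el[OF T]]
    proof eventually_elim
      case (elim x)
      then have "x \<in> T" using interior_subset by blast
      then show ?case using pf(2)[OF T elim] F\<psi>(2)[OF T] by (simp add: strong_residual_def F1_def)
    qed
    have res2: "AE x in lebesgue_on T. laplacian (?pu T) x + \<psi>h x = strong_residual 1 ?p\<psi> ?pu T x" if T: "T \<in> \<T>" for T
      using AE_interior[OF el[OF T]]
    proof eventually_elim
      case (elim x)
      then have "x \<in> T" using interior_subset by blast
      then show ?case using F\<psi>(2)[OF T] by (simp add: strong_residual_def)
    qed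
    have dT: "diameter T \<le> diameter \<Omega>" if "T \<in> \<T>" for T
    proof -
      have "diameter T \<le> diameter (closure \<Omega>)"
        using \<Omega>(2) \<T>(2) that by (intro diameter_subset) (auto intro: bounded_closure)
      then show ?thesis using \<Omega>(2) by (simp add: diameter_closure)
    qed
    have E2: "(energy_norm \<Omega> \<epsilon> (\<lambda>x. \<psi> x - \<psi>h x))\<^sup>2 = \<epsilon>\<^sup>2 * sqnorm_on Z \<Omega> + sqnorm_on e \<Omega>"
    proof -
      have "(energy_norm \<Omega> \<epsilon> (\<lambda>x. \<psi> x - \<psi>h x))\<^sup>2 =
        \<epsilon>\<^sup>2 * (h1_seminorm \<Omega> (\<lambda>x. \<psi> x - \<psi>h x))\<^sup>2 + (l2_norm (lebesgue_on \<Omega>) (\<lambda>x. \<psi> x - \<psi>h x))\<^sup>2"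
        unfolding energy_norm_def by (intro real_sqrt_pow2) auto
      then show ?thesis unfolding h1_seminorm_eq[OF \<Omega> wgZ] l2_norm_sqnorm[OF \<Omega>s] e_def[abs_def] .
    qed
    have P2: "(pair_norm \<Omega> \<epsilon> (\<lambda>x. \<psi> x - \<psi>h x) (\<lambda>x. u x - uh x))\<^sup>2 = \<epsilon>\<^sup>2 * sqnorm_on Z \<Omega> + sqnorm_on e \<Omega> + sqnorm_on X \<Omega>"
    proof -
      have "(pair_norm \<Omega> \<epsilon> (\<lambda>x. \<psi> x - \<psi>h x) (\<lambda>x. u x - uh x))\<^sup>2 =
        (energy_norm \<Omega> \<epsilon> (\<lambda>x. \<psi> x - \<psi>h x))\<^sup>2 + (h1_seminorm \<Omega> (\<lambda>x. u x - uh x))\<^sup>2"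
        unfolding pair_norm_def by (intro real_sqrt_pow2) auto
      then show ?thesis unfolding E2 h1_seminorm_eq[OF \<Omega> wgX] l2_norm_sqnorm[OF \<Omega>s] .
    qed
    have ee: "sqnorm_on e' \<Omega> = sqnorm_on e \<Omega>" by (simp add: sqnorm_on_def e_def e'_def power2_commute)
    have b1: "(\<Sum>T\<in>\<T>. (eta_psi \<epsilon> \<T> f \<psi>h T)\<^sup>2) \<le> C1 * (\<epsilon>\<^sup>2 * sqnorm_on Z \<Omega> + sqnorm_on e \<Omega>)"
      by (rule C1(2)) (use R1 gm sZ \<epsilon> res1 in blast)
    have b2: "(\<Sum>T\<in>\<T>. (eta_u \<T> \<psi>h uh T)\<^sup>2) \<le> C2 * (sqnorm_on X \<Omega> + sqnorm_on e \<Omega>)"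
      using C2(2)[of \<Omega> \<T> ?p\<psi> uh X e' \<psi>h] R2 gm dT res2 unfolding ee by blast
    have nn: "0 \<le> \<epsilon>\<^sup>2 * sqnorm_on Z \<Omega>" "0 \<le> sqnorm_on X \<Omega>" by (auto simp: sqnorm_on_nonneg)
    have b3: "(\<Sum>T\<in>\<T>. (eta_psi \<epsilon> \<T> f \<psi>h T)\<^sup>2 + (eta_u \<T> \<psi>h uh T)\<^sup>2) \<le> (C1 + C2) * (\<epsilon>\<^sup>2 * sqnorm_on Z \<Omega> + sqnorm_on e \<Omega> + sqnorm_on X \<Omega>)"
    proof -
      have "C1 * (\<epsilon>\<^sup>2 * sqnorm_on Z \<Omega> + sqnorm_on e \<Omega>) \<le> C1 * (\<epsilon>\<^sup>2 * sqnorm_on Z \<Omega> + sqnorm_on e \<Omega> + sqnorm_on X \<Omega>)"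
        "C2 * (sqnorm_on X \<Omega> + sqnorm_on e \<Omega>) \<le> C2 * (\<epsilon>\<^sup>2 * sqnorm_on Z \<Omega> + sqnorm_on e \<Omega> + sqnorm_on X \<Omega>)"
        using C1(1) C2(1) nn by (auto intro!: mult_left_mono)
      then show ?thesis using b1 b2 by (simp add: sum.distrib distrib_right)
    qed
    have pos: "energy_norm \<Omega> \<epsilon> (\<lambda>x. \<psi> x - \<psi>h x) \<ge> 0" "pair_norm \<Omega> \<epsilon> (\<lambda>x. \<psi> x - \<psi>h x) (\<lambda>x. u x - uh x) \<ge> 0"
      by (auto simp: energy_norm_def pair_norm_def)
    show "1 / sqrt C1 * sqrt (\<Sum>T\<in>\<T>. (eta_psi \<epsilon> \<T> f \<psi>h T)\<^sup>2) \<le> energy_norm \<Omega> \<epsilon> (\<lambda>x. \<psi> x - \<psi>h x) \<and>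
      1 / sqrt (C1 + C2) * sqrt (\<Sum>T\<in>\<T>. (eta_psi \<epsilon> \<T> f \<psi>h T)\<^sup>2 + (eta_u \<T> \<psi>h uh T)\<^sup>2)
      \<le> pair_norm \<Omega> \<epsilon> (\<lambda>x. \<psi> x - \<psi>h x) (\<lambda>x. u x - uh x)"
      using sqrt_bound[OF C1(1) _ pos(1)] sqrt_bound[OF _ _ pos(2), of "C1 + C2"] b1 b3 C1(1) C2(1) unfolding E2 P2 by auto
  qed
qed

end
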